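(* Let $d=1$ and $L^2_r=\{u\in L^2(\mathbb{R}): u(x)=u(-x),\ x\in\mathbb{R}\}$, $\Sigma_r=\Sigma\cap L^2_r$. Consider $$2iu_t=-\Delta u+\lambda|x|^2u+\eta(|x|^2*|u|^2)u,\quad (t,x)\in\mathbb{R}^{1+1}.\qquad(\mathrm{H})$$ (i) Let $\lambda=0$ and $\eta=1$. Then for any $m\in\mathbb{N}$ there exists a stable standing wave $e^{-i\omega t/2}\phi_\omega$ of (H) with $\phi_\omega\in\Sigma_r$, $d''(\omega)<0$ and $n\big(S_\omega''(\phi_\omega)|_{L^2_r}\big)=2m$. (ii) Let $\lambda=2$ and $\eta=-1$. Then for any $m\in\mathbb{N}$ there exists a stable standing wave $e^{-i\omega t/2}\phi_\omega$ of (H) with $\phi_\omega\in\Sigma_r$, $d''(\omega)>0$ and $n\big(S_\omega''(\phi_\omega)|_{L^2_r}\big)=2m+1$.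
   Context: $\mathbb{N}=\{1,2,\dots\}$. $\Sigma=\{\phi\in H^1:\langle x\rangle\phi\in L^2\}$, where $\langle x\rangle=(1+|x|^2)^{1/2}$. The Cauchy problem for (H) is globally well-posed in $\Sigma$. Energy, charge, action: $$E[u]=\tfrac12\|\nabla u\|_{L^2}^2+\tfrac\lambda2\|xu\|_{L^2}^2+\tfrac\eta4\iint|x-y|^2|u(x)|^2|u(y)|^2\,dx\,dy,\quad Q(u)=\tfrac12\|u\|_{L^2}^2,\quad S_\omega=E-\omega Q .$$ Derivatives are taken in the real sense, with respect to the real inner product $\mathrm{Re}\int u\bar v$, so that (H) reads $2iu_t=E'(u)$, and $e^{-i\omega t/2}\phi_\omega$ is a standing wave solution iff $S_\omega'(\phi_\omega)=0$. $S_\omega''(\phi_\omega)$ is a real-linear self-adjoint operator on $L^2(\mathbb{R};\mathbb{C})\cong L^2(\mathbb{R};\mathbb{R})^2$ (real and imaginary parts); $n(\cdot)$ denotes the number of negative eigenvalues counted with multiplicity, and $S_\omega''(\phi_\omega)|_{L^2_r}$ is the restriction to even functions. The standing wave profile $\phi_\omega$ is a member of a smooth frequency-to-standing-wave map $\omega\mapsto\phi_\omega$, defined on an open interval of frequencies, with $S_\omega'(\phi_\omega)=0$; $d(\omega):=S_\omega(\phi_\omega)$ is computed along this map. A standing wave $e^{-i\omega t/2}\phi$ is stable (in $\Sigma$) if for every $\varepsilon>0$ there is $\delta>0$ such that $\|u_0-\phi\|_\Sigma<\delta$ implies $\sup_{t>0}\inf_{\theta\in\mathbb{R},y\in\mathbb{R}}\|\phi-e^{i\theta}u(t,\cdot-y)\|_\Sigma<\varepsilon$,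 where $u$ is the solution of (H) with $u(0)=u_0\in\Sigma$. *)

theory Defs
  imports "HOL-Analysis.Analysis"
begin

definition L2 :: "(real \<Rightarrow> complex) set" where
  "L2 = {f \<in> borel_measurable lborel. integrable lborel (\<lambda>x. (cmod (f x))\<^sup>2)}"

definition C1c :: "(real \<Rightarrow> real) set" where
  "C1c = {\<psi>. (\<forall>x. \<psi> field_differentiable at x) \<and> continuous_on UNIV (deriv \<psi>) \<and>
              bounded {x. \<psi> x \<noteq> 0}}"

text \<open>Testing against compactly supported \<open>C\<^sup>1\<close> functions gives the same weak derivative as testing
  against smooth ones; complex test functions reduce to real ones by linearity.\<close>

definition weak_deriv :: "(real \<Rightarrow> complex) \<Rightarrow> (real \<Rightarrow> complex) \<Rightarrow> bool" where
  "weak_deriv u g \<longleftrightarrow>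
     (\<forall>\<psi>\<in>C1c. (LINT x|lborel. u x * of_real (deriv \<psi> x)) = - (LINT x|lborel. g x * of_real (\<psi> x)))"

definition H1 :: "(real \<Rightarrow> complex) set" where
  "H1 = {u \<in> L2. \<exists>g\<in>L2. weak_deriv u g}"

lemma L2_I: "f \<in> borel_measurable lborel \<Longrightarrow> integrable lborel (\<lambda>x. (cmod (f x))\<^sup>2) \<Longrightarrow> f \<in> L2"
  by (simp add: L2_def)

lemma L2_measurable: "f \<in> L2 \<Longrightarrow> f \<in> borel_measurable borel"
  by (simp add: L2_def)

lemma L2_square_integrable: "f \<in> L2 \<Longrightarrow> integrable lborel (\<lambda>x. (cmod (f x))\<^sup>2)"
  by (simp add: L2_def)

lemma L2_mult_integrable:
  assumes f: "f \<in> L2" and g: "g \<in> L2"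
  shows "integrable lborel (\<lambda>x. f x * g x)"
proof (rule Bochner_Integration.integrable_bound)
  show "integrable lborel (\<lambda>x. (cmod (f x))\<^sup>2 + (cmod (g x))\<^sup>2)"
    using f g by (intro Bochner_Integration.integrable_add L2_square_integrable)
  show "(\<lambda>x. f x * g x) \<in> borel_measurable lborel"
    using L2_measurable[OF f] L2_measurable[OF g] by simp
  have "a * b \<le> a\<^sup>2 + b\<^sup>2" for a b :: real
    using sum_squares_bound[of a b] zero_le_power2[of a] zero_le_power2[of b] by linarith
  then have "norm (f x * g x) \<le> norm ((cmod (f x))\<^sup>2 + (cmod (g x))\<^sup>2)" for x
    by (simp add: norm_mult)
  then show "AE x in lborel. norm (f x * g x) \<le> norm ((cmod (f x))\<^sup>2 + (cmod (g x))\<^sup>2)"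
    by simp
qed

lemma L2_cnj: "f \<in> L2 \<Longrightarrow> (\<lambda>x. cnj (f x)) \<in> L2"
  using measurable_compose[OF _ borel_measurable_continuous_onI[OF continuous_on_cnj[OF continuous_on_id]], of f borel]
  by (simp add: L2_def)

lemma L2_mult_cnj_integrable:
  "f \<in> L2 \<Longrightarrow> g \<in> L2 \<Longrightarrow> integrable lborel (\<lambda>x. f x * cnj (g x))"
  by (intro L2_mult_integrable L2_cnj)

lemma L2_add: 
  assumes f: "f \<in> L2" and g: "g \<in> L2"
  shows "(\<lambda>x. f x + g x) \<in> L2"
proof (rule L2_I)
  show m: "(\<lambda>x. f x + g x) \<in> borel_measurable lborel"
    using L2_measurable[OF f] L2_measurable[OF g] by simp
  show "integrable lborel (\<lambda>x. (cmod (f x + g x))\<^sup>2)"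
  proof (rule Bochner_Integration.integrable_bound)
    show "integrable lborel (\<lambda>x. 2 * (cmod (f x))\<^sup>2 + 2 * (cmod (g x))\<^sup>2)"
      using f g by (intro Bochner_Integration.integrable_add integrable_mult_right L2_square_integrable)
    show "(\<lambda>x. (cmod (f x + g x))\<^sup>2) \<in> borel_measurable lborel" using m by measurable
    have "(cmod (a + b))\<^sup>2 \<le> 2 * (cmod a)\<^sup>2 + 2 * (cmod b)\<^sup>2" for a b
    proof -
      have "(cmod (a + b))\<^sup>2 \<le> (cmod a + cmod b)\<^sup>2"
        by (intro power_mono norm_triangle_ineq) auto
      also have "\<dots> \<le> 2 * (cmod a)\<^sup>2 + 2 * (cmod b)\<^sup>2"
        using sum_squares_bound[of "cmod a" "cmod b"] by (simp add: power2_sum)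
      finally show ?thesis .
    qed
    then show "AE x in lborel. norm ((cmod (f x + g x))\<^sup>2)
        \<le> norm (2 * (cmod (f x))\<^sup>2 + 2 * (cmod (g x))\<^sup>2)"
      by auto
  qed
qed

lemma L2_cmult: "f \<in> L2 \<Longrightarrow> (\<lambda>x. c * f x) \<in> L2"
  by (auto simp: L2_def norm_mult power_mult_distrib)

lemma L2_diff: "f \<in> L2 \<Longrightarrow> g \<in> L2 \<Longrightarrow> (\<lambda>x. f x - g x) \<in> L2"
  using L2_add[of f "\<lambda>x. -1 * g x"] L2_cmult[of g "-1"] by simp

lemma L2_translate: 
  assumes "f \<in> L2"
  shows "(\<lambda>x. f (x - y)) \<in> L2"
proof (rule L2_I)
  show "(\<lambda>x. f (x - y)) \<in> borel_measurable lborel"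
    using L2_measurable[OF assms] by measurable
  show "integrable lborel (\<lambda>x. (cmod (f (x - y)))\<^sup>2)"
    using lborel_integrable_real_affine[OF L2_square_integrable[OF assms], of 1 "-y"] by simp
qed

lemma L2_continuous_compact_support:
  assumes c: "continuous_on UNIV h" and R: "\<And>x. \<bar>x\<bar> > R \<Longrightarrow> h x = 0"
  shows "(\<lambda>x. complex_of_real (h x)) \<in> L2"
proof (rule L2_I)
  show "(\<lambda>x. complex_of_real (h x)) \<in> borel_measurable lborel"
    using borel_measurable_continuous_onI[OF c] by simp
  have "continuous_on {-R..R} (\<lambda>x. (h x)\<^sup>2)"
    by (intro continuous_intros continuous_on_subset[OF c]) auto
  then have "integrable lborel (\<lambda>x. indicator {-R..R} x *\<^sub>R (h x)\<^sup>2)"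
    by (intro borel_integrable_compact) auto
  also have "(\<lambda>x. indicator {-R..R} x *\<^sub>R (h x)\<^sup>2) = (\<lambda>x. (cmod (complex_of_real (h x)))\<^sup>2)"
  proof
    fix x
    show "indicator {-R..R} x *\<^sub>R (h x)\<^sup>2 = (cmod (complex_of_real (h x)))\<^sup>2"
      using R[of x] by (cases "\<bar>x\<bar> > R") (auto simp: indicator_def)
  qed
  finally show "integrable lborel (\<lambda>x. (cmod (complex_of_real (h x)))\<^sup>2)" .
qed

lemma C1c_L2:
  assumes "\<psi> \<in> C1c"
  shows "(\<lambda>x. complex_of_real (\<psi> x)) \<in> L2" "(\<lambda>x. complex_of_real (deriv \<psi> x)) \<in> L2"
proof -
  have diff: "\<psi> field_differentiable at x" for x using assms by (auto simp: C1c_def)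
  have c': "continuous_on UNIV (deriv \<psi>)" using assms by (auto simp: C1c_def)
  have c: "continuous_on UNIV \<psi>"
    using diff by (simp add: continuous_at_imp_continuous_on field_differentiable_imp_continuous_at)
  have "bounded {x. \<psi> x \<noteq> 0}" using assms by (auto simp: C1c_def)
  then obtain R where R: "\<And>x. \<psi> x \<noteq> 0 \<Longrightarrow> \<bar>x\<bar> \<le> R" by (auto simp: bounded_iff)
  then have R0: "\<psi> x = 0" if "\<bar>x\<bar> > R" for x using that by (meson not_le)
  show "(\<lambda>x. complex_of_real (\<psi> x)) \<in> L2"
    by (rule L2_continuous_compact_support[OF c R0])
  have "deriv \<psi> x = 0" if "\<bar>x\<bar> > R" for x
  proof -
    have "open {x::real. \<bar>x\<bar> > R}" by (intro open_Collect_less continuous_intros)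
    then have "(\<psi> has_field_derivative 0) (at x)"
      using that R0 by (intro has_field_derivative_transform_within_open[OF DERIV_const[of 0]]) auto
    then show ?thesis by (rule DERIV_imp_deriv)
  qed
  then show "(\<lambda>x. complex_of_real (deriv \<psi> x)) \<in> L2"
    by (rule L2_continuous_compact_support[OF c'])
qed

lemma weak_deriv_add:
  assumes "u \<in> L2" "g \<in> L2" "v \<in> L2" "h \<in> L2" "weak_deriv u g" "weak_deriv v h"
  shows "weak_deriv (\<lambda>x. u x + v x) (\<lambda>x. g x + h x)"
  using assms unfolding weak_deriv_def
  by (auto simp: distrib_right Bochner_Integration.integral_add L2_mult_integrable C1c_L2)

lemma weak_deriv_cmult:
  assumes "weak_deriv u g"
  shows "weak_deriv (\<lambda>x. c * u x) (\<lambda>x. c * g x)"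
  using assms unfolding weak_deriv_def by (auto simp: mult.assoc)

lemma weak_deriv_zero: "weak_deriv (\<lambda>x. 0) (\<lambda>x. 0)"
  by (auto simp: weak_deriv_def)

lemma C1c_translate:
  assumes "\<psi> \<in> C1c"
  shows "(\<lambda>x. \<psi> (x + y)) \<in> C1c" "deriv (\<lambda>x. \<psi> (x + y)) x = deriv \<psi> (x + y)"
proof -
  have d: "(\<psi> has_field_derivative deriv \<psi> x) (at x)" for x
    using assms by (auto simp: C1c_def field_differentiable_derivI)
  have d': "((\<lambda>x. \<psi> (x + y)) has_field_derivative deriv \<psi> (x + y)) (at x)" for x
    using d[of "x + y"] by (simp add: DERIV_shift)
  show e: "deriv (\<lambda>x. \<psi> (x + y)) x = deriv \<psi> (x + y)" for x
    by (rule DERIV_imp_deriv[OF d'])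
  have "bounded {x. \<psi> x \<noteq> 0}" using assms by (auto simp: C1c_def)
  then have "bounded ((\<lambda>x. - y + x) ` {x. \<psi> x \<noteq> 0})" by (rule bounded_translation)
  then have b: "bounded {x. \<psi> (x + y) \<noteq> 0}"
    by (rule bounded_subset) (force simp: image_iff intro: exI[of _ "_ + y"])
  have "continuous_on UNIV (deriv \<psi>)" using assms by (auto simp: C1c_def)
  then have "continuous_on UNIV (\<lambda>x. deriv \<psi> (x + y))"
    by (rule continuous_on_compose2) (auto intro!: continuous_intros)
  then show "(\<lambda>x. \<psi> (x + y)) \<in> C1c"
    using d' b by (auto simp: C1c_def field_differentiable_def e cong: continuous_on_cong)
qed

lemma weak_deriv_translate:
  assumes "weak_deriv u g"
  shows "weak_deriv (\<lambda>x. u (x - y)) (\<lambda>x. g (x - y))"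
  unfolding weak_deriv_def
proof
  fix \<psi> assume p: "\<psi> \<in> C1c"
  have "(LINT x|lborel. u (x - y) * of_real (deriv \<psi> x)) =
        (LINT x|lborel. u x * of_real (deriv (\<lambda>x. \<psi> (x + y)) x))"
    by (subst lborel_integral_real_affine[where c = 1 and t = y])
       (simp_all add: C1c_translate(2)[OF p] add.commute)
  also have "\<dots> = - (LINT x|lborel. g x * of_real (\<psi> (x + y)))"
    using assms C1c_translate(1)[OF p] unfolding weak_deriv_def by blast
  also have "(LINT x|lborel. g x * of_real (\<psi> (x + y))) = (LINT x|lborel. g (x - y) * of_real (\<psi> x))"
    by (subst (2) lborel_integral_real_affine[where c = 1 and t = y]) (simp_all add: add.commute)
  finally show "(LINT x|lborel. u (x - y) * of_real (deriv \<psi> x)) =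
      - (LINT x|lborel. g (x - y) * of_real (\<psi> x))" .
qed

lemma pos_part_square_deriv:
  "((\<lambda>y::real. (max 0 y)\<^sup>2) has_field_derivative 2 * max 0 y) (at y)"
proof -
  consider "y > 0" | "y < 0" | "y = 0" by linarith
  then show ?thesis
  proof cases
    case 1
    have "((\<lambda>y::real. y\<^sup>2) has_field_derivative 2 * max 0 y) (at y)"
      using 1 by (auto intro!: derivative_eq_intros)
    then show ?thesis
      by (rule has_field_derivative_transform_within_open[of _ _ _ "{0<..}"]) (use 1 in auto)
  next
    case 2
    have "((\<lambda>y::real. 0) has_field_derivative 2 * max 0 y) (at y)"
      using 2 by (auto intro!: derivative_eq_intros)
    then show ?thesis
      by (rule has_field_derivative_transform_within_open[of _ _ _ "{..<0}"]) (use 2 in auto)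
  next
    case 3
    have "((\<lambda>h::real. max 0 h) \<longlongrightarrow> 0) (at 0)"
      using tendsto_max[OF tendsto_const[of "0::real"] tendsto_ident_at, of 0 UNIV] by simp
    moreover have "(max 0 h)\<^sup>2 / h = max 0 h" for h :: real
      by (simp add: max_def power2_eq_square)
    ultimately have "((\<lambda>h::real. (max 0 h)\<^sup>2 / h) \<longlongrightarrow> 0) (at 0)" by simp
    then show ?thesis using 3 by (simp add: DERIV_def)
  qed
qed

lemma bump_function:
  fixes a b :: real and n :: nat
  defines "q \<equiv> \<lambda>x. (max 0 ((x - a) * (b - x)))\<^sup>2"
  assumes ab: "a < b"
  shows "(\<lambda>x. real n * q x / (1 + real n * q x)) \<in> C1c"
proof -
  define q' where "q' = (\<lambda>x. 2 * max 0 ((x - a) * (b - x)) * (b - x - (x - a)))"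
  have "((\<lambda>x. (x - a) * (b - x)) has_field_derivative (b - x - (x - a))) (at x)" for x
    by (auto intro!: derivative_eq_intros)
  from DERIV_chain2[OF pos_part_square_deriv this]
  have q: "(q has_field_derivative q' x) (at x)" for x
    unfolding q_def q'_def by simp
  have pos: "1 + real n * q x > 0" for x unfolding q_def by (simp add: add_pos_nonneg)
  define p' where "p' = (\<lambda>x. real n * q' x / (1 + real n * q x)\<^sup>2)"
  have d: "((\<lambda>x. real n * q x / (1 + real n * q x)) has_field_derivative p' x) (at x)" for x
    using pos[of x]
    by (auto intro!: derivative_eq_intros q simp: p'_def power2_eq_square algebra_simps)
  have cq: "continuous_on UNIV q" unfolding q_def by (intro continuous_intros)
  have "continuous_on UNIV p'"
    unfolding p'_def q'_def using pos
    by (intro continuous_intros cq) (metis less_irrefl power_eq_0_iff)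
  moreover have "deriv (\<lambda>x. real n * q x / (1 + real n * q x)) = p'"
    using DERIV_imp_deriv[OF d] by auto
  moreover have "{x. real n * q x / (1 + real n * q x) \<noteq> 0} \<subseteq> {a..b}"
  proof
    fix x assume "x \<in> {x. real n * q x / (1 + real n * q x) \<noteq> 0}"
    then have "q x \<noteq> 0" by auto
    then have "(x - a) * (b - x) > 0" unfolding q_def by (cases "(x - a) * (b - x) > 0") auto
    then show "x \<in> {a..b}" using ab by (auto simp: zero_less_mult_iff)
  qed
  then have "bounded {x. real n * q x / (1 + real n * q x) \<noteq> 0}"
    by (rule bounded_subset[OF bounded_closed_interval])
  ultimately show ?thesis using d unfolding C1c_def by (auto simp: field_differentiable_def)
qed

lemma L2_set_integrable:
  assumes f: "f \<in> L2" and A: "A \<in> sets borel" "A \<subseteq> {a..b}"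
  shows "integrable lborel (\<lambda>x. indicator A x *\<^sub>R f x)"
proof -
  have "(\<lambda>x. (cmod (indicator {a..b} x))\<^sup>2) = indicat_real {a..b}"
    by (auto simp: indicator_def)
  moreover have "integrable lborel (indicat_real {a..b})"
    by (intro integrable_real_indicator) (auto simp: emeasure_lborel_Icc_eq)
  ultimately have "(\<lambda>x. indicator {a..b} x :: complex) \<in> L2"
    by (intro L2_I) auto
  from L2_mult_integrable[OF this f]
  have i: "integrable lborel (\<lambda>x. indicator {a..b} x * f x)" .
  show ?thesis
    by (rule Bochner_Integration.integrable_bound[OF i])
       (use L2_measurable[OF f] A in \<open>auto simp: indicator_def intro!: AE_I2\<close>)
qed

lemma integral_C1c_zero_interval:
  assumes f: "f \<in> L2" and z: "\<And>\<psi>. \<psi> \<in> C1c \<Longrightarrow> (LINT x|lborel. f x * of_real (\<psi> x)) = 0"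
  shows "(LINT x|lborel. indicator {a<..<b} x *\<^sub>R f x) = 0"
proof (cases "a < b")
  case True
  define q where "q = (\<lambda>x. (max 0 ((x - a) * (b - x)))\<^sup>2)"
  define p where "p = (\<lambda>n x. real n * q x / (1 + real n * q x))"
  have p: "p n \<in> C1c" for n unfolding p_def q_def by (rule bump_function[OF True])
  have q0: "q x \<ge> 0" for x unfolding q_def by simp
  have q1: "q x = 0" if "x \<notin> {a<..<b}" for x
  proof -
    have "(x - a) * (b - x) \<le> 0"
      using that True by (auto simp: mult_le_0_iff)
    then show ?thesis unfolding q_def by simp
  qed
  have q2: "q x > 0" if "x \<in> {a<..<b}" for x
    using that unfolding q_def by (auto simp: max_def zero_less_mult_iff)
  have lim: "(\<lambda>n. f x * of_real (p n x)) \<longlonglongrightarrow> indicator {a<..<b} x *\<^sub>R f x" for x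
  proof (cases "x \<in> {a<..<b}")
    case x: True
    have "filterlim (\<lambda>n. real n * q x) at_top sequentially"
      using filterlim_tendsto_pos_mult_at_top[OF tendsto_const q2[OF x] filterlim_real_sequentially]
      by (simp add: mult.commute)
    then have "filterlim (\<lambda>n. 1 + real n * q x) at_top sequentially"
      by (rule filterlim_tendsto_add_at_top[OF tendsto_const])
    then have "(\<lambda>n. 1 / (1 + real n * q x)) \<longlonglongrightarrow> 0"
      by (intro tendsto_divide_0[OF tendsto_const] filterlim_at_top_imp_at_infinity)
    from tendsto_diff[OF tendsto_const this]
    have "(\<lambda>n. 1 - 1 / (1 + real n * q x)) \<longlonglongrightarrow> 1 - 0" .
    moreover have "1 - 1 / (1 + real n * q x) = p n x" for n
    proof -
      have "1 + real n * q x > 0" using q0[of x] by (simp add: add_pos_nonneg)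
      then show ?thesis by (simp add: p_def divide_simps)
    qed
    ultimately have "(\<lambda>n. p n x) \<longlonglongrightarrow> 1" by simp
    then have "(\<lambda>n. f x * of_real (p n x)) \<longlonglongrightarrow> f x * of_real 1" by (intro tendsto_intros)
    then show ?thesis using x by simp
  next
    case False
    then show ?thesis by (simp add: p_def q1)
  qed
  have bound: "norm (f x * of_real (p n x)) \<le> norm (indicator {a<..<b} x *\<^sub>R f x)" for n x
  proof (cases "x \<in> {a<..<b}")
    case x: True
    have "1 + real n * q x > 0" using q0[of x] by (simp add: add_pos_nonneg)
    then have "\<bar>p n x\<bar> \<le> 1" using q0[of x] by (simp add: p_def divide_simps abs_mult)
    then show ?thesis using x by (simp add: norm_mult mult_left_le)
  next
    case False
    then show ?thesis by (simp add: p_def q1)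
  qed
  have int: "integrable lborel (\<lambda>x. indicator {a<..<b} x *\<^sub>R f x)"
    by (rule L2_set_integrable[OF f, of _ a b]) auto
  have "(\<lambda>n. LINT x|lborel. f x * of_real (p n x)) \<longlonglongrightarrow> (LINT x|lborel. indicator {a<..<b} x *\<^sub>R f x)"
  proof (rule integral_dominated_convergence[where w = "\<lambda>x. norm (indicator {a<..<b} x *\<^sub>R f x)"])
    show "(\<lambda>x. f x * of_real (p n x)) \<in> borel_measurable lborel" for n
      using L2_measurable[OF f] L2_measurable[OF C1c_L2(1)[OF p[of n]]] by simp
    show "integrable lborel (\<lambda>x. norm (indicator {a<..<b} x *\<^sub>R f x))"
      using int by (rule integrable_norm)
    show "(\<lambda>x. indicator {a<..<b} x *\<^sub>R f x) \<in> borel_measurable lborel"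
      using int by (rule borel_measurable_integrable)
  qed (use lim bound in auto)
  moreover have "(LINT x|lborel. f x * of_real (p n x)) = 0" for n by (rule z[OF p])
  ultimately show ?thesis by (simp add: LIMSEQ_const_iff)
qed simp

lemma fundamental_lemma:
  assumes f: "f \<in> L2" and z: "\<And>\<psi>. \<psi> \<in> C1c \<Longrightarrow> (LINT x|lborel. f x * of_real (\<psi> x)) = 0"
  shows "AE x in lborel. f x = 0"
proof -
  have loc: "AE x in lborel. indicator {- real N<..<real N} x *\<^sub>R f x = 0" for N
  proof (rule sigma_finite_measure.density_zero[OF sigma_finite_lborel])
    let ?I = "{- real N<..<real N}"
    have intA: "integrable lborel (\<lambda>x. indicator (A \<inter> ?I) x *\<^sub>R f x)" if "A \<in> sets borel" for A
      by (rule L2_set_integrable[OF f, of _ "- real N" "real N"]) (use that in auto)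
    show "integrable lborel (\<lambda>x. indicator ?I x *\<^sub>R f x)"
      using intA[of UNIV] by simp
    fix A :: "real set" assume "A \<in> sets lborel"
    then have A: "A \<in> sets borel" by simp
    let ?G = "range (\<lambda>(a, b). box a b :: real set)"
    have "Int_stable ?G" by (auto simp: Int_stable_def box_Int_box)
    moreover have "?G \<subseteq> Pow UNIV" by auto
    moreover have "A \<in> sigma_sets UNIV ?G"
      using A unfolding borel_eq_box by (simp del: box_real)
    ultimately have "(LINT x|lborel. indicator (A \<inter> ?I) x *\<^sub>R f x) = 0"
    proof (induction rule: sigma_sets_induct_disjoint)
      case (basic A)
      then obtain a b where "A = {a<..<b}" by auto
      then have "A \<inter> ?I = {max a (- real N)<..<min b (real N)}" by auto
      then show ?case using integral_C1c_zero_interval[OF f z] by simp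
    next
      case empty
      then show ?case by simp
    next
      case (compl A)
      then have A: "A \<in> sets borel" by (simp add: borel_eq_box)
      have "(LINT x|lborel. indicator ((UNIV - A) \<inter> ?I) x *\<^sub>R f x) =
            (LINT x|lborel. indicator (UNIV \<inter> ?I) x *\<^sub>R f x - indicator (A \<inter> ?I) x *\<^sub>R f x)"
        by (intro Bochner_Integration.integral_cong) (auto simp: indicator_def)
      also have "\<dots> = (LINT x|lborel. indicator (UNIV \<inter> ?I) x *\<^sub>R f x) -
            (LINT x|lborel. indicator (A \<inter> ?I) x *\<^sub>R f x)"
        by (intro Bochner_Integration.integral_diff intA A) auto
      also have "\<dots> = 0"
        using compl integral_C1c_zero_interval[OF f z] by simp
      finally show ?case .
    next
      case (union F)
      then have F: "\<And>i. F i \<in> sets borel" by (auto simp: borel_eq_box)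
      have d: "disjoint_family (\<lambda>i. F i \<inter> ?I)"
        using union(1) by (auto simp: disjoint_family_on_def)
      have eq: "(\<Union>i. F i) \<inter> ?I = (\<Union>i. F i \<inter> ?I)" by auto
      have m: "F i \<inter> ?I \<in> sets lborel" for i using F by auto
      have si: "set_integrable lborel (\<Union>i. F i \<inter> ?I) f"
        using intA[of "\<Union>i. F i"] F unfolding set_integrable_def eq[symmetric] by auto
      have "set_lebesgue_integral lborel (\<Union>i. F i \<inter> ?I) f =
            (\<Sum>i. set_lebesgue_integral lborel (F i \<inter> ?I) f)"
        by (rule lebesgue_integral_countable_add[OF m _ si]) (use d in \<open>auto simp: disjoint_family_on_def\<close>)
      also have "\<dots> = 0"
        using union.IH by (simp add: set_lebesgue_integral_def)
      finally show ?case unfolding eq set_lebesgue_integral_def .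
    qed
    then show "set_lebesgue_integral lborel A (\<lambda>x. indicator ?I x *\<^sub>R f x) = 0"
      by (simp add: set_lebesgue_integral_def indicator_inter_arith mult.commute)
  qed
  have "AE x in lborel. \<forall>N::nat. indicator {- real N<..<real N} x *\<^sub>R f x = 0"
    by (subst AE_all_countable) (intro allI loc)
  then show ?thesis
  proof (rule AE_mp, intro AE_I2 impI)
    fix x assume elim: "\<forall>N::nat. indicator {- real N<..<real N} x *\<^sub>R f x = 0"
    obtain N :: nat where "\<bar>x\<bar> < real N" using reals_Archimedean2 by blast
    then have "x \<in> {- real N<..<real N}" by auto
    then show "f x = 0" using spec[OF elim, of N] by simp
  qed
qed

lemma weak_deriv_unique:
  assumes "g \<in> L2" "h \<in> L2" "weak_deriv u g" "weak_deriv u h"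
  shows "AE x in lborel. g x = h x"
proof -
  have "AE x in lborel. g x - h x = 0"
  proof (rule fundamental_lemma[OF L2_diff[OF assms(1,2)]])
    fix \<psi> assume p: "\<psi> \<in> C1c"
    have "(LINT x|lborel. (g x - h x) * of_real (\<psi> x)) =
        (LINT x|lborel. g x * of_real (\<psi> x)) - (LINT x|lborel. h x * of_real (\<psi> x))"
      using p assms by (simp add: left_diff_distrib L2_mult_integrable C1c_L2)
    also have "\<dots> = 0" using p assms(3,4) unfolding weak_deriv_def by (simp add: minus_equation_iff)
    finally show "(LINT x|lborel. (g x - h x) * of_real (\<psi> x)) = 0" .
  qed
  then show ?thesis by eventually_elim simp
qed

definition bracket :: "real \<Rightarrow> real" where
  "bracket x = sqrt (1 + x\<^sup>2)"

text \<open>Every class in \<open>H\<^sup>1(\<real>)\<close> has exactly one continuous representative. Using it as the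
  element of the space makes equality of functions the same as equality almost everywhere, so that
  no quotient is needed.\<close>

definition Sigma_fun :: "(real \<Rightarrow> complex) set" where
  "Sigma_fun = {u \<in> H1. continuous_on UNIV u \<and> (\<lambda>x. of_real (bracket x) * u x) \<in> L2}"

lemma L2_zero: "(\<lambda>x. 0) \<in> L2"
  by (simp add: L2_def)

lemma L2_bound:
  assumes f: "f \<in> L2" and g: "g \<in> borel_measurable borel" and le: "\<And>x. cmod (g x) \<le> c * cmod (f x)"
  shows "g \<in> L2"
proof (rule L2_I)
  show "g \<in> borel_measurable lborel" using g by simp
  show "integrable lborel (\<lambda>x. (cmod (g x))\<^sup>2)"
  proof (rule Bochner_Integration.integrable_bound)
    show "integrable lborel (\<lambda>x. c\<^sup>2 * (cmod (f x))\<^sup>2)"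
      using f by (intro integrable_mult_right L2_square_integrable)
    show "(\<lambda>x. (cmod (g x))\<^sup>2) \<in> borel_measurable lborel" using g by simp
    have "(cmod (g x))\<^sup>2 \<le> c\<^sup>2 * (cmod (f x))\<^sup>2" for x
      using power_mono[OF le, of x 2] by (simp add: power_mult_distrib)
    then show "AE x in lborel. norm ((cmod (g x))\<^sup>2) \<le> norm (c\<^sup>2 * (cmod (f x))\<^sup>2)" by simp
  qed
qed

lemma Sigma_fun_zero: "(\<lambda>x. 0) \<in> Sigma_fun"
  using L2_zero weak_deriv_zero by (auto simp: Sigma_fun_def H1_def)

lemma Sigma_fun_add:
  assumes "u \<in> Sigma_fun" "v \<in> Sigma_fun"
  shows "(\<lambda>x. u x + v x) \<in> Sigma_fun"
proof -
  obtain g h where gh: "g \<in> L2" "weak_deriv u g" "h \<in> L2" "weak_deriv v h"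
    using assms by (auto simp: Sigma_fun_def H1_def)
  have uv: "u \<in> L2" "v \<in> L2" "continuous_on UNIV u" "continuous_on UNIV v"
    "(\<lambda>x. of_real (bracket x) * u x) \<in> L2" "(\<lambda>x. of_real (bracket x) * v x) \<in> L2"
    using assms by (auto simp: Sigma_fun_def H1_def)
  have "(\<lambda>x. g x + h x) \<in> L2" "weak_deriv (\<lambda>x. u x + v x) (\<lambda>x. g x + h x)"
    using gh uv by (auto intro: L2_add weak_deriv_add)
  moreover have "(\<lambda>x. u x + v x) \<in> L2" "continuous_on UNIV (\<lambda>x. u x + v x)"
    using uv by (auto intro: L2_add continuous_on_add)
  moreover have "(\<lambda>x. of_real (bracket x) * (u x + v x)) \<in> L2"
    using L2_add[OF uv(5,6)] by (simp add: distrib_left)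
  ultimately show ?thesis unfolding Sigma_fun_def H1_def by blast
qed

lemma Sigma_fun_cmult:
  assumes "u \<in> Sigma_fun"
  shows "(\<lambda>x. c * u x) \<in> Sigma_fun"
proof -
  obtain g where g: "g \<in> L2" "weak_deriv u g"
    using assms by (auto simp: Sigma_fun_def H1_def)
  have u: "u \<in> L2" "continuous_on UNIV u" "(\<lambda>x. of_real (bracket x) * u x) \<in> L2"
    using assms by (auto simp: Sigma_fun_def H1_def)
  have "(\<lambda>x. c * g x) \<in> L2" "weak_deriv (\<lambda>x. c * u x) (\<lambda>x. c * g x)"
    using g by (auto intro: L2_cmult weak_deriv_cmult)
  moreover have "(\<lambda>x. c * u x) \<in> L2" "continuous_on UNIV (\<lambda>x. c * u x)"
    using u by (auto intro: L2_cmult continuous_on_mult_left)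
  moreover have "(\<lambda>x. of_real (bracket x) * (c * u x)) \<in> L2"
    using L2_cmult[OF u(3), of c] by (simp add: mult.left_commute)
  ultimately show ?thesis unfolding Sigma_fun_def H1_def by blast
qed

lemma Sigma_fun_translate:
  assumes "u \<in> Sigma_fun"
  shows "(\<lambda>x. u (x - y)) \<in> Sigma_fun"
proof -
  obtain g where g: "g \<in> L2" "weak_deriv u g"
    using assms by (auto simp: Sigma_fun_def H1_def)
  have u: "u \<in> L2" "continuous_on UNIV u" "(\<lambda>x. of_real (bracket x) * u x) \<in> L2"
    using assms by (auto simp: Sigma_fun_def H1_def)
  have "(\<lambda>x. g (x - y)) \<in> L2" "weak_deriv (\<lambda>x. u (x - y)) (\<lambda>x. g (x - y))"
    using g by (auto intro: L2_translate weak_deriv_translate)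
  moreover have "(\<lambda>x. u (x - y)) \<in> L2" by (intro L2_translate u)
  moreover have c: "continuous_on UNIV (\<lambda>x. u (x - y))"
    by (rule continuous_on_compose2[OF u(2)]) (auto intro: continuous_on_diff continuous_on_id continuous_on_const)
  moreover have "(\<lambda>x. of_real (bracket x) * u (x - y)) \<in> L2"
  proof (rule L2_bound[OF L2_translate[OF u(3), of y]])
    have "continuous_on UNIV (\<lambda>x. of_real (bracket x) * u (x - y))"
      unfolding bracket_def by (intro continuous_intros c)
    then show "(\<lambda>x. of_real (bracket x) * u (x - y)) \<in> borel_measurable borel"
      by (rule borel_measurable_continuous_onI)
    fix x
    have "1 + x\<^sup>2 \<le> 2 * (1 + y\<^sup>2) * (1 + (x - y)\<^sup>2)"
    proof -
      have "2 * (1 + y\<^sup>2) * (1 + (x - y)\<^sup>2) - (1 + x\<^sup>2) = 1 + (x - 2 * y)\<^sup>2 + 2 * y\<^sup>2 * (x - y)\<^sup>2"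
        by (simp add: power2_eq_square algebra_simps)
      moreover have "0 \<le> 1 + (x - 2 * y)\<^sup>2 + 2 * y\<^sup>2 * (x - y)\<^sup>2" by simp
      ultimately show ?thesis by linarith
    qed
    then have "bracket x \<le> sqrt (2 * (1 + y\<^sup>2)) * bracket (x - y)"
      unfolding bracket_def real_sqrt_mult[symmetric] by (rule real_sqrt_le_mono)
    then have "bracket x * cmod (u (x - y)) \<le> sqrt (2 * (1 + y\<^sup>2)) * bracket (x - y) * cmod (u (x - y))"
      by (rule mult_right_mono) simp
    then show "cmod (of_real (bracket x) * u (x - y)) \<le>
        sqrt (2 * (1 + y\<^sup>2)) * cmod (of_real (bracket (x - y)) * u (x - y))"
      by (simp add: norm_mult bracket_def)
  qed
  ultimately show ?thesis unfolding Sigma_fun_def H1_def by blast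
qed

typedef energy_space = Sigma_fun
  morphisms fn mk
  using Sigma_fun_zero by blast

definition grad :: "energy_space \<Rightarrow> real \<Rightarrow> complex" where
  "grad u = (SOME g. g \<in> L2 \<and> weak_deriv (fn u) g)"

definition l2_inner :: "(real \<Rightarrow> complex) \<Rightarrow> (real \<Rightarrow> complex) \<Rightarrow> real" where
  "l2_inner f g = Re (LINT x|lborel. f x * cnj (g x))"

lemma grad: "grad u \<in> L2" "weak_deriv (fn u) (grad u)"
proof -
  have "\<exists>g. g \<in> L2 \<and> weak_deriv (fn u) g" using fn[of u] by (auto simp: Sigma_fun_def H1_def)
  from someI_ex[OF this] show "grad u \<in> L2" "weak_deriv (fn u) (grad u)"
    by (simp_all add: grad_def)
qed

lemma fn_L2: "fn u \<in> L2"
  and fn_continuous: "continuous_on UNIV (fn u)"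
  and fn_bracket_L2: "(\<lambda>x. of_real (bracket x) * fn u x) \<in> L2"
  using fn[of u] by (auto simp: Sigma_fun_def H1_def)

lemma grad_AE_eq:
  assumes "g \<in> L2" "weak_deriv (fn u) g"
  shows "AE x in lborel. grad u x = g x"
  using weak_deriv_unique[OF grad(1) assms(1) grad(2) assms(2)] .

lemma l2_inner_add:
  "f \<in> L2 \<Longrightarrow> g \<in> L2 \<Longrightarrow> h \<in> L2 \<Longrightarrow> l2_inner (\<lambda>x. f x + g x) h = l2_inner f h + l2_inner g h"
  by (simp add: l2_inner_def distrib_right L2_mult_cnj_integrable)

lemma l2_inner_scale: "l2_inner (\<lambda>x. of_real r * f x) h = r * l2_inner f h"
  by (simp add: l2_inner_def mult.assoc)

lemma l2_inner_commute: "l2_inner f g = l2_inner g f"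
proof -
  have "(LINT x|lborel. g x * cnj (f x)) = (LINT x|lborel. cnj (f x * cnj (g x)))"
    by (simp add: mult.commute)
  also have "\<dots> = cnj (LINT x|lborel. f x * cnj (g x))"
    by (rule Bochner_Integration.integral_cnj)
  finally show ?thesis unfolding l2_inner_def by simp
qed

lemma l2_inner_self: "l2_inner f f = (LINT x|lborel. (cmod (f x))\<^sup>2)"
proof -
  have "(LINT x|lborel. f x * cnj (f x)) = (LINT x|lborel. complex_of_real ((cmod (f x))\<^sup>2))"
    by (simp only: complex_norm_square)
  also have "\<dots> = of_real (LINT x|lborel. (cmod (f x))\<^sup>2)" by (rule integral_complex_of_real)
  finally show ?thesis by (simp add: l2_inner_def)
qed

lemma l2_inner_cong_AE:
  assumes "AE x in lborel. f x = f' x" "f \<in> L2" "f' \<in> L2" "h \<in> L2"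
  shows "l2_inner f h = l2_inner f' h"
  unfolding l2_inner_def
  by (intro arg_cong[where f = Re] integral_cong_AE borel_measurable_integrable
      L2_mult_cnj_integrable assms) (use assms(1) in \<open>auto elim: eventually_mono\<close>)

instantiation energy_space :: real_vector
begin

definition zero_energy_space :: energy_space where
  "0 = mk (\<lambda>x. 0)"

definition plus_energy_space :: "energy_space \<Rightarrow> energy_space \<Rightarrow> energy_space" where
  "u + v = mk (\<lambda>x. fn u x + fn v x)"

definition uminus_energy_space :: "energy_space \<Rightarrow> energy_space" where
  "- u = mk (\<lambda>x. - fn u x)"

definition minus_energy_space :: "energy_space \<Rightarrow> energy_space \<Rightarrow> energy_space" where
  "u - v = mk (\<lambda>x. fn u x - fn v x)"

definition scaleR_energy_space :: "real \<Rightarrow> energy_space \<Rightarrow> energy_space" where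
  "r *\<^sub>R u = mk (\<lambda>x. of_real r * fn u x)"

lemma fn_zero: "fn 0 = (\<lambda>x. 0)"
  unfolding zero_energy_space_def by (rule mk_inverse[OF Sigma_fun_zero])

lemma fn_plus: "fn (u + v) = (\<lambda>x. fn u x + fn v x)"
  unfolding plus_energy_space_def by (rule mk_inverse[OF Sigma_fun_add[OF fn fn]])

lemma fn_scaleR: "fn (r *\<^sub>R u) = (\<lambda>x. of_real r * fn u x)"
  unfolding scaleR_energy_space_def by (rule mk_inverse[OF Sigma_fun_cmult[OF fn]])

lemma fn_uminus: "fn (- u) = (\<lambda>x. - fn u x)"
  unfolding uminus_energy_space_def
  using mk_inverse[OF Sigma_fun_cmult[OF fn, of "-1" u]] by simp

lemma fn_minus: "fn (u - v) = (\<lambda>x. fn u x - fn v x)"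
  unfolding minus_energy_space_def
  using mk_inverse[OF Sigma_fun_add[OF fn[of u] Sigma_fun_cmult[OF fn, of "-1" v]]] by simp

instance
proof
  fix u v w :: energy_space and r s :: real
  note eqI = fn_inject[THEN iffD1]
  show "u + v + w = u + (v + w)" by (rule eqI) (simp add: fn_plus add.assoc)
  show "u + v = v + u" by (rule eqI) (simp add: fn_plus add.commute)
  show "0 + u = u" by (rule eqI) (simp add: fn_plus fn_zero)
  show "- u + u = 0" by (rule eqI) (simp add: fn_plus fn_zero fn_uminus)
  show "u - v = u + - v" by (rule eqI) (simp add: fn_plus fn_uminus fn_minus)
  show "r *\<^sub>R (u + v) = r *\<^sub>R u + r *\<^sub>R v"
    by (rule eqI) (simp add: fn_plus fn_scaleR distrib_left)
  show "(r + s) *\<^sub>R u = r *\<^sub>R u + s *\<^sub>R u"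
    by (rule eqI) (simp add: fn_plus fn_scaleR distrib_right)
  show "r *\<^sub>R s *\<^sub>R u = (r * s) *\<^sub>R u" by (rule eqI) (simp add: fn_scaleR mult.assoc)
  show "1 *\<^sub>R u = u" by (rule eqI) (simp add: fn_scaleR)
qed

end

lemma grad_plus: "AE x in lborel. grad (u + v) x = grad u x + grad v x"
  by (rule grad_AE_eq) (auto simp: fn_plus intro!: L2_add weak_deriv_add grad fn_L2)

lemma grad_scaleR: "AE x in lborel. grad (r *\<^sub>R u) x = of_real r * grad u x"
  by (rule grad_AE_eq) (auto simp: fn_scaleR intro!: L2_cmult weak_deriv_cmult grad)

definition Sigma_inner :: "energy_space \<Rightarrow> energy_space \<Rightarrow> real" where
  "Sigma_inner u v = l2_inner (fn u) (fn v) + l2_inner (grad u) (grad v) +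
     l2_inner (\<lambda>x. of_real (bracket x) * fn u x) (\<lambda>x. of_real (bracket x) * fn v x)"

lemma Sigma_inner_commute: "Sigma_inner u v = Sigma_inner v u"
  unfolding Sigma_inner_def by (simp add: l2_inner_commute)

lemma Sigma_inner_add: "Sigma_inner (u + v) w = Sigma_inner u w + Sigma_inner v w"
proof -
  have "l2_inner (grad (u + v)) (grad w) = l2_inner (\<lambda>x. grad u x + grad v x) (grad w)"
    by (intro l2_inner_cong_AE grad_plus grad L2_add)
  then show ?thesis
    unfolding Sigma_inner_def
    by (simp add: fn_plus distrib_left l2_inner_add grad fn_L2 fn_bracket_L2)
qed

lemma Sigma_inner_scaleR: "Sigma_inner (r *\<^sub>R u) v = r * Sigma_inner u v"
proof -
  have "l2_inner (grad (r *\<^sub>R u)) (grad v) = l2_inner (\<lambda>x. of_real r * grad u x) (grad v)"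
    by (intro l2_inner_cong_AE grad_scaleR grad L2_cmult)
  then show ?thesis
    unfolding Sigma_inner_def
    by (simp add: fn_scaleR l2_inner_scale mult.left_commute[of "of_real (bracket _)"] distrib_left)
qed

lemma Sigma_inner_add_right: "Sigma_inner w (u + v) = Sigma_inner w u + Sigma_inner w v"
  using Sigma_inner_add[of u v w] by (simp only: Sigma_inner_commute[of w])

lemma Sigma_inner_scaleR_right: "Sigma_inner v (r *\<^sub>R u) = r * Sigma_inner v u"
  using Sigma_inner_scaleR[of r u v] by (simp only: Sigma_inner_commute[of v])

lemma Sigma_inner_nonneg: "0 \<le> Sigma_inner u u"
  unfolding Sigma_inner_def by (simp add: l2_inner_self)

lemma Sigma_inner_eq_0: "Sigma_inner u u = 0 \<longleftrightarrow> u = 0"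
proof
  have nonneg: "0 \<le> l2_inner f f" for f by (simp add: l2_inner_self)
  assume "Sigma_inner u u = 0"
  then have "l2_inner (fn u) (fn u) = 0"
    unfolding Sigma_inner_def
    using nonneg[of "fn u"] nonneg[of "grad u"] nonneg[of "\<lambda>x. of_real (bracket x) * fn u x"]
    by linarith
  then have "AE x in lborel. (cmod (fn u x))\<^sup>2 = 0"
    unfolding l2_inner_self
    by (subst (asm) integral_nonneg_eq_0_iff_AE) (auto intro: L2_square_integrable fn_L2)
  then have "AE x in lborel. x \<in> {x. fn u x = 0}" by simp
  then have ae: "AE x in lebesgue. x \<in> {x. fn u x = 0}" by (rule AE_completion)
  have "closed {x. fn u x = 0}"
    using continuous_closed_preimage_constant[OF fn_continuous closed_UNIV, of u 0] by simp
  from mem_closed_if_AE_lebesgue[OF this ae] have "fn u x = 0" for x by simp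
  then show "u = 0" by (intro fn_inject[THEN iffD1]) (auto simp: fn_zero)
next
  assume "u = 0"
  then show "Sigma_inner u u = 0" using Sigma_inner_scaleR[of 0 u u] by simp
qed

lemma Sigma_inner_CS: "(Sigma_inner u v)\<^sup>2 \<le> Sigma_inner u u * Sigma_inner v v"
proof (cases "v = 0")
  case True
  then show ?thesis
    using Sigma_inner_scaleR_right[of u 0 v] Sigma_inner_scaleR_right[of v 0 v] by simp
next
  case False
  then have pos: "Sigma_inner v v > 0"
    using Sigma_inner_nonneg[of v] Sigma_inner_eq_0[of v] by linarith
  define r where "r = - (Sigma_inner u v / Sigma_inner v v)"
  have "Sigma_inner (u + r *\<^sub>R v) (u + r *\<^sub>R v) =
      Sigma_inner u u + 2 * r * Sigma_inner u v + r\<^sup>2 * Sigma_inner v v"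
    using Sigma_inner_commute[of v u]
    by (simp add: Sigma_inner_add Sigma_inner_scaleR Sigma_inner_add_right Sigma_inner_scaleR_right
        power2_eq_square algebra_simps)
  also have "\<dots> = Sigma_inner u u - (Sigma_inner u v)\<^sup>2 / Sigma_inner v v"
    using pos by (simp add: r_def power2_eq_square field_simps)
  finally have "(Sigma_inner u v)\<^sup>2 / Sigma_inner v v \<le> Sigma_inner u u"
    using Sigma_inner_nonneg[of "u + r *\<^sub>R v"] by linarith
  then show ?thesis using pos by (simp add: divide_le_eq)
qed

instantiation energy_space :: real_normed_vector
begin

definition norm_energy_space_def: "norm (u :: energy_space) = sqrt (Sigma_inner u u)"

definition sgn_energy_space_def: "sgn (u :: energy_space) = u /\<^sub>R norm u"

definition dist_energy_space_def: "dist (u :: energy_space) v = norm (u - v)"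

definition uniformity_energy_space_def:
  "(uniformity :: (energy_space \<times> energy_space) filter) =
     (INF e\<in>{0 <..}. principal {(u, v). dist u v < e})"

definition open_energy_space_def:
  "open (U :: energy_space set) \<longleftrightarrow> (\<forall>u\<in>U. \<forall>\<^sub>F (u', v) in uniformity. u' = u \<longrightarrow> v \<in> U)"

instance
proof
  fix u v :: energy_space and r :: real and U :: "energy_space set"
  show "sgn u = u /\<^sub>R norm u" by (rule sgn_energy_space_def)
  show "dist u v = norm (u - v)" by (rule dist_energy_space_def)
  show "uniformity = (INF e\<in>{0 <..}. principal {(u, v :: energy_space). dist u v < e})"
    by (rule uniformity_energy_space_def)
  show "open U \<longleftrightarrow> (\<forall>u\<in>U. \<forall>\<^sub>F (u', v) in uniformity. u' = u \<longrightarrow> v \<in> U)"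
    by (rule open_energy_space_def)
  show "norm u = 0 \<longleftrightarrow> u = 0" by (simp add: norm_energy_space_def Sigma_inner_eq_0)
  show "norm (r *\<^sub>R u) = \<bar>r\<bar> * norm u"
    by (simp add: norm_energy_space_def Sigma_inner_scaleR Sigma_inner_scaleR_right
        real_sqrt_mult mult.assoc[symmetric])
  have "Sigma_inner u v \<le> norm u * norm v"
    unfolding norm_energy_space_def real_sqrt_mult[symmetric]
    by (rule real_le_rsqrt[OF Sigma_inner_CS])
  moreover have "Sigma_inner (u + v) (u + v) =
      Sigma_inner u u + 2 * Sigma_inner u v + Sigma_inner v v"
    using Sigma_inner_commute[of v u] by (simp add: Sigma_inner_add Sigma_inner_add_right)
  ultimately have "Sigma_inner (u + v) (u + v) \<le> (norm u + norm v)\<^sup>2"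
    by (simp add: power2_sum norm_energy_space_def Sigma_inner_nonneg)
  then show "norm (u + v) \<le> norm u + norm v"
    unfolding norm_energy_space_def[of "u + v"]
    by (rule real_le_lsqrt[rotated]) (simp add: norm_energy_space_def Sigma_inner_nonneg)
qed

end

instantiation energy_space :: real_inner
begin

definition inner_energy_space :: "energy_space \<Rightarrow> energy_space \<Rightarrow> real" where
  "inner u v = Sigma_inner u v"

instance
  by standard
     (simp_all add: inner_energy_space_def Sigma_inner_add Sigma_inner_scaleR Sigma_inner_nonneg
       Sigma_inner_eq_0 norm_energy_space_def, rule Sigma_inner_commute)

end

definition even_fns :: "energy_space set" where
  "even_fns = {u. \<forall>x. fn u (- x) = fn u x}"

definition gauge_translate :: "real \<Rightarrow> real \<Rightarrow> energy_space \<Rightarrow> energy_space" where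
  "gauge_translate \<theta> y u = mk (\<lambda>x. cis \<theta> * fn u (x - y))"

lemma fn_gauge_translate: "fn (gauge_translate \<theta> y u) = (\<lambda>x. cis \<theta> * fn u (x - y))"
  unfolding gauge_translate_def
  by (rule mk_inverse[OF Sigma_fun_cmult[OF Sigma_fun_translate[OF fn]]])

definition energy :: "real \<Rightarrow> real \<Rightarrow> energy_space \<Rightarrow> real" where
  "energy lam \<eta> u =
     1/2 * (LINT x|lborel. (cmod (grad u x))\<^sup>2) +
     lam/2 * (LINT x|lborel. (cmod (of_real x * fn u x))\<^sup>2) +
     \<eta>/4 * (LINT x|lborel. LINT y|lborel. \<bar>x - y\<bar>\<^sup>2 * (cmod (fn u x))\<^sup>2 * (cmod (fn u y))\<^sup>2)"

definition charge :: "energy_space \<Rightarrow> real" where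
  "charge u = 1/2 * (LINT x|lborel. (cmod (fn u x))\<^sup>2)"

definition action :: "real \<Rightarrow> real \<Rightarrow> real \<Rightarrow> energy_space \<Rightarrow> real" where
  "action lam \<eta> \<omega> u = energy lam \<eta> u - \<omega> * charge u"

definition action_deriv :: "real \<Rightarrow> real \<Rightarrow> real \<Rightarrow> energy_space \<Rightarrow> energy_space \<Rightarrow>\<^sub>L real" where
  "action_deriv lam \<eta> \<omega> u = Blinfun (frechet_derivative (action lam \<eta> \<omega>) (at u))"

definition action_deriv2 ::
    "real \<Rightarrow> real \<Rightarrow> real \<Rightarrow> energy_space \<Rightarrow> energy_space \<Rightarrow> energy_space \<Rightarrow> real" where
  "action_deriv2 lam \<eta> \<omega> u v w =
     blinfun_apply (frechet_derivative (action_deriv lam \<eta> \<omega>) (at u) v) w"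

text \<open>At a nonzero standing wave \<open>\<phi>\<close> the second derivative of the action is a closed, semibounded,
  symmetric real form on the energy space. \<open>S''(\<phi>)\<close> as an operator on \<open>L\<^sup>2\<close> is the self-adjoint
  operator represented by this form, given here by its graph: \<open>v\<close> is in the domain with image \<open>f\<close> iff
  \<open>S''(\<phi>)[v, w] = Re \<integral> f cnj(w)\<close> for all \<open>w\<close>.\<close>

definition hessian_graph ::
    "real \<Rightarrow> real \<Rightarrow> real \<Rightarrow> energy_space \<Rightarrow> energy_space \<Rightarrow> (real \<Rightarrow> complex) \<Rightarrow> bool" where
  "hessian_graph lam \<eta> \<omega> \<phi> v f \<longleftrightarrow>
     f \<in> L2 \<and> (\<forall>w. action_deriv2 lam \<eta> \<omega> \<phi> v w = l2_inner f (fn w))"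

definition even_eigenspace ::
    "real \<Rightarrow> real \<Rightarrow> real \<Rightarrow> energy_space \<Rightarrow> real \<Rightarrow> energy_space set" where
  "even_eigenspace lam \<eta> \<omega> \<phi> \<mu> =
     {v \<in> even_fns. hessian_graph lam \<eta> \<omega> \<phi> v (\<lambda>x. of_real \<mu> * fn v x)}"

definition even_neg_eigenvalues :: "real \<Rightarrow> real \<Rightarrow> real \<Rightarrow> energy_space \<Rightarrow> real set" where
  "even_neg_eigenvalues lam \<eta> \<omega> \<phi> = {\<mu>. \<mu> < 0 \<and> (\<exists>v\<in>even_eigenspace lam \<eta> \<omega> \<phi> \<mu>. v \<noteq> 0)}"

text \<open>A relation rather than a function, because \<^const>\<open>sum\<close> and \<^const>\<open>dim\<close> return 0 on infinite
  sets and infinite-dimensional spaces. Multiplicities are real dimensions.\<close>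

definition even_neg_count :: "real \<Rightarrow> real \<Rightarrow> real \<Rightarrow> energy_space \<Rightarrow> nat \<Rightarrow> bool" where
  "even_neg_count lam \<eta> \<omega> \<phi> n \<longleftrightarrow>
     finite (even_neg_eigenvalues lam \<eta> \<omega> \<phi>) \<and>
     (\<forall>\<mu>\<in>even_neg_eigenvalues lam \<eta> \<omega> \<phi>.
        \<exists>B. finite B \<and> even_eigenspace lam \<eta> \<omega> \<phi> \<mu> \<subseteq> span B) \<and>
     (\<Sum>\<mu>\<in>even_neg_eigenvalues lam \<eta> \<omega> \<phi>. dim (even_eigenspace lam \<eta> \<omega> \<phi> \<mu>)) = n"

definition smooth_curve_on :: "real set \<Rightarrow> (real \<Rightarrow> 'a::real_normed_vector) \<Rightarrow> bool" where
  "smooth_curve_on I \<Phi> \<longleftrightarrow>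
     (\<exists>D. D 0 = \<Phi> \<and> (\<forall>k::nat. \<forall>\<nu>\<in>I. (D k has_vector_derivative D (Suc k) \<nu>) (at \<nu>)))"

definition standing_wave_map :: "real \<Rightarrow> real \<Rightarrow> real set \<Rightarrow> (real \<Rightarrow> energy_space) \<Rightarrow> bool" where
  "standing_wave_map lam \<eta> I \<Phi> \<longleftrightarrow>
     open I \<and> is_interval I \<and> smooth_curve_on I \<Phi> \<and>
     (\<forall>\<nu>\<in>I. (action lam \<eta> \<nu> has_derivative (\<lambda>_. 0)) (at (\<Phi> \<nu>)))"

text \<open>Solutions are continuous in time with values in the energy space and satisfy
  \<open>2 i u\<^sub>t = - \<Delta>u + \<lambda> |x|\<^sup>2 u + \<eta> (|x|\<^sup>2 * |u|\<^sup>2) u\<close> in its dual space. The right-hand side is then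
  continuous in time with values in the dual, so that testing with each \<open>v\<close> separately amounts to
  \<open>u\<close> being \<open>C\<^sup>1\<close> with values in the dual.\<close>

definition solution_H :: "real \<Rightarrow> real \<Rightarrow> (real \<Rightarrow> energy_space) \<Rightarrow> bool" where
  "solution_H lam \<eta> u \<longleftrightarrow> continuous_on {0..} u \<and>
     (\<forall>v. \<forall>t\<ge>0.
        ((\<lambda>s. 2 * \<i> * (LINT x|lborel. fn (u s) x * cnj (fn v x))) has_vector_derivative
           (LINT x|lborel. grad (u t) x * cnj (grad v x)) +
           of_real lam * (LINT x|lborel. of_real (\<bar>x\<bar>\<^sup>2) * fn (u t) x * cnj (fn v x)) +
           of_real \<eta> * (LINT x|lborel.
              of_real (LINT y|lborel. \<bar>x - y\<bar>\<^sup>2 * (cmod (fn (u t) y))\<^sup>2) * fn (u t) x * cnj (fn v x)))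
         (at t within {0..}))"

text \<open>The Cauchy problem is globally well-posed in the energy space, so for each \<open>u\<^sub>0\<close> the
  quantifier over \<open>u\<close> concerns exactly one solution on \<open>[0, \<infinity>)\<close>. Supremum and infimum are taken in
  \<^typ>\<open>ereal\<close>, so that an unbounded orbit gives \<open>\<infinity>\<close>.\<close>

definition orbitally_stable :: "real \<Rightarrow> real \<Rightarrow> energy_space \<Rightarrow> bool" where
  "orbitally_stable lam \<eta> \<phi> \<longleftrightarrow>
     (\<forall>\<epsilon>>0. \<exists>\<delta>>0. \<forall>u\<^sub>0. norm (u\<^sub>0 - \<phi>) < \<delta> \<longrightarrow>
        (\<forall>u. solution_H lam \<eta> u \<and> u 0 = u\<^sub>0 \<longrightarrow>
           (SUP t\<in>{0<..}. INF (\<theta>, y)\<in>UNIV. ereal (norm (\<phi> - gauge_translate \<theta> y (u t)))) < ereal \<epsilon>))"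

end

(*
  With M the conserved mass and V the second moment, the Hartree potential of an even function is the
  polynomial M x^2 + V. Hence the standing waves are Hermite functions: with Om^2 = lam + eta M, the
  k-th Hermite function of the oscillator - u'' + Om^2 x^2 u, with mass M, is a standing wave of
  frequency omega = (2 k + 1) (3 Om / 2 - lam / (2 Om)). Here d'(omega) = - M / 2, so that d'' has
  the sign of - eta.

  Stability: once the mass is known to be conserved, (H) becomes a linear oscillator equation in a
  suitable moving frame. The moduli of the Hermite coefficients are then constant in time, so by
  Parseval's identity the distance to the phase orbit of the standing wave, in the energy norm of the
  oscillator, is constant as well.

  Index: on even functions the Hessian at the k-th state, k = 2 m, is diagonal in the Hermite basis,
  except for a rank two term that couples the real parts of the coefficients k - 2, k, k + 2. The
  imaginary part contributes m and the uncoupled real part m - 1 negative eigenvalues; the sign of the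
  determinant of the coupled 3 x 3 block decides between one (eta = 1) and two (eta = -1) more.
*)

theory Submission
  imports Defs "HOL-Probability.Probability"
begin

subsection \<open>Square-integrable functions\<close>

text \<open>The action has arbitrarily many negative directions at these states, so stability cannot
  be read off its Hessian; it rests on the rigidity of the flow. Three obstacles shape the argument.
  The oscillator frequency depends on the mass, so a solution is compared with the Hermite state of
  its own mass and width, which is close to the given state when the data are close. Stability is
  measured modulo phases and translations but not modulo boosts, so the velocity of the moving frame
  must stay small for all times; this uses 0 \<le> lam. Finally, the equation is available only
  after pairing with a fixed element of the energy space, so the frame is carried by the test
  functions and not by the solution. Everything closes on finitely many numbers because |x - y|^2,
  multiplied out, leaves only the mass and the first two moments. The origin of omega: the constant
  part eta V of the potential, with V = M (2 k + 1) / (2 Om), is added to the oscillator eigenvalue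
  (2 k + 1) Om, and eta M = Om^2 - lam.\<close>

definition ip :: "(real \<Rightarrow> complex) \<Rightarrow> (real \<Rightarrow> complex) \<Rightarrow> complex" where
  "ip f g = (LINT x|lborel. f x * cnj (g x))"

definition l2n :: "(real \<Rightarrow> complex) \<Rightarrow> real" where
  "l2n f = sqrt (LINT x|lborel. (cmod (f x))\<^sup>2)"

lemma l2n_nonneg [simp]: "0 \<le> l2n f"
  by (simp add: l2n_def)

lemma l2n_sq: "(l2n f)\<^sup>2 = (LINT x|lborel. (cmod (f x))\<^sup>2)"
  by (simp add: l2n_def)

lemma ip_self: "ip f f = of_real ((l2n f)\<^sup>2)"
  unfolding ip_def l2n_sq by (simp only: complex_norm_square[symmetric] integral_complex_of_real)

lemma l2_inner_ip: "l2_inner f g = Re (ip f g)"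
  by (simp add: l2_inner_def ip_def)

lemma ip_commute: "ip g f = cnj (ip f g)"
  unfolding ip_def by (subst Bochner_Integration.integral_cnj[symmetric]) (simp add: mult.commute)

lemma ip_add_left: "f \<in> L2 \<Longrightarrow> g \<in> L2 \<Longrightarrow> h \<in> L2 \<Longrightarrow> ip (\<lambda>x. f x + g x) h = ip f h + ip g h"
  by (simp add: ip_def distrib_right L2_mult_cnj_integrable)

lemma ip_add_right: "f \<in> L2 \<Longrightarrow> g \<in> L2 \<Longrightarrow> h \<in> L2 \<Longrightarrow> ip h (\<lambda>x. f x + g x) = ip h f + ip h g"
  by (simp add: ip_def distrib_left L2_mult_cnj_integrable)

lemma ip_diff_left: "f \<in> L2 \<Longrightarrow> g \<in> L2 \<Longrightarrow> h \<in> L2 \<Longrightarrow> ip (\<lambda>x. f x - g x) h = ip f h - ip g h"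
  by (simp add: ip_def left_diff_distrib L2_mult_cnj_integrable)

lemma ip_diff_right: "f \<in> L2 \<Longrightarrow> g \<in> L2 \<Longrightarrow> h \<in> L2 \<Longrightarrow> ip h (\<lambda>x. f x - g x) = ip h f - ip h g"
  by (simp add: ip_def right_diff_distrib L2_mult_cnj_integrable)

lemma ip_cmult_left: "ip (\<lambda>x. c * f x) g = c * ip f g"
  by (simp add: ip_def mult.assoc)

lemma ip_cmult_right: "ip f (\<lambda>x. c * g x) = cnj c * ip f g"
  by (simp add: ip_def mult.left_commute)

lemma ip_minus_right: "ip f (\<lambda>x. - g x) = - ip f g"
  using ip_cmult_right[of f "-1" g] by simp

lemma ip_minus_left: "ip (\<lambda>x. - f x) g = - ip f g"
  using ip_cmult_left[of "-1" f g] by simp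

lemma ip_cong_AE:
  assumes "AE x in lborel. f x = f' x" "AE x in lborel. g x = g' x"
    "f \<in> L2" "f' \<in> L2" "g \<in> L2" "g' \<in> L2"
  shows "ip f g = ip f' g'"
  unfolding ip_def
  by (intro integral_cong_AE borel_measurable_integrable L2_mult_cnj_integrable assms)
     (use assms(1,2) in \<open>eventually_elim, simp\<close>)

lemma L2_norm_integrable:
  assumes f: "f \<in> L2" and g: "g \<in> L2"
  shows "integrable lborel (\<lambda>x. cmod (f x) * cmod (g x))"
  using integrable_norm[OF L2_mult_integrable[OF f g]] by (simp add: norm_mult)

text \<open>The leading coefficient may be 0, since \<open>l2n f\<close> may vanish; the quadratic
  is then affine, and an affine function that is bounded below has slope 0.\<close>

lemma quadratic_nonneg_discriminant:
  fixes a b c :: real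
  assumes "\<And>t. 0 \<le> t\<^sup>2 * a + 2 * t * b + c" "0 \<le> a"
  shows "b\<^sup>2 \<le> a * c"
proof (cases "a = 0")
  case True
  have "b = 0"
  proof (rule ccontr)
    assume "b \<noteq> 0"
    \<comment> \<open>At this t the affine function takes the value -1.\<close>
    then show False using assms(1)[of "- (c + 1) / (2 * b)"] True by (simp add: field_simps)
  qed
  then show ?thesis using True by simp
next
  case False
  then show ?thesis using assms(1)[of "- b / a"] assms(2)
    by (simp add: field_simps power2_eq_square)
qed

lemma ip_norm_CS:
  assumes f: "f \<in> L2" and g: "g \<in> L2"
  shows "(LINT x|lborel. cmod (f x) * cmod (g x)) \<le> l2n f * l2n g"
proof -
  let ?I = "LINT x|lborel. cmod (f x) * cmod (g x)"
  have "0 \<le> t\<^sup>2 * (l2n f)\<^sup>2 + 2 * t * ?I + (l2n g)\<^sup>2" for t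
  proof -
    have "0 \<le> (LINT x|lborel. (t * cmod (f x) + cmod (g x))\<^sup>2)" by simp
    also have "\<dots> = (LINT x|lborel. t\<^sup>2 * (cmod (f x))\<^sup>2 + 2 * t * (cmod (f x) * cmod (g x)) + (cmod (g x))\<^sup>2)"
      by (intro Bochner_Integration.integral_cong) (auto simp: power2_eq_square algebra_simps)
    also have "\<dots> = t\<^sup>2 * (l2n f)\<^sup>2 + 2 * t * ?I + (l2n g)\<^sup>2"
      unfolding l2n_sq using f g
      by (simp add: L2_square_integrable L2_norm_integrable)
    finally show ?thesis .
  qed
  then have "?I\<^sup>2 \<le> (l2n f)\<^sup>2 * (l2n g)\<^sup>2"
    by (rule quadratic_nonneg_discriminant) auto
  then have "?I\<^sup>2 \<le> (l2n f * l2n g)\<^sup>2" by (simp add: power_mult_distrib)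
  then show ?thesis by (rule power2_le_imp_le) simp
qed

lemma ip_CS:
  assumes f: "f \<in> L2" and g: "g \<in> L2"
  shows "cmod (ip f g) \<le> l2n f * l2n g"
proof -
  have "cmod (ip f g) \<le> (LINT x|lborel. cmod (f x * cnj (g x)))"
    unfolding ip_def by (rule integral_norm_bound)
  then show ?thesis using ip_norm_CS[OF f g] by (simp add: norm_mult)
qed

lemma l2n_add_sq:
  assumes "f \<in> L2" "g \<in> L2"
  shows "(l2n (\<lambda>x. f x + g x))\<^sup>2 = (l2n f)\<^sup>2 + 2 * Re (ip f g) + (l2n g)\<^sup>2"
proof -
  have "complex_of_real ((l2n (\<lambda>x. f x + g x))\<^sup>2) = ip f f + ip g f + (ip f g + ip g g)"
    unfolding ip_self[symmetric] using assms by (simp add: ip_add_left ip_add_right L2_add)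
  also have "\<dots> = of_real ((l2n f)\<^sup>2 + 2 * Re (ip f g) + (l2n g)\<^sup>2)"
    by (subst ip_commute[of g f], auto simp: ip_self complex_eq_iff)
  finally show ?thesis using of_real_eq_iff by blast
qed

lemma l2n_minus [simp]: "l2n (\<lambda>x. - f x) = l2n f"
  by (simp add: l2n_def)

lemma l2n_cmult: "l2n (\<lambda>x. c * f x) = cmod c * l2n f"
  by (simp add: l2n_def norm_mult power_mult_distrib real_sqrt_mult)

lemma L2_minus: "f \<in> L2 \<Longrightarrow> (\<lambda>x. - f x) \<in> L2"
  using L2_cmult[of f "-1"] by simp

lemma l2n_diff_sq:
  assumes "f \<in> L2" "g \<in> L2"
  shows "(l2n (\<lambda>x. f x - g x))\<^sup>2 = (l2n f)\<^sup>2 - 2 * Re (ip f g) + (l2n g)\<^sup>2"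
  using l2n_add_sq[OF assms(1) L2_minus[OF assms(2)]] by (simp add: ip_minus_right)

lemma l2n_triangle:
  assumes "f \<in> L2" "g \<in> L2"
  shows "l2n (\<lambda>x. f x + g x) \<le> l2n f + l2n g"
proof (rule power2_le_imp_le)
  have "Re (ip f g) \<le> l2n f * l2n g"
    using ip_CS[OF assms] complex_Re_le_cmod order_trans by blast
  then show "(l2n (\<lambda>x. f x + g x))\<^sup>2 \<le> (l2n f + l2n g)\<^sup>2"
    by (simp add: l2n_add_sq[OF assms] power2_sum)
qed simp

lemma l2n_cong_AE:
  assumes "AE x in lborel. f x = g x" "f \<in> L2" "g \<in> L2"
  shows "l2n f = l2n g"
proof -
  have "complex_of_real ((l2n f)\<^sup>2) = of_real ((l2n g)\<^sup>2)"
    unfolding ip_self[symmetric] by (rule ip_cong_AE) (use assms in auto)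
  then show ?thesis by (simp only: of_real_eq_iff power2_eq_iff_nonneg l2n_nonneg)
qed

lemma L2_sum: "(\<And>i. i \<in> A \<Longrightarrow> f i \<in> L2) \<Longrightarrow> (\<lambda>x. \<Sum>i\<in>A. f i x) \<in> L2"
  by (induction A rule: infinite_finite_induct) (auto intro: L2_zero L2_add)

lemma ip_zero_left [simp]: "ip (\<lambda>x. 0) g = 0"
  and ip_zero_right [simp]: "ip f (\<lambda>x. 0) = 0"
  by (simp_all add: ip_def)

lemma ip_sum_right:
  assumes "\<And>i. i \<in> A \<Longrightarrow> f i \<in> L2" "g \<in> L2"
  shows "ip g (\<lambda>x. \<Sum>i\<in>A. f i x) = (\<Sum>i\<in>A. ip g (f i))"
  using assms by (induction A rule: infinite_finite_induct) (auto simp: ip_add_right L2_sum)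

lemma fn_times_x_L2: "(\<lambda>x. of_real x * fn u x) \<in> L2"
proof (rule L2_bound[OF fn_bracket_L2[of u], where c = 1])
  show "(\<lambda>x. of_real x * fn u x) \<in> borel_measurable borel"
    using L2_measurable[OF fn_L2[of u]] by simp
  fix x
  have "\<bar>x\<bar> \<le> bracket x" unfolding bracket_def by (rule real_le_rsqrt) simp
  then have "\<bar>x\<bar> * cmod (fn u x) \<le> \<bar>bracket x\<bar> * cmod (fn u x)"
    by (intro mult_right_mono) auto
  then show "cmod (of_real x * fn u x) \<le> 1 * cmod (of_real (bracket x) * fn u x)"
    by (simp add: norm_mult)
qed

text \<open>The mass counts twice: once on its own and once through the square of
  \<open>bracket x\<close>, which is 1 + x^2.\<close>

lemma norm_energy_sq:
  "(norm u)\<^sup>2 = 2 * (l2n (fn u))\<^sup>2 + (l2n (grad u))\<^sup>2 + (l2n (\<lambda>x. of_real x * fn u x))\<^sup>2"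
proof -
  have "(l2n (\<lambda>x. of_real (bracket x) * fn u x))\<^sup>2 =
      (LINT x|lborel. (cmod (fn u x))\<^sup>2 + (cmod (of_real x * fn u x))\<^sup>2)"
    unfolding l2n_sq
    by (intro Bochner_Integration.integral_cong)
       (auto simp: norm_mult power_mult_distrib bracket_def distrib_right)
  also have "\<dots> = (l2n (fn u))\<^sup>2 + (l2n (\<lambda>x. of_real x * fn u x))\<^sup>2"
    unfolding l2n_sq
    by (rule Bochner_Integration.integral_add) (intro L2_square_integrable fn_L2 fn_times_x_L2)+
  finally show ?thesis
    unfolding norm_energy_space_def using Sigma_inner_nonneg[of u]
    by (simp add: Sigma_inner_def l2_inner_self l2n_sq)
qed

lemma norm_energy_bounds:
  "l2n (fn u) \<le> norm u" "l2n (grad u) \<le> norm u" "l2n (\<lambda>x. of_real x * fn u x) \<le> norm u"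
  by (rule power2_le_imp_le, simp_all add: norm_energy_sq)+

lemma norm_energy_le:
  "norm u \<le> 2 * l2n (fn u) + l2n (grad u) + l2n (\<lambda>x. of_real x * fn u x)"
proof (rule power2_le_imp_le)
  have "2 * a\<^sup>2 + b\<^sup>2 + c\<^sup>2 \<le> (2 * a + b + c)\<^sup>2" if "0 \<le> a" "0 \<le> b" "0 \<le> c" for a b c :: real
  proof -
    have "(2 * a + b + c)\<^sup>2 - (2 * a\<^sup>2 + b\<^sup>2 + c\<^sup>2) = 2 * a\<^sup>2 + 4 * (a * b) + 4 * (a * c) + 2 * (b * c)"
      by (simp add: power2_eq_square algebra_simps)
    moreover have "0 \<le> \<dots>" using that by (intro add_nonneg_nonneg mult_nonneg_nonneg) auto
    ultimately show ?thesis by linarith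
  qed
  then show "(norm u)\<^sup>2 \<le> (2 * l2n (fn u) + l2n (grad u) + l2n (\<lambda>x. of_real x * fn u x))\<^sup>2"
    unfolding norm_energy_sq by simp
qed simp

section \<open>Sesquilinear forms for mass, kinetic energy and moments\<close>

definition cm :: "energy_space \<Rightarrow> energy_space \<Rightarrow> complex" where
  "cm u v = ip (fn u) (fn v)"

definition cg :: "energy_space \<Rightarrow> energy_space \<Rightarrow> complex" where
  "cg u v = ip (grad u) (grad v)"

text \<open>After |x - y|^2 is multiplied out, the equation and the action are polynomial
  expressions in \<open>cm\<close>, \<open>cg\<close>, \<open>cx\<close> and \<open>cv\<close>; all
  analysis on the energy space is done with these four forms.\<close>

definition cx :: "energy_space \<Rightarrow> energy_space \<Rightarrow> complex" where
  "cx u v = ip (\<lambda>x. of_real x * fn u x) (fn v)"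

definition cv :: "energy_space \<Rightarrow> energy_space \<Rightarrow> complex" where
  "cv u v = ip (\<lambda>x. of_real x * fn u x) (\<lambda>x. of_real x * fn v x)"

text \<open>Antilinearity in the second argument is linearity over the reals, and Hermitian symmetry
  carries the rules from the first argument to the second.\<close>

lemma bounded_bilinear_of_sesqui:
  assumes add1: "\<And>u u' v. f (u + u') v = f u v + f u' v"
    and comm: "\<And>u v. f u v = cnj (f v u)"
    and scale: "\<And>r u v. f (r *\<^sub>R u) v = of_real r * (f u v :: complex)"
    and bnd: "\<And>u v. cmod (f u v) \<le> norm u * norm v"
  shows "bounded_bilinear f"
proof
  show "f (a + a') b = f a b + f a' b" for a a' b by (rule add1)
  show "f a (b + b') = f a b + f a b'" for a b b'
    by (subst comm, simp add: add1, subst (1 2) comm[symmetric], simp)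
  show "f (r *\<^sub>R a) b = r *\<^sub>R f a b" for r a b by (simp add: scale scaleR_conv_of_real)
  show "f a (r *\<^sub>R b) = r *\<^sub>R f a b" for r a b
    by (subst comm, simp add: scale, subst comm[symmetric], simp add: scaleR_conv_of_real)
  show "\<exists>K. \<forall>a b. norm (f a b) \<le> norm a * norm b * K"
    by (rule exI[of _ 1]) (use bnd in auto)
qed

lemma cm_commute: "cm u v = cnj (cm v u)"
  and cg_commute: "cg u v = cnj (cg v u)"
  and cv_commute: "cv u v = cnj (cv v u)"
  unfolding cm_def cg_def cv_def by (rule ip_commute)+

lemma cx_commute: "cx u v = cnj (cx v u)"
proof -
  have "cx u v = ip (fn u) (\<lambda>x. of_real x * fn v x)"
    unfolding cx_def ip_def by (simp add: ac_simps)
  then show ?thesis by (simp add: ip_commute[of "fn u"] cx_def)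
qed

lemma bounded_bilinear_cm: "bounded_bilinear cm"
proof (rule bounded_bilinear_of_sesqui)
  show "cmod (cm u v) \<le> norm u * norm v" for u v
    unfolding cm_def
    by (rule order_trans[OF ip_CS]) (auto intro!: mult_mono norm_energy_bounds fn_L2)
  show "cm (u + u') v = cm u v + cm u' v" for u u' v
    unfolding cm_def fn_plus by (intro ip_add_left fn_L2)
  show "cm (r *\<^sub>R u) v = of_real r * cm u v" for r u v
    unfolding cm_def fn_scaleR by (rule ip_cmult_left)
qed (rule cm_commute)

lemma bounded_bilinear_cx: "bounded_bilinear cx"
proof (rule bounded_bilinear_of_sesqui)
  show "cmod (cx u v) \<le> norm u * norm v" for u v
    unfolding cx_def
    by (rule order_trans[OF ip_CS]) (auto intro!: mult_mono norm_energy_bounds fn_L2 fn_times_x_L2)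
  show "cx (u + u') v = cx u v + cx u' v" for u u' v
    unfolding cx_def fn_plus distrib_left by (intro ip_add_left fn_L2 fn_times_x_L2)
  show "cx (r *\<^sub>R u) v = of_real r * cx u v" for r u v
    unfolding cx_def fn_scaleR mult.left_commute[of "of_real _" "of_real r"] by (rule ip_cmult_left)
qed (rule cx_commute)

lemma bounded_bilinear_cv: "bounded_bilinear cv"
proof (rule bounded_bilinear_of_sesqui)
  show "cmod (cv u v) \<le> norm u * norm v" for u v
    unfolding cv_def
    by (rule order_trans[OF ip_CS]) (auto intro!: mult_mono norm_energy_bounds fn_L2 fn_times_x_L2)
  show "cv (u + u') v = cv u v + cv u' v" for u u' v
    unfolding cv_def fn_plus distrib_left by (intro ip_add_left fn_L2 fn_times_x_L2)
  show "cv (r *\<^sub>R u) v = of_real r * cv u v" for r u v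
    unfolding cv_def fn_scaleR mult.left_commute[of "of_real _" "of_real r"] by (rule ip_cmult_left)
qed (rule cv_commute)

lemma bounded_bilinear_cg: "bounded_bilinear cg"
proof (rule bounded_bilinear_of_sesqui)
  show "cmod (cg u v) \<le> norm u * norm v" for u v
    unfolding cg_def
    by (rule order_trans[OF ip_CS]) (auto intro!: mult_mono norm_energy_bounds grad)
  show "cg (u + u') v = cg u v + cg u' v" for u u' v
    unfolding cg_def
    by (subst ip_add_left[symmetric, OF grad(1) grad(1) grad(1)], rule ip_cong_AE[OF grad_plus])
       (auto intro: grad L2_add)
  show "cg (r *\<^sub>R u) v = of_real r * cg u v" for r u v
    unfolding cg_def
    by (subst ip_cmult_left[symmetric], rule ip_cong_AE[OF grad_scaleR])
       (auto intro: grad L2_cmult)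
qed (rule cg_commute)

lemma cm_self: "cm u u = of_real ((l2n (fn u))\<^sup>2)"
  and cg_self: "cg u u = of_real ((l2n (grad u))\<^sup>2)"
  and cv_self: "cv u u = of_real ((l2n (\<lambda>x. of_real x * fn u x))\<^sup>2)"
  unfolding cm_def cg_def cv_def by (rule ip_self)+

subsection \<open>Polynomials times Gaussians and integration by parts\<close>

text \<open>The quadratic Taylor bound for exp gives a comparison with 1 / (1 + x^2). The function
  serves as the common majorant for convergence in the mean (\<open>L2_dct\<close>,
  \<open>L2_deriv\<close>).\<close>

lemma integrable_exp_minus_abs: "integrable lborel (\<lambda>x::real. exp (- \<bar>x\<bar>))"
proof (rule Bochner_Integration.integrable_bound)
  have "einterval (-\<infinity>) \<infinity> = (UNIV :: real set)" by (auto simp: einterval_def)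
  then show "integrable lborel (\<lambda>x::real. 2 * inverse (1 + x\<^sup>2))"
    using integrable_inverse_1_plus_square by (simp add: set_integrable_def)
  have "exp (- \<bar>x\<bar>) \<le> 2 * inverse (1 + x\<^sup>2)" for x :: real
  proof -
    have "1 + \<bar>x\<bar> + \<bar>x\<bar>\<^sup>2 / 2 \<le> exp \<bar>x\<bar>" by (rule exp_lower_Taylor_quadratic) simp
    then have "(1 + x\<^sup>2) / 2 \<le> exp \<bar>x\<bar>" by simp
    then have "inverse (exp \<bar>x\<bar>) \<le> inverse ((1 + x\<^sup>2) / 2)"
      by (intro le_imp_inverse_le) (auto simp: add_pos_nonneg)
    then show ?thesis by (simp add: exp_minus field_simps)
  qed
  then show "AE x in lborel. norm (exp (- \<bar>x\<bar>)) \<le> norm (2 * inverse (1 + (x::real)\<^sup>2))"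
    by (intro AE_I2) auto
qed simp

lemma integrable_exp_decay:
  fixes f :: "real \<Rightarrow> complex"
  assumes "f \<in> borel_measurable borel" "\<And>x. cmod (f x) \<le> C * exp (- \<bar>x\<bar>)"
  shows "integrable lborel f"
proof (rule Bochner_Integration.integrable_bound)
  show "integrable lborel (\<lambda>x::real. C * exp (- \<bar>x\<bar>))"
    by (intro integrable_mult_right integrable_exp_minus_abs)
  show "AE x in lborel. norm (f x) \<le> norm (C * exp (- \<bar>x\<bar>))"
    using assms(2) by (intro AE_I2) (metis abs_ge_self order_trans real_norm_def)
qed (use assms in simp)

lemma L2_exp_decay:
  fixes f :: "real \<Rightarrow> complex"
  assumes f: "f \<in> borel_measurable borel" "\<And>x. cmod (f x) \<le> C * exp (- \<bar>x\<bar>)"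
  shows "f \<in> L2"
proof (rule L2_I)
  have "integrable lborel (\<lambda>x. complex_of_real ((cmod (f x))\<^sup>2))"
  proof (rule integrable_exp_decay)
    show "(\<lambda>x. complex_of_real ((cmod (f x))\<^sup>2)) \<in> borel_measurable borel"
      using f(1) by measurable
    fix x
    have "(cmod (f x))\<^sup>2 \<le> (C * exp (- \<bar>x\<bar>))\<^sup>2" using f(2) by (intro power_mono) auto
    also have "\<dots> = C\<^sup>2 * (exp (- \<bar>x\<bar>) * exp (- \<bar>x\<bar>))" by (simp add: power2_eq_square)
    also have "\<dots> \<le> C\<^sup>2 * exp (- \<bar>x\<bar>)" by (intro mult_left_mono) auto
    finally show "cmod (of_real ((cmod (f x))\<^sup>2)) \<le> C\<^sup>2 * exp (- \<bar>x\<bar>)"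
      unfolding norm_of_real by simp
  qed
  then show "integrable lborel (\<lambda>x. (cmod (f x))\<^sup>2)"
    by (simp only: complex_of_real_integrable_eq)
qed (use f in simp)

text \<open>exp (- a x^2 / 2) is the ground state of - u'' + a^2 x^2 u. The class is closed under
  differentiation, which acts on the polynomial factor as \<open>dpg a\<close>, and under
  multiplication by x, so that calculus becomes polynomial algebra.\<close>

definition pg :: "real poly \<Rightarrow> real \<Rightarrow> real \<Rightarrow> real" where
  "pg p a x = poly p x * exp (- (a * x\<^sup>2 / 2))"

definition dpg :: "real \<Rightarrow> real poly \<Rightarrow> real poly" where
  "dpg a p = pderiv p - [:0, a:] * p"

lemma pg_deriv: "(pg p a has_field_derivative pg (dpg a p) a x) (at x)"
  unfolding pg_def dpg_def
  by (auto intro!: derivative_eq_intros poly_DERIV simp: algebra_simps)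

lemma pg_continuous: "continuous_on A (pg p a)"
  unfolding pg_def by (auto intro!: continuous_intros)

lemma pg_add: "pg (p + q) a x = pg p a x + pg q a x"
  and pg_diff: "pg (p - q) a x = pg p a x - pg q a x"
  and pg_smult: "pg (smult c p) a x = c * pg p a x"
  and pg_times_x: "pg ([:0, c:] * p) a x = c * x * pg p a x"
  by (simp_all add: pg_def algebra_simps)

text \<open>An exponential rate in place of the degree suits the induction: the factor x is absorbed
  by \<bar>x\<bar> \<le> exp \<bar>x\<bar>, which raises the rate by one.\<close>

lemma poly_exp_bound: "\<exists>C k. 0 \<le> C \<and> 0 \<le> k \<and> (\<forall>x::real. \<bar>poly p x\<bar> \<le> C * exp (k * \<bar>x\<bar>))"
proof (induction p)
  case 0
  show ?case by (rule exI[of _ 0], rule exI[of _ 0]) simp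
next
  case (pCons c p)
  then obtain C k where C: "0 \<le> C" "0 \<le> k" "\<And>x. \<bar>poly p x\<bar> \<le> C * exp (k * \<bar>x\<bar>)" by blast
  have "\<bar>poly (pCons c p) x\<bar> \<le> (\<bar>c\<bar> + C) * exp ((k + 1) * \<bar>x\<bar>)" for x
  proof -
    have "\<bar>x\<bar> \<le> exp \<bar>x\<bar>" using exp_ge_add_one_self[of "\<bar>x\<bar>"] by linarith
    then have "\<bar>x\<bar> * \<bar>poly p x\<bar> \<le> exp \<bar>x\<bar> * (C * exp (k * \<bar>x\<bar>))"
      using C by (intro mult_mono) auto
    moreover have "\<bar>c\<bar> * 1 \<le> \<bar>c\<bar> * exp ((k + 1) * \<bar>x\<bar>)" using C(2) by (intro mult_left_mono) auto
    moreover have "\<bar>poly (pCons c p) x\<bar> \<le> \<bar>c\<bar> + \<bar>x\<bar> * \<bar>poly p x\<bar>"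
      using abs_triangle_ineq[of c "x * poly p x"] by (simp add: abs_mult)
    ultimately have "\<bar>poly (pCons c p) x\<bar> \<le> \<bar>c\<bar> * exp ((k + 1) * \<bar>x\<bar>) + exp \<bar>x\<bar> * (C * exp (k * \<bar>x\<bar>))"
      by linarith
    then show ?thesis by (simp add: distrib_left distrib_right exp_add algebra_simps)
  qed
  then show ?case using C by (intro exI[of _ "\<bar>c\<bar> + C"] exI[of _ "k + 1"]) auto
qed

lemma pg_bound:
  assumes "0 < a"
  shows "\<exists>C\<ge>0. \<forall>x. \<bar>pg p a x\<bar> \<le> C * exp (- (b * \<bar>x\<bar>))"
proof -
  obtain C k where C: "0 \<le> C" "0 \<le> k" "\<And>x. \<bar>poly p x\<bar> \<le> C * exp (k * \<bar>x\<bar>)"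
    using poly_exp_bound by blast
  \<comment> \<open>The maximum over s of (k + b) s - a s^2 / 2; the inequality below is the
    completed square.\<close>
  let ?D = "(k + b)\<^sup>2 / (2 * a)"
  have "\<bar>pg p a x\<bar> \<le> (C * exp ?D) * exp (- (b * \<bar>x\<bar>))" for x
  proof -
    have "0 \<le> (a * \<bar>x\<bar> - (k + b))\<^sup>2" by simp
    then have "(k + b) * \<bar>x\<bar> \<le> ?D + a * x\<^sup>2 / 2"
      using assms by (simp add: field_simps power2_eq_square)
    then have e: "k * \<bar>x\<bar> - a * x\<^sup>2 / 2 \<le> ?D - b * \<bar>x\<bar>" by (simp add: distrib_right)
    have "\<bar>pg p a x\<bar> \<le> C * exp (k * \<bar>x\<bar>) * exp (- (a * x\<^sup>2 / 2))"
      unfolding pg_def abs_mult using C by (simp add: mult_right_mono)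
    also have "\<dots> = C * exp (k * \<bar>x\<bar> - a * x\<^sup>2 / 2)" by (simp add: mult.assoc exp_add[symmetric])
    also have "\<dots> \<le> C * exp (?D - b * \<bar>x\<bar>)" using e C by (intro mult_left_mono) auto
    finally show ?thesis by (simp add: mult.assoc exp_add[symmetric])
  qed
  then show ?thesis using C by (intro exI[of _ "C * exp ?D"]) auto
qed

lemma pg_L2:
  assumes "0 < a"
  shows "(\<lambda>x. complex_of_real (pg p a x)) \<in> L2"
proof -
  obtain C where C: "\<And>x. \<bar>pg p a x\<bar> \<le> C * exp (- \<bar>x\<bar>)"
    using pg_bound[OF assms, of p 1] by auto
  show ?thesis
    by (rule L2_exp_decay[of _ C])
       (use C borel_measurable_continuous_onI[OF pg_continuous[of UNIV p a]] in auto)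
qed

section \<open>Integration by parts for decaying test functions\<close>

lemma cutoff_exists:
  "\<exists>\<kappa>\<in>C1c. \<kappa> 0 > 0 \<and> (\<exists>B. \<forall>x. \<bar>\<kappa> x\<bar> \<le> B \<and> \<bar>deriv \<kappa> x\<bar> \<le> B)"
proof -
  define q where "q = (\<lambda>x::real. (max 0 ((x - (-1)) * (1 - x)))\<^sup>2)"
  define \<kappa> where "\<kappa> = (\<lambda>x. real 1 * q x / (1 + real 1 * q x))"
  have \<kappa>: "\<kappa> \<in> C1c" unfolding \<kappa>_def q_def by (rule bump_function) simp
  have "bounded (range f)" if c: "continuous_on UNIV f" and z: "\<And>x. \<bar>x\<bar> > R \<Longrightarrow> f x = 0"
    for f :: "real \<Rightarrow> real" and R
  proof -
    have "bounded (f ` {-R..R})"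
      by (intro compact_imp_bounded compact_continuous_image continuous_on_subset[OF c]) auto
    then have "bounded (insert 0 (f ` {-R..R}))" by simp
    moreover have "range f \<subseteq> insert 0 (f ` {-R..R})"
    proof
      fix y assume "y \<in> range f"
      then obtain x where "y = f x" by auto
      then show "y \<in> insert 0 (f ` {-R..R})" using z[of x] by (cases "\<bar>x\<bar> > R") (auto simp: abs_le_iff not_less)
    qed
    ultimately show ?thesis by (rule bounded_subset)
  qed note bdd = this
  have diff: "\<kappa> field_differentiable at x" for x using \<kappa> by (auto simp: C1c_def)
  have c': "continuous_on UNIV (deriv \<kappa>)" using \<kappa> by (auto simp: C1c_def)
  have c: "continuous_on UNIV \<kappa>"
    using diff by (simp add: continuous_at_imp_continuous_on field_differentiable_imp_continuous_at)
  have "bounded {x. \<kappa> x \<noteq> 0}" using \<kappa> by (auto simp: C1c_def)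
  then obtain R where R: "\<And>x. \<kappa> x \<noteq> 0 \<Longrightarrow> \<bar>x\<bar> \<le> R" by (auto simp: bounded_iff)
  then have R0: "\<kappa> x = 0" if "\<bar>x\<bar> > R" for x using that by (meson not_le)
  have "deriv \<kappa> x = 0" if "\<bar>x\<bar> > R" for x
  proof -
    have "open {x::real. \<bar>x\<bar> > R}" by (intro open_Collect_less continuous_intros)
    then have "(\<kappa> has_field_derivative 0) (at x)"
      using that R0 by (intro has_field_derivative_transform_within_open[OF DERIV_const[of 0]]) auto
    then show ?thesis by (rule DERIV_imp_deriv)
  qed
  from bdd[OF c' this] obtain B' where B': "\<And>x. \<bar>deriv \<kappa> x\<bar> \<le> B'" by (auto simp: bounded_iff)
  from bdd[OF c R0] obtain B where B: "\<And>x. \<bar>\<kappa> x\<bar> \<le> B" by (auto simp: bounded_iff)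
  have "\<kappa> 0 > 0" by (simp add: \<kappa>_def q_def)
  with \<kappa> show ?thesis
    by (intro bexI[of _ \<kappa>] conjI exI[of _ "max B B'"]) (auto intro: order_trans[OF B] order_trans[OF B'])
qed

lemma C1c_deriv: "\<psi> \<in> C1c \<Longrightarrow> (\<psi> has_field_derivative deriv \<psi> x) (at x)"
  by (auto simp: C1c_def field_differentiable_derivI)

lemma C1c_continuous:
  assumes "\<psi> \<in> C1c"
  shows "continuous_on A \<psi>" "continuous_on A (deriv \<psi>)"
  using assms C1c_deriv[OF assms]
  by (auto simp: C1c_def intro: continuous_on_subset DERIV_continuous_on has_field_derivative_at_within)

lemma C1c_mult:
  assumes p: "\<psi> \<in> C1c" and f: "\<And>x. (f has_field_derivative f' x) (at x)" "continuous_on UNIV f'"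
  shows "(\<lambda>x. f x * \<psi> x) \<in> C1c" "deriv (\<lambda>x. f x * \<psi> x) x = f x * deriv \<psi> x + f' x * \<psi> x"
proof -
  have d: "((\<lambda>x. f x * \<psi> x) has_field_derivative f x * deriv \<psi> x + f' x * \<psi> x) (at x)" for x
    using f(1) C1c_deriv[OF p] by (auto intro!: derivative_eq_intros)
  then show e: "deriv (\<lambda>x. f x * \<psi> x) x = f x * deriv \<psi> x + f' x * \<psi> x" for x
    by (rule DERIV_imp_deriv)
  have "continuous_on UNIV f" by (intro DERIV_continuous_on[OF has_field_derivative_at_within[OF f(1)]])
  then have "continuous_on UNIV (\<lambda>x. f x * deriv \<psi> x + f' x * \<psi> x)"
    by (intro continuous_intros f(2) C1c_continuous[OF p])
  moreover have "bounded {x. f x * \<psi> x \<noteq> 0}"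
    by (rule bounded_subset[of "{x. \<psi> x \<noteq> 0}"]) (use p in \<open>auto simp: C1c_def\<close>)
  ultimately show "(\<lambda>x. f x * \<psi> x) \<in> C1c"
    using d by (auto simp: C1c_def field_differentiable_def e cong: continuous_on_cong)
qed

lemma C1c_scale:
  assumes p: "\<psi> \<in> C1c" and c: "c > 0"
  shows "(\<lambda>x. \<psi> (c * x)) \<in> C1c" "deriv (\<lambda>x. \<psi> (c * x)) x = c * deriv \<psi> (c * x)"
proof -
  have d: "((\<lambda>x. \<psi> (c * x)) has_field_derivative c * deriv \<psi> (c * x)) (at x)" for x
    using DERIV_chain2[where f = \<psi> and g = "\<lambda>x. c * x" and x = x and s = UNIV,
        OF C1c_deriv[OF p] DERIV_cmult_Id]
    by (simp add: mult.commute)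
  then show e: "deriv (\<lambda>x. \<psi> (c * x)) x = c * deriv \<psi> (c * x)" for x by (rule DERIV_imp_deriv)
  have "bounded {x. \<psi> x \<noteq> 0}" using p by (auto simp: C1c_def)
  then have "bounded ((\<lambda>x. x /\<^sub>R c) ` {x. \<psi> x \<noteq> 0})"
    by (rule bounded_scaling)
  then have b: "bounded {x. \<psi> (c * x) \<noteq> 0}"
    by (rule bounded_subset) (use c in \<open>force simp: image_iff\<close>)
  have "continuous_on UNIV (\<lambda>x. c * deriv \<psi> (c * x))"
    by (intro continuous_intros continuous_on_compose2[OF C1c_continuous(2)[OF p, of UNIV]]) auto
  then show "(\<lambda>x. \<psi> (c * x)) \<in> C1c"
    using d b by (auto simp: C1c_def field_differentiable_def e cong: continuous_on_cong)
qed

text \<open>The weak derivative is tested with \<psi>(x) \<kappa>(c x), where c tends to 0. The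
  derivative of the cutoff carries the factor c and disappears in the limit, and the cutoff tends to
  the constant \<open>\<kappa> 0\<close>, which is divided out at the end; a positive value at 0 is
  all that is asked of \<kappa>.\<close>

lemma ibp_real:
  fixes \<psi> \<psi>' :: "real \<Rightarrow> real"
  assumes u: "u \<in> L2" "g \<in> L2" "weak_deriv u g"
    and d: "\<And>x. (\<psi> has_field_derivative \<psi>' x) (at x)" "continuous_on UNIV \<psi>'"
    and l: "(\<lambda>x. complex_of_real (\<psi> x)) \<in> L2" "(\<lambda>x. complex_of_real (\<psi>' x)) \<in> L2"
  shows "(LINT x|lborel. u x * of_real (\<psi>' x)) = - (LINT x|lborel. g x * of_real (\<psi> x))"
proof -
  obtain \<kappa> B where \<kappa>: "\<kappa> \<in> C1c" "\<kappa> 0 > 0" and B: "\<And>x. \<bar>\<kappa> x\<bar> \<le> B" "\<And>x. \<bar>deriv \<kappa> x\<bar> \<le> B"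
    using cutoff_exists by auto
  have B0: "0 \<le> B" using B(1)[of 0] by linarith
  define c where "c = (\<lambda>n. inverse (real (Suc n)))"
  have c: "c n > 0" "c n \<le> 1" for n by (auto simp: c_def divide_simps)
  have c0: "c \<longlonglongrightarrow> 0" unfolding c_def by (rule LIMSEQ_inverse_real_of_nat)
  define k where "k = (\<lambda>n x. \<kappa> (c n * x))"
  have k: "k n \<in> C1c" "deriv (k n) x = c n * deriv \<kappa> (c n * x)" for n x
    unfolding k_def by (rule C1c_scale[OF \<kappa>(1) c(1)])+
  have lim1: "(\<lambda>n. k n x) \<longlonglongrightarrow> \<kappa> 0" for x
  proof -
    have "(\<lambda>n. c n * x) \<longlonglongrightarrow> 0 * x" by (intro tendsto_intros c0)
    then show ?thesis unfolding k_def
      using continuous_on_tendsto_compose[OF C1c_continuous(1)[OF \<kappa>(1), of UNIV], of "\<lambda>n. c n * x" 0] by simp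
  qed
  have lim2: "(\<lambda>n. deriv (k n) x) \<longlonglongrightarrow> 0" for x
  proof (rule tendsto_rabs_zero_cancel, rule tendsto_sandwich[of "\<lambda>_. 0" _ _ "\<lambda>n. c n * B"])
    show "\<forall>\<^sub>F n in sequentially. \<bar>deriv (k n) x\<bar> \<le> c n * B"
      using c B by (intro always_eventually) (auto simp: k abs_mult less_imp_le intro!: mult_mono)
    show "(\<lambda>n. c n * B) \<longlonglongrightarrow> 0" using tendsto_mult[OF c0 tendsto_const[of B]] by simp
  qed auto
  have psi_c: "continuous_on UNIV \<psi>" by (intro DERIV_continuous_on[OF has_field_derivative_at_within[OF d(1)]])
  note [measurable] = L2_measurable[OF u(1)] L2_measurable[OF u(2)]
    borel_measurable_continuous_onI[OF psi_c] borel_measurable_continuous_onI[OF d(2)]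
    borel_measurable_continuous_onI[OF C1c_continuous(1)[OF k(1)]]
    borel_measurable_continuous_onI[OF C1c_continuous(2)[OF k(1)]]
  have eq: "(LINT x|lborel. u x * of_real (\<psi> x * deriv (k n) x + \<psi>' x * k n x)) =
     - (LINT x|lborel. g x * of_real (\<psi> x * k n x))" for n
    using u(3)[unfolded weak_deriv_def, rule_format, OF C1c_mult(1)[OF k(1)[of n] d]]
    unfolding C1c_mult(2)[OF k(1)[of n] d] .
  have "(\<lambda>n. LINT x|lborel. u x * of_real (\<psi> x * deriv (k n) x + \<psi>' x * k n x)) \<longlonglongrightarrow>
     (LINT x|lborel. u x * of_real (\<psi> x * 0 + \<psi>' x * \<kappa> 0))"
  proof (rule integral_dominated_convergence)
    show "integrable lborel (\<lambda>x. B * (cmod (u x) * cmod (of_real (\<psi> x))) + B * (cmod (u x) * cmod (of_real (\<psi>' x))))"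
      by (intro Bochner_Integration.integrable_add integrable_mult_right L2_norm_integrable u l)
    show "AE x in lborel. (\<lambda>n. u x * of_real (\<psi> x * deriv (k n) x + \<psi>' x * k n x)) \<longlonglongrightarrow>
        u x * of_real (\<psi> x * 0 + \<psi>' x * \<kappa> 0)"
      by (intro AE_I2 tendsto_intros lim1 lim2)
    show "AE x in lborel. norm (u x * of_real (\<psi> x * deriv (k n) x + \<psi>' x * k n x)) \<le>
      B * (cmod (u x) * cmod (of_real (\<psi> x))) + B * (cmod (u x) * cmod (of_real (\<psi>' x)))" for n
    proof (rule AE_I2)
      fix x
      have "\<bar>deriv (k n) x\<bar> \<le> 1 * B"
        unfolding k abs_mult using c B by (intro mult_mono) (auto simp: less_imp_le)
      then have "\<bar>\<psi> x * deriv (k n) x\<bar> \<le> B * \<bar>\<psi> x\<bar>"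
        by (simp add: abs_mult mult.commute[of B] mult_left_mono)
      moreover have "\<bar>\<psi>' x * k n x\<bar> \<le> B * \<bar>\<psi>' x\<bar>"
        using B(1)[of "c n * x"] by (simp add: k_def abs_mult mult.commute[of B] mult_left_mono)
      ultimately have "\<bar>\<psi> x * deriv (k n) x + \<psi>' x * k n x\<bar> \<le> B * \<bar>\<psi> x\<bar> + B * \<bar>\<psi>' x\<bar>" by linarith
      then have "cmod (u x) * \<bar>\<psi> x * deriv (k n) x + \<psi>' x * k n x\<bar> \<le> cmod (u x) * (B * \<bar>\<psi> x\<bar> + B * \<bar>\<psi>' x\<bar>)"
        by (intro mult_left_mono) auto
      then show "norm (u x * of_real (\<psi> x * deriv (k n) x + \<psi>' x * k n x)) \<le>
         B * (cmod (u x) * cmod (of_real (\<psi> x))) + B * (cmod (u x) * cmod (of_real (\<psi>' x)))"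
        unfolding norm_mult norm_of_real by (simp add: algebra_simps)
    qed
  qed measurable
  moreover have "(\<lambda>n. - (LINT x|lborel. g x * of_real (\<psi> x * k n x))) \<longlonglongrightarrow>
     - (LINT x|lborel. g x * of_real (\<psi> x * \<kappa> 0))"
  proof (intro tendsto_minus integral_dominated_convergence)
    show "integrable lborel (\<lambda>x. B * (cmod (g x) * cmod (of_real (\<psi> x))))"
      by (intro integrable_mult_right L2_norm_integrable u l)
    show "AE x in lborel. (\<lambda>n. g x * of_real (\<psi> x * k n x)) \<longlonglongrightarrow> g x * of_real (\<psi> x * \<kappa> 0)"
      by (intro AE_I2 tendsto_intros lim1)
    show "AE x in lborel. norm (g x * of_real (\<psi> x * k n x)) \<le> B * (cmod (g x) * cmod (of_real (\<psi> x)))" for n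
    proof (rule AE_I2)
      fix x
      have "\<bar>k n x\<bar> \<le> B" using B(1) by (simp add: k_def)
      then have "cmod (g x) * \<bar>\<psi> x\<bar> * \<bar>k n x\<bar> \<le> cmod (g x) * \<bar>\<psi> x\<bar> * B"
        by (intro mult_left_mono) auto
      then show "norm (g x * of_real (\<psi> x * k n x)) \<le> B * (cmod (g x) * cmod (of_real (\<psi> x)))"
        by (simp add: norm_mult abs_mult ac_simps)
    qed
  qed measurable
  ultimately have e: "(LINT x|lborel. u x * of_real (\<psi> x * 0 + \<psi>' x * \<kappa> 0)) =
      - (LINT x|lborel. g x * of_real (\<psi> x * \<kappa> 0))"
    unfolding eq by (rule LIMSEQ_unique)
  have "(LINT x|lborel. u x * of_real (\<psi>' x)) * of_real (\<kappa> 0) =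
      - (LINT x|lborel. g x * of_real (\<psi> x)) * of_real (\<kappa> 0)"
    using e by (simp only: mult_zero_right add_0_left of_real_mult mult.assoc[symmetric]
      integral_mult_left_zero mult_minus_left)
  then show ?thesis using \<kappa>(2) by (subst (asm) mult_right_cancel) auto
qed

lemma L2_Re_Im:
  assumes "f \<in> L2"
  shows "(\<lambda>x. complex_of_real (Re (f x))) \<in> L2" "(\<lambda>x. complex_of_real (Im (f x))) \<in> L2"
  using L2_measurable[OF assms]
  by (auto intro!: L2_bound[OF assms, where c = 1] abs_Re_le_cmod abs_Im_le_cmod)

lemma ibp:
  fixes \<psi> \<psi>' :: "real \<Rightarrow> complex"
  assumes u: "u \<in> L2" "g \<in> L2" "weak_deriv u g"
    and d: "\<And>x. (\<psi> has_vector_derivative \<psi>' x) (at x)" "continuous_on UNIV \<psi>'"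
    and l: "\<psi> \<in> L2" "\<psi>' \<in> L2"
  shows "ip u \<psi>' = - ip g \<psi>"
proof -
  have split: "ip f h = (LINT x|lborel. f x * of_real (Re (h x))) - \<i> * (LINT x|lborel. f x * of_real (Im (h x)))"
    if "f \<in> L2" "h \<in> L2" for f h
  proof -
    have "ip f h = (LINT x|lborel. f x * of_real (Re (h x)) - \<i> * (f x * of_real (Im (h x))))"
      unfolding ip_def by (intro Bochner_Integration.integral_cong) (auto simp: complex_eq_iff algebra_simps)
    also have "\<dots> = (LINT x|lborel. f x * of_real (Re (h x))) - (LINT x|lborel. \<i> * (f x * of_real (Im (h x))))"
      by (intro Bochner_Integration.integral_diff integrable_mult_right L2_mult_integrable L2_Re_Im that)
    finally show ?thesis by simp
  qed
  have "((\<lambda>x. Re (\<psi> x)) has_field_derivative Re (\<psi>' x)) (at x)"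
       "((\<lambda>x. Im (\<psi> x)) has_field_derivative Im (\<psi>' x)) (at x)" for x
    unfolding has_real_derivative_iff_has_vector_derivative
    by (intro bounded_linear.has_vector_derivative[OF bounded_linear_Re] d
         bounded_linear.has_vector_derivative[OF bounded_linear_Im])+
  moreover have "continuous_on UNIV (\<lambda>x. Re (\<psi>' x))" "continuous_on UNIV (\<lambda>x. Im (\<psi>' x))"
    by (intro continuous_intros d)+
  ultimately show ?thesis
    using ibp_real[OF u, of "\<lambda>x. Re (\<psi> x)" "\<lambda>x. Re (\<psi>' x)"]
          ibp_real[OF u, of "\<lambda>x. Im (\<psi> x)" "\<lambda>x. Im (\<psi>' x)"] u l
    by (simp add: split L2_Re_Im)
qed

lemma weak_deriv_C1:
  fixes f f' :: "real \<Rightarrow> complex"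
  assumes d: "\<And>x. (f has_vector_derivative f' x) (at x)" "continuous_on UNIV f'"
  shows "weak_deriv f f'"
  unfolding weak_deriv_def
proof
  fix \<psi> assume p: "\<psi> \<in> C1c"
  have cf: "continuous_on UNIV f" using d(1) by (meson continuous_on_eq_continuous_within
      has_vector_derivative_continuous has_vector_derivative_at_within)
  have "bounded {x. \<psi> x \<noteq> 0}" using p by (auto simp: C1c_def)
  then obtain R' where R': "\<And>x. \<psi> x \<noteq> 0 \<Longrightarrow> \<bar>x\<bar> \<le> R'" by (auto simp: bounded_iff)
  \<comment> \<open>One more than a bound for the support: \<psi> then vanishes at the endpoints R
    and -R too, which kills the boundary terms, and R is positive.\<close>
  define R where "R = \<bar>R'\<bar> + 1"
  have R0: "\<psi> x = 0" if "\<bar>x\<bar> \<ge> R" for x using that R'[of x] unfolding R_def by linarith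
  have R1: "deriv \<psi> x = 0" if "\<bar>x\<bar> > R" for x
  proof -
    have "open {x::real. \<bar>x\<bar> > R}" by (intro open_Collect_less continuous_intros)
    then have "(\<psi> has_field_derivative 0) (at x)"
      using that R0 by (intro has_field_derivative_transform_within_open[OF DERIV_const[of 0]]) auto
    then show ?thesis by (rule DERIV_imp_deriv)
  qed
  have dd: "((\<lambda>x. f x * of_real (\<psi> x)) has_vector_derivative f x * of_real (deriv \<psi> x) + f' x * of_real (\<psi> x))
     (at x within {-R..R})" for x
    by (rule has_vector_derivative_at_within, rule has_vector_derivative_mult[OF d(1)],
        rule has_vector_derivative_of_real)
       (use C1c_deriv[OF p] in \<open>simp add: has_real_derivative_iff_has_vector_derivative\<close>)
  have int: "integrable lborel h"
    if "continuous_on UNIV h" "\<And>x. \<bar>x\<bar> > R \<Longrightarrow> h x = 0" for h :: "real \<Rightarrow> complex"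
  proof -
    have "integrable lborel (\<lambda>x. indicator {-R..R} x *\<^sub>R h x)"
      by (intro borel_integrable_compact continuous_on_subset[OF that(1)]) auto
    also have "(\<lambda>x. indicator {-R..R} x *\<^sub>R h x) = h"
      using that(2) by (fastforce simp: indicator_def)
    finally show ?thesis .
  qed
  have cont: "continuous_on UNIV (\<lambda>x. f x * of_real (deriv \<psi> x) + f' x * of_real (\<psi> x))"
    by (intro continuous_intros cf d(2) C1c_continuous[OF p])
  have "(LINT x|lborel. f x * of_real (deriv \<psi> x)) + (LINT x|lborel. f' x * of_real (\<psi> x)) =
     (LINT x|lborel. f x * of_real (deriv \<psi> x) + f' x * of_real (\<psi> x))"
    by (intro Bochner_Integration.integral_add[symmetric] int continuous_intros cf d(2) C1c_continuous[OF p])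
       (use R0 R1 in auto)
  also have "\<dots> = (LINT x|lborel. indicator {-R..R} x *\<^sub>R (f x * of_real (deriv \<psi> x) + f' x * of_real (\<psi> x)))"
    using R0 R1 by (intro Bochner_Integration.integral_cong) (auto simp: indicator_def)
  also have "\<dots> = f R * of_real (\<psi> R) - f (-R) * of_real (\<psi> (-R))"
    by (rule integral_FTC_Icc[OF _ dd continuous_on_subset[OF cont]]) (auto simp: R_def)
  also have "\<dots> = 0" using R0[of R] R0[of "-R"] by (simp add: R_def)
  finally show "(LINT x|lborel. f x * of_real (deriv \<psi> x)) = - (LINT x|lborel. f' x * of_real (\<psi> x))"
    by (simp add: eq_neg_iff_add_eq_0)
qed

lemma Sigma_fun_C1:
  assumes "\<And>x. (f has_vector_derivative f' x) (at x)" "continuous_on UNIV f'"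
    and "f \<in> L2" "f' \<in> L2" "(\<lambda>x. of_real x * f x) \<in> L2"
  shows "f \<in> Sigma_fun"
proof -
  have c: "continuous_on UNIV f" using assms(1) by (meson continuous_on_eq_continuous_within
      has_vector_derivative_continuous has_vector_derivative_at_within)
  have "(\<lambda>x. of_real (bracket x) * f x) \<in> L2"
  proof (rule L2_I)
    show "(\<lambda>x. of_real (bracket x) * f x) \<in> borel_measurable lborel"
      unfolding bracket_def using L2_measurable[OF assms(3)] by measurable
    have "integrable lborel (\<lambda>x. (cmod (f x))\<^sup>2 + (cmod (of_real x * f x))\<^sup>2)"
      by (intro Bochner_Integration.integrable_add L2_square_integrable assms)
    also have "(\<lambda>x. (cmod (f x))\<^sup>2 + (cmod (of_real x * f x))\<^sup>2) = (\<lambda>x. (cmod (of_real (bracket x) * f x))\<^sup>2)"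
      by (auto simp: norm_mult power_mult_distrib bracket_def distrib_right)
    finally show "integrable lborel (\<lambda>x. (cmod (of_real (bracket x) * f x))\<^sup>2)" .
  qed
  then show ?thesis
    using assms weak_deriv_C1[OF assms(1,2)] c by (auto simp: Sigma_fun_def H1_def)
qed

lemma has_vector_derivative_of_pg:
  "((\<lambda>x. complex_of_real (pg p a x)) has_vector_derivative of_real (pg (dpg a p) a x)) (at x)"
  by (rule has_vector_derivative_of_real[OF pg_deriv])

definition pgs :: "real poly \<Rightarrow> real \<Rightarrow> energy_space" where
  "pgs p a = mk (\<lambda>x. of_real (pg p a x))"

lemma pg_times_x': "x * pg p a x = pg ([:0, 1:] * p) a x"
  by (simp only: pg_times_x)

lemma fn_pgs: "0 < a \<Longrightarrow> fn (pgs p a) = (\<lambda>x. of_real (pg p a x))"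
  unfolding pgs_def
  by (intro mk_inverse Sigma_fun_C1[OF has_vector_derivative_of_pg] continuous_intros pg_continuous pg_L2)
     (auto simp: of_real_mult[symmetric] pg_times_x' intro: pg_L2 simp del: of_real_mult)

lemma grad_pgs: "0 < a \<Longrightarrow> AE x in lborel. grad (pgs p a) x = of_real (pg (dpg a p) a x)"
  by (rule grad_AE_eq)
     (auto simp: fn_pgs intro!: pg_L2 weak_deriv_C1 has_vector_derivative_of_pg continuous_intros pg_continuous)

subsection \<open>Hermite functions\<close>

abbreviation PG :: "real poly \<Rightarrow> real \<Rightarrow> real \<Rightarrow> complex" where
  "PG p a \<equiv> \<lambda>x. complex_of_real (pg p a x)"

text \<open>With H_n the physicists' Hermite polynomials this is a^(n/2) H_n(sqrt a x). The scaling
  makes the coefficients polynomial in a, so that they can be differentiated along the curve of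
  standing waves.\<close>

fun hp :: "real \<Rightarrow> nat \<Rightarrow> real poly" where
  "hp a 0 = 1"
| "hp a (Suc n) = [:0, 2 * a:] * hp a n - pderiv (hp a n)"

declare hp.simps(2) [simp del]

text \<open>Differentiation lowers the index because its commutator with the raising map, which
  sends p to 2 a x p - p', is the constant 2 a; each induction step adds one such constant.\<close>

lemma pderiv_hp: "pderiv (hp a (Suc n)) = smult (2 * a * real (Suc n)) (hp a n)"
proof (induction n)
  case 0
  show ?case by (simp add: hp.simps(2) pderiv_pCons one_pCons)
next
  case (Suc n)
  have "pderiv (hp a (Suc (Suc n))) =
      [:0, 2 * a:] * pderiv (hp a (Suc n)) + hp a (Suc n) * [:2 * a:] - pderiv (pderiv (hp a (Suc n)))"
    by (subst hp.simps(2)) (simp add: pderiv_diff pderiv_mult pderiv_pCons del: mult_pCons_left mult_pCons_right)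
  also have "\<dots> = smult (2 * a) (hp a (Suc n)) + smult (2 * a * real (Suc n)) ([:0, 2 * a:] * hp a n - pderiv (hp a n))"
    unfolding Suc by (simp add: pderiv_smult smult_diff_right algebra_simps)
  also have "\<dots> = smult (2 * a * real (Suc (Suc n))) (hp a (Suc n))"
    unfolding hp.simps(2)[symmetric] by (simp add: smult_add_left[symmetric] algebra_simps)
  finally show ?case .
qed

text \<open>The squared norm of \<open>hp a n\<close> times the Gaussian: sqrt (pi / a) is the
  integral of exp (- a x^2), and raising from n to n + 1 contributes 2 a (n + 1).\<close>

definition hN :: "real \<Rightarrow> nat \<Rightarrow> real" where
  "hN a n = (2 * a) ^ n * fact n * sqrt (pi / a)"

definition hn :: "real \<Rightarrow> nat \<Rightarrow> real poly" where
  "hn a n = smult (1 / sqrt (hN a n)) (hp a n)"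

abbreviation HE :: "real \<Rightarrow> nat \<Rightarrow> real \<Rightarrow> complex" where
  "HE a n \<equiv> PG (hn a n) a"

lemma hN_pos: "0 < a \<Longrightarrow> 0 < hN a n"
  by (simp add: hN_def)

lemma hN_Suc: "hN a (Suc n) = (2 * a * real (Suc n)) * hN a n"
  by (simp add: hN_def)

lemma pderiv_hn_Suc:
  assumes a: "0 < a"
  shows "pderiv (hn a (Suc n)) = smult (sqrt (2 * a * real (Suc n))) (hn a n)"
proof -
  let ?t = "2 * a * real (Suc n)"
  have t: "?t > 0" using a by simp
  have "1 / sqrt (hN a (Suc n)) * ?t = (?t / sqrt ?t) * (1 / sqrt (hN a n))"
    unfolding hN_Suc by (simp only: real_sqrt_mult) simp
  also have "?t / sqrt ?t = sqrt ?t" using t by (simp only: real_div_sqrt less_imp_le)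
  finally show ?thesis by (simp only: hn_def pderiv_smult pderiv_hp smult_smult)
qed

text \<open>At n = 0 the truncated index n - 1 is harmless, because its coefficient is 0. The ladder
  formulas below follow the same convention.\<close>

lemma pderiv_hn:
  assumes "0 < a"
  shows "pderiv (hn a n) = smult (sqrt (2 * a * real n)) (hn a (n - 1))"
  using pderiv_hn_Suc[OF assms] by (cases n) (simp_all add: hn_def pderiv_smult)

lemma raise_hn:
  assumes a: "0 < a"
  shows "[:0, 2 * a:] * hn a n - pderiv (hn a n) = smult (sqrt (2 * a * real (Suc n))) (hn a (Suc n))"
proof -
  let ?t = "2 * a * real (Suc n)"
  have t: "?t > 0" using a by simp
  have "sqrt ?t * (1 / sqrt (hN a (Suc n))) = 1 / sqrt (hN a n)"
    unfolding hN_Suc using a by (simp only: real_sqrt_mult) simp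
  then have "smult (sqrt ?t) (hn a (Suc n)) = smult (1 / sqrt (hN a n)) (hp a (Suc n))"
    by (simp only: hn_def smult_smult)
  also have "\<dots> = [:0, 2 * a:] * hn a n - pderiv (hn a n)"
    by (simp only: hn_def hp.simps(2) pderiv_smult smult_diff_right mult_smult_right)
  finally show ?thesis by simp
qed

lemma ip_grad_PG:
  assumes "0 < a"
  shows "ip (grad u) (PG p a) = - ip (fn u) (PG (dpg a p) a)"
  using ibp[OF fn_L2 grad(1) grad(2) has_vector_derivative_of_pg[of p a], of u] assms
  by (simp add: pg_L2 continuous_on_of_real pg_continuous)

lemma ax_fn_L2: "(\<lambda>x. of_real (a * x) * fn u x) \<in> L2"
  using L2_cmult[OF fn_times_x_L2[of u], of "of_real a"] by (simp add: mult.assoc)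

lemma ip_ax_PG: "ip (\<lambda>x. of_real (a * x) * f x) (PG p a) = ip f (PG ([:0, a:] * p) a)"
  unfolding ip_def pg_times_x by (simp add: ac_simps)

lemma ip_PG_add: "0 < a \<Longrightarrow> f \<in> L2 \<Longrightarrow> ip f (PG (p + q) a) = ip f (PG p a) + ip f (PG q a)"
  and ip_PG_diff: "0 < a \<Longrightarrow> f \<in> L2 \<Longrightarrow> ip f (PG (p - q) a) = ip f (PG p a) - ip f (PG q a)"
  by (simp_all add: pg_add pg_diff ip_add_right ip_diff_right pg_L2)

lemma ip_PG_smult: "ip f (PG (smult c p) a) = of_real c * ip f (PG p a)"
  and ip_PG_smult_left: "ip (PG (smult c p) a) f = of_real c * ip (PG p a) f"
  by (simp_all add: pg_smult ip_cmult_left ip_cmult_right)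

text \<open>Moved to the other side, the annihilation operator d/dx + a x becomes - d/dx + a x. On a
  polynomial times the Gaussian this acts on the polynomial p as 2 a x p - p', because the Gaussian
  itself contributes another a x p.\<close>

lemma ip_lower:
  assumes a: "0 < a"
  shows "ip (\<lambda>x. grad u x + of_real (a * x) * fn u x) (PG p a) = ip (fn u) (PG ([:0, 2 * a:] * p - pderiv p) a)"
proof -
  have e: "[:0, 2 * a:] * p - pderiv p = [:0, a:] * p - dpg a p"
    by (simp add: dpg_def algebra_simps smult_add_left[symmetric])
  show ?thesis
    unfolding e ip_PG_diff[OF a fn_L2]
    by (simp add: ip_add_left grad ax_fn_L2 pg_L2 a ip_grad_PG ip_ax_PG del: of_real_mult)
qed

lemma ip_raise:
  assumes a: "0 < a"
  shows "ip (\<lambda>x. - grad u x + of_real (a * x) * fn u x) (PG p a) = ip (fn u) (PG (pderiv p) a)"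
proof -
  have e: "pderiv p = [:0, a:] * p + dpg a p"
    by (simp add: dpg_def)
  show ?thesis
    unfolding e ip_PG_add[OF a fn_L2]
    unfolding ip_add_left[OF L2_minus[OF grad(1)] ax_fn_L2 pg_L2[OF a]] ip_minus_left ip_grad_PG[OF a] ip_ax_PG
    by simp
qed

lemma ip_PG_adjoint:
  assumes a: "0 < a"
  shows "ip (PG (pderiv q) a) (PG p a) = ip (PG q a) (PG ([:0, 2 * a:] * p - pderiv p) a)"
proof -
  have "ip (PG (pderiv q) a) (PG p a) = ip (\<lambda>x. grad (pgs q a) x + of_real (a * x) * fn (pgs q a) x) (PG p a)"
  proof (rule ip_cong_AE)
    show "AE x in lborel. PG (pderiv q) a x = grad (pgs q a) x + of_real (a * x) * fn (pgs q a) x"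
      using grad_pgs[OF a, of q]
    proof eventually_elim
      case (elim x)
      have "pg (pderiv q) a x = pg (dpg a q) a x + a * x * pg q a x"
        unfolding dpg_def pg_diff pg_times_x by simp
      then show ?case using elim by (simp add: fn_pgs[OF a])
    qed
  qed (auto intro: pg_L2 a L2_add grad ax_fn_L2 simp del: of_real_mult)
  then show ?thesis using ip_lower[OF a, of "pgs q a" p] unfolding fn_pgs[OF a] by (rule trans)
qed

lemma ip_HE_step:
  assumes a: "0 < a"
  shows "of_real (sqrt (2 * a * real (Suc n))) * ip (HE a m) (HE a (Suc n)) =
      of_real (sqrt (2 * a * real m)) * ip (HE a (m - 1)) (HE a n)"
  using ip_PG_adjoint[OF a, of "hn a m" "hn a n"]
  unfolding raise_hn[OF a] pderiv_hn[OF a, of m] ip_PG_smult ip_PG_smult_left by simp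

text \<open>The square of the normalised ground state is the normal density of variance 1 / (2
  a).\<close>

lemma ip_HE_0:
  assumes a: "0 < a"
  shows "ip (HE a 0) (HE a 0) = 1"
proof -
  have "ip (HE a 0) (HE a 0) = (LINT x|lborel. complex_of_real (normal_density 0 (1 / sqrt (2 * a)) x))"
    unfolding ip_def
  proof (intro Bochner_Integration.integral_cong)
    fix x
    have "pg (hn a 0) a x * pg (hn a 0) a x = (1 / sqrt (pi / a)) * (exp (- (a * x\<^sup>2 / 2)) * exp (- (a * x\<^sup>2 / 2)))"
      using a by (simp add: pg_def hn_def hN_def field_simps real_sqrt_mult[symmetric])
    also have "\<dots> = (1 / sqrt (pi / a)) * exp (- (a * x\<^sup>2))"
      unfolding exp_add[symmetric] by simp
    also have "\<dots> = normal_density 0 (1 / sqrt (2 * a)) x"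
      using a by (simp add: normal_density_def power_divide)
    finally show "HE a 0 x * cnj (HE a 0 x) = complex_of_real (normal_density 0 (1 / sqrt (2 * a)) x)"
      by (simp only: complex_cnj_complex_of_real of_real_mult[symmetric])
  qed simp
  also have "\<dots> = 1" using a by simp
  finally show ?thesis .
qed

text \<open>\<open>ip_HE_step\<close> lowers both indices at once, so every pairing reduces to one
  that contains the ground state. Such a pairing is 0 unless both indices are 0, since lowering the
  ground state gives 0.\<close>

lemma ip_HE:
  assumes a: "0 < a"
  shows "ip (HE a m) (HE a n) = (if m = n then 1 else 0)"
proof (induction n arbitrary: m)
  case 0
  show ?case
  proof (cases m)
    case 0
    then show ?thesis using ip_HE_0[OF a] by simp
  next
    case (Suc k)
    have "ip (HE a 0) (HE a (Suc k)) = 0" using ip_HE_step[OF a, of k 0] a by simp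
    then show ?thesis using ip_commute[of "HE a m" "HE a 0"] Suc by simp
  qed
next
  case (Suc n)
  show ?case
  proof (cases m)
    case 0
    then show ?thesis using ip_HE_step[OF a, of n 0] a by simp
  next
    case (Suc k)
    have "ip (HE a k) (HE a n) = (if k = n then 1 else 0)" by (rule Suc.IH)
    then show ?thesis using ip_HE_step[OF a, of n "Suc k"] a Suc by (cases "k = n") auto
  qed
qed

lemma x_hn:
  assumes a: "0 < a"
  shows "[:0, 2 * a:] * hn a n = smult (sqrt (2 * a * real (Suc n))) (hn a (Suc n)) + smult (sqrt (2 * a * real n)) (hn a (n - 1))"
  using raise_hn[OF a, of n] unfolding pderiv_hn[OF a, of n, symmetric] by (simp add: algebra_simps)

lemma ip_x_HE:
  assumes a: "0 < a" and f: "f \<in> L2"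
  shows "of_real (2 * a) * ip f (\<lambda>x. of_real x * HE a n x) =
     of_real (sqrt (2 * a * real (Suc n))) * ip f (HE a (Suc n)) + of_real (sqrt (2 * a * real n)) * ip f (HE a (n - 1))"
proof -
  have "of_real (2 * a) * ip f (\<lambda>x. of_real x * HE a n x) = ip f (PG ([:0, 2 * a:] * hn a n) a)"
    unfolding pg_times_x
    using ip_cmult_right[of f "of_real (2 * a)" "\<lambda>x. of_real x * HE a n x"] by (simp add: mult.assoc)
  then show ?thesis unfolding x_hn[OF a] by (simp only: ip_PG_add[OF a f] ip_PG_smult)
qed

text \<open>Lowering after raising multiplies by 2 a (n + 1). Written out this is a second-order
  equation for the polynomial factor; with the Gaussian restored it is the oscillator equation with
  eigenvalue (2 n + 1) a.\<close>

lemma HE_ode: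
  assumes a: "0 < a"
  shows "pg (dpg a (dpg a (hn a n))) a x = (a\<^sup>2 * x\<^sup>2 - (2 * real n + 1) * a) * pg (hn a n) a x"
proof -
  define p where "p = hn a n"
  have "pderiv ([:0, 2 * a:] * p - pderiv p) = smult (2 * a * real (Suc n)) p"
    unfolding p_def raise_hn[OF a] pderiv_smult pderiv_hn_Suc[OF a] smult_smult
    using a by (simp only: real_sqrt_mult_self abs_of_nonneg) simp
  then have "pderiv (pderiv p) = [:0, 2 * a:] * pderiv p + smult (2 * a) p - smult (2 * a * real (Suc n)) p"
    by (simp add: pderiv_diff pderiv_mult pderiv_pCons pderiv_smult algebra_simps)
  then have pp: "poly (pderiv (pderiv p)) x = 2 * a * x * poly (pderiv p) x + 2 * a * poly p x - 2 * a * real (Suc n) * poly p x"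
    by simp
  have "poly (dpg a (dpg a p)) x = (a\<^sup>2 * x\<^sup>2 - (2 * real n + 1) * a) * poly p x"
    unfolding dpg_def
    by (simp add: pderiv_diff pderiv_mult pderiv_pCons pderiv_smult pp power2_eq_square algebra_simps)
  then show ?thesis by (simp add: pg_def p_def)
qed

subsection \<open>Completeness\<close>

text \<open>The densities \<open>\<bar>r\<bar> + r\<close> and \<open>\<bar>r\<bar>\<close> have the same total mass and the same characteristic function.\<close>

lemma fourier_zero:
  fixes r :: "real \<Rightarrow> real"
  assumes r: "integrable lborel r" and z: "\<And>t. (LINT x|lborel. of_real (r x) * iexp (t * x)) = 0"
  shows "AE x in lborel. r x = 0"
proof -
  define C where "C = (LINT x|lborel. \<bar>r x\<bar>)"
  have r': "integrable lborel (\<lambda>x. \<bar>r x\<bar>)" using r by (rule integrable_abs)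
  have rc: "integrable lborel (\<lambda>x. complex_of_real (r x))" using r by (rule integrable_of_real)
  note [measurable] = borel_measurable_integrable[OF r]
  have C0: "0 \<le> C" unfolding C_def by (intro integral_nonneg_AE) simp
  show ?thesis
  proof (cases "C = 0")
    case True
    then have "AE x in lborel. \<bar>r x\<bar> = 0" unfolding C_def
      using integral_nonneg_eq_0_iff_AE[OF r'] by simp
    then show ?thesis by simp
  next
    case False
    then have C: "C > 0" using C0 by simp
    define f where "f = (\<lambda>x. (\<bar>r x\<bar> + r x) / C)"
    define g where "g = (\<lambda>x. \<bar>r x\<bar> / C)"
    have [measurable]: "f \<in> borel_measurable borel" "g \<in> borel_measurable borel"
      unfolding f_def g_def by measurable
    have fg0: "0 \<le> f x" "0 \<le> g x" for x unfolding f_def g_def using C by auto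
    have int: "integrable lborel f" "integrable lborel g"
      unfolding f_def g_def using r r' by auto
    have "(LINT x|lborel. complex_of_real (r x)) = 0" using z[of 0] by simp
    then have r0: "(LINT x|lborel. r x) = 0" by (simp add: integral_complex_of_real)
    have "(LINT x|lborel. f x) = 1" "(LINT x|lborel. g x) = 1"
      unfolding f_def g_def using r r' r0 C by (simp_all add: C_def[symmetric])
    then have nn: "(\<integral>\<^sup>+x. ennreal (f x) \<partial>lborel) = 1" "(\<integral>\<^sup>+x. ennreal (g x) \<partial>lborel) = 1"
      using int fg0 by (simp_all add: nn_integral_eq_integral)
    have rd: "real_distribution (density lborel (\<lambda>x. ennreal (h x)))"
      if "h \<in> borel_measurable borel" "(\<integral>\<^sup>+x. ennreal (h x) \<partial>lborel) = 1" for h :: "real \<Rightarrow> real"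
      using that by (auto simp: real_distribution_def real_distribution_axioms_def emeasure_density intro!: prob_spaceI)
    have "char (density lborel (\<lambda>x. ennreal (f x))) = char (density lborel (\<lambda>x. ennreal (g x)))"
    proof
      fix t
      have i: "integrable lborel (\<lambda>x. of_real (h x) * iexp (t * x))" if "integrable lborel h" for h :: "real \<Rightarrow> real"
      proof (rule Bochner_Integration.integrable_bound[OF integrable_norm[OF that]])
        show "(\<lambda>x. of_real (h x) * iexp (t * x)) \<in> borel_measurable lborel"
          using borel_measurable_integrable[OF that] by measurable
      qed (simp add: norm_mult)
      have "char (density lborel (\<lambda>x. ennreal (f x))) t = (LINT x|lborel. f x *\<^sub>R iexp (t * x))"
        unfolding char_def using fg0 by (intro integral_density) auto
      also have "\<dots> = (LINT x|lborel. of_real (g x) * iexp (t * x) + (of_real (r x) * iexp (t * x)) / of_real C)"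
        by (intro Bochner_Integration.integral_cong) (auto simp: f_def g_def scaleR_conv_of_real add_divide_distrib algebra_simps)
      also have "\<dots> = (LINT x|lborel. of_real (g x) * iexp (t * x)) + (LINT x|lborel. (of_real (r x) * iexp (t * x)) / of_real C)"
        by (intro Bochner_Integration.integral_add integrable_divide i int r)
      also have "\<dots> = (LINT x|lborel. g x *\<^sub>R iexp (t * x))"
        using z[of t] by (simp add: scaleR_conv_of_real)
      also have "\<dots> = char (density lborel (\<lambda>x. ennreal (g x))) t"
        unfolding char_def using fg0 by (intro integral_density[symmetric]) auto
      finally show "char (density lborel (\<lambda>x. ennreal (f x))) t = char (density lborel (\<lambda>x. ennreal (g x))) t" .
    qed
    then have "density lborel (\<lambda>x. ennreal (f x)) = density lborel (\<lambda>x. ennreal (g x))"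
      by (intro Levy_uniqueness rd nn) auto
    then have "AE x in lborel. ennreal (f x) = ennreal (g x)"
      by (intro sigma_finite_measure.density_unique[OF sigma_finite_lborel]) auto
    then show ?thesis
    proof eventually_elim
      case (elim x)
      then have "f x = g x" using fg0[of x] by simp
      then show ?case using C by (simp add: f_def g_def)
    qed
  qed
qed

text \<open>All moments of \<open>r\<close>, the product of f with the Gaussian, vanish. Expanding
  the exponential under the integral shows that its Fourier transform vanishes; the partial sums are
  bounded by exp (\<bar>t\<bar> \<bar>x\<bar>), which the Gaussian absorbs.\<close>

lemma moments_zero_AE:
  fixes f :: "real \<Rightarrow> real"
  assumes a: "0 < a" and f: "(\<lambda>x. complex_of_real (f x)) \<in> L2"
    and z: "\<And>i. (LINT x|lborel. complex_of_real (f x) * of_real (x ^ i * exp (- (a * x\<^sup>2 / 2)))) = 0"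
  shows "AE x in lborel. f x = 0"
proof -
  define r where "r = (\<lambda>x. f x * exp (- (a * x\<^sup>2 / 2)))"
  have fm: "f \<in> borel_measurable borel"
    using measurable_compose[OF L2_measurable[OF f] borel_measurable_Re] by simp
  note [measurable] = fm
  have pg1: "pg 1 a x = exp (- (a * x\<^sup>2 / 2))" for x by (simp add: pg_def)
  have "integrable lborel (\<lambda>x. complex_of_real (f x) * PG 1 a x)"
    by (intro L2_mult_integrable f pg_L2 a)
  then have "integrable lborel (\<lambda>x. complex_of_real (r x))" by (simp add: r_def pg1)
  then have r: "integrable lborel r" by (simp only: complex_of_real_integrable_eq)
  have "(LINT x|lborel. of_real (r x) * iexp (t * x)) = 0" for t
  proof -
    define S where "S = (\<lambda>n x. \<Sum>k<n. (\<i> * of_real (t * x)) ^ k / fact k)"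
    have Slim: "(\<lambda>n. S n x) \<longlonglongrightarrow> iexp (t * x)" for x
      using exp_converges[of "\<i> * of_real (t * x)"] unfolding sums_def S_def
      by (simp add: scaleR_conv_of_real divide_inverse mult.commute)
    have Sb: "cmod (S n x) \<le> exp (\<bar>t\<bar> * \<bar>x\<bar>)" for n x
    proof -
      have "cmod (S n x) \<le> (\<Sum>k<n. (\<bar>t\<bar> * \<bar>x\<bar>) ^ k / fact k)"
        unfolding S_def by (rule order_trans[OF norm_sum]) (simp add: norm_divide norm_power norm_mult abs_mult power_mult_distrib)
      also have "\<dots> \<le> exp (\<bar>t\<bar> * \<bar>x\<bar>)"
        using summable_exp[of "\<bar>t\<bar> * \<bar>x\<bar>"] unfolding exp_def
        by (simp add: divide_inverse mult.commute scaleR_conv_of_real) (rule sum_le_suminf, auto)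
      finally show ?thesis .
    qed
    \<comment> \<open>The rate |t| + 1 pays for exp (\<bar>t\<bar> \<bar>x\<bar>) and leaves exp (-
      \<bar>x\<bar>).\<close>
    obtain C where C: "0 \<le> C" "\<And>x. \<bar>pg 1 a x\<bar> \<le> C * exp (- ((\<bar>t\<bar> + 1) * \<bar>x\<bar>))"
      using pg_bound[OF a, of 1 "\<bar>t\<bar> + 1"] by auto
    have gL: "(\<lambda>x. complex_of_real (pg 1 a x * exp (\<bar>t\<bar> * \<bar>x\<bar>))) \<in> L2"
    proof (rule L2_exp_decay)
      show "(\<lambda>x. complex_of_real (pg 1 a x * exp (\<bar>t\<bar> * \<bar>x\<bar>))) \<in> borel_measurable borel"
        by (intro borel_measurable_continuous_onI continuous_intros pg_continuous)
      show "cmod (of_real (pg 1 a x * exp (\<bar>t\<bar> * \<bar>x\<bar>))) \<le> C * exp (- \<bar>x\<bar>)" for x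
      proof -
        have "\<bar>pg 1 a x\<bar> * exp (\<bar>t\<bar> * \<bar>x\<bar>) \<le> C * exp (- ((\<bar>t\<bar> + 1) * \<bar>x\<bar>)) * exp (\<bar>t\<bar> * \<bar>x\<bar>)"
          using C by (intro mult_right_mono) auto
        also have "\<dots> = C * exp (- \<bar>x\<bar>)" unfolding mult.assoc exp_add[symmetric] by (simp add: algebra_simps)
        finally show ?thesis unfolding norm_of_real abs_mult by simp
      qed
    qed
    have "(\<lambda>n. LINT x|lborel. of_real (r x) * S n x) \<longlonglongrightarrow> (LINT x|lborel. of_real (r x) * iexp (t * x))"
    proof (rule integral_dominated_convergence)
      show "integrable lborel (\<lambda>x. cmod (complex_of_real (f x)) * cmod (complex_of_real (pg 1 a x * exp (\<bar>t\<bar> * \<bar>x\<bar>))))"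
        by (intro L2_norm_integrable f gL)
      show "AE x in lborel. (\<lambda>n. of_real (r x) * S n x) \<longlonglongrightarrow> of_real (r x) * iexp (t * x)"
        by (intro AE_I2 tendsto_intros Slim)
      show "AE x in lborel. norm (of_real (r x) * S n x) \<le>
         cmod (complex_of_real (f x)) * cmod (complex_of_real (pg 1 a x * exp (\<bar>t\<bar> * \<bar>x\<bar>)))" for n
        using Sb by (intro AE_I2) (simp add: norm_mult abs_mult r_def pg1 mult.assoc mult_left_mono)
    qed (simp_all add: r_def S_def)
    moreover have "(LINT x|lborel. of_real (r x) * S n x) = 0" for n
    proof -
      have i: "integrable lborel (\<lambda>x. ((\<i> * of_real t) ^ k / fact k) * (complex_of_real (f x) * of_real (x ^ k * exp (- (a * x\<^sup>2 / 2)))))" for k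
      proof -
        have "integrable lborel (\<lambda>x. complex_of_real (f x) * PG (monom 1 k) a x)"
          by (intro L2_mult_integrable f pg_L2 a)
        then have "integrable lborel (\<lambda>x. complex_of_real (f x) * of_real (x ^ k * exp (- (a * x\<^sup>2 / 2))))"
          by (simp only: pg_def poly_monom mult_1)
        then show ?thesis by (rule integrable_mult_right)
      qed
      have "(LINT x|lborel. of_real (r x) * S n x) =
        (LINT x|lborel. (\<Sum>k<n. ((\<i> * of_real t) ^ k / fact k) * (complex_of_real (f x) * of_real (x ^ k * exp (- (a * x\<^sup>2 / 2))))))"
        by (intro Bochner_Integration.integral_cong)
           (auto simp: S_def r_def sum_distrib_left power_mult_distrib algebra_simps)
      also have "\<dots> = (\<Sum>k<n. LINT x|lborel. ((\<i> * of_real t) ^ k / fact k) * (complex_of_real (f x) * of_real (x ^ k * exp (- (a * x\<^sup>2 / 2)))))"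
        by (rule Bochner_Integration.integral_sum) (rule i)
      also have "\<dots> = 0" by (simp only: integral_mult_right_zero z mult_zero_right sum.neutral_const)
      finally show ?thesis .
    qed
    ultimately show ?thesis by (simp add: LIMSEQ_const_iff)
  qed
  then have "AE x in lborel. r x = 0" by (rule fourier_zero[OF r])
  then show ?thesis by (simp add: r_def)
qed

text \<open>The three-term recursion for multiplication by x shows, by induction on i, that f is
  orthogonal to x^i times every Hermite function. Index 0 gives the plain moments against the
  Gaussian, to which \<open>moments_zero_AE\<close> applies for real and imaginary part.\<close>

lemma hermite_complete:
  assumes a: "0 < a" and f: "f \<in> L2" and z: "\<And>n. ip f (HE a n) = 0"
  shows "AE x in lborel. f x = 0"
proof -
  have xp: "ip f (PG (monom 1 i * hn a j) a) = 0" for i j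
  proof (induction i arbitrary: j)
    case 0
    show ?case using z by simp
  next
    case (Suc i)
    have e: "smult (2 * a) (monom 1 (Suc i) * hn a j) =
        smult (sqrt (2 * a * real (Suc j))) (monom 1 i * hn a (Suc j)) + smult (sqrt (2 * a * real j)) (monom 1 i * hn a (j - 1))"
    proof -
      have "smult (2 * a) (monom 1 (Suc i) * hn a j) = monom 1 i * ([:0, 2 * a:] * hn a j)"
        by (simp add: monom_Suc)
      also have "\<dots> = smult (sqrt (2 * a * real (Suc j))) (monom 1 i * hn a (Suc j)) + smult (sqrt (2 * a * real j)) (monom 1 i * hn a (j - 1))"
        unfolding x_hn[OF a] by (simp only: distrib_left mult_smult_right)
      finally show ?thesis .
    qed
    have "of_real (2 * a) * ip f (PG (monom 1 (Suc i) * hn a j) a) = 0"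
      unfolding ip_PG_smult[symmetric] e ip_PG_add[OF a f] unfolding ip_PG_smult Suc by simp
    then show ?case using a by simp
  qed
  have m: "ip f (PG (monom 1 i) a) = 0" for i
  proof -
    have "hn a 0 = [:1 / sqrt (hN a 0):]" by (simp add: hn_def)
    then have "monom 1 i * hn a 0 = smult (1 / sqrt (hN a 0)) (monom 1 i)" by simp
    then show ?thesis using xp[of i 0] hN_pos[OF a, of 0] by (simp add: ip_PG_smult)
  qed
  have pgm: "PG (monom 1 i) a x = of_real (x ^ i * exp (- (a * x\<^sup>2 / 2)))" for i x
    by (simp add: pg_def poly_monom)
  have int: "integrable lborel (\<lambda>x. f x * PG (monom 1 i) a x)" for i
    by (intro L2_mult_integrable f pg_L2 a)
  have mi: "(LINT x|lborel. f x * PG (monom 1 i) a x) = 0" for i using m[of i] by (simp add: ip_def)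
  have "AE x in lborel. Re (f x) = 0"
  proof (rule moments_zero_AE[OF a L2_Re_Im(1)[OF f]])
    fix i
    have "(LINT x|lborel. Re (f x * PG (monom 1 i) a x)) = 0"
      using mi[of i] int[of i] by (simp only: integral_Re zero_complex.simps)
    then have "(LINT x|lborel. complex_of_real (Re (f x * PG (monom 1 i) a x))) = 0"
      by (simp only: integral_complex_of_real of_real_0)
    then show "(LINT x|lborel. of_real (Re (f x)) * complex_of_real (x ^ i * exp (- (a * x\<^sup>2 / 2)))) = 0"
      unfolding pgm by simp
  qed
  moreover have "AE x in lborel. Im (f x) = 0"
  proof (rule moments_zero_AE[OF a L2_Re_Im(2)[OF f]])
    fix i
    have "(LINT x|lborel. Im (f x * PG (monom 1 i) a x)) = 0"
      using mi[of i] int[of i] by (simp only: integral_Im zero_complex.simps)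
    then have "(LINT x|lborel. complex_of_real (Im (f x * PG (monom 1 i) a x))) = 0"
      by (simp only: integral_complex_of_real of_real_0)
    then show "(LINT x|lborel. of_real (Im (f x)) * complex_of_real (x ^ i * exp (- (a * x\<^sup>2 / 2)))) = 0"
      unfolding pgm by simp
  qed
  ultimately show ?thesis by eventually_elim (simp add: complex_eq_iff)
qed

subsection \<open>Parseval identity\<close>

lemma nn_integral_l2n:
  "f \<in> L2 \<Longrightarrow> (\<integral>\<^sup>+x. ennreal ((cmod (f x))\<^sup>2) \<partial>lborel) = ennreal ((l2n f)\<^sup>2)"
  unfolding l2n_sq by (rule nn_integral_eq_integral[OF L2_square_integrable]) auto

lemma L2_of_nn_bound:
  assumes [measurable]: "f \<in> borel_measurable borel"
    and "(\<integral>\<^sup>+x. ennreal ((cmod (f x))\<^sup>2) \<partial>lborel) \<le> ennreal (c\<^sup>2)" "0 \<le> c"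
  shows "f \<in> L2" "l2n f \<le> c"
proof -
  show f: "f \<in> L2"
  proof (rule L2_I)
    show "integrable lborel (\<lambda>x. (cmod (f x))\<^sup>2)"
      by (rule integrableI_bounded) (use assms(2) in \<open>auto intro: le_less_trans\<close>)
  qed simp
  show "l2n f \<le> c"
  proof (rule power2_le_imp_le)
    show "(l2n f)\<^sup>2 \<le> c\<^sup>2" using assms(2) unfolding nn_integral_l2n[OF f] by simp
  qed (rule assms(3))
qed

text \<open>Riesz-Fischer. Along a subsequence the differences have norm below 2^-k, so the sum of
  2^k times their squared moduli has finite integral. Almost everywhere the differences are
  therefore O(2^(-k/2)), and the subsequence converges.\<close>

lemma L2_complete:
  fixes F :: "nat \<Rightarrow> real \<Rightarrow> complex"
  assumes F: "\<And>n. F n \<in> L2"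
    and C: "\<And>e. e > 0 \<Longrightarrow> \<exists>K. \<forall>m\<ge>K. \<forall>n\<ge>K. l2n (\<lambda>x. F m x - F n x) < e"
  shows "\<exists>g\<in>L2. (\<lambda>n. l2n (\<lambda>x. F n x - g x)) \<longlonglongrightarrow> 0"
proof -
  have "\<exists>K. \<forall>m\<ge>K. \<forall>n\<ge>K. l2n (\<lambda>x. F m x - F n x) < (1/2) ^ k" for k :: nat
    by (rule C) simp
  then obtain K :: "nat \<Rightarrow> nat" where K: "\<And>k m n. m \<ge> K k \<Longrightarrow> n \<ge> K k \<Longrightarrow> l2n (\<lambda>x. F m x - F n x) < (1/2) ^ k"
    by metis
  define r where "r = (\<lambda>k. \<Sum>i\<le>k. K i)"
  have r: "K j \<le> r k" if "j \<le> k" for j k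
    unfolding r_def using member_le_sum[of j "{..k}" K] that by auto
  define D where "D = (\<lambda>k x. F (r (Suc k)) x - F (r k) x)"
  have DL: "D k \<in> L2" for k unfolding D_def by (intro L2_diff F)
  have Dn: "l2n (D k) < (1/2) ^ k" for k unfolding D_def by (rule K; rule r) auto
  note [measurable] = L2_measurable[OF F] L2_measurable[OF DL]
  have "(\<integral>\<^sup>+x. (\<Sum>k. ennreal (2 ^ k) * ennreal ((cmod (D k x))\<^sup>2)) \<partial>lborel) =
      (\<Sum>k. ennreal (2 ^ k) * ennreal ((l2n (D k))\<^sup>2))"
    by (subst nn_integral_suminf) (auto simp: nn_integral_cmult nn_integral_l2n DL)
  also have "\<dots> \<le> (\<Sum>k. ennreal ((1/2) ^ k))"
  proof (intro suminf_le)
    fix k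
    have "2 ^ k * (l2n (D k))\<^sup>2 \<le> 2 ^ k * ((1/2) ^ k)\<^sup>2"
      using Dn[of k] by (intro mult_left_mono power_mono) auto
    also have "\<dots> = (1/2 :: real) ^ k" by (simp add: power2_eq_square power_mult_distrib[symmetric])
    finally show "ennreal (2 ^ k) * ennreal ((l2n (D k))\<^sup>2) \<le> ennreal ((1/2) ^ k)"
      by (simp add: ennreal_mult'[symmetric] ennreal_leI)
  qed auto
  also have "\<dots> = ennreal (\<Sum>k. (1/2) ^ k)"
    by (intro suminf_ennreal2) auto
  finally have "(\<integral>\<^sup>+x. (\<Sum>k. ennreal (2 ^ k) * ennreal ((cmod (D k x))\<^sup>2)) \<partial>lborel) \<noteq> \<infinity>"
    by (auto simp: top_unique)
  then have "AE x in lborel. (\<Sum>k. ennreal (2 ^ k) * ennreal ((cmod (D k x))\<^sup>2)) \<noteq> \<infinity>"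
    by (intro nn_integral_PInf_AE) auto
  then have conv: "AE x in lborel. convergent (\<lambda>k. F (r k) x)"
  proof eventually_elim
    case (elim x)
    then obtain B where B: "0 \<le> B" "(\<Sum>k. ennreal (2 ^ k) * ennreal ((cmod (D k x))\<^sup>2)) = ennreal B"
      by (cases "(\<Sum>k. ennreal (2 ^ k) * ennreal ((cmod (D k x))\<^sup>2))") auto
    have le: "cmod (D k x) \<le> sqrt (B + 1) * (sqrt (1/2)) ^ k" for k
    proof -
      have "(\<Sum>k. ennreal (2 ^ k) * ennreal ((cmod (D k x))\<^sup>2)) < ennreal (B + 1)"
        unfolding B using B(1) by (simp add: ennreal_less_iff)
      from ennreal_suminf_lessD[OF this, of k]
      have "2 ^ k * (cmod (D k x))\<^sup>2 < B + 1"
        by (simp add: ennreal_mult'[symmetric] ennreal_less_iff)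
      then have "(cmod (D k x))\<^sup>2 \<le> (B + 1) * (1/2) ^ k" by (simp add: field_simps power_one_over)
      also have "(1/2 :: real) ^ k = ((sqrt (1/2)) ^ k)\<^sup>2"
        by (subst power_mult[symmetric], subst mult.commute, subst power_mult) simp
      also have "(B + 1) * ((sqrt (1/2)) ^ k)\<^sup>2 = (sqrt (B + 1) * (sqrt (1/2)) ^ k)\<^sup>2"
        using B(1) by (simp add: power_mult_distrib)
      finally show ?thesis by (rule power2_le_imp_le) (use B in auto)
    qed
    have "summable (\<lambda>k. sqrt (B + 1) * (sqrt (1/2)) ^ k)"
      by (intro summable_mult summable_geometric) simp
    then have "summable (\<lambda>k. D k x)"
      by (rule summable_comparison_test'[where N = 0]) (rule le)
    then have "convergent (\<lambda>k. \<Sum>i<k. D i x)" by (simp add: summable_iff_convergent)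
    then have "convergent (\<lambda>k. F (r k) x - F (r 0) x)"
      by (simp add: D_def sum_lessThan_telescope[of "\<lambda>k. F (r k) x"])
    from convergent_add[OF this convergent_const[of "F (r 0) x"]] show ?case by simp
  qed
  define g where "g = (\<lambda>x. lim (\<lambda>k. F (r k) x))"
  have [measurable]: "g \<in> borel_measurable borel" unfolding g_def by measurable
  have lim: "AE x in lborel. (\<lambda>k. F (r k) x) \<longlonglongrightarrow> g x"
    using conv by eventually_elim (simp add: g_def convergent_LIMSEQ_iff)
  \<comment> \<open>Fatou's lemma passes the Cauchy estimate to the limit and gives membership in
    \<open>L2\<close> at the same time.\<close>
  have bnd: "(\<lambda>x. F m x - g x) \<in> L2 \<and> l2n (\<lambda>x. F m x - g x) \<le> (1/2) ^ j" if m: "m \<ge> K j" for m j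
  proof -
    have "(\<integral>\<^sup>+x. ennreal ((cmod (F m x - g x))\<^sup>2) \<partial>lborel) =
        (\<integral>\<^sup>+x. liminf (\<lambda>k. ennreal ((cmod (F m x - F (r k) x))\<^sup>2)) \<partial>lborel)"
    proof (rule nn_integral_cong_AE)
      show "AE x in lborel. ennreal ((cmod (F m x - g x))\<^sup>2) = liminf (\<lambda>k. ennreal ((cmod (F m x - F (r k) x))\<^sup>2))"
        using lim
      proof eventually_elim
        case (elim x)
        then have "(\<lambda>k. ennreal ((cmod (F m x - F (r k) x))\<^sup>2)) \<longlonglongrightarrow> ennreal ((cmod (F m x - g x))\<^sup>2)"
          by (intro tendsto_ennrealI tendsto_intros)
        then show ?case by (intro lim_imp_Liminf[symmetric]) auto
      qed
    qed
    also have "\<dots> \<le> liminf (\<lambda>k. \<integral>\<^sup>+x. ennreal ((cmod (F m x - F (r k) x))\<^sup>2) \<partial>lborel)"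
      by (rule nn_integral_liminf) measurable
    also have "\<dots> = liminf (\<lambda>k. ennreal ((l2n (\<lambda>x. F m x - F (r k) x))\<^sup>2))"
      by (simp add: nn_integral_l2n L2_diff F)
    also have "\<dots> \<le> limsup (\<lambda>k. ennreal ((l2n (\<lambda>x. F m x - F (r k) x))\<^sup>2))"
      by (rule Liminf_le_Limsup) simp
    also have "\<dots> \<le> ennreal (((1/2) ^ j)\<^sup>2)"
    proof (rule Limsup_bounded)
      show "\<forall>\<^sub>F k in sequentially. ennreal ((l2n (\<lambda>x. F m x - F (r k) x))\<^sup>2) \<le> ennreal (((1/2) ^ j)\<^sup>2)"
        using eventually_ge_at_top[of j]
      proof eventually_elim
        case (elim k)
        have "l2n (\<lambda>x. F m x - F (r k) x) < (1/2) ^ j" by (rule K[OF m r[OF elim]])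
        then show ?case by (intro ennreal_leI power_mono) auto
      qed
    qed
    finally show ?thesis
      using L2_of_nn_bound[of "\<lambda>x. F m x - g x" "(1/2) ^ j"] by auto
  qed
  have "g \<in> L2"
    using L2_diff[OF F[of "K 0"] conjunct1[OF bnd[OF order_refl[of "K 0"]]]] by simp
  moreover have "(\<lambda>n. l2n (\<lambda>x. F n x - g x)) \<longlonglongrightarrow> 0"
  proof (rule LIMSEQ_I)
    fix e :: real assume "0 < e"
    then obtain j where "(1/2) ^ j < e" using real_arch_pow_inv[of e "1/2"] by auto
    then show "\<exists>no. \<forall>n\<ge>no. norm (l2n (\<lambda>x. F n x - g x) - 0) < e"
      using bnd[of j] by (intro exI[of _ "K j"]) (auto intro: le_less_trans)
  qed
  ultimately show ?thesis by blast
qed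

definition hcoef :: "real \<Rightarrow> (real \<Rightarrow> complex) \<Rightarrow> nat \<Rightarrow> complex" where
  "hcoef a f n = ip f (HE a n)"

definition hsum :: "real \<Rightarrow> (real \<Rightarrow> complex) \<Rightarrow> nat \<Rightarrow> real \<Rightarrow> complex" where
  "hsum a f N x = (\<Sum>n<N. hcoef a f n * HE a n x)"

lemma hsum_L2: "0 < a \<Longrightarrow> hsum a f N \<in> L2"
  unfolding hsum_def by (intro L2_sum L2_cmult pg_L2)

lemma ip_hsum_right:
  assumes a: "0 < a" and h: "h \<in> L2"
  shows "ip h (hsum a f N) = (\<Sum>n<N. hcoef a h n * cnj (hcoef a f n))"
  unfolding hsum_def
  by (subst ip_sum_right[OF L2_cmult[OF pg_L2[OF a]] h]) (simp only: ip_cmult_right, simp add: hcoef_def mult.commute)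

lemma ip_hsum_left:
  assumes a: "0 < a" and h: "h \<in> L2"
  shows "ip (hsum a f N) h = (\<Sum>n<N. hcoef a f n * cnj (hcoef a h n))"
  using ip_hsum_right[OF assms, of f N] ip_commute[of "hsum a f N" h]
  by (simp add: mult.commute)

lemma hcoef_hsum:
  assumes a: "0 < a"
  shows "hcoef a (hsum a f N) n = (if n < N then hcoef a f n else 0)"
proof -
  have "hcoef a (hsum a f N) n = (\<Sum>i<N. hcoef a f i * (if i = n then 1 else 0))"
    unfolding hcoef_def[of a "hsum a f N"] ip_hsum_left[OF a pg_L2[OF a]]
    by (intro sum.cong) (auto simp: hcoef_def ip_HE[OF a])
  also have "\<dots> = (if n < N then hcoef a f n else 0)" by (simp add: if_distrib cong: if_cong)
  finally show ?thesis .
qed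

lemma l2n_hsum_diff:
  assumes a: "0 < a" and MN: "M \<le> N"
  shows "(l2n (\<lambda>x. hsum a f N x - hsum a f M x))\<^sup>2 = (\<Sum>n=M..<N. (cmod (hcoef a f n))\<^sup>2)"
proof -
  have s: "(l2n (hsum a f K))\<^sup>2 = (\<Sum>n<K. (cmod (hcoef a f n))\<^sup>2)" for K
  proof -
    have "complex_of_real ((l2n (hsum a f K))\<^sup>2) = (\<Sum>n<K. hcoef a f n * cnj (hcoef a f n))"
      unfolding ip_self[symmetric] ip_hsum_right[OF a hsum_L2[OF a]] hcoef_hsum[OF a] by simp
    also have "\<dots> = of_real (\<Sum>n<K. (cmod (hcoef a f n))\<^sup>2)"
      by (simp only: complex_norm_square of_real_sum)
    finally show ?thesis by (simp only: of_real_eq_iff)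
  qed
  have "ip (hsum a f N) (hsum a f M) = (\<Sum>n<M. hcoef a f n * cnj (hcoef a f n))"
    unfolding ip_hsum_right[OF a hsum_L2[OF a]] hcoef_hsum[OF a] using MN by (intro sum.cong) auto
  also have "\<dots> = of_real (\<Sum>n<M. (cmod (hcoef a f n))\<^sup>2)"
    by (simp only: complex_norm_square of_real_sum)
  finally have "(l2n (\<lambda>x. hsum a f N x - hsum a f M x))\<^sup>2 =
     (\<Sum>n<N. (cmod (hcoef a f n))\<^sup>2) - (\<Sum>n<M. (cmod (hcoef a f n))\<^sup>2)"
    unfolding l2n_diff_sq[OF hsum_L2[OF a] hsum_L2[OF a]] s by simp
  also have "\<dots> = (\<Sum>n=M..<N. (cmod (hcoef a f n))\<^sup>2)"
    using sum_diff_nat_ivl[of 0 M N "\<lambda>n. (cmod (hcoef a f n))\<^sup>2"] MN by (simp add: atLeast0LessThan)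
  finally show ?thesis .
qed

lemma bessel:
  assumes a: "0 < a" and f: "f \<in> L2"
  shows "(\<Sum>n<N. (cmod (hcoef a f n))\<^sup>2) \<le> (l2n f)\<^sup>2"
proof -
  have 1: "(l2n (hsum a f N))\<^sup>2 = (\<Sum>n<N. (cmod (hcoef a f n))\<^sup>2)"
    using l2n_hsum_diff[OF a, of 0 N f] by (simp add: hsum_def[of a f 0] atLeast0LessThan)
  have "ip f (hsum a f N) = of_real (\<Sum>n<N. (cmod (hcoef a f n))\<^sup>2)"
    unfolding ip_hsum_right[OF a f] by (simp only: complex_norm_square of_real_sum)
  then show ?thesis
    using l2n_diff_sq[OF f hsum_L2[OF a, of f N]] 1 zero_le_power2[of "l2n (\<lambda>x. f x - hsum a f N x)"]
    by (simp del: zero_le_power2)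
qed

text \<open>Bessel's inequality makes the partial sums Cauchy. Their limit has the same Hermite
  coefficients as f and so equals f almost everywhere by completeness of the Hermite
  functions.\<close>

lemma hsum_tendsto:
  assumes a: "0 < a" and f: "f \<in> L2"
  shows "(\<lambda>N. l2n (\<lambda>x. f x - hsum a f N x)) \<longlonglongrightarrow> 0"
proof -
  have "summable (\<lambda>n. (cmod (hcoef a f n))\<^sup>2)"
    by (intro summableI_nonneg_bounded[where x = "(l2n f)\<^sup>2"] bessel[OF a f]) simp
  then have S: "\<exists>K. \<forall>m\<ge>K. \<forall>n. norm (\<Sum>k=m..<n. (cmod (hcoef a f k))\<^sup>2) < e" if "e > 0" for e
    using that by (auto simp: summable_Cauchy)
  have "\<exists>K. \<forall>m\<ge>K. \<forall>n\<ge>K. l2n (\<lambda>x. hsum a f m x - hsum a f n x) < e" if e: "e > 0" for e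
  proof -
    obtain K where K: "\<And>m n. m \<ge> K \<Longrightarrow> norm (\<Sum>k=m..<n. (cmod (hcoef a f k))\<^sup>2) < e\<^sup>2"
      using S[of "e\<^sup>2"] e by auto
    have 1: "l2n (\<lambda>x. hsum a f n x - hsum a f m x) < e" if "m \<ge> K" "m \<le> n" for m n
    proof (rule power2_less_imp_less)
      show "(l2n (\<lambda>x. hsum a f n x - hsum a f m x))\<^sup>2 < e\<^sup>2"
        unfolding l2n_hsum_diff[OF a that(2)] using K[OF that(1), of n] by simp
    qed (use e in simp)
    have sym: "l2n (\<lambda>x. hsum a f n x - hsum a f m x) = l2n (\<lambda>x. hsum a f m x - hsum a f n x)" for m n
      by (simp add: l2n_def norm_minus_commute)
    show ?thesis
    proof (intro exI[of _ K] allI impI)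
      fix m n assume "K \<le> m" "K \<le> n"
      then show "l2n (\<lambda>x. hsum a f m x - hsum a f n x) < e"
        using 1[of m n] 1[of n m] sym[of n m] by (cases "m \<le> n") auto
    qed
  qed
  from L2_complete[of "hsum a f", OF hsum_L2[OF a] this]
  obtain g where g: "g \<in> L2" "(\<lambda>n. l2n (\<lambda>x. hsum a f n x - g x)) \<longlonglongrightarrow> 0" by blast
  have "ip (\<lambda>x. f x - g x) (HE a n) = 0" for n
  proof -
    have "(\<lambda>N. ip (\<lambda>x. hsum a f N x - g x) (HE a n)) \<longlonglongrightarrow> 0"
    proof (rule Lim_null_comparison)
      show "\<forall>\<^sub>F N in sequentially. norm (ip (\<lambda>x. hsum a f N x - g x) (HE a n)) \<le> l2n (\<lambda>x. hsum a f N x - g x) * l2n (HE a n)"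
        by (intro always_eventually allI ip_CS L2_diff hsum_L2 pg_L2 g a)
      show "(\<lambda>N. l2n (\<lambda>x. hsum a f N x - g x) * l2n (HE a n)) \<longlonglongrightarrow> 0"
        using tendsto_mult[OF g(2) tendsto_const[of "l2n (HE a n)"]] by simp
    qed
    moreover have "\<forall>\<^sub>F N in sequentially. ip (\<lambda>x. hsum a f N x - g x) (HE a n) = ip (\<lambda>x. f x - g x) (HE a n)"
      using eventually_gt_at_top[of n]
    proof eventually_elim
      case (elim N)
      have "ip (hsum a f N) (HE a n) = ip f (HE a n)"
        using hcoef_hsum[OF a, of f N n] elim by (simp add: hcoef_def)
      then show ?case by (simp add: ip_diff_left hsum_L2 a pg_L2 g f)
    qed
    ultimately have "(\<lambda>N. ip (\<lambda>x. f x - g x) (HE a n)) \<longlonglongrightarrow> 0"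
      by (rule Lim_transform_eventually)
    then show ?thesis by (simp add: LIMSEQ_const_iff)
  qed
  then have ae: "AE x in lborel. f x - g x = 0"
    by (intro hermite_complete[OF a] L2_diff f g)
  have "l2n (\<lambda>x. f x - hsum a f N x) = l2n (\<lambda>x. hsum a f N x - g x)" for N
  proof -
    have "l2n (\<lambda>x. f x - hsum a f N x) = l2n (\<lambda>x. - (hsum a f N x - g x))"
      by (rule l2n_cong_AE) (use ae in \<open>auto intro!: L2_diff f g hsum_L2 a elim: eventually_mono\<close>)
    then show ?thesis by (simp only: l2n_minus)
  qed
  then show ?thesis using g(2) by simp
qed

lemma parseval:
  assumes a: "0 < a" and f: "f \<in> L2" and h: "h \<in> L2"
  shows "(\<lambda>n. hcoef a f n * cnj (hcoef a h n)) sums ip f h"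
proof -
  have "(\<lambda>N. ip (\<lambda>x. f x - hsum a f N x) h) \<longlonglongrightarrow> 0"
  proof (rule Lim_null_comparison)
    show "\<forall>\<^sub>F N in sequentially. norm (ip (\<lambda>x. f x - hsum a f N x) h) \<le> l2n (\<lambda>x. f x - hsum a f N x) * l2n h"
      by (intro always_eventually allI ip_CS L2_diff hsum_L2 f h a)
    show "(\<lambda>N. l2n (\<lambda>x. f x - hsum a f N x) * l2n h) \<longlonglongrightarrow> 0"
      using tendsto_mult[OF hsum_tendsto[OF a f] tendsto_const[of "l2n h"]] by simp
  qed
  then have "(\<lambda>N. ip f h - (\<Sum>n<N. hcoef a f n * cnj (hcoef a h n))) \<longlonglongrightarrow> 0"
    by (simp add: ip_diff_left f h hsum_L2 a ip_hsum_left)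
  from tendsto_diff[OF tendsto_const[of "ip f h"] this]
  show ?thesis by (simp add: sums_def)
qed

lemma parseval_norm:
  assumes a: "0 < a" and f: "f \<in> L2"
  shows "(\<lambda>n. (cmod (hcoef a f n))\<^sup>2) sums (l2n f)\<^sup>2"
  using parseval[OF a f f] unfolding ip_self complex_norm_square[symmetric] sums_of_real_iff .

section \<open>Ladder operators and the oscillator energy\<close>

definition lower :: "real \<Rightarrow> energy_space \<Rightarrow> real \<Rightarrow> complex" where
  "lower a u = (\<lambda>x. grad u x + of_real (a * x) * fn u x)"

definition raise :: "real \<Rightarrow> energy_space \<Rightarrow> real \<Rightarrow> complex" where
  "raise a u = (\<lambda>x. - grad u x + of_real (a * x) * fn u x)"

lemma lower_L2: "lower a u \<in> L2"
  unfolding lower_def by (intro L2_add grad ax_fn_L2)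

lemma raise_L2: "raise a u \<in> L2"
  unfolding raise_def by (intro L2_add L2_minus grad ax_fn_L2)

lemma hcoef_lower:
  "0 < a \<Longrightarrow> hcoef a (lower a u) n = of_real (sqrt (2 * a * real (Suc n))) * hcoef a (fn u) (Suc n)"
  unfolding hcoef_def lower_def by (simp only: ip_lower raise_hn ip_PG_smult)

lemma hcoef_raise:
  "0 < a \<Longrightarrow> hcoef a (raise a u) n = of_real (sqrt (2 * a * real n)) * hcoef a (fn u) (n - 1)"
  unfolding hcoef_def raise_def by (simp only: ip_raise pderiv_hn ip_PG_smult)

text \<open>The cross terms of |u' + a x u|^2 and |- u' + a x u|^2 cancel in the sum, so Parseval
  for the two ladder operators gives the energy with half the sum of 2 a n and 2 a (n + 1) as
  weights. Only one weak derivative of u enters; u need not lie in the domain of the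
  oscillator.\<close>

lemma oscillator_energy_sums:
  assumes a: "0 < a"
  shows "(\<lambda>n. a * (2 * real n + 1) * (cmod (hcoef a (fn u) n))\<^sup>2) sums
     ((l2n (grad u))\<^sup>2 + a\<^sup>2 * (l2n (\<lambda>x. of_real x * fn u x))\<^sup>2)"
proof -
  let ?c = "\<lambda>n. (cmod (hcoef a (fn u) n))\<^sup>2"
  have "(\<lambda>n. (2 * a * real (Suc n)) * ?c (Suc n)) sums (l2n (lower a u))\<^sup>2"
    using parseval_norm[OF a lower_L2[of a u]] a by (simp add: hcoef_lower norm_mult power_mult_distrib)
  then have 1: "(\<lambda>n. (2 * a * real n) * ?c n) sums (l2n (lower a u))\<^sup>2"
    by (subst (asm) sums_Suc_iff) simp
  have "(\<lambda>n. (2 * a * real n) * ?c (n - 1)) sums (l2n (raise a u))\<^sup>2"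
    using parseval_norm[OF a raise_L2[of a u]] a by (simp add: hcoef_raise norm_mult power_mult_distrib)
  then have 2: "(\<lambda>n. (2 * a * real (Suc n)) * ?c n) sums (l2n (raise a u))\<^sup>2"
    using sums_Suc_iff[of "\<lambda>n. (2 * a * real n) * ?c (n - 1)"] by simp
  have X: "l2n (\<lambda>x. of_real (a * x) * fn u x) = a * l2n (\<lambda>x. of_real x * fn u x)"
    using l2n_cmult[of "of_real a" "\<lambda>x. of_real x * fn u x"] a by (simp add: mult.assoc)
  have "(l2n (lower a u))\<^sup>2 + (l2n (raise a u))\<^sup>2 =
      2 * ((l2n (grad u))\<^sup>2 + a\<^sup>2 * (l2n (\<lambda>x. of_real x * fn u x))\<^sup>2)"
    unfolding lower_def raise_def
    unfolding l2n_add_sq[OF grad(1) ax_fn_L2] l2n_add_sq[OF L2_minus[OF grad(1)] ax_fn_L2] X ip_minus_left l2n_minus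
    by (simp add: power_mult_distrib)
  moreover have "(\<lambda>n. 1/2 * ((2 * a * real n) * ?c n + (2 * a * real (Suc n)) * ?c n)) sums
      (1/2 * ((l2n (lower a u))\<^sup>2 + (l2n (raise a u))\<^sup>2))"
    by (intro sums_mult sums_add 1 2)
  ultimately show ?thesis by (simp add: algebra_simps)
qed

text \<open>The real part of the limit is a times the first moment, the imaginary part is the
  momentum. Only products of neighbouring coefficients occur, so in the moving frame the whole
  number rotates with a single frequency.\<close>

lemma lower_moment_sums:
  assumes a: "0 < a"
  shows "(\<lambda>n. of_real (sqrt (2 * a * real (Suc n))) * hcoef a (fn u) (Suc n) * cnj (hcoef a (fn u) n)) sums
     ip (lower a u) (fn u)"
  using parseval[OF a lower_L2[of a u] fn_L2[of u]] by (simp only: hcoef_lower[OF a])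

subsection \<open>Convergence and differentiation in the mean\<close>

lemma L2_dct:
  fixes f :: "nat \<Rightarrow> real \<Rightarrow> complex"
  assumes meas: "\<And>n. f n \<in> borel_measurable borel"
    and lim: "\<And>x. (\<lambda>n. f n x) \<longlonglongrightarrow> g x"
    and bnd: "\<forall>\<^sub>F n in sequentially. \<forall>x. cmod (f n x) \<le> C * exp (- \<bar>x\<bar>)"
  shows "g \<in> L2" "(\<lambda>n. l2n (\<lambda>x. f n x - g x)) \<longlonglongrightarrow> 0"
proof -
  have gm: "g \<in> borel_measurable borel"
    using borel_measurable_LIMSEQ_metric[OF meas lim] .
  have gb: "cmod (g x) \<le> C * exp (- \<bar>x\<bar>)" for x
  proof (rule tendsto_upperbound[OF tendsto_norm[OF lim]])
    show "\<forall>\<^sub>F n in sequentially. cmod (f n x) \<le> C * exp (- \<bar>x\<bar>)"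
      using bnd by eventually_elim auto
  qed simp
  then show "g \<in> L2" using gm by (intro L2_exp_decay) auto
  obtain N where N: "\<And>n x. n \<ge> N \<Longrightarrow> cmod (f n x) \<le> C * exp (- \<bar>x\<bar>)"
    using bnd by (auto simp: eventually_sequentially)
  note [measurable] = meas gm
  have "(\<lambda>n. LINT x|lborel. (cmod (f (n + N) x - g x))\<^sup>2) \<longlonglongrightarrow> (LINT x::real|lborel. 0)"
  proof (rule integral_dominated_convergence)
    show "integrable lborel (\<lambda>x::real. (2 * C)\<^sup>2 * exp (- \<bar>x\<bar>))"
      by (intro integrable_mult_right integrable_exp_minus_abs)
    show "AE x in lborel. (\<lambda>n. (cmod (f (n + N) x - g x))\<^sup>2) \<longlonglongrightarrow> 0"
    proof (rule AE_I2)
      fix x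
      have "(\<lambda>n. (cmod (f (n + N) x - g x))\<^sup>2) \<longlonglongrightarrow> (cmod (g x - g x))\<^sup>2"
        by (intro tendsto_intros LIMSEQ_ignore_initial_segment lim)
      then show "(\<lambda>n. (cmod (f (n + N) x - g x))\<^sup>2) \<longlonglongrightarrow> 0" by simp
    qed
    show "AE x in lborel. norm ((cmod (f (n + N) x - g x))\<^sup>2) \<le> (2 * C)\<^sup>2 * exp (- \<bar>x\<bar>)" for n
    proof (rule AE_I2)
      fix x
      have "cmod (f (n + N) x - g x) \<le> 2 * C * exp (- \<bar>x\<bar>)"
        using norm_triangle_ineq4[of "f (n + N) x" "g x"] N[of "n + N" x] gb[of x] by simp
      then have "(cmod (f (n + N) x - g x))\<^sup>2 \<le> (2 * C * exp (- \<bar>x\<bar>))\<^sup>2" by (intro power_mono) auto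
      also have "\<dots> = (2 * C)\<^sup>2 * (exp (- \<bar>x\<bar>) * exp (- \<bar>x\<bar>))" by (simp add: power2_eq_square)
      also have "\<dots> \<le> (2 * C)\<^sup>2 * exp (- \<bar>x\<bar>)" by (intro mult_left_mono) auto
      finally show "norm ((cmod (f (n + N) x - g x))\<^sup>2) \<le> (2 * C)\<^sup>2 * exp (- \<bar>x\<bar>)" by simp
    qed
  qed measurable
  from tendsto_real_sqrt[OF this] have "(\<lambda>n. l2n (\<lambda>x. f (n + N) x - g x)) \<longlonglongrightarrow> 0"
    by (simp add: l2n_def)
  then show "(\<lambda>n. l2n (\<lambda>x. f n x - g x)) \<longlonglongrightarrow> 0" by (rule LIMSEQ_offset)
qed

lemma vector_derivative_bound:
  fixes f :: "real \<Rightarrow> 'a::real_normed_vector"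
  assumes "convex S" "\<And>x. x \<in> S \<Longrightarrow> (f has_vector_derivative f' x) (at x within S)"
    "\<And>x. x \<in> S \<Longrightarrow> norm (f' x) \<le> B" "x \<in> S" "y \<in> S"
  shows "norm (f x - f y) \<le> B * \<bar>x - y\<bar>"
proof -
  have B: "0 \<le> B" using assms(3)[OF assms(4)] norm_ge_zero order_trans by blast
  have "norm (f x - f y) \<le> B * norm (x - y)"
  proof (rule differentiable_bound[OF assms(1), where f' = "\<lambda>x h. h *\<^sub>R f' x"])
    show "(f has_derivative (\<lambda>h. h *\<^sub>R f' x)) (at x within S)" if "x \<in> S" for x
      using assms(2)[OF that] by (simp add: has_vector_derivative_def)
    show "onorm (\<lambda>h. h *\<^sub>R f' x) \<le> B" if "x \<in> S" for x
      using assms(3)[OF that] B by (intro onorm_bound) (auto simp: mult.commute[of B] mult_left_mono)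
  qed (use assms in auto)
  then show ?thesis by simp
qed

lemma has_vector_derivative_quotient:
  fixes f :: "real \<Rightarrow> 'a::real_normed_vector"
  shows "(f has_vector_derivative D) (at t within S) \<longleftrightarrow>
     ((\<lambda>s. (f s - f t) /\<^sub>R (s - t)) \<longlongrightarrow> D) (at t within S)"
proof -
  have "norm ((1 / norm (s - t)) *\<^sub>R (f s - (f t + (s - t) *\<^sub>R D))) = norm ((f s - f t) /\<^sub>R (s - t) - D)"
    if "s \<noteq> t" for s
  proof -
    have "f s - (f t + (s - t) *\<^sub>R D) = (s - t) *\<^sub>R ((f s - f t) /\<^sub>R (s - t) - D)"
      using that by (simp add: scaleR_diff_right)
    then show ?thesis using that by (simp only: norm_scaleR) simp
  qed
  then have "\<forall>\<^sub>F s in at t within S. norm ((1 / norm (s - t)) *\<^sub>R (f s - (f t + (s - t) *\<^sub>R D))) = norm ((f s - f t) /\<^sub>R (s - t) - D)"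
    by (simp add: eventually_at_filter)
  then have "((\<lambda>s. norm ((1 / norm (s - t)) *\<^sub>R (f s - (f t + (s - t) *\<^sub>R D)))) \<longlongrightarrow> 0) (at t within S) \<longleftrightarrow>
     ((\<lambda>s. norm ((f s - f t) /\<^sub>R (s - t) - D)) \<longlongrightarrow> 0) (at t within S)"
    by (rule tendsto_cong)
  then show ?thesis
    unfolding has_vector_derivative_def has_derivative_within tendsto_norm_zero_iff LIM_zero_iff
    by (simp add: bounded_linear_scaleR_left)
qed

text \<open>By the mean value inequality the difference quotients obey the same exponential bound as
  the derivative. Dominated convergence along sequences then turns the pointwise derivative into one
  in the mean.\<close>

lemma L2_deriv:
  fixes g g' :: "real \<Rightarrow> real \<Rightarrow> complex"
  assumes S: "convex S" "t \<in> S" "0 < d"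
    and der: "\<And>s x. s \<in> S \<Longrightarrow> \<bar>s - t\<bar> < d \<Longrightarrow> ((\<lambda>s. g s x) has_vector_derivative g' s x) (at s within S)"
    and bnd: "\<And>s x. s \<in> S \<Longrightarrow> \<bar>s - t\<bar> < d \<Longrightarrow> cmod (g' s x) \<le> C * exp (- \<bar>x\<bar>)"
    and meas: "\<And>s. s \<in> S \<Longrightarrow> g s \<in> borel_measurable borel"
  shows "((\<lambda>s. l2n (\<lambda>x. (g s x - g t x) /\<^sub>R (s - t) - g' t x)) \<longlongrightarrow> 0) (at t within S)"
  unfolding tendsto_at_iff_sequentially comp_def
proof (intro allI impI)
  fix s :: "nat \<Rightarrow> real" assume s: "\<forall>i. s i \<in> S - {t}" and lim: "s \<longlonglongrightarrow> t"
  have "\<forall>\<^sub>F n in sequentially. \<bar>s n - t\<bar> < d"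
    using tendstoD[OF lim S(3)] by (simp add: dist_real_def)
  then have ev: "\<forall>\<^sub>F n in sequentially. \<forall>x. cmod ((g (s n) x - g t x) /\<^sub>R (s n - t)) \<le> C * exp (- \<bar>x\<bar>)"
  proof eventually_elim
    case (elim n)
    show ?case
    proof
      fix x
      have "cmod (g (s n) x - g t x) \<le> C * exp (- \<bar>x\<bar>) * \<bar>s n - t\<bar>"
      proof (rule vector_derivative_bound[where S = "S \<inter> ball t d"])
        show "convex (S \<inter> ball t d)" by (intro convex_Int S convex_ball)
        show "((\<lambda>s. g s x) has_vector_derivative g' r x) (at r within S \<inter> ball t d)" if "r \<in> S \<inter> ball t d" for r
          using der[of r x] that
          by (auto simp: dist_real_def abs_minus_commute intro: has_vector_derivative_within_subset[where S = S])
        show "cmod (g' r x) \<le> C * exp (- \<bar>x\<bar>)" if "r \<in> S \<inter> ball t d" for r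
          using that by (intro bnd) (auto simp: dist_real_def abs_minus_commute)
      qed (use s S elim in \<open>auto simp: dist_real_def abs_minus_commute\<close>)
      moreover have "s n \<noteq> t" using s by auto
      ultimately show "cmod ((g (s n) x - g t x) /\<^sub>R (s n - t)) \<le> C * exp (- \<bar>x\<bar>)"
        by (simp add: divide_inverse[symmetric] pos_divide_le_eq mult.commute[of "inverse _"])
    qed
  qed
  show "(\<lambda>n. l2n (\<lambda>x. (g (s n) x - g t x) /\<^sub>R (s n - t) - g' t x)) \<longlonglongrightarrow> 0"
  proof (rule L2_dct(2)[OF _ _ ev])
    show "(\<lambda>x. (g (s n) x - g t x) /\<^sub>R (s n - t)) \<in> borel_measurable borel" for n
    proof -
      have [measurable]: "g (s n) \<in> borel_measurable borel" "g t \<in> borel_measurable borel"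
        using meas s S(2) by auto
      show ?thesis by measurable
    qed
    show "(\<lambda>n. (g (s n) x - g t x) /\<^sub>R (s n - t)) \<longlonglongrightarrow> g' t x" for x
    proof -
      have "((\<lambda>s. (g s x - g t x) /\<^sub>R (s - t)) \<longlongrightarrow> g' t x) (at t within S)"
        using der[OF S(2), of x] S(3) by (simp add: has_vector_derivative_quotient)
      then show ?thesis using s lim unfolding tendsto_at_iff_sequentially comp_def by blast
    qed
  qed
qed

subsection \<open>Boosts and translations\<close>

lemma cmod_cis_mult [simp]: "cmod (cis y * z) = cmod z"
  by (simp add: norm_mult)

lemma L2_cis:
  assumes "f \<in> L2"
  shows "(\<lambda>x. cis (v * x) * f x) \<in> L2"
proof -
  have "(\<lambda>x. cis (v * x)) \<in> borel_measurable borel"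
    by (intro borel_measurable_continuous_onI continuous_intros)
  then show ?thesis using L2_measurable[OF assms] by (intro L2_bound[OF assms, where c = 1]) auto
qed

lemma l2n_cis [simp]: "l2n (\<lambda>x. cis (v * x) * f x) = l2n f"
  by (simp add: l2n_def)

lemma l2n_translate [simp]: "l2n (\<lambda>x. f (x - X)) = l2n f"
proof -
  have "(LINT x|lborel. (cmod (f x))\<^sup>2) = (LINT x|lborel. (cmod (f (x - X)))\<^sup>2)"
    by (subst lborel_integral_real_affine[where c = 1 and t = "- X"]) simp_all
  then show ?thesis by (simp add: l2n_def)
qed

text \<open>The phase is moved to the test function, which thereby becomes complex; this calls for
  the complex form \<open>ibp\<close> of integration by parts.\<close>

lemma weak_deriv_cis:
  assumes u: "u \<in> L2" "g \<in> L2" "weak_deriv u g"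
  shows "weak_deriv (\<lambda>x. cis (v * x) * u x) (\<lambda>x. cis (v * x) * (g x + \<i> * of_real v * u x))"
  unfolding weak_deriv_def
proof
  fix \<psi> assume p: "\<psi> \<in> C1c"
  let ?p = "\<lambda>x. cis (- v * x) * of_real (\<psi> x)"
  let ?p' = "\<lambda>x. cis (- v * x) * (of_real (deriv \<psi> x) - \<i> * of_real v * of_real (\<psi> x))"
  have cis': "((\<lambda>x. cis (- v * x)) has_vector_derivative (- v) *\<^sub>R (\<i> * cis (- v * x))) (at x)" for x
  proof -
    have "((\<lambda>x. - v * x) has_vector_derivative - v) (at x)"
      by (auto intro!: derivative_eq_intros)
    from vector_diff_chain_at[OF this has_vector_derivative_iexp[of "- v * x" UNIV]]
    show ?thesis by (simp add: comp_def cis_conv_exp)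
  qed
  have "((\<lambda>x. complex_of_real (\<psi> x)) has_vector_derivative of_real (deriv \<psi> x)) (at x)" for x
    by (rule has_vector_derivative_of_real[OF C1c_deriv[OF p]])
  moreover have "?p' x = cis (- v * x) * of_real (deriv \<psi> x) + (- v) *\<^sub>R (\<i> * cis (- v * x)) * of_real (\<psi> x)" for x
    by (simp add: scaleR_conv_of_real right_diff_distrib mult.commute mult.left_commute)
  ultimately have d: "(?p has_vector_derivative ?p' x) (at x)" for x
    using has_vector_derivative_mult[OF cis', of "\<lambda>x. complex_of_real (\<psi> x)" "of_real (deriv \<psi> x)" x] by simp
  have c: "continuous_on UNIV ?p'"
    by (intro continuous_intros C1c_continuous[OF p])
  have l: "?p \<in> L2" "?p' \<in> L2"
    by (intro L2_cis[of _ "- v"] L2_diff L2_cmult C1c_L2[OF p])+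
  have "(LINT x|lborel. cis (v * x) * u x * of_real (deriv \<psi> x)) =
      (LINT x|lborel. u x * cnj (?p' x) + cis (v * x) * u x * (- (\<i> * of_real v * of_real (\<psi> x))))"
    by (intro Bochner_Integration.integral_cong) (auto simp: cis_cnj algebra_simps)
  also have "\<dots> = ip u ?p' + (LINT x|lborel. cis (v * x) * u x * (- (\<i> * of_real v * of_real (\<psi> x))))"
    unfolding ip_def
    by (intro Bochner_Integration.integral_add L2_mult_cnj_integrable u l L2_mult_integrable L2_cis L2_minus L2_cmult C1c_L2[OF p])
  also have "ip u ?p' = - ip g ?p" by (rule ibp[OF u d c l])
  also have "\<dots> = (LINT x|lborel. cis (v * x) * g x * (- of_real (\<psi> x)))"
    unfolding ip_def by (subst integral_minus[symmetric]) (auto intro!: Bochner_Integration.integral_cong simp: cis_cnj)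
  also have "\<dots> + (LINT x|lborel. cis (v * x) * u x * (- (\<i> * of_real v * of_real (\<psi> x)))) =
     (LINT x|lborel. cis (v * x) * g x * (- of_real (\<psi> x)) + cis (v * x) * u x * (- (\<i> * of_real v * of_real (\<psi> x))))"
    by (intro Bochner_Integration.integral_add[symmetric] L2_mult_integrable L2_cis u L2_minus L2_cmult C1c_L2[OF p])
  also have "\<dots> = - (LINT x|lborel. cis (v * x) * (g x + \<i> * of_real v * u x) * of_real (\<psi> x))"
    by (subst integral_minus[symmetric]) (auto intro!: Bochner_Integration.integral_cong simp: algebra_simps)
  finally show "(LINT x|lborel. cis (v * x) * u x * of_real (deriv \<psi> x)) =
      - (LINT x|lborel. cis (v * x) * (g x + \<i> * of_real v * u x) * of_real (\<psi> x))" .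
qed

text \<open>A Galilean boost at a fixed time: first the translation by X, then the phase. For 2 i
  u_t = - u_xx the wave number v is also the group velocity, so a frame with centre X and X' = v
  needs no further constant.\<close>

definition boost :: "real \<Rightarrow> real \<Rightarrow> energy_space \<Rightarrow> energy_space" where
  "boost v X u = mk (\<lambda>x. cis (v * x) * fn u (x - X))"

lemma boost_weak_deriv:
  "weak_deriv (\<lambda>x. cis (v * x) * fn u (x - X))
     (\<lambda>x. cis (v * x) * (grad u (x - X) + \<i> * of_real v * fn u (x - X)))"
  by (intro weak_deriv_cis L2_translate fn_L2 grad weak_deriv_translate)

lemma boost_deriv_L2: "(\<lambda>x. cis (v * x) * (grad u (x - X) + \<i> * of_real v * fn u (x - X))) \<in> L2"
  by (intro L2_cis L2_add L2_cmult L2_translate fn_L2 grad)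

lemma fn_boost: "fn (boost v X u) = (\<lambda>x. cis (v * x) * fn u (x - X))"
  unfolding boost_def
proof (rule mk_inverse)
  have s: "(\<lambda>x. fn u (x - X)) \<in> Sigma_fun" by (rule Sigma_fun_translate[OF fn])
  then have b: "(\<lambda>x. of_real (bracket x) * fn u (x - X)) \<in> L2" and c: "continuous_on UNIV (\<lambda>x. fn u (x - X))"
    by (auto simp: Sigma_fun_def)
  have "(\<lambda>x. of_real (bracket x) * (cis (v * x) * fn u (x - X))) \<in> L2"
    using L2_cis[OF b, of v] by (simp add: mult.left_commute)
  moreover have "continuous_on UNIV (\<lambda>x. cis (v * x) * fn u (x - X))"
    by (intro continuous_intros c)
  ultimately show "(\<lambda>x. cis (v * x) * fn u (x - X)) \<in> Sigma_fun"
    using boost_weak_deriv[of v u X] boost_deriv_L2[of v u X] L2_cis[OF L2_translate[OF fn_L2[of u], of X], of v]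
    unfolding Sigma_fun_def H1_def by blast
qed

lemma grad_boost: "AE x in lborel. grad (boost v X u) x = cis (v * x) * (grad u (x - X) + \<i> * of_real v * fn u (x - X))"
  by (rule grad_AE_eq[OF boost_deriv_L2]) (simp add: fn_boost boost_weak_deriv)

lemma fn_eqI: "(\<And>x. fn u x = fn v x) \<Longrightarrow> u = v"
  by (rule fn_inject[THEN iffD1]) auto

lemma boost_diff: "boost v X (u - w) = boost v X u - boost v X w"
  by (rule fn_eqI) (simp add: fn_boost fn_minus algebra_simps)

lemma l2n_x_boost: "l2n (\<lambda>x. of_real x * fn (boost v X u) x) \<le> l2n (\<lambda>x. of_real x * fn u x) + \<bar>X\<bar> * l2n (fn u)"
proof -
  have "l2n (\<lambda>x. of_real x * fn (boost v X u) x) =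
      l2n (\<lambda>x. cis (v * x) * (of_real (x - X) * fn u (x - X) + of_real X * fn u (x - X)))"
    unfolding fn_boost by (rule arg_cong[where f = l2n]) (auto simp: algebra_simps)
  also have "\<dots> = l2n (\<lambda>x. of_real (x - X) * fn u (x - X) + of_real X * fn u (x - X))" by simp
  also have "\<dots> \<le> l2n (\<lambda>x. of_real (x - X) * fn u (x - X)) + l2n (\<lambda>x. of_real X * fn u (x - X))"
    by (intro l2n_triangle L2_cmult L2_translate[where f = "\<lambda>x. of_real x * fn u x"] L2_translate fn_times_x_L2 fn_L2)
  also have "l2n (\<lambda>x. of_real (x - X) * fn u (x - X)) = l2n (\<lambda>x. of_real x * fn u x)"
    by (rule l2n_translate[where f = "\<lambda>x. of_real x * fn u x"])
  finally show ?thesis by (simp add: l2n_cmult)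
qed

lemma l2n_grad_boost: "l2n (grad (boost v X u)) \<le> l2n (grad u) + \<bar>v\<bar> * l2n (fn u)"
proof -
  have "l2n (grad (boost v X u)) = l2n (\<lambda>x. cis (v * x) * (grad u (x - X) + \<i> * of_real v * fn u (x - X)))"
    by (rule l2n_cong_AE[OF grad_boost grad(1) boost_deriv_L2])
  also have "\<dots> = l2n (\<lambda>x. grad u (x - X) + \<i> * of_real v * fn u (x - X))" by simp
  also have "\<dots> \<le> l2n (\<lambda>x. grad u (x - X)) + l2n (\<lambda>x. \<i> * of_real v * fn u (x - X))"
    by (intro l2n_triangle L2_cmult L2_translate grad fn_L2)
  finally show ?thesis by (simp add: l2n_cmult norm_mult)
qed

lemma norm_boost_le: "norm (boost v X u) \<le> (4 + \<bar>v\<bar> + \<bar>X\<bar>) * norm u"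
proof -
  have "norm (boost v X u) \<le> 2 * l2n (fn u) + (l2n (grad u) + \<bar>v\<bar> * l2n (fn u)) +
     (l2n (\<lambda>x. of_real x * fn u x) + \<bar>X\<bar> * l2n (fn u))"
    using norm_energy_le[of "boost v X u"] l2n_x_boost[of v X u] l2n_grad_boost[of v X u] by (simp add: fn_boost)
  also have "\<dots> \<le> 2 * norm u + (norm u + \<bar>v\<bar> * norm u) + (norm u + \<bar>X\<bar> * norm u)"
    by (intro add_mono mult_left_mono norm_energy_bounds) auto
  finally show ?thesis by (simp add: algebra_simps)
qed

text \<open>Formally this is half the integral of (|u|^2)'. In coefficients: after a shift of the
  index the series for \<open>raise\<close> is the conjugate of that for \<open>lower\<close>, and
  removing the real term with x leaves - z = cnj z for the pairing z.\<close>

lemma Re_ip_grad_self: "Re (ip (grad u) (fn u)) = 0"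
proof -
  let ?t = "\<lambda>n. complex_of_real (sqrt (2 * 1 * real (Suc n))) * hcoef 1 (fn u) (Suc n) * cnj (hcoef 1 (fn u) n)"
  have 1: "?t sums ip (lower 1 u) (fn u)" by (rule lower_moment_sums) simp
  have "(\<lambda>n. hcoef 1 (raise 1 u) n * cnj (hcoef 1 (fn u) n)) sums ip (raise 1 u) (fn u)"
    by (intro parseval raise_L2 fn_L2) simp
  then have "(\<lambda>n. hcoef 1 (raise 1 u) (Suc n) * cnj (hcoef 1 (fn u) (Suc n))) sums ip (raise 1 u) (fn u)"
    by (subst sums_Suc_iff) (simp add: hcoef_raise)
  then have "(\<lambda>n. cnj (?t n)) sums ip (raise 1 u) (fn u)"
    by (simp add: hcoef_raise mult.commute mult.left_commute)
  moreover have "(\<lambda>n. cnj (?t n)) sums cnj (ip (lower 1 u) (fn u))" using 1 by (simp only: sums_cnj)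
  ultimately have e: "ip (raise 1 u) (fn u) = cnj (ip (lower 1 u) (fn u))" by (rule sums_unique2)
  have x: "cnj (ip (\<lambda>x. of_real (1 * x) * fn u x) (fn u)) = ip (\<lambda>x. of_real (1 * x) * fn u x) (fn u)"
    using cx_commute[of u u] by (simp add: cx_def)
  have "- ip (grad u) (fn u) = cnj (ip (grad u) (fn u))"
    using e x unfolding raise_def lower_def
      ip_add_left[OF grad(1) ax_fn_L2 fn_L2] ip_add_left[OF L2_minus[OF grad(1)] ax_fn_L2 fn_L2] ip_minus_left
    by (simp only: complex_cnj_add add_right_cancel)
  then show ?thesis by (simp add: complex_eq_iff)
qed

subsection \<open>Forms as bounded operators\<close>

text \<open>Currying a form into a bounded operator makes its dependence on the first argument
  continuous in operator norm, that is, uniformly in the test function.\<close>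

definition bl :: "('a::real_normed_vector \<Rightarrow> 'b::real_normed_vector \<Rightarrow> 'c::real_normed_vector) \<Rightarrow> 'a \<Rightarrow> 'b \<Rightarrow>\<^sub>L 'c" where
  "bl f x = Blinfun (f x)"

lemma bl_apply: "bounded_bilinear f \<Longrightarrow> blinfun_apply (bl f x) y = f x y"
  unfolding bl_def by (simp add: bounded_linear_Blinfun_apply bounded_bilinear.bounded_linear_right)

lemma bounded_linear_bl:
  assumes f: "bounded_bilinear f"
  shows "bounded_linear (bl f)"
proof -
  obtain K where K: "0 \<le> K" "\<And>a b. norm (f a b) \<le> norm a * norm b * K"
    using bounded_bilinear.nonneg_bounded[OF f] by blast
  show ?thesis
  proof (rule bounded_linear_intro)
    show "bl f (x + y) = bl f x + bl f y" for x y
      by (rule blinfun_eqI) (simp add: bl_apply[OF f] blinfun.add_left bounded_bilinear.add_left[OF f])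
    show "bl f (r *\<^sub>R x) = r *\<^sub>R bl f x" for r x
      by (rule blinfun_eqI) (simp add: bl_apply[OF f] blinfun.scaleR_left bounded_bilinear.scaleR_left[OF f])
    show "norm (bl f x) \<le> norm x * K" for x
      by (rule norm_blinfun_bound) (use K in \<open>auto simp: bl_apply[OF f] ac_simps\<close>)
  qed
qed

definition mass :: "energy_space \<Rightarrow> real" where "mass u = Re (cm u u)"
definition mom1 :: "energy_space \<Rightarrow> real" where "mom1 u = Re (cx u u)"
definition mom2 :: "energy_space \<Rightarrow> real" where "mom2 u = Re (cv u u)"

lemma tendsto_forms [tendsto_intros]:
  assumes "(f \<longlongrightarrow> u) F"
  shows "((\<lambda>s. mass (f s)) \<longlongrightarrow> mass u) F" "((\<lambda>s. mom1 (f s)) \<longlongrightarrow> mom1 u) F" "((\<lambda>s. mom2 (f s)) \<longlongrightarrow> mom2 u) F"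
  unfolding mass_def mom1_def mom2_def
  by (intro tendsto_Re bounded_bilinear.tendsto[OF bounded_bilinear_cm] bounded_bilinear.tendsto[OF bounded_bilinear_cx]
      bounded_bilinear.tendsto[OF bounded_bilinear_cv] assms)+

lemma cx_self: "cx u u = of_real (mom1 u)"
  using cx_commute[of u u] by (simp add: mom1_def complex_eq_iff)

lemma mass_l2n: "mass u = (l2n (fn u))\<^sup>2"
  and cm_mass: "cm u u = of_real (mass u)"
  and cv_mom2: "cv u u = of_real (mom2 u)"
  by (simp_all add: mass_def mom2_def cm_self cv_self)

lemma hartree:
  "(LINT y|lborel. \<bar>x - y\<bar>\<^sup>2 * (cmod (fn u y))\<^sup>2) = x\<^sup>2 * mass u - 2 * x * mom1 u + mom2 u"
proof -
  have i0: "integrable lborel (\<lambda>y. (cmod (fn u y))\<^sup>2)" by (rule L2_square_integrable[OF fn_L2])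
  have i2: "integrable lborel (\<lambda>y. (cmod (of_real y * fn u y))\<^sup>2)" by (rule L2_square_integrable[OF fn_times_x_L2])
  have i1': "integrable lborel (\<lambda>y. of_real y * fn u y * cnj (fn u y))"
    by (rule L2_mult_cnj_integrable[OF fn_times_x_L2 fn_L2])
  have e1: "of_real y * fn u y * cnj (fn u y) = of_real (y * (cmod (fn u y))\<^sup>2)" for y
    by (simp only: mult.assoc complex_norm_square[symmetric] of_real_mult)
  have i1: "integrable lborel (\<lambda>y. y * (cmod (fn u y))\<^sup>2)"
    using i1' unfolding e1 by (simp only: complex_of_real_integrable_eq)
  have m1: "mom1 u = (LINT y|lborel. y * (cmod (fn u y))\<^sup>2)"
    unfolding mom1_def cx_def ip_def e1 by (simp only: integral_complex_of_real Re_complex_of_real)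
  have m0: "mass u = (LINT y|lborel. (cmod (fn u y))\<^sup>2)" by (simp add: mass_l2n l2n_sq)
  have m2: "mom2 u = (LINT y|lborel. (cmod (of_real y * fn u y))\<^sup>2)" by (simp add: mom2_def cv_self l2n_sq)
  have "(LINT y|lborel. \<bar>x - y\<bar>\<^sup>2 * (cmod (fn u y))\<^sup>2) =
     (LINT y|lborel. x\<^sup>2 * (cmod (fn u y))\<^sup>2 - 2 * x * (y * (cmod (fn u y))\<^sup>2) + (cmod (of_real y * fn u y))\<^sup>2)"
    by (intro Bochner_Integration.integral_cong)
       (auto simp: norm_mult power_mult_distrib power2_eq_square algebra_simps)
  also have "\<dots> = x\<^sup>2 * mass u - 2 * x * mom1 u + mom2 u"
    unfolding m0 m1 m2 using i0 i1 i2 by simp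
  finally show ?thesis .
qed

subsection \<open>Conservation of mass\<close>

text \<open>The right-hand side of (H) as a functional on the energy space. The Hartree potential
  enters through its three moments, so this depends continuously on u in the dual norm.\<close>

definition FB :: "real \<Rightarrow> real \<Rightarrow> energy_space \<Rightarrow> energy_space \<Rightarrow>\<^sub>L complex" where
  "FB lam \<eta> u = bl cg u + (lam + \<eta> * mass u) *\<^sub>R bl cv u - (2 * \<eta> * mom1 u) *\<^sub>R bl cx u + (\<eta> * mom2 u) *\<^sub>R bl cm u"

lemma FB_apply:
  "blinfun_apply (FB lam \<eta> u) v = cg u v + of_real (lam + \<eta> * mass u) * cv u v
     - of_real (2 * \<eta> * mom1 u) * cx u v + of_real (\<eta> * mom2 u) * cm u v"
  unfolding FB_def
  by (simp add: blinfun.add_left blinfun.diff_left blinfun.scaleR_left bl_apply bounded_bilinear_cg bounded_bilinear_cv bounded_bilinear_cx bounded_bilinear_cm scaleR_conv_of_real)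

lemma tendsto_FB [tendsto_intros]: "(f \<longlongrightarrow> u) F \<Longrightarrow> ((\<lambda>s. FB lam \<eta> (f s)) \<longlongrightarrow> FB lam \<eta> u) F"
  unfolding FB_def
  by (intro tendsto_intros bounded_linear.tendsto[OF bounded_linear_bl] bounded_bilinear_cg bounded_bilinear_cv bounded_bilinear_cx bounded_bilinear_cm)

lemma Im_FB_self: "Im (blinfun_apply (FB lam \<eta> u) u) = 0"
  unfolding FB_apply cg_self cv_mom2 cx_self cm_mass by simp

lemma solution_rhs:
  "(LINT x|lborel. grad u x * cnj (grad v x)) +
   of_real lam * (LINT x|lborel. of_real (\<bar>x\<bar>\<^sup>2) * fn u x * cnj (fn v x)) +
   of_real \<eta> * (LINT x|lborel.
      of_real (LINT y|lborel. \<bar>x - y\<bar>\<^sup>2 * (cmod (fn u y))\<^sup>2) * fn u x * cnj (fn v x)) =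
   blinfun_apply (FB lam \<eta> u) v"
proof -
  have v: "(LINT x|lborel. of_real (\<bar>x\<bar>\<^sup>2) * fn u x * cnj (fn v x)) = cv u v"
    unfolding cv_def ip_def
    by (intro Bochner_Integration.integral_cong) (auto simp: power2_eq_square ac_simps)
  have "(LINT x|lborel. of_real (x\<^sup>2 * mass u - 2 * x * mom1 u + mom2 u) * fn u x * cnj (fn v x)) =
    (LINT x|lborel. of_real (mass u) * (of_real x * fn u x * cnj (of_real x * fn v x))
       - of_real (2 * mom1 u) * (of_real x * fn u x * cnj (fn v x)) + of_real (mom2 u) * (fn u x * cnj (fn v x)))"
    by (intro Bochner_Integration.integral_cong) (auto simp: power2_eq_square algebra_simps)
  also have "\<dots> = of_real (mass u) * cv u v - of_real (2 * mom1 u) * cx u v + of_real (mom2 u) * cm u v"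
    unfolding cv_def cx_def cm_def ip_def
    using L2_mult_cnj_integrable[OF fn_times_x_L2[of u] fn_times_x_L2[of v]]
      L2_mult_cnj_integrable[OF fn_times_x_L2[of u] fn_L2[of v]] L2_mult_cnj_integrable[OF fn_L2[of u] fn_L2[of v]]
    by simp
  finally have E: "(LINT x|lborel. of_real (x\<^sup>2 * mass u - 2 * x * mom1 u + mom2 u) * fn u x * cnj (fn v x)) =
    of_real (mass u) * cv u v - of_real (2 * mom1 u) * cx u v + of_real (mom2 u) * cm u v" .
  show ?thesis
    unfolding hartree v E FB_apply cg_def[of u v, unfolded ip_def, symmetric] by (simp add: algebra_simps)
qed

lemma solution_cm_deriv:
  assumes "solution_H lam \<eta> u" "0 \<le> t"
  shows "((\<lambda>s. cm (u s) v) has_vector_derivative (- \<i> / 2) * blinfun_apply (FB lam \<eta> (u t)) v) (at t within {0..})"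
proof -
  have "((\<lambda>s. 2 * \<i> * cm (u s) v) has_vector_derivative blinfun_apply (FB lam \<eta> (u t)) v) (at t within {0..})"
    using assms unfolding solution_H_def solution_rhs cm_def ip_def by blast
  then have "((\<lambda>s. (- \<i> / 2) * (2 * \<i> * cm (u s) v)) has_vector_derivative (- \<i> / 2) * blinfun_apply (FB lam \<eta> (u t)) v) (at t within {0..})"
    by (rule has_vector_derivative_mult_right)
  then show ?thesis by (simp add: mult.assoc[symmetric])
qed

lemma solution_tendsto:
  assumes "solution_H lam \<eta> u" "0 \<le> t"
  shows "(u \<longlongrightarrow> u t) (at t within {0..})"
  using assms by (auto simp: solution_H_def continuous_on_def)

text \<open>The time derivative lives in the dual of the energy space only, so \<open>t \<mapsto> cm (u t) (u t)\<close> cannot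
  be differentiated by the product rule; the factorization
  \<open>mass v - mass w = Re cm (v - w) (v + w)\<close> and the mean value theorem for fixed test functions replace it.\<close>

lemma solution_mass_deriv:
  assumes sol: "solution_H lam \<eta> u" and t: "0 \<le> t"
  shows "((\<lambda>s. mass (u s)) has_derivative (\<lambda>_. 0)) (at t within {0..})"
  unfolding has_derivative_within_alt
proof (intro conjI allI impI)
  show "bounded_linear (\<lambda>_::real. 0::real)" by (rule bounded_linear_zero)
  fix e :: real assume e: "0 < e"
  let ?F = "\<lambda>s. FB lam \<eta> (u s)"
  \<comment> \<open>\<open>R\<close> bounds the norm of \<open>u s + u t\<close> for s near t,
    \<open>N\<close> the operator norm at time t. The variation of the functional and the change of
    u will each cost half of e.\<close>
  define R where "R = 2 * norm (u t) + 1"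
  define N where "N = norm (?F t) + 1"
  have pos: "0 < R" "0 < N" by (auto simp: R_def N_def add_nonneg_pos)
  have "\<forall>\<^sub>F s in at t within {0..}. dist (?F s) (?F t) < e / R"
    by (intro tendstoD tendsto_FB solution_tendsto[OF sol t]) (use e pos in auto)
  moreover have "\<forall>\<^sub>F s in at t within {0..}. dist (u s) (u t) < min 1 (e / N)"
    by (intro tendstoD solution_tendsto[OF sol t]) (use e pos in auto)
  ultimately have "\<forall>\<^sub>F s in at t within {0..}. dist (?F s) (?F t) < e / R \<and> dist (u s) (u t) < min 1 (e / N)"
    by (rule eventually_conj)
  then obtain d where d: "d > 0" and dd: "\<And>s. 0 \<le> s \<Longrightarrow> s \<noteq> t \<Longrightarrow> dist s t < d \<Longrightarrow>
      dist (?F s) (?F t) < e / R \<and> dist (u s) (u t) < min 1 (e / N)"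
    unfolding eventually_at by auto
  have dF: "norm (?F s - ?F t) \<le> e / R" if "0 \<le> s" "dist s t < d" for s
    using dd[of s] that e pos by (cases "s = t") (auto simp: dist_norm)
  have du: "norm (u s - u t) \<le> 1" "norm (u s - u t) \<le> e / N" if "0 \<le> s" "dist s t < d" for s
    using dd[of s] that e pos by (cases "s = t"; auto simp: dist_norm)+
  show "\<exists>d>0. \<forall>s\<in>{0..}. norm (s - t) < d \<longrightarrow> norm (mass (u s) - mass (u t) - 0) \<le> e * norm (s - t)"
  proof (intro exI[of _ d] conjI ballI impI d)
    fix s assume "s \<in> {0..}" and sd: "norm (s - t) < d"
    then have s: "0 \<le> s" "dist s t < d" by (auto simp: dist_norm)
    define v where "v = u s + u t"
    have vR: "norm v \<le> R"
    proof -
      have "norm v = norm ((u s - u t) + 2 *\<^sub>R u t)" by (simp add: v_def scaleR_2)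
      also have "\<dots> \<le> norm (u s - u t) + norm (2 *\<^sub>R u t)" by (rule norm_triangle_ineq)
      also have "\<dots> \<le> R" using du(1)[OF s] by (simp add: R_def)
      finally show ?thesis .
    qed
    let ?D = "(- \<i> / 2) * blinfun_apply (?F t) v"
    \<comment> \<open>The vector v is frozen at its value for this s, so the weak equation applies;
      the linear part at t is subtracted before the mean value inequality is used.\<close>
    have "norm ((cm (u s) v - s *\<^sub>R ?D) - (cm (u t) v - t *\<^sub>R ?D)) \<le> (e / 2) * \<bar>s - t\<bar>"
    proof (rule vector_derivative_bound[where S = "{0..} \<inter> ball t d" and f' = "\<lambda>r. (- \<i> / 2) * blinfun_apply (?F r) v - ?D" and f = "\<lambda>r. cm (u r) v - r *\<^sub>R ?D"])
      show "convex ({0..} \<inter> ball t d)" by (intro convex_Int convex_ball) auto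
      fix r assume r: "r \<in> {0..} \<inter> ball t d"
      have "((\<lambda>r. cm (u r) v) has_vector_derivative (- \<i> / 2) * blinfun_apply (?F r) v) (at r within {0..} \<inter> ball t d)"
        by (rule has_vector_derivative_within_subset[OF solution_cm_deriv[OF sol]]) (use r in auto)
      moreover have "((\<lambda>r. r *\<^sub>R ?D) has_vector_derivative ?D) (at r within {0..} \<inter> ball t d)"
        by (auto intro!: derivative_eq_intros)
      ultimately show "((\<lambda>r. cm (u r) v - r *\<^sub>R ?D) has_vector_derivative (- \<i> / 2) * blinfun_apply (?F r) v - ?D) (at r within {0..} \<inter> ball t d)"
        by (rule has_vector_derivative_diff)
      have "norm ((- \<i> / 2) * blinfun_apply (?F r) v - ?D) = norm (blinfun_apply (?F r - ?F t) v) / 2"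
        unfolding right_diff_distrib[symmetric] norm_mult by (simp add: blinfun.diff_left)
      also have "\<dots> \<le> (norm (?F r - ?F t) * norm v) / 2" by (intro divide_right_mono norm_blinfun) auto
      also have "\<dots> \<le> (e / R * R) / 2"
        using r e pos by (intro divide_right_mono mult_mono dF vR) (auto simp: dist_commute)
      finally show "norm ((- \<i> / 2) * blinfun_apply (?F r) v - ?D) \<le> e / 2" using pos by simp
    qed (use s d t in \<open>auto simp: dist_commute\<close>)
    then have A: "cmod (cm (u s - u t) v - (s - t) *\<^sub>R ?D) \<le> (e / 2) * \<bar>s - t\<bar>"
      by (simp add: bounded_bilinear.diff_left[OF bounded_bilinear_cm] scaleR_diff_left algebra_simps)
    have m: "mass (u s) - mass (u t) = Re (cm (u s - u t) v)"
    proof -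
      have "Re (cm (u s) (u t)) = Re (cm (u t) (u s))" by (subst cm_commute) simp
      then show ?thesis
        by (simp add: mass_def v_def bounded_bilinear.diff_left[OF bounded_bilinear_cm] bounded_bilinear.add_right[OF bounded_bilinear_cm])
    qed
    \<comment> \<open>v is u s - u t plus twice u t. The second part contributes nothing by
      \<open>Im_FB_self\<close>, the first one is small.\<close>
    have "blinfun_apply (?F t) v = blinfun_apply (?F t) (u s - u t) + 2 * blinfun_apply (?F t) (u t)"
      by (simp add: v_def blinfun.add_right blinfun.diff_right)
    then have "Re ?D = Im (blinfun_apply (?F t) (u s - u t)) / 2"
      using Im_FB_self[of lam \<eta> "u t"] by simp
    moreover have "\<bar>Im (blinfun_apply (?F t) (u s - u t))\<bar> \<le> e"
    proof -
      have "\<bar>Im (blinfun_apply (?F t) (u s - u t))\<bar> \<le> norm (?F t) * norm (u s - u t)"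
        using abs_Im_le_cmod norm_blinfun order_trans by blast
      also have "\<dots> \<le> N * (e / N)" using pos by (intro mult_mono du(2)[OF s]) (auto simp: N_def)
      finally show ?thesis using pos by simp
    qed
    ultimately have B: "\<bar>Re ?D\<bar> \<le> e / 2" by simp
    have "\<bar>mass (u s) - mass (u t)\<bar> = \<bar>Re (cm (u s - u t) v - (s - t) *\<^sub>R ?D) + (s - t) * Re ?D\<bar>"
      unfolding m by simp
    also have "\<dots> \<le> cmod (cm (u s - u t) v - (s - t) *\<^sub>R ?D) + \<bar>s - t\<bar> * \<bar>Re ?D\<bar>"
      unfolding abs_mult[symmetric] using abs_Re_le_cmod abs_triangle_ineq order_trans add_mono order_refl by meson
    also have "\<dots> \<le> (e / 2) * \<bar>s - t\<bar> + \<bar>s - t\<bar> * (e / 2)"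
      by (intro add_mono A mult_left_mono B) auto
    finally show "norm (mass (u s) - mass (u t) - 0) \<le> e * norm (s - t)" by (simp add: algebra_simps)
  qed
qed

lemma solution_mass:
  assumes sol: "solution_H lam \<eta> u" and t: "0 \<le> t"
  shows "mass (u t) = mass (u 0)"
  by (rule has_derivative_zero_unique[of "{0..}" "\<lambda>s. mass (u s)"])
     (use solution_mass_deriv[OF sol] t in auto)

subsection \<open>The moving frame\<close>

text \<open>Test functions that are carried along at velocity \<open>v\<close> with a centre \<open>X\<close>. If \<open>X\<close> solves the
  oscillator equation forced by the first moment of the solution, all terms that couple different
  Hermite coefficients cancel.\<close>

definition EB :: "real \<Rightarrow> real \<Rightarrow> real \<Rightarrow> real poly \<Rightarrow> real \<Rightarrow> complex" where
  "EB a v X q x = cis (v * x) * of_real (pg q a (x - X))"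

lemma EB_L2: "0 < a \<Longrightarrow> EB a v X q \<in> L2"
  unfolding EB_def by (intro L2_cis L2_translate[where f = "PG q a"] pg_L2)

lemma EB_continuous: "continuous_on A (EB a v X q)"
  unfolding EB_def
  by (intro continuous_intros continuous_on_compose2[OF pg_continuous[of UNIV]]) auto

lemma EB_bound:
  assumes "0 < a"
  shows "\<exists>C\<ge>0. \<forall>v X x. \<bar>X\<bar> \<le> R \<longrightarrow> cmod (EB a v X q x) \<le> C * exp (- \<bar>x\<bar>)"
proof -
  obtain C where C: "0 \<le> C" "\<And>x. \<bar>pg q a x\<bar> \<le> C * exp (- \<bar>x\<bar>)"
    using pg_bound[OF assms, of q 1] by auto
  have "cmod (EB a v X q x) \<le> (C * exp R) * exp (- \<bar>x\<bar>)" if "\<bar>X\<bar> \<le> R" for v X x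
  proof -
    have "cmod (EB a v X q x) \<le> C * exp (- \<bar>x - X\<bar>)" using C by (simp add: EB_def)
    also have "\<dots> \<le> C * exp (R - \<bar>x\<bar>)" using that C(1) by (intro mult_left_mono) auto
    finally show ?thesis by (simp add: exp_diff exp_minus divide_inverse mult.assoc)
  qed
  then show ?thesis using C(1) by (intro exI[of _ "C * exp R"]) auto
qed

lemma has_vector_derivative_cis_comp:
  assumes "(h has_real_derivative h') (at s within S)"
  shows "((\<lambda>s. cis (h s)) has_vector_derivative of_real h' * \<i> * cis (h s)) (at s within S)"
proof -
  have "(h has_derivative (\<lambda>t. t * h')) (at s within S)"
    using assms unfolding has_field_derivative_def by (simp add: mult_commute_abs)
  from has_derivative_cis[OF this] show ?thesis
    by (simp add: has_vector_derivative_def scaleR_conv_of_real ac_simps)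
qed

lemma EB_deriv_param:
  assumes X: "(X has_real_derivative X') (at s within S)" and v: "(v has_real_derivative v') (at s within S)"
  shows "((\<lambda>s. EB a (v s) (X s) q x) has_vector_derivative
     \<i> * of_real (v' * x) * EB a (v s) (X s) q x - of_real X' * EB a (v s) (X s) (dpg a q) x) (at s within S)"
proof -
  have "((\<lambda>s. v s * x) has_real_derivative v' * x) (at s within S)"
    using v by (auto intro!: derivative_eq_intros)
  note c = has_vector_derivative_cis_comp[OF this]
  have "((\<lambda>s. x - X s) has_real_derivative - X') (at s within S)"
    using X by (auto intro!: derivative_eq_intros)
  from DERIV_chain2[OF pg_deriv this]
  have "((\<lambda>s. pg q a (x - X s)) has_real_derivative pg (dpg a q) a (x - X s) * - X') (at s within S)" .
  from has_vector_derivative_mult[OF c has_vector_derivative_of_real[OF this]]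
  show ?thesis by (simp add: EB_def ac_simps)
qed

lemma EB_deriv: "(EB a v X q has_vector_derivative EB a v X (dpg a q) x + \<i> * of_real v * EB a v X q x) (at x)"
proof -
  have "((\<lambda>x. v * x) has_real_derivative v) (at x)" by (auto intro!: derivative_eq_intros)
  note c = has_vector_derivative_cis_comp[OF this]
  have "((\<lambda>x. x - X) has_real_derivative 1) (at x)" by (auto intro!: derivative_eq_intros)
  from DERIV_chain2[OF pg_deriv this]
  have "((\<lambda>x. pg q a (x - X)) has_real_derivative pg (dpg a q) a (x - X) * 1) (at x)" .
  from has_vector_derivative_mult[OF c has_vector_derivative_of_real[OF this]]
  have "((\<lambda>x. cis (v * x) * of_real (pg q a (x - X))) has_vector_derivative
     EB a v X (dpg a q) x + \<i> * of_real v * EB a v X q x) (at x)"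
    by (simp add: EB_def ac_simps)
  then show ?thesis by (simp add: EB_def[abs_def])
qed

lemma fn_boost_pgs: "0 < a \<Longrightarrow> fn (boost v X (pgs q a)) = EB a v X q"
  by (simp add: fn_boost fn_pgs EB_def[abs_def])

lemma grad_boost_pgs:
  assumes "0 < a"
  shows "AE x in lborel. grad (boost v X (pgs q a)) x = EB a v X (dpg a q) x + \<i> * of_real v * EB a v X q x"
  by (rule grad_AE_eq)
     (use assms in \<open>auto simp: fn_boost_pgs intro!: L2_add L2_cmult EB_L2 weak_deriv_C1 EB_deriv continuous_intros EB_continuous\<close>)

lemma EB_x: "of_real x * EB a v X q x = EB a v X ([:0, 1:] * q) x + of_real X * EB a v X q x"
proof -
  have "pg ([:0, 1:] * q) a (x - X) = (x - X) * pg q a (x - X)" by (simp only: pg_times_x)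
  then show ?thesis by (simp only: EB_def of_real_mult of_real_diff) (simp add: algebra_simps)
qed

text \<open>u has only one weak derivative, so both derivatives are put on the smooth test
  function.\<close>

lemma cg_boost_pgs:
  assumes a: "0 < a"
  shows "cg u (boost v X (pgs q a)) = - ip (fn u) (EB a v X (dpg a (dpg a q)))
     + 2 * \<i> * of_real v * ip (fn u) (EB a v X (dpg a q)) + of_real (v\<^sup>2) * ip (fn u) (EB a v X q)"
proof -
  let ?E = "EB a v X"
  let ?g = "\<lambda>x. ?E (dpg a q) x + \<i> * of_real v * ?E q x"
  let ?g' = "\<lambda>x. (?E (dpg a (dpg a q)) x + \<i> * of_real v * ?E (dpg a q) x) + \<i> * of_real v * (?E (dpg a q) x + \<i> * of_real v * ?E q x)"
  have d: "(?g has_vector_derivative ?g' x) (at x)" for x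
    by (intro has_vector_derivative_add EB_deriv has_vector_derivative_mult_right)
  have L: "?g \<in> L2" "?g' \<in> L2" by (intro L2_add L2_cmult EB_L2 a)+
  have "cg u (boost v X (pgs q a)) = ip (grad u) ?g"
    unfolding cg_def by (rule ip_cong_AE) (use grad_boost_pgs[OF a] L in \<open>auto intro: grad\<close>)
  also have "\<dots> = - ip (fn u) ?g'"
    using ibp[OF fn_L2 grad d _ L, of u] by (simp add: continuous_intros EB_continuous)
  also have "ip (fn u) ?g' = ip (fn u) (?E (dpg a (dpg a q))) - 2 * \<i> * of_real v * ip (fn u) (?E (dpg a q))
      - of_real (v\<^sup>2) * ip (fn u) (?E q)"
    by (simp only: ip_add_right[OF EB_L2[OF a] L2_cmult[OF EB_L2[OF a]] fn_L2]
          ip_add_right[OF L2_add[OF EB_L2[OF a] L2_cmult[OF EB_L2[OF a]]]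
            L2_cmult[OF L2_add[OF EB_L2[OF a] L2_cmult[OF EB_L2[OF a]]]] fn_L2] ip_cmult_right)
       (simp add: power2_eq_square algebra_simps)
  finally show ?thesis by simp
qed

lemma ip_x_EB:
  assumes a: "0 < a"
  shows "cx u (boost v X (pgs q a)) = ip (fn u) (EB a v X ([:0, 1:] * q)) + of_real X * ip (fn u) (EB a v X q)"
proof -
  have "cx u (boost v X (pgs q a)) = ip (fn u) (\<lambda>x. of_real x * EB a v X q x)"
    unfolding cx_def fn_boost_pgs[OF a] ip_def
    by (intro Bochner_Integration.integral_cong) (auto simp: ac_simps)
  then show ?thesis unfolding EB_x
    by (simp only: ip_add_right[OF EB_L2[OF a] L2_cmult[OF EB_L2[OF a]] fn_L2] ip_cmult_right complex_cnj_complex_of_real)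
qed

lemma ip_xx_EB:
  assumes a: "0 < a"
  shows "cv u (boost v X (pgs q a)) = ip (fn u) (EB a v X ([:0, 1:] * ([:0, 1:] * q)))
     + 2 * of_real X * ip (fn u) (EB a v X ([:0, 1:] * q)) + of_real (X\<^sup>2) * ip (fn u) (EB a v X q)"
proof -
  define q1 where "q1 = [:0, 1:] * q"
  define q2 where "q2 = [:0, 1:] * q1"
  have e: "of_real x * (of_real x * EB a v X q x) = EB a v X q2 x
      + (2 * of_real X * EB a v X q1 x + of_real (X\<^sup>2) * EB a v X q x)" for x
    unfolding EB_x[of x a v X q] distrib_left mult.left_commute[of "of_real x" "of_real X"]
      EB_x[of x a v X q, folded q1_def] unfolding q1_def[symmetric] EB_x[of x a v X q1, folded q2_def]
    by (simp add: power2_eq_square algebra_simps)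
  have "cv u (boost v X (pgs q a)) = ip (fn u) (\<lambda>x. of_real x * (of_real x * EB a v X q x))"
    unfolding cv_def fn_boost_pgs[OF a] ip_def
    by (intro Bochner_Integration.integral_cong) (auto simp: ac_simps)
  also have "\<dots> = ip (fn u) (EB a v X q2) + (ip (fn u) (\<lambda>x. 2 * of_real X * EB a v X q1 x) + ip (fn u) (\<lambda>x. of_real (X\<^sup>2) * EB a v X q x))"
    unfolding e by (subst ip_add_right, (intro L2_add L2_cmult EB_L2 a fn_L2)+)+ simp
  finally show ?thesis unfolding ip_cmult_right q2_def q1_def by simp
qed

text \<open>Expansion about the centre with y = x - X. The oscillator equation absorbs the second
  derivative together with a^2 y^2. What is left off the diagonal is linear in y or contains one
  derivative; exactly these two terms are produced by a moving test function with X' = v and v' = -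
  a^2 X + \<eta> \<open>mom1 u\<close>.\<close>

lemma FB_boost_HE:
  assumes a: "0 < a" and M: "lam + \<eta> * mass u = a\<^sup>2"
  shows "blinfun_apply (FB lam \<eta> u) (boost v X (pgs (hn a n) a)) =
     of_real ((2 * real n + 1) * a + v\<^sup>2 + a\<^sup>2 * X\<^sup>2 - 2 * \<eta> * mom1 u * X + \<eta> * mom2 u) * ip (fn u) (EB a v X (hn a n))
     + of_real (2 * a\<^sup>2 * X - 2 * \<eta> * mom1 u) * ip (fn u) (EB a v X ([:0, 1:] * hn a n))
     + 2 * \<i> * of_real v * ip (fn u) (EB a v X (dpg a (hn a n)))"
proof -
  let ?q = "hn a n"
  let ?yy = "[:0, 1:] * ([:0, 1:] * ?q)"
  have "EB a v X (dpg a (dpg a ?q)) x = of_real (a\<^sup>2) * EB a v X ?yy x - of_real ((2 * real n + 1) * a) * EB a v X ?q x" for x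
  proof -
    have yy: "pg ?yy a (x - X) = (x - X)\<^sup>2 * pg ?q a (x - X)"
      by (simp only: pg_times_x) (simp add: power2_eq_square mult.assoc)
    have "pg (dpg a (dpg a ?q)) a (x - X) = a\<^sup>2 * pg ?yy a (x - X) - (2 * real n + 1) * a * pg ?q a (x - X)"
      unfolding HE_ode[OF a] yy by (simp add: algebra_simps)
    then show ?thesis unfolding EB_def by (simp only: of_real_diff of_real_mult) (simp add: algebra_simps)
  qed
  then have "ip (fn u) (EB a v X (dpg a (dpg a ?q))) =
      ip (fn u) (\<lambda>x. of_real (a\<^sup>2) * EB a v X ?yy x - of_real ((2 * real n + 1) * a) * EB a v X ?q x)"
    by presburger
  also have "\<dots> = of_real (a\<^sup>2) * ip (fn u) (EB a v X ?yy) - of_real ((2 * real n + 1) * a) * ip (fn u) (EB a v X ?q)"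
    by (simp only: ip_diff_right[OF L2_cmult[OF EB_L2[OF a]] L2_cmult[OF EB_L2[OF a]] fn_L2] ip_cmult_right complex_cnj_complex_of_real)
  finally show ?thesis
    unfolding FB_apply M cg_boost_pgs[OF a] ip_x_EB[OF a] ip_xx_EB[OF a]
    by (simp add: cm_def fn_boost_pgs[OF a] algebra_simps del: mult_pCons_left)
qed

lemma tendsto_ip:
  assumes f: "\<And>s. f s \<in> L2" "\<And>s. g s \<in> L2" "f0 \<in> L2" "g0 \<in> L2"
    and lf: "((\<lambda>s. l2n (\<lambda>x. f s x - f0 x)) \<longlongrightarrow> 0) F" and lg: "((\<lambda>s. l2n (\<lambda>x. g s x - g0 x)) \<longlongrightarrow> 0) F"
  shows "((\<lambda>s. ip (f s) (g s)) \<longlongrightarrow> ip f0 g0) F"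
proof -
  have e: "ip (f s) (g s) - ip f0 g0 =
      ip (\<lambda>x. f s x - f0 x) (\<lambda>x. g s x - g0 x) + ip f0 (\<lambda>x. g s x - g0 x) + ip (\<lambda>x. f s x - f0 x) g0" for s
    by (simp add: ip_diff_left ip_diff_right L2_diff f)
  have "((\<lambda>s. ip (f s) (g s) - ip f0 g0) \<longlongrightarrow> 0) F"
  proof (rule Lim_null_comparison)
    show "\<forall>\<^sub>F s in F. norm (ip (f s) (g s) - ip f0 g0) \<le> l2n (\<lambda>x. f s x - f0 x) * l2n (\<lambda>x. g s x - g0 x)
       + l2n f0 * l2n (\<lambda>x. g s x - g0 x) + l2n (\<lambda>x. f s x - f0 x) * l2n g0"
      unfolding e
      by (intro always_eventually allI order_trans[OF norm_triangle_ineq] add_mono ip_CS L2_diff f)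
    have "((\<lambda>s. l2n (\<lambda>x. f s x - f0 x) * l2n (\<lambda>x. g s x - g0 x)
       + l2n f0 * l2n (\<lambda>x. g s x - g0 x) + l2n (\<lambda>x. f s x - f0 x) * l2n g0) \<longlongrightarrow> 0 * 0 + l2n f0 * 0 + 0 * l2n g0) F"
      by (intro tendsto_intros lf lg)
    then show "((\<lambda>s. l2n (\<lambda>x. f s x - f0 x) * l2n (\<lambda>x. g s x - g0 x)
       + l2n f0 * l2n (\<lambda>x. g s x - g0 x) + l2n (\<lambda>x. f s x - f0 x) * l2n g0) \<longlongrightarrow> 0) F" by simp
  qed
  then show ?thesis by (simp add: LIM_zero_iff)
qed

lemma solution_l2n_tendsto:
  assumes "solution_H lam \<eta> u" "0 \<le> t"
  shows "((\<lambda>s. l2n (\<lambda>x. fn (u s) x - fn (u t) x)) \<longlongrightarrow> 0) (at t within {0..})"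
proof (rule Lim_null_comparison)
  have "((\<lambda>s. norm (u s - u t)) \<longlongrightarrow> norm (u t - u t)) (at t within {0..})"
    by (intro tendsto_intros solution_tendsto[OF assms])
  then show "((\<lambda>s. norm (u s - u t)) \<longlongrightarrow> 0) (at t within {0..})" by simp
  show "\<forall>\<^sub>F s in at t within {0..}. norm (l2n (\<lambda>x. fn (u s) x - fn (u t) x)) \<le> norm (u s - u t)"
    using norm_energy_bounds(1)[of "u _ - u t"] by (intro always_eventually) (simp add: fn_minus)
qed

text \<open>The difference quotient is split into one with the test function frozen at time t, where
  the weak equation applies, and one with the test function moving, which converges in the mean and
  only needs u to be continuous in time. Apart from (2 n + 1) a the real factor \<kappa> does not
  depend on n.\<close>

lemma moving_coefficient_deriv:
  fixes n :: nat
  assumes sol: "solution_H lam \<eta> u" and t: "0 \<le> t" and a: "0 < a" and M: "lam + \<eta> * mass (u t) = a\<^sup>2"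
    and X: "\<And>s. 0 \<le> s \<Longrightarrow> (X has_real_derivative Y s) (at s within {0..})"
    and Y: "\<And>s. 0 \<le> s \<Longrightarrow> (Y has_real_derivative (- (a\<^sup>2) * X s + \<eta> * mom1 (u s))) (at s within {0..})"
  defines "\<kappa> \<equiv> (2 * real n + 1) * a +
     ((Y t)\<^sup>2 + a\<^sup>2 * (X t)\<^sup>2 - 2 * \<eta> * mom1 (u t) * X t + \<eta> * mom2 (u t) + 2 * (- (a\<^sup>2) * X t + \<eta> * mom1 (u t)) * X t)"
  shows "((\<lambda>s. ip (fn (u s)) (EB a (Y s) (X s) (hn a n))) has_vector_derivative
     (- \<i> / 2) * of_real \<kappa> * ip (fn (u t)) (EB a (Y t) (X t) (hn a n))) (at t within {0..})"
proof -
  let ?S = "{0::real..}"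
  let ?q = "hn a n"
  define f where "f = (\<lambda>s. - (a\<^sup>2) * X s + \<eta> * mom1 (u s))"
  define g where "g = (\<lambda>s. EB a (Y s) (X s) ?q)"
  define g' where "g' = (\<lambda>s x. \<i> * of_real (f s * x) * EB a (Y s) (X s) ?q x - of_real (Y s) * EB a (Y s) (X s) (dpg a ?q) x)"
  have g'_eq: "g' s x = \<i> * of_real (f s) * EB a (Y s) (X s) ([:0, 1:] * ?q) x
      + (\<i> * of_real (f s * X s) * EB a (Y s) (X s) ?q x - of_real (Y s) * EB a (Y s) (X s) (dpg a ?q) x)" for s x
  proof -
    have "\<i> * of_real (f s * x) * EB a (Y s) (X s) ?q x = \<i> * of_real (f s) * (of_real x * EB a (Y s) (X s) ?q x)"
      by simp
    then show ?thesis unfolding g'_def EB_x by (simp add: algebra_simps del: mult_pCons_left)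
  qed
  have cX: "continuous_on ?S X" using X by (intro DERIV_continuous_on) auto
  have cY: "continuous_on ?S Y" using Y by (intro DERIV_continuous_on) auto
  have cP: "continuous_on ?S (\<lambda>s. mom1 (u s))"
    unfolding continuous_on_def by (auto intro!: tendsto_forms solution_tendsto[OF sol])
  have cf: "continuous_on ?S f" unfolding f_def by (intro continuous_intros cX cP)
  \<comment> \<open>Compactness of the time interval up to t + 1 bounds centre, velocity and force;
    this yields one exponential majorant for all times within distance 1 of t.\<close>
  have "bounded (h ` {0..t + 1})" if "continuous_on ?S h" for h :: "real \<Rightarrow> real"
    by (intro compact_imp_bounded compact_continuous_image continuous_on_subset[OF that]) auto
  then have "\<exists>R. \<forall>s\<in>{0..t+1}. \<bar>h s\<bar> \<le> R" if "continuous_on ?S h" for h :: "real \<Rightarrow> real"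
    using that by (fastforce simp: bounded_iff)
  from this[OF cX] this[OF cY] this[OF cf] obtain R1 R2 R3 where
    R: "\<And>s. s \<in> {0..t+1} \<Longrightarrow> \<bar>X s\<bar> \<le> R1" "\<And>s. s \<in> {0..t+1} \<Longrightarrow> \<bar>Y s\<bar> \<le> R2" "\<And>s. s \<in> {0..t+1} \<Longrightarrow> \<bar>f s\<bar> \<le> R3"
    by blast
  obtain C1 where C1: "0 \<le> C1" "\<And>v X x. \<bar>X\<bar> \<le> R1 \<Longrightarrow> cmod (EB a v X ([:0, 1:] * ?q) x) \<le> C1 * exp (- \<bar>x\<bar>)"
    using EB_bound[OF a] by blast
  obtain C2 where C2: "0 \<le> C2" "\<And>v X x. \<bar>X\<bar> \<le> R1 \<Longrightarrow> cmod (EB a v X ?q x) \<le> C2 * exp (- \<bar>x\<bar>)"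
    using EB_bound[OF a] by blast
  obtain C3 where C3: "0 \<le> C3" "\<And>v X x. \<bar>X\<bar> \<le> R1 \<Longrightarrow> cmod (EB a v X (dpg a ?q) x) \<le> C3 * exp (- \<bar>x\<bar>)"
    using EB_bound[OF a] by blast
  have gd: "((\<lambda>s. g s x) has_vector_derivative g' s x) (at s within ?S)" if "0 \<le> s" for s x
    unfolding g_def g'_def f_def using EB_deriv_param[OF X[OF that] Y[OF that]] by simp
  have q: "((\<lambda>s. l2n (\<lambda>x. (g s x - g t x) /\<^sub>R (s - t) - g' t x)) \<longlongrightarrow> 0) (at t within ?S)"
  proof (rule L2_deriv[where d = 1 and C = "R3 * C1 + (R3 * R1 * C2 + R2 * C3)"])
    show "((\<lambda>s. g s x) has_vector_derivative g' s x) (at s within ?S)" if "s \<in> ?S" for s x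
      using that by (intro gd) auto
    show "cmod (g' s x) \<le> (R3 * C1 + (R3 * R1 * C2 + R2 * C3)) * exp (- \<bar>x\<bar>)" if "s \<in> ?S" "\<bar>s - t\<bar> < 1" for s x
    proof -
      have s: "s \<in> {0..t+1}" using that by auto
      note Rs = R[OF s]
      have R0: "0 \<le> R1" "0 \<le> R2" "0 \<le> R3" using Rs by (auto intro: order_trans[OF abs_ge_zero])
      have "cmod (g' s x) \<le> cmod (\<i> * of_real (f s) * EB a (Y s) (X s) ([:0, 1:] * ?q) x)
          + (cmod (\<i> * of_real (f s * X s) * EB a (Y s) (X s) ?q x) + cmod (of_real (Y s) * EB a (Y s) (X s) (dpg a ?q) x))"
        unfolding g'_eq by (intro order_trans[OF norm_triangle_ineq] add_mono order_refl norm_triangle_ineq4)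
      also have "\<dots> = \<bar>f s\<bar> * cmod (EB a (Y s) (X s) ([:0, 1:] * ?q) x)
          + (\<bar>f s\<bar> * \<bar>X s\<bar> * cmod (EB a (Y s) (X s) ?q x) + \<bar>Y s\<bar> * cmod (EB a (Y s) (X s) (dpg a ?q) x))"
        by (simp add: norm_mult abs_mult del: mult_pCons_left)
      also have "\<dots> \<le> R3 * (C1 * exp (- \<bar>x\<bar>)) + (R3 * R1 * (C2 * exp (- \<bar>x\<bar>)) + R2 * (C3 * exp (- \<bar>x\<bar>)))"
        using Rs R0 C1 C2 C3 by (intro add_mono mult_mono) auto
      finally show ?thesis by (simp add: algebra_simps)
    qed
    show "g s \<in> borel_measurable borel" if "s \<in> ?S" for s
      unfolding g_def by (rule borel_measurable_continuous_onI[OF EB_continuous])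
  qed (use t in auto)
  have gL: "g s \<in> L2" for s unfolding g_def by (rule EB_L2[OF a])
  have g'L: "g' s \<in> L2" for s
    unfolding g'_eq[abs_def] by (intro L2_add L2_diff L2_cmult EB_L2 a)
  have qL: "(\<lambda>x. (g s x - g t x) /\<^sub>R (s - t)) \<in> L2" for s
    unfolding scaleR_conv_of_real by (intro L2_cmult L2_diff gL)
  have second: "((\<lambda>s. ip (fn (u s)) (\<lambda>x. (g s x - g t x) /\<^sub>R (s - t))) \<longlongrightarrow> ip (fn (u t)) (g' t)) (at t within ?S)"
    by (rule tendsto_ip[OF fn_L2 qL fn_L2 g'L solution_l2n_tendsto[OF sol t] q])
  have gt: "g t = fn (boost (Y t) (X t) (pgs ?q a))" unfolding g_def fn_boost_pgs[OF a] ..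
  let ?v = "boost (Y t) (X t) (pgs ?q a)"
  have first: "((\<lambda>s. (ip (fn (u s)) (g t) - ip (fn (u t)) (g t)) /\<^sub>R (s - t)) \<longlongrightarrow> (- \<i> / 2) * blinfun_apply (FB lam \<eta> (u t)) ?v) (at t within ?S)"
    using solution_cm_deriv[OF sol t, of ?v] unfolding has_vector_derivative_quotient cm_def gt .
  have split: "(ip (fn (u s)) (g s) - ip (fn (u t)) (g t)) /\<^sub>R (s - t) =
     (ip (fn (u s)) (g t) - ip (fn (u t)) (g t)) /\<^sub>R (s - t) + ip (fn (u s)) (\<lambda>x. (g s x - g t x) /\<^sub>R (s - t))" for s
  proof -
    have "ip (fn (u s)) (\<lambda>x. (g s x - g t x) /\<^sub>R (s - t)) = (ip (fn (u s)) (g s) - ip (fn (u s)) (g t)) /\<^sub>R (s - t)"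
      unfolding scaleR_conv_of_real by (simp add: ip_cmult_right ip_diff_right gL fn_L2)
    then show ?thesis by (simp add: algebra_simps)
  qed
  have main: "((\<lambda>s. ip (fn (u s)) (g s)) has_vector_derivative
     (- \<i> / 2) * blinfun_apply (FB lam \<eta> (u t)) ?v + ip (fn (u t)) (g' t)) (at t within ?S)"
    unfolding has_vector_derivative_quotient split by (rule tendsto_add[OF first second])
  have g'ip: "ip (fn (u t)) (g' t) = - \<i> * of_real (f t) * ip (fn (u t)) (EB a (Y t) (X t) ([:0, 1:] * ?q))
     + (- \<i> * of_real (f t * X t) * ip (fn (u t)) (EB a (Y t) (X t) ?q) - of_real (Y t) * ip (fn (u t)) (EB a (Y t) (X t) (dpg a ?q)))"
    unfolding g'_eq[abs_def]
    by (subst ip_add_right, (intro L2_add L2_diff L2_cmult EB_L2 a fn_L2)+, subst ip_diff_right, (intro L2_cmult EB_L2 a fn_L2)+)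
       (simp add: ip_cmult_right del: mult_pCons_left)
  have "(- \<i> / 2) * blinfun_apply (FB lam \<eta> (u t)) ?v + ip (fn (u t)) (g' t) =
     (- \<i> / 2) * of_real \<kappa> * ip (fn (u t)) (EB a (Y t) (X t) ?q)"
    unfolding FB_boost_HE[OF a M] g'ip \<kappa>_def f_def
    by (simp add: algebra_simps del: mult_pCons_left)
  then show ?thesis using main unfolding g_def by simp
qed

text \<open>Moving the test function forward and pulling the solution back differ by the constant
  phase cis (v X), because a boost translates before it multiplies. Moduli and products of a
  coefficient with a conjugate one do not see this phase.\<close>

lemma hcoef_boost:
  assumes a: "0 < a"
  shows "hcoef a (fn (boost (- v) (- X) u)) n = cis (v * X) * ip (fn u) (EB a v X (hn a n))"
proof -
  have "ip (fn u) (EB a v X (hn a n)) = (LINT x|lborel. fn u (x + X) * cnj (EB a v X (hn a n) (x + X)))"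
    unfolding ip_def by (subst lborel_integral_real_affine[where c = 1 and t = X]) (simp_all add: add.commute)
  then have "cis (v * X) * ip (fn u) (EB a v X (hn a n)) = (LINT x|lborel. cis (v * X) * (fn u (x + X) * cnj (EB a v X (hn a n) (x + X))))"
    by simp
  also have "\<dots> = ip (fn (boost (- v) (- X) u)) (HE a n)"
    unfolding ip_def fn_boost
  proof (intro Bochner_Integration.integral_cong refl)
    fix x
    have "cis (v * X) * cis (- (v * (x + X))) = cis (- v * x)" by (simp add: cis_mult algebra_simps)
    then show "cis (v * X) * (fn u (x + X) * cnj (EB a v X (hn a n) (x + X))) = cis (- v * x) * fn u (x - - X) * cnj (HE a n x)"
      by (simp add: EB_def cis_cnj mult.assoc[symmetric] mult.commute[of _ "fn u (x + X)"])
  qed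
  finally show ?thesis by (simp add: hcoef_def)
qed

text \<open>Variation of constants. The kernel sin (a (t - s)) / a is expanded by the addition
  theorem, so that t occurs in the integrals \<open>C\<close> and \<open>S\<close> only as upper
  limit.\<close>

lemma forced_oscillator:
  fixes P :: "real \<Rightarrow> real"
  assumes a: "0 < a" and P: "continuous_on {0..} P"
  shows "\<exists>X Y. X 0 = X0 \<and> Y 0 = Y0 \<and>
     (\<forall>s\<ge>0. (X has_real_derivative Y s) (at s within {0..})) \<and>
     (\<forall>s\<ge>0. (Y has_real_derivative (- (a\<^sup>2) * X s + P s)) (at s within {0..}))"
proof -
  define C where "C = (\<lambda>t. integral {0..t} (\<lambda>s. cos (a * s) * P s))"
  define S where "S = (\<lambda>t. integral {0..t} (\<lambda>s. sin (a * s) * P s))"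
  have FTC: "((\<lambda>t. integral {0..t} h) has_real_derivative h t) (at t within {0..})"
    if h: "continuous_on {0..} h" and t: "0 \<le> t" for h :: "real \<Rightarrow> real" and t
  proof -
    have "((\<lambda>t. integral {0..t} h) has_real_derivative h t) (at t within {0..t+1})"
      by (rule integral_has_real_derivative[OF continuous_on_subset[OF h]]) (use t in auto)
    moreover have "at t within {0..t+1} = at t within {0..}"
      by (rule at_within_nhd[of _ "{..<t+1}"]) (use t in auto)
    ultimately show ?thesis by simp
  qed
  have C: "(C has_real_derivative cos (a * t) * P t) (at t within {0..})" if "0 \<le> t" for t
    unfolding C_def by (rule FTC) (use that in \<open>auto intro!: continuous_intros P\<close>)
  have S: "(S has_real_derivative sin (a * t) * P t) (at t within {0..})" if "0 \<le> t" for t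
    unfolding S_def by (rule FTC) (use that in \<open>auto intro!: continuous_intros P\<close>)
  define X where "X = (\<lambda>t. X0 * cos (a * t) + (Y0 / a) * sin (a * t) + (sin (a * t) * C t - cos (a * t) * S t) / a)"
  define Y where "Y = (\<lambda>t. - a * X0 * sin (a * t) + Y0 * cos (a * t) + (cos (a * t) * C t + sin (a * t) * S t))"
  have "(X has_real_derivative Y t) (at t within {0..})" if "0 \<le> t" for t
    unfolding X_def Y_def using a
    by (auto intro!: derivative_eq_intros C S that simp: field_simps)
  moreover have "(Y has_real_derivative (- (a\<^sup>2) * X t + P t)) (at t within {0..})" if "0 \<le> t" for t
  proof -
    have "(Y has_real_derivative (- (a\<^sup>2) * X t + (cos (a * t) * (cos (a * t) * P t) + sin (a * t) * (sin (a * t) * P t)))) (at t within {0..})"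
      unfolding X_def Y_def using a
      by (auto intro!: derivative_eq_intros C S that simp: field_simps power2_eq_square)
    also have "cos (a * t) * (cos (a * t) * P t) + sin (a * t) * (sin (a * t) * P t) = ((sin (a * t))\<^sup>2 + (cos (a * t))\<^sup>2) * P t"
      by (simp only: power2_eq_square distrib_right mult.assoc add.commute)
    finally show ?thesis by simp
  qed
  moreover have "X 0 = X0" "Y 0 = Y0" by (simp_all add: X_def Y_def C_def S_def)
  ultimately show ?thesis by blast
qed

text \<open>In the products the n-independent part of the phase velocity cancels and a rotation with
  frequency a (m - n) remains. Equal indices give constant moduli; neighbouring indices give the
  rotation of the pairing in \<open>lower_moment_sums\<close>. The initial centre and velocity are
  left free.\<close>

lemma moving_frame:
  assumes sol: "solution_H lam \<eta> u" and a: "0 < a" and M: "lam + \<eta> * mass (u 0) = a\<^sup>2"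
  shows "\<exists>X Y. X 0 = X0 \<and> Y 0 = Y0 \<and>
     (\<forall>s\<ge>0. (X has_real_derivative Y s) (at s within {0..})) \<and>
     (\<forall>s\<ge>0. (Y has_real_derivative (- (a\<^sup>2) * X s + \<eta> * mom1 (u s))) (at s within {0..})) \<and>
     (\<forall>t\<ge>0. \<forall>n m. hcoef a (fn (boost (- Y t) (- X t) (u t))) n * cnj (hcoef a (fn (boost (- Y t) (- X t) (u t))) m) =
        cis (a * (real m - real n) * t) *
        (hcoef a (fn (boost (- Y0) (- X0) (u 0))) n * cnj (hcoef a (fn (boost (- Y0) (- X0) (u 0))) m)))"
proof -
  have cP: "continuous_on {0..} (\<lambda>s. \<eta> * mom1 (u s))"
    unfolding continuous_on_def by (auto intro!: tendsto_intros solution_tendsto[OF sol])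
  obtain X Y where X0: "X 0 = X0" "Y 0 = Y0" and X: "\<And>s. 0 \<le> s \<Longrightarrow> (X has_real_derivative Y s) (at s within {0..})"
    and Y: "\<And>s. 0 \<le> s \<Longrightarrow> (Y has_real_derivative (- (a\<^sup>2) * X s + \<eta> * mom1 (u s))) (at s within {0..})"
    using forced_oscillator[OF a cP, of X0 Y0] by blast
  define A where "A = (\<lambda>n s. ip (fn (u s)) (EB a (Y s) (X s) (hn a n)))"
  have co: "hcoef a (fn (boost (- Y t) (- X t) (u t))) n * cnj (hcoef a (fn (boost (- Y t) (- X t) (u t))) m) = A n t * cnj (A m t)" for n m t
  proof -
    have "cis (Y t * X t) * A n t * cnj (cis (Y t * X t) * A m t) = (cis (Y t * X t) * cis (- (Y t * X t))) * (A n t * cnj (A m t))"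
      by (simp add: cis_cnj)
    then show ?thesis unfolding hcoef_boost[OF a] A_def by (simp add: cis_mult)
  qed
  have c0: "hcoef a (fn (boost (- Y0) (- X0) (u 0))) n * cnj (hcoef a (fn (boost (- Y0) (- X0) (u 0))) m) = A n 0 * cnj (A m 0)" for n m
    using co[where t = 0 and n = n and m = m] unfolding X0 .
  have main: "A n t * cnj (A m t) = cis (a * (real m - real n) * t) * (A n 0 * cnj (A m 0))" if t: "0 \<le> t" for n m t
  proof -
    define z where "z = (\<lambda>s. cis (a * (real n - real m) * s) * (A n s * cnj (A m s)))"
    have "(z has_derivative (\<lambda>_. 0)) (at s within {0..})" if s: "0 \<le> s" for s
    proof -
      have Ms: "lam + \<eta> * mass (u s) = a\<^sup>2" using M solution_mass[OF sol s] by simp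
      define b where "b = (Y s)\<^sup>2 + a\<^sup>2 * (X s)\<^sup>2 - 2 * \<eta> * mom1 (u s) * X s + \<eta> * mom2 (u s) + 2 * (- (a\<^sup>2) * X s + \<eta> * mom1 (u s)) * X s"
      have dA: "(A j has_vector_derivative (- \<i> / 2) * of_real ((2 * real j + 1) * a + b) * A j s) (at s within {0..})" for j
        using moving_coefficient_deriv[OF sol s a Ms X Y, of j] unfolding A_def[abs_def] b_def .
      have dC: "((\<lambda>s. cnj (A j s)) has_vector_derivative cnj ((- \<i> / 2) * of_real ((2 * real j + 1) * a + b) * A j s)) (at s within {0..})" for j
        by (rule bounded_linear.has_vector_derivative[OF bounded_linear_cnj dA])
      have "((\<lambda>s. a * (real n - real m) * s) has_real_derivative a * (real n - real m)) (at s within {0..})"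
        by (auto intro!: derivative_eq_intros)
      from has_vector_derivative_mult[OF has_vector_derivative_cis_comp[OF this] has_vector_derivative_mult[OF dA[of n] dC[of m]]]
      have "(z has_vector_derivative 0) (at s within {0..})"
        unfolding z_def by (simp add: algebra_simps)
      then show ?thesis by (simp add: has_vector_derivative_def)
    qed
    then have "z t = z 0"
      by (intro has_derivative_zero_unique[of "{0..}" z]) (use t in auto)
    then have "A n t * cnj (A m t) = cis (a * (real m - real n) * t) * (cis (a * (real n - real m) * t) * (A n t * cnj (A m t)))
        \<and> cis (a * (real n - real m) * t) * (A n t * cnj (A m t)) = A n 0 * cnj (A m 0)"
      unfolding z_def mult.assoc[symmetric] cis_mult by (simp add: algebra_simps)
    then show ?thesis by metis
  qed
  show ?thesis
  proof (rule exI[of _ X], rule exI[of _ Y], intro conjI allI impI)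
    fix t :: real and n m assume "0 \<le> t"
    then show "hcoef a (fn (boost (- Y t) (- X t) (u t))) n * cnj (hcoef a (fn (boost (- Y t) (- X t) (u t))) m) =
        cis (a * (real m - real n) * t) *
        (hcoef a (fn (boost (- Y0) (- X0) (u 0))) n * cnj (hcoef a (fn (boost (- Y0) (- X0) (u 0))) m))"
      unfolding co c0 by (rule main)
  qed (use X Y X0 in auto)
qed

subsection \<open>Dependence on the width of the Gaussian\<close>

lemma pg_mono_width: "b \<le> a \<Longrightarrow> \<bar>pg p a x\<bar> \<le> \<bar>pg p b x\<bar>"
  unfolding pg_def abs_mult by (intro mult_left_mono) (auto intro: mult_right_mono)

lemma pg_deriv_width:
  "((\<lambda>a. pg p a x) has_real_derivative pg (smult (-1/2) ([:0, 1:] * ([:0, 1:] * p))) a x) (at a)"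
  unfolding pg_smult pg_times_x unfolding pg_def
  by (auto intro!: derivative_eq_intros simp: power2_eq_square)

lemma PG_L2_deriv_width:
  assumes t: "0 < t"
  shows "((\<lambda>s. l2n (\<lambda>x. (PG p s x - PG p t x) /\<^sub>R (s - t) - PG (smult (-1/2) ([:0, 1:] * ([:0, 1:] * p))) t x)) \<longlongrightarrow> 0) (at t)"
proof -
  let ?q = "smult (-1/2) ([:0, 1:] * ([:0, 1:] * p))"
  obtain C where C: "\<And>x. \<bar>pg ?q (t / 2) x\<bar> \<le> C * exp (- \<bar>x\<bar>)"
    using pg_bound[of "t / 2" ?q 1] t by auto
  show ?thesis
  \<comment> \<open>For |s - t| < t / 2 the parameter s stays above t / 2, and the Gaussian with
    parameter t / 2 dominates all those with a larger one.\<close>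
  proof (rule L2_deriv[where d = "t / 2" and C = C and g' = "\<lambda>s. PG ?q s"])
    show "((\<lambda>s. PG p s x) has_vector_derivative PG ?q s x) (at s)" for s x
      by (rule has_vector_derivative_of_real[OF pg_deriv_width])
    show "cmod (PG ?q s x) \<le> C * exp (- \<bar>x\<bar>)" if "\<bar>s - t\<bar> < t / 2" for s x
    proof -
      have "t / 2 \<le> s" using that unfolding abs_less_iff by linarith
      from order_trans[OF pg_mono_width[OF this, of ?q x] C] show ?thesis by (simp only: norm_of_real)
    qed
    show "PG p s \<in> borel_measurable borel" for s
      by (intro borel_measurable_continuous_onI continuous_intros pg_continuous)
  qed (use t in auto)
qed

lemma PG_dpg_L2_deriv_width:
  assumes t: "0 < t"
  shows "((\<lambda>s. l2n (\<lambda>x. (PG (dpg s p) s x - PG (dpg t p) t x) /\<^sub>R (s - t)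
     - PG (dpg t (smult (-1/2) ([:0, 1:] * ([:0, 1:] * p)))) t x)) \<longlongrightarrow> 0) (at t)"
proof -
  define q where "q = smult (-1/2) ([:0, 1:] * ([:0, 1:] * p))"
  have dq: "pg (dpg s q) s x = pg (pderiv q) s x - s * pg ([:0, 1:] * q) s x" for s x
    unfolding dpg_def pg_diff pg_times_x by simp
  obtain C1 where C1: "0 \<le> C1" "\<And>x. \<bar>pg (pderiv q) (t / 2) x\<bar> \<le> C1 * exp (- \<bar>x\<bar>)"
    using pg_bound[of "t / 2" "pderiv q" 1] t by auto
  obtain C2 where C2: "0 \<le> C2" "\<And>x. \<bar>pg ([:0, 1:] * q) (t / 2) x\<bar> \<le> C2 * exp (- \<bar>x\<bar>)"
    using pg_bound[of "t / 2" "[:0, 1:] * q" 1] t by auto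
  have "((\<lambda>s. l2n (\<lambda>x. (PG (dpg s p) s x - PG (dpg t p) t x) /\<^sub>R (s - t) - PG (dpg t q) t x)) \<longlongrightarrow> 0) (at t)"
  proof (rule L2_deriv[where d = "t / 2" and C = "C1 + 2 * t * C2" and g' = "\<lambda>s. PG (dpg s q) s"])
    show "((\<lambda>s. PG (dpg s p) s x) has_vector_derivative PG (dpg s q) s x) (at s)" for s x
    proof -
      have e: "pg (dpg s p) s x = pg (pderiv p) s x - s * (x * pg p s x)" for s
        unfolding dpg_def pg_diff pg_times_x by simp
      have pe: "poly (pderiv q) x = - (x * poly p x) - x * (x * poly (pderiv p) x) / 2"
        unfolding q_def by (simp only: pderiv_smult pderiv_mult) (simp add: pderiv_pCons algebra_simps)
      have pq: "pg (pderiv q) s x = - (x * pg p s x) - x * (x * pg (pderiv p) s x) / 2" for s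
        by (simp only: pg_def pe) (simp add: field_simps)
      have d1: "((\<lambda>s. pg (pderiv p) s x) has_real_derivative - (x * (x * pg (pderiv p) s x)) / 2) (at s)"
        using pg_deriv_width[of "pderiv p" x s] unfolding pg_smult pg_times_x by simp
      have d2: "((\<lambda>s. pg p s x) has_real_derivative - (x * (x * pg p s x)) / 2) (at s)"
        using pg_deriv_width[of p x s] unfolding pg_smult pg_times_x by simp
      have "((\<lambda>s. pg (dpg s p) s x) has_real_derivative pg (dpg s q) s x) (at s)"
        unfolding e dq pq unfolding q_def pg_smult pg_times_x
        by (auto intro!: derivative_eq_intros d1 d2 simp: field_simps)
      then show ?thesis by (rule has_vector_derivative_of_real)
    qed
    show "cmod (PG (dpg s q) s x) \<le> (C1 + 2 * t * C2) * exp (- \<bar>x\<bar>)" if "\<bar>s - t\<bar> < t / 2" for s x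
    proof -
      have s: "t / 2 \<le> s" "s \<le> 2 * t" using that t unfolding abs_less_iff by linarith+
      have "\<bar>pg (pderiv q) s x - s * pg ([:0, 1:] * q) s x\<bar> \<le> \<bar>pg (pderiv q) s x\<bar> + \<bar>s\<bar> * \<bar>pg ([:0, 1:] * q) s x\<bar>"
        unfolding abs_mult[symmetric] by (rule abs_triangle_ineq4)
      also have "\<dots> \<le> C1 * exp (- \<bar>x\<bar>) + (2 * t) * (C2 * exp (- \<bar>x\<bar>))"
        using s t by (intro add_mono mult_mono order_trans[OF pg_mono_width[OF s(1)] C1(2)]
            order_trans[OF pg_mono_width[OF s(1)] C2(2)]) auto
      finally show ?thesis unfolding norm_of_real dq by (simp add: algebra_simps)
    qed
    show "PG (dpg s p) s \<in> borel_measurable borel" for s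
      by (intro borel_measurable_continuous_onI continuous_intros pg_continuous)
  qed (use t in auto)
  then show ?thesis unfolding q_def .
qed

text \<open>Differentiating in the width multiplies by - x^2 / 2, which again gives a polynomial
  times the Gaussian; iteration yields derivatives of every order. By \<open>norm_energy_le\<close>
  convergence in the energy space is convergence in the mean of the functions, their derivatives and
  their products with x.\<close>

lemma pgs_has_vector_derivative:
  assumes t: "0 < t"
  shows "(pgs p has_vector_derivative pgs (smult (-1/2) ([:0, 1:] * ([:0, 1:] * p))) t) (at t)"
proof -
  define q where "q = smult (-1/2) ([:0, 1:] * ([:0, 1:] * p))"
  define d where "d = (\<lambda>s. (pgs p s - pgs p t) /\<^sub>R (s - t) - pgs q t)"
  define A where "A = (\<lambda>s x. (PG p s x - PG p t x) /\<^sub>R (s - t) - PG q t x)"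
  define B where "B = (\<lambda>s x. (PG (dpg s p) s x - PG (dpg t p) t x) /\<^sub>R (s - t) - PG (dpg t q) t x)"
  define C where "C = (\<lambda>s x. (PG ([:0, 1:] * p) s x - PG ([:0, 1:] * p) t x) /\<^sub>R (s - t) - PG ([:0, 1:] * q) t x)"
  have "norm (d s) \<le> 2 * l2n (A s) + l2n (B s) + l2n (C s)" if s: "s > 0" for s
  proof -
    have fn: "fn (d s) = A s"
      unfolding d_def A_def fn_minus fn_scaleR fn_pgs[OF s] fn_pgs[OF t] by (simp add: scaleR_conv_of_real)
    have "(\<lambda>x. of_real x * fn (d s) x) = C s"
    proof
      fix x
      have "PG ([:0, 1:] * r) b x = of_real x * PG r b x" for r b unfolding pg_times_x by simp
      then show "of_real x * fn (d s) x = C s x"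
        unfolding fn A_def C_def by (simp add: scaleR_conv_of_real algebra_simps del: mult_pCons_left)
    qed
    moreover have "l2n (grad (d s)) = l2n (B s)"
    proof (rule l2n_cong_AE)
      have m: "AE x in lborel. grad (u - v) x = grad u x - grad v x" for u v
        using grad_plus[of u "- 1 *\<^sub>R v"] grad_scaleR[of "-1" v] by eventually_elim simp
      show "AE x in lborel. grad (d s) x = B s x"
        using m[of "(pgs p s - pgs p t) /\<^sub>R (s - t)" "pgs q t"] m[of "pgs p s" "pgs p t"]
          grad_scaleR[of "inverse (s - t)" "pgs p s - pgs p t"] grad_pgs[OF s, of p] grad_pgs[OF t, of p] grad_pgs[OF t, of q]
        unfolding d_def by eventually_elim (simp add: B_def scaleR_conv_of_real)
      show "B s \<in> L2" unfolding B_def scaleR_conv_of_real using s t by (intro L2_diff L2_cmult pg_L2)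
    qed (rule grad)
    ultimately show ?thesis using norm_energy_le[of "d s"] by (simp add: fn)
  qed
  then have "\<forall>\<^sub>F s in at t. norm (d s) \<le> 2 * l2n (A s) + l2n (B s) + l2n (C s)"
    using eventually_at_filter[of _ t UNIV] order_tendstoD(1)[OF tendsto_ident_at t, of UNIV] by (auto elim: eventually_mono)
  moreover have "((\<lambda>s. 2 * l2n (A s) + l2n (B s) + l2n (C s)) \<longlongrightarrow> 0) (at t)"
  proof -
    have "[:0, 1:] * q = smult (-1/2) ([:0, 1:] * ([:0, 1:] * ([:0, 1:] * p)))"
      unfolding q_def by (simp only: mult_smult_right)
    then have "((\<lambda>s. l2n (C s)) \<longlongrightarrow> 0) (at t)"
      using PG_L2_deriv_width[OF t, of "[:0, 1:] * p"] unfolding C_def by simp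
    then have "((\<lambda>s. 2 * l2n (A s) + l2n (B s) + l2n (C s)) \<longlongrightarrow> 2 * 0 + 0 + 0) (at t)"
      using PG_L2_deriv_width[OF t, of p] PG_dpg_L2_deriv_width[OF t, of p] unfolding A_def B_def q_def
      by (intro tendsto_intros)
    then show ?thesis by simp
  qed
  ultimately have "(d \<longlongrightarrow> 0) (at t)" by (rule Lim_null_comparison)
  then show ?thesis
    unfolding has_vector_derivative_quotient q_def[symmetric] d_def by (simp add: LIM_zero_iff)
qed

lemma pgs_sum:
  assumes a: "0 < a"
  shows "pgs p a = (\<Sum>j\<le>degree p. coeff p j *\<^sub>R pgs (monom 1 j) a)"
proof (rule fn_eqI)
  fix x
  have s: "fn (\<Sum>j\<in>A. c j *\<^sub>R f j) x = (\<Sum>j\<in>A. of_real (c j) * fn (f j) x)" for A :: "nat set" and c f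
    by (induction A rule: infinite_finite_induct) (auto simp: fn_zero fn_plus fn_scaleR)
  have "pg p a x = (\<Sum>j\<le>degree p. coeff p j * pg (monom 1 j) a x)"
    by (simp add: pg_def poly_altdef[of p] poly_monom sum_distrib_right mult.assoc)
  then show "fn (pgs p a) x = fn (\<Sum>j\<le>degree p. coeff p j *\<^sub>R pgs (monom 1 j) a) x"
    unfolding s fn_pgs[OF a] by simp
qed

lemma degree_hp: "degree (hp a n) \<le> n"
proof (induction n)
  case (Suc n)
  have "degree ([:0, 2 * a:] * hp a n) \<le> Suc n"
    using degree_mult_le[of "[:0, 2 * a:]" "hp a n"] Suc degree_pCons_le[of 0 "[:2 * a:]"]
    by (simp del: mult_pCons_left)
  moreover have "degree (pderiv (hp a n)) \<le> Suc n" using Suc degree_pderiv[of "hp a n"] by simp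
  ultimately show ?case unfolding hp.simps(2) by (rule degree_diff_le)
qed simp

section \<open>Hermite states of given mass and width\<close>

definition hstate :: "real \<Rightarrow> real \<Rightarrow> nat \<Rightarrow> energy_space" where
  "hstate M a k = pgs (smult (sqrt M) (hn a k)) a"

text \<open>The width enters through the coefficients and through the Gaussian. Over monomials the
  two are separated, so continuity, and later smoothness, can be treated factor by factor.\<close>

lemma hstate_expand:
  assumes a: "0 < a"
  shows "hstate M a k = (\<Sum>j\<le>k. (sqrt M / sqrt (hN a k) * coeff (hp a k) j) *\<^sub>R pgs (monom 1 j) a)"
proof -
  let ?p = "smult (sqrt M) (hn a k)"
  have c: "coeff ?p j = sqrt M / sqrt (hN a k) * coeff (hp a k) j" for j
    by (simp add: hn_def)
  have "degree ?p \<le> k" using degree_hp[of a k] unfolding hn_def by (intro order_trans[OF degree_smult_le])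
  then have "(\<Sum>j\<le>degree ?p. coeff ?p j *\<^sub>R pgs (monom 1 j) a) = (\<Sum>j\<le>k. coeff ?p j *\<^sub>R pgs (monom 1 j) a)"
    by (intro sum.mono_neutral_left) (auto simp: coeff_eq_0 simp del: coeff_smult)
  then show ?thesis unfolding hstate_def pgs_sum[OF a, of ?p] c .
qed

lemma coeff_hp_Suc: "coeff (hp a (Suc n)) j = (case j of 0 \<Rightarrow> 0 | Suc i \<Rightarrow> 2 * a * coeff (hp a n) i) - real (Suc j) * coeff (hp a n) (Suc j)"
  by (simp add: hp.simps(2) coeff_pderiv coeff_pCons split: nat.split)

lemma continuous_coeff_hp: "continuous_on UNIV (\<lambda>a. coeff (hp a n) j)"
proof (induction n arbitrary: j)
  case (Suc n)
  show ?case unfolding coeff_hp_Suc by (cases j) (auto intro!: continuous_intros Suc)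
qed simp

lemma tendsto_hstate:
  assumes M: "(M \<longlongrightarrow> M0) F" and a: "(a \<longlongrightarrow> a0) F" and a0: "0 < a0"
  shows "((\<lambda>s. hstate (M s) (a s) k) \<longlongrightarrow> hstate M0 a0 k) F"
proof -
  have cp: "((\<lambda>s. coeff (hp (a s) k) j) \<longlongrightarrow> coeff (hp a0 k) j) F" for j
    using continuous_on_tendsto_compose[OF continuous_coeff_hp a, of k j] by simp
  have gm: "((\<lambda>s. pgs (monom 1 j) (a s)) \<longlongrightarrow> pgs (monom 1 j) a0) F" for j
  proof -
    have "isCont (pgs (monom 1 j)) a0"
      using has_vector_derivative_continuous[OF pgs_has_vector_derivative[OF a0]] .
    then show ?thesis using a by (rule isCont_tendsto_compose)
  qed
  have "((\<lambda>s. \<Sum>j\<le>k. (sqrt (M s) / sqrt (hN (a s) k) * coeff (hp (a s) k) j) *\<^sub>R pgs (monom 1 j) (a s)) \<longlongrightarrow> hstate M0 a0 k) F"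
    unfolding hstate_expand[OF a0] unfolding hN_def
    using a0 by (intro tendsto_intros M a cp gm) auto
  moreover have "\<forall>\<^sub>F s in F. (\<Sum>j\<le>k. (sqrt (M s) / sqrt (hN (a s) k) * coeff (hp (a s) k) j) *\<^sub>R pgs (monom 1 j) (a s)) = hstate (M s) (a s) k"
    using order_tendstoD(1)[OF a a0] by eventually_elim (simp add: hstate_expand)
  ultimately show ?thesis by (rule Lim_transform_eventually)
qed

lemma fn_hstate: "0 < a \<Longrightarrow> fn (hstate M a k) = (\<lambda>x. of_real (sqrt M) * HE a k x)"
  unfolding hstate_def fn_pgs by (simp add: pg_smult)

lemma hcoef_hstate:
  "0 < a \<Longrightarrow> hcoef a (fn (hstate M a k)) n = (if n = k then of_real (sqrt M) else 0)"
  unfolding hcoef_def fn_hstate ip_cmult_left by (simp add: ip_HE)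

lemma mass_hstate:
  assumes "0 < a" "0 \<le> M"
  shows "mass (hstate M a k) = M"
proof -
  have "complex_of_real ((l2n (HE a k))\<^sup>2) = of_real 1"
    unfolding ip_self[symmetric] using ip_HE[OF assms(1), of k k] by simp
  then have "(l2n (HE a k))\<^sup>2 = 1" by (simp only: of_real_eq_iff)
  then show ?thesis
    unfolding mass_l2n fn_hstate[OF assms(1)] l2n_cmult using assms(2) by (simp add: power_mult_distrib)
qed

text \<open>A state has a single nonzero coefficient, so all products of neighbouring coefficients
  vanish. Hence its first moment and its momentum are 0.\<close>

lemma ip_lower_hstate:
  assumes a: "0 < a"
  shows "ip (lower a (hstate M a k)) (fn (hstate M a k)) = 0"
proof -
  have "(\<lambda>n. of_real (sqrt (2 * a * real (Suc n))) * hcoef a (fn (hstate M a k)) (Suc n) * cnj (hcoef a (fn (hstate M a k)) n)) = (\<lambda>n. 0)"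
    by (auto simp: hcoef_hstate[OF a])
  then show ?thesis using lower_moment_sums[OF a, of "hstate M a k"] by (metis sums_unique2 sums_zero)
qed

lemma ip_lower_self:
  "ip (lower a u) (fn u) = ip (grad u) (fn u) + of_real (a * mom1 u)"
proof -
  have "ip (\<lambda>x. of_real (a * x) * fn u x) (fn u) = of_real a * cx u u"
    using ip_cmult_left[of "of_real a" "\<lambda>x. of_real x * fn u x" "fn u"] by (simp add: cx_def mult.assoc)
  then show ?thesis
    unfolding lower_def ip_add_left[OF grad(1) ax_fn_L2 fn_L2] by (simp add: cx_self)
qed

lemma ip_lower_eq_0:
  assumes "0 < a" "ip (lower a u) (fn u) = 0"
  shows "mom1 u = 0" "ip (grad u) (fn u) = 0"
proof -
  have "Re (ip (grad u) (fn u) + of_real (a * mom1 u)) = 0"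
    using assms(2) unfolding ip_lower_self by simp
  then show m: "mom1 u = 0" using Re_ip_grad_self[of u] assms(1) by simp
  show "ip (grad u) (fn u) = 0" using assms(2) unfolding ip_lower_self m by simp
qed

subsection \<open>Orbital stability\<close>

text \<open>Equivalent to the squared energy norm (\<open>osc_le\<close>,
  \<open>norm_le_osc\<close>) and diagonal in the Hermite basis of the same a.\<close>

definition osc :: "real \<Rightarrow> energy_space \<Rightarrow> real" where
  "osc a u = (l2n (grad u))\<^sup>2 + a\<^sup>2 * (l2n (\<lambda>x. of_real x * fn u x))\<^sup>2"

lemma osc_le: "osc a u \<le> (1 + a\<^sup>2) * (norm u)\<^sup>2"
proof -
  have "osc a u \<le> (norm u)\<^sup>2 + a\<^sup>2 * (norm u)\<^sup>2"
    unfolding osc_def by (intro add_mono mult_left_mono power_mono norm_energy_bounds) auto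
  then show ?thesis by (simp add: algebra_simps)
qed

text \<open>The lowest oscillator eigenvalue a controls the mass; the other two parts of the norm
  are terms of \<open>osc\<close>.\<close>

lemma norm_le_osc:
  assumes a: "0 < a"
  shows "(norm u)\<^sup>2 \<le> (2 / a + 1 + 1 / a\<^sup>2) * osc a u"
proof -
  have "a * (l2n (fn u))\<^sup>2 \<le> osc a u"
    unfolding osc_def
  proof (rule sums_le[OF _ sums_mult[OF parseval_norm[OF a fn_L2]] oscillator_energy_sums[OF a]])
    fix n show "a * (cmod (hcoef a (fn u) n))\<^sup>2 \<le> a * (2 * real n + 1) * (cmod (hcoef a (fn u) n))\<^sup>2"
      using a by (simp add: mult_right_mono)
  qed
  then have "(l2n (fn u))\<^sup>2 \<le> osc a u / a" using a by (simp add: field_simps)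
  moreover have "(l2n (grad u))\<^sup>2 \<le> osc a u" by (simp add: osc_def)
  moreover have "a\<^sup>2 * (l2n (\<lambda>x. of_real x * fn u x))\<^sup>2 \<le> osc a u" by (simp add: osc_def)
  then have "(l2n (\<lambda>x. of_real x * fn u x))\<^sup>2 \<le> osc a u / a\<^sup>2" using a by (simp add: field_simps)
  ultimately have "(norm u)\<^sup>2 \<le> 2 * (osc a u / a) + osc a u + osc a u / a\<^sup>2"
    unfolding norm_energy_sq by linarith
  then show ?thesis by (simp add: algebra_simps)
qed

lemma fn_phase: "fn (gauge_translate \<theta> 0 u) = (\<lambda>x. cis \<theta> * fn u x)"
  by (simp add: fn_gauge_translate)

lemma hcoef_diff: "0 < a \<Longrightarrow> hcoef a (fn (u - v)) n = hcoef a (fn u) n - hcoef a (fn v) n"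
  unfolding hcoef_def fn_minus by (rule ip_diff_left) (auto intro: fn_L2 pg_L2)

text \<open>The state occupies one mode only. Turning w until its k-th coefficient is nonnegative
  makes the k-th distance a difference of moduli, at most the one for \<open>w0\<close> by the
  reverse triangle inequality; in all other modes the two distances agree.\<close>

lemma osc_phase_dist:
  assumes a: "0 < a" and M: "0 \<le> M" and eq: "\<And>n. cmod (hcoef a (fn w) n) = cmod (hcoef a (fn w0) n)"
  shows "\<exists>\<theta>. osc a (hstate M a k - gauge_translate \<theta> 0 w) \<le> osc a (hstate M a k - w0)"
proof -
  let ?z = "hcoef a (fn w) k"
  have z: "cis (- Arg ?z) * ?z = of_real (cmod ?z)"
  proof (cases "?z = 0")
    case False
    then have "?z = rcis (cmod ?z) (Arg ?z)" by (simp add: rcis_cmod_Arg)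
    then have "cis (- Arg ?z) * ?z = of_real (cmod ?z) * (cis (- Arg ?z) * cis (Arg ?z))"
      unfolding rcis_def by (metis mult.left_commute)
    then show ?thesis by (simp add: cis_mult)
  qed simp
  have "osc a (hstate M a k - gauge_translate (- Arg ?z) 0 w) \<le> osc a (hstate M a k - w0)"
    unfolding osc_def
  proof (rule sums_le[OF _ oscillator_energy_sums[OF a] oscillator_energy_sums[OF a]])
    fix n
    have p: "hcoef a (fn (gauge_translate (- Arg ?z) 0 w)) n = cis (- Arg ?z) * hcoef a (fn w) n"
      unfolding hcoef_def fn_phase ip_cmult_left ..
    have "cmod (hcoef a (fn (hstate M a k - gauge_translate (- Arg ?z) 0 w)) n) \<le> cmod (hcoef a (fn (hstate M a k - w0)) n)"
    proof (cases "n = k")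
      case True
      have "cmod (of_real (sqrt M) - of_real (cmod ?z)) = \<bar>cmod (complex_of_real (sqrt M)) - cmod (hcoef a (fn w0) k)\<bar>"
        unfolding of_real_diff[symmetric] norm_of_real eq using M by simp
      also have "\<dots> \<le> cmod (of_real (sqrt M) - hcoef a (fn w0) k)" by (rule norm_triangle_ineq3)
      finally show ?thesis unfolding hcoef_diff[OF a] p unfolding True hcoef_hstate[OF a] z by simp
    next
      case False
      then show ?thesis unfolding hcoef_diff[OF a] p hcoef_hstate[OF a] by (simp add: eq)
    qed
    then show "a * (2 * real n + 1) * (cmod (hcoef a (fn (hstate M a k - gauge_translate (- Arg ?z) 0 w)) n))\<^sup>2
       \<le> a * (2 * real n + 1) * (cmod (hcoef a (fn (hstate M a k - w0)) n))\<^sup>2"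
      using a by (intro mult_left_mono power_mono) auto
  qed
  then show ?thesis by blast
qed

lemma ip_boost: "ip (\<lambda>x. cis (v * x) * f (x - X)) (\<lambda>x. cis (v * x) * g (x - X)) = ip f g"
proof -
  have "ip f g = (LINT x|lborel. f (x - X) * cnj (g (x - X)))"
    unfolding ip_def by (subst lborel_integral_real_affine[where c = 1 and t = "- X"]) simp_all
  also have "\<dots> = ip (\<lambda>x. cis (v * x) * f (x - X)) (\<lambda>x. cis (v * x) * g (x - X))"
    unfolding ip_def
  proof (intro Bochner_Integration.integral_cong refl)
    fix x
    have "cis (v * x) * f (x - X) * cnj (cis (v * x) * g (x - X)) = (cis (v * x) * cis (- (v * x))) * (f (x - X) * cnj (g (x - X)))"
      by (simp add: cis_cnj)
    then show "f (x - X) * cnj (g (x - X)) = cis (v * x) * f (x - X) * cnj (cis (v * x) * g (x - X))"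
      by (simp add: cis_mult)
  qed
  finally show ?thesis by simp
qed

text \<open>With \<open>ip_grad_boost\<close> this dictates the initial frame: boosting by -
  \<open>Y0\<close> and - \<open>X0\<close>, where these are momentum and first moment divided by
  the mass, makes both vanish.\<close>

lemma mom1_boost: "mom1 (boost v X u) = mom1 u + X * mass u"
proof -
  have "cx (boost v X u) (boost v X u) = ip (\<lambda>x. cis (v * x) * (of_real ((x - X) + X) * fn u (x - X))) (\<lambda>x. cis (v * x) * fn u (x - X))"
    unfolding cx_def fn_boost by (simp add: mult.left_commute)
  also have "\<dots> = ip (\<lambda>x. of_real (x + X) * fn u x) (fn u)"
    by (rule ip_boost[where f = "\<lambda>x. of_real (x + X) * fn u x"])
  also have "\<dots> = ip (\<lambda>x. of_real x * fn u x + of_real X * fn u x) (fn u)"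
    by (simp add: distrib_right)
  also have "\<dots> = cx u u + of_real X * cm u u"
    by (simp add: ip_add_left fn_times_x_L2 L2_cmult fn_L2 ip_cmult_left cx_def cm_def)
  finally show ?thesis unfolding cx_self cm_mass by (simp only: of_real_mult[symmetric] of_real_add[symmetric] of_real_eq_iff)
qed

lemma ip_grad_boost: "ip (grad (boost v X u)) (fn (boost v X u)) = ip (grad u) (fn u) + \<i> * of_real (v * mass u)"
proof -
  have "ip (grad (boost v X u)) (fn (boost v X u)) =
     ip (\<lambda>x. cis (v * x) * (grad u (x - X) + \<i> * of_real v * fn u (x - X))) (\<lambda>x. cis (v * x) * fn u (x - X))"
    unfolding fn_boost[symmetric, of v u X]
    by (rule ip_cong_AE[OF grad_boost]) (auto intro: grad boost_deriv_L2 fn_L2)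
  also have "\<dots> = ip (\<lambda>x. grad u x + \<i> * of_real v * fn u x) (fn u)"
    by (rule ip_boost[where f = "\<lambda>x. grad u x + \<i> * of_real v * fn u x"])
  also have "\<dots> = ip (grad u) (fn u) + \<i> * of_real v * cm u u"
    by (simp add: ip_add_left grad L2_cmult fn_L2 ip_cmult_left cm_def)
  finally show ?thesis by (simp add: cm_mass)
qed

text \<open>In the moving frame \<open>ip (lower a w) (fn w)\<close> only rotates in time. As it vanishes initially, \<open>X\<close> stays
  the centre of mass of the solution, and the forced equation turns into \<open>X'' = - lam X\<close>, which keeps
  the velocity small.\<close>

lemma solution_near_orbit:
  assumes sol: "solution_H lam \<eta> u" and a: "0 < a" and lam: "0 \<le> lam" and M: "lam + \<eta> * mass (u 0) = a\<^sup>2" "0 < mass (u 0)"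
    and t: "0 \<le> t"
  defines "X0 \<equiv> mom1 (u 0) / mass (u 0)" and "Y0 \<equiv> Im (ip (grad (u 0)) (fn (u 0))) / mass (u 0)"
  shows "\<exists>\<theta> y v w. \<bar>v\<bar> \<le> sqrt (Y0\<^sup>2 + lam * X0\<^sup>2) \<and> gauge_translate \<theta> y (u t) = boost v 0 w \<and>
     osc a (hstate (mass (u 0)) a k - w) \<le> osc a (hstate (mass (u 0)) a k - boost (- Y0) (- X0) (u 0))"
proof -
  let ?w0 = "boost (- Y0) (- X0) (u 0)"
  obtain X Y where X0: "X 0 = X0" "Y 0 = Y0"
    and X: "\<And>s. 0 \<le> s \<Longrightarrow> (X has_real_derivative Y s) (at s within {0..})"
    and Y: "\<And>s. 0 \<le> s \<Longrightarrow> (Y has_real_derivative (- (a\<^sup>2) * X s + \<eta> * mom1 (u s))) (at s within {0..})"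
    and co: "\<And>t n m. 0 \<le> t \<Longrightarrow> hcoef a (fn (boost (- Y t) (- X t) (u t))) n * cnj (hcoef a (fn (boost (- Y t) (- X t) (u t))) m) =
        cis (a * (real m - real n) * t) * (hcoef a (fn ?w0) n * cnj (hcoef a (fn ?w0) m))"
    using moving_frame[OF sol a M(1), of X0 Y0] by blast
  define w where "w = (\<lambda>t. boost (- Y t) (- X t) (u t))"
  have Mt: "mass (u s) = mass (u 0)" if "0 \<le> s" for s by (rule solution_mass[OF sol that])
  have w0: "ip (lower a ?w0) (fn ?w0) = 0"
  proof -
    have "mom1 ?w0 = 0" unfolding mom1_boost X0_def using M(2) by simp
    moreover have "ip (grad ?w0) (fn ?w0) = 0"
    proof (rule complex_eqI)
      show "Re (ip (grad ?w0) (fn ?w0)) = Re 0" by (simp add: Re_ip_grad_self)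
      show "Im (ip (grad ?w0) (fn ?w0)) = Im 0" unfolding ip_grad_boost Y0_def using M(2) by simp
    qed
    ultimately show ?thesis unfolding ip_lower_self by simp
  qed
  have mX: "mom1 (u s) = X s * mass (u 0)" if s: "0 \<le> s" for s
  proof -
    have "(\<lambda>n. of_real (sqrt (2 * a * real (Suc n))) * hcoef a (fn (w s)) (Suc n) * cnj (hcoef a (fn (w s)) n)) =
       (\<lambda>n. cis (- a * s) * (of_real (sqrt (2 * a * real (Suc n))) * hcoef a (fn ?w0) (Suc n) * cnj (hcoef a (fn ?w0) n)))"
      using co[OF s] unfolding w_def mult.assoc by (simp add: mult.left_commute)
    then have "ip (lower a (w s)) (fn (w s)) = cis (- a * s) * ip (lower a ?w0) (fn ?w0)"
      using lower_moment_sums[OF a, of "w s"] sums_mult[OF lower_moment_sums[OF a, of ?w0], of "cis (- a * s)"]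
      by (metis (no_types, lifting) sums_unique2)
    then have "mom1 (w s) = 0" using w0 by (intro ip_lower_eq_0[OF a]) simp
    then show ?thesis unfolding w_def mom1_boost using Mt[OF s] by simp
  qed
  \<comment> \<open>The classical energy of the centre under X'' = - lam X. It is conserved, and 0
    \<le> lam turns it into a bound on the velocity. The centre itself may drift off when lam =
    0.\<close>
  define H where "H = (\<lambda>s. (Y s)\<^sup>2 + lam * (X s)\<^sup>2)"
  have Y': "(Y has_real_derivative (- lam * X s)) (at s within {0..})" if s: "0 \<le> s" for s
  proof -
    have "- (a\<^sup>2) * X s + \<eta> * mom1 (u s) = - lam * X s"
      unfolding mX[OF s] M(1)[symmetric] by (simp add: algebra_simps)
    then show ?thesis using Y[OF s] by simp
  qed
  have "(H has_derivative (\<lambda>_. 0)) (at s within {0..})" if s: "0 \<le> s" for s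
  proof -
    have "(H has_real_derivative 0) (at s within {0..})"
      unfolding H_def by (auto intro!: derivative_eq_intros X[OF s] Y'[OF s])
    then show ?thesis by (simp add: has_field_derivative_def lambda_zero)
  qed
  then have "H t = H 0"
    by (intro has_derivative_zero_unique[of "{0..}" H]) (use t in auto)
  then have "(Y t)\<^sup>2 \<le> Y0\<^sup>2 + lam * X0\<^sup>2" unfolding H_def X0 using lam zero_le_power2[of "X t"]
    by (metis add_increasing2 le_add_same_cancel1 mult_nonneg_nonneg)
  then have v: "\<bar>Y t\<bar> \<le> sqrt (Y0\<^sup>2 + lam * X0\<^sup>2)"
    using real_sqrt_le_mono by fastforce
  have "cmod (hcoef a (fn (w t)) n) = cmod (hcoef a (fn ?w0) n)" for n
  proof -
    have "hcoef a (fn (w t)) n * cnj (hcoef a (fn (w t)) n) = hcoef a (fn ?w0) n * cnj (hcoef a (fn ?w0) n)"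
      using co[OF t, of n n] by (simp add: w_def)
    then have "(cmod (hcoef a (fn (w t)) n))\<^sup>2 = (cmod (hcoef a (fn ?w0) n))\<^sup>2"
      unfolding complex_norm_square[symmetric] by (simp only: of_real_eq_iff)
    then show ?thesis by (simp add: power2_eq_iff_nonneg)
  qed
  then obtain \<theta> where \<theta>: "osc a (hstate (mass (u 0)) a k - gauge_translate \<theta> 0 (w t)) \<le> osc a (hstate (mass (u 0)) a k - ?w0)"
    using osc_phase_dist[OF a, of "mass (u 0)" "w t" ?w0 k] M(2) by auto
  \<comment> \<open>The orbit may be corrected by a phase and by a translation back from the centre
    X t; what cannot be removed is the boost with velocity Y t.\<close>
  have "gauge_translate \<theta> (- X t) (u t) = boost (Y t) 0 (gauge_translate \<theta> 0 (w t))"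
  proof (rule fn_eqI)
    fix x
    have "cis (Y t * x) * (cis \<theta> * (cis (- Y t * x) * fn (u t) (x + X t))) = (cis (Y t * x) * cis (- Y t * x)) * (cis \<theta> * fn (u t) (x + X t))"
      by simp
    then show "fn (gauge_translate \<theta> (- X t) (u t)) x = fn (boost (Y t) 0 (gauge_translate \<theta> 0 (w t))) x"
      unfolding fn_gauge_translate fn_boost w_def by (simp add: cis_mult)
  qed
  then show ?thesis using v \<theta> by blast
qed

lemma EB_L2_tendsto:
  assumes a: "0 < a" and v: "v \<longlonglongrightarrow> 0" and X: "X \<longlonglongrightarrow> 0"
  shows "(\<lambda>n. l2n (\<lambda>x. EB a (v n) (X n) q x - PG q a x)) \<longlonglongrightarrow> 0"
proof -
  obtain C where C: "\<And>v X x. \<bar>X\<bar> \<le> 1 \<Longrightarrow> cmod (EB a v X q x) \<le> C * exp (- \<bar>x\<bar>)"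
    using EB_bound[OF a, of 1 q] by blast
  show ?thesis
  proof (rule L2_dct(2)[where C = C])
    show "EB a (v n) (X n) q \<in> borel_measurable borel" for n
      by (rule borel_measurable_continuous_onI[OF EB_continuous])
    show "(\<lambda>n. EB a (v n) (X n) q x) \<longlonglongrightarrow> PG q a x" for x
    proof -
      have "(\<lambda>n. cis (v n * x) * of_real (pg q a (x - X n))) \<longlonglongrightarrow> cis (0 * x) * of_real (pg q a (x - 0))"
        by (intro tendsto_intros v X continuous_on_tendsto_compose[OF pg_continuous[of UNIV q a]] tendsto_cis) auto
      then show ?thesis by (simp add: EB_def)
    qed
    have "\<forall>\<^sub>F n in sequentially. \<bar>X n\<bar> < 1" using tendstoD[OF X, of 1] by simp
    then show "\<forall>\<^sub>F n in sequentially. \<forall>x. cmod (EB a (v n) (X n) q x) \<le> C * exp (- \<bar>x\<bar>)"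
      by eventually_elim (auto intro: C)
  qed
qed

text \<open>Boosts are only strongly continuous, so smallness is shown at elements of the form
  \<open>pgs q a\<close>. For general perturbations the bound \<open>norm_boost_le\<close>
  suffices.\<close>

lemma boost_pgs_tendsto:
  assumes a: "0 < a" and v: "v \<longlonglongrightarrow> 0" and X: "X \<longlonglongrightarrow> 0"
  shows "(\<lambda>n. norm (boost (v n) (X n) (pgs q a) - pgs q a)) \<longlonglongrightarrow> 0"
proof (rule Lim_null_comparison)
  let ?E = "\<lambda>n p x. EB a (v n) (X n) p x - PG p a x"
  let ?b = "\<lambda>n. 2 * l2n (?E n q) + (l2n (?E n (dpg a q)) + \<bar>v n\<bar> * l2n (PG q a)) + (l2n (?E n ([:0, 1:] * q)) + \<bar>X n\<bar> * l2n (PG q a))"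
  have lEB: "l2n (EB a v X q) = l2n (PG q a)" for v X
    unfolding EB_def[abs_def] l2n_cis by (rule l2n_translate[where f = "PG q a"])
  show "\<forall>\<^sub>F n in sequentially. norm (norm (boost (v n) (X n) (pgs q a) - pgs q a)) \<le> ?b n"
  proof (intro always_eventually allI)
    fix n
    let ?d = "boost (v n) (X n) (pgs q a) - pgs q a"
    have fn: "fn ?d = ?E n q" unfolding fn_minus fn_boost_pgs[OF a] fn_pgs[OF a] ..
    have "l2n (grad ?d) = l2n (\<lambda>x. ?E n (dpg a q) x + \<i> * of_real (v n) * EB a (v n) (X n) q x)"
    proof (rule l2n_cong_AE)
      have m: "AE x in lborel. grad (u - v) x = grad u x - grad v x" for u v
        using grad_plus[of u "- 1 *\<^sub>R v"] grad_scaleR[of "-1" v] by eventually_elim simp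
      show "AE x in lborel. grad ?d x = ?E n (dpg a q) x + \<i> * of_real (v n) * EB a (v n) (X n) q x"
        using m[of "boost (v n) (X n) (pgs q a)" "pgs q a"] grad_boost_pgs[OF a, of "v n" "X n" q] grad_pgs[OF a, of q]
        by eventually_elim simp
    qed (intro grad L2_add L2_diff L2_cmult EB_L2 pg_L2 a)+
    also have "\<dots> \<le> l2n (?E n (dpg a q)) + l2n (\<lambda>x. \<i> * of_real (v n) * EB a (v n) (X n) q x)"
      by (intro l2n_triangle L2_diff L2_cmult EB_L2 pg_L2 a)
    finally have g: "l2n (grad ?d) \<le> l2n (?E n (dpg a q)) + \<bar>v n\<bar> * l2n (PG q a)"
      by (simp add: l2n_cmult norm_mult lEB)
    have "l2n (\<lambda>x. of_real x * fn ?d x) = l2n (\<lambda>x. ?E n ([:0, 1:] * q) x + of_real (X n) * EB a (v n) (X n) q x)"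
    proof (rule arg_cong[where f = l2n], rule ext)
      fix x
      have "of_real x * PG q a x = PG ([:0, 1:] * q) a x" unfolding pg_times_x by simp
      then show "of_real x * fn ?d x = ?E n ([:0, 1:] * q) x + of_real (X n) * EB a (v n) (X n) q x"
        unfolding fn right_diff_distrib EB_x by (simp del: mult_pCons_left)
    qed
    also have "\<dots> \<le> l2n (?E n ([:0, 1:] * q)) + l2n (\<lambda>x. of_real (X n) * EB a (v n) (X n) q x)"
      by (intro l2n_triangle L2_diff L2_cmult EB_L2 pg_L2 a)
    finally have "l2n (\<lambda>x. of_real x * fn ?d x) \<le> l2n (?E n ([:0, 1:] * q)) + \<bar>X n\<bar> * l2n (PG q a)"
      by (simp add: l2n_cmult lEB del: mult_pCons_left)
    then show "norm (norm ?d) \<le> ?b n"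
      using norm_energy_le[of ?d] g unfolding fn by simp
  qed
  have "?b \<longlonglongrightarrow> 2 * 0 + (0 + \<bar>0\<bar> * l2n (PG q a)) + (0 + \<bar>0\<bar> * l2n (PG q a))"
    by (intro tendsto_intros EB_L2_tendsto a v X)
  then show "?b \<longlonglongrightarrow> 0" by simp
qed

lemma boost_pgs_near:
  assumes a: "0 < a" and e: "0 < e"
  shows "\<forall>\<^sub>F z in nhds (0, 0). norm (boost (fst z) (snd z) (pgs q a) - pgs q a) < e"
proof (unfold eventually_nhds_iff_sequentially, intro allI impI)
  fix f :: "nat \<Rightarrow> real \<times> real" assume "f \<longlonglongrightarrow> (0, 0)"
  then have "(\<lambda>n. fst (f n)) \<longlonglongrightarrow> 0" "(\<lambda>n. snd (f n)) \<longlonglongrightarrow> 0"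
    using tendsto_fst tendsto_snd by fastforce+
  from order_tendstoD(2)[OF boost_pgs_tendsto[OF a this] e]
  show "\<forall>\<^sub>F n in sequentially. norm (boost (fst (f n)) (snd (f n)) (pgs q a) - pgs q a) < e" .
qed

lemma bounded_bilinear_grad_fn: "bounded_bilinear (\<lambda>u v. ip (grad u) (fn v))"
proof
  show "ip (grad (u + u')) (fn v) = ip (grad u) (fn v) + ip (grad u') (fn v)" for u u' v
    by (subst ip_add_left[symmetric, OF grad(1) grad(1) fn_L2], rule ip_cong_AE[OF grad_plus])
       (auto intro: grad L2_add fn_L2)
  show "ip (grad u) (fn (v + v')) = ip (grad u) (fn v) + ip (grad u) (fn v')" for u v v'
    unfolding fn_plus by (intro ip_add_right fn_L2 grad)
  show "ip (grad (r *\<^sub>R u)) (fn v) = r *\<^sub>R ip (grad u) (fn v)" for r u v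
    unfolding scaleR_conv_of_real
    by (subst ip_cmult_left[symmetric], rule ip_cong_AE[OF grad_scaleR]) (auto intro: grad L2_cmult fn_L2)
  show "ip (grad u) (fn (r *\<^sub>R v)) = r *\<^sub>R ip (grad u) (fn v)" for r u v
    unfolding scaleR_conv_of_real fn_scaleR ip_cmult_right by simp
  show "\<exists>K. \<forall>a b. norm (ip (grad a) (fn b)) \<le> norm a * norm b * K"
  proof (intro exI[of _ 1] allI)
    fix a b
    have "norm (ip (grad a) (fn b)) \<le> l2n (grad a) * l2n (fn b)" by (intro ip_CS grad fn_L2)
    also have "\<dots> \<le> norm a * norm b" by (intro mult_mono norm_energy_bounds) auto
    finally show "norm (ip (grad a) (fn b)) \<le> norm a * norm b * 1" by simp
  qed
qed

text \<open>The moduli in the moving frame keep the oscillator distance from growing for all times,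
  so it is enough that finitely many continuous functions of the initial datum vanish at the state:
  the deviations of mass and width, the centre, the velocity, and the distance itself.\<close>

theorem hstate_stable:
  assumes lam: "0 \<le> lam" and a0: "0 < a0" and M0: "0 < M0" and eq: "lam + \<eta> * M0 = a0\<^sup>2"
  shows "orbitally_stable lam \<eta> (hstate M0 a0 k)"
  unfolding orbitally_stable_def
proof (intro allI impI)
  fix \<epsilon> :: real assume \<epsilon>: "0 < \<epsilon>"
  define \<phi> where "\<phi> = hstate M0 a0 k"
  let ?F = "nhds \<phi>"
  define A where "A = (\<lambda>u0. sqrt (lam + \<eta> * mass u0))"
  define X0 where "X0 = (\<lambda>u0. mom1 u0 / mass u0)"
  define Y0 where "Y0 = (\<lambda>u0. Im (ip (grad u0) (fn u0)) / mass u0)"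
  define V where "V = (\<lambda>u0. sqrt ((Y0 u0)\<^sup>2 + lam * (X0 u0)\<^sup>2))"
  define hs where "hs = (\<lambda>u0. hstate (mass u0) (A u0) k)"
  \<comment> \<open>\<open>W\<close> bounds the distance of the recentred datum from the state
    \<open>hs\<close> of its own mass. \<open>K\<close> bounds the later distance from \<phi> after
    both changes between the energy norm and \<open>osc\<close> and after a final boost with
    velocity at most \<open>V\<close>.\<close>
  define W where "W = (\<lambda>u0. norm (hs u0 - \<phi>) + norm (boost (- Y0 u0) (- X0 u0) \<phi> - \<phi>)
      + (4 + \<bar>Y0 u0\<bar> + \<bar>X0 u0\<bar>) * norm (u0 - \<phi>))"
  define K where "K = (\<lambda>u0. (4 + V u0) * (norm (hs u0 - \<phi>) +
      sqrt ((2 / A u0 + 1 + 1 / (A u0)\<^sup>2) * (1 + (A u0)\<^sup>2)) * W u0))"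
  have id: "((\<lambda>u. u) \<longlongrightarrow> \<phi>) ?F" by (rule filterlim_ident)
  have \<phi>M: "mass \<phi> = M0" unfolding \<phi>_def using mass_hstate a0 M0 by simp
  note \<phi>0 = ip_lower_eq_0[OF a0 ip_lower_hstate[OF a0, of M0 k], folded \<phi>_def]
  have tM: "(mass \<longlongrightarrow> M0) ?F" using tendsto_forms(1)[OF id] \<phi>M by simp
  have tA: "(A \<longlongrightarrow> a0) ?F"
  proof -
    have "(A \<longlongrightarrow> sqrt (lam + \<eta> * M0)) ?F" unfolding A_def by (intro tendsto_intros tM)
    then show ?thesis using eq a0 by simp
  qed
  have tX: "(X0 \<longlongrightarrow> 0) ?F"
    using tendsto_divide[OF tendsto_forms(2)[OF id] tM] M0 \<phi>0 by (simp add: X0_def)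
  have tY: "(Y0 \<longlongrightarrow> 0) ?F"
    using tendsto_divide[OF tendsto_Im[OF bounded_bilinear.tendsto[OF bounded_bilinear_grad_fn id id]] tM] M0 \<phi>0 by (simp add: Y0_def)
  have tV: "(V \<longlongrightarrow> 0) ?F"
  proof -
    have "(V \<longlongrightarrow> sqrt (0\<^sup>2 + lam * 0\<^sup>2)) ?F" unfolding V_def by (intro tendsto_intros tX tY)
    then show ?thesis by simp
  qed
  have ths: "((\<lambda>u0. norm (hs u0 - \<phi>)) \<longlongrightarrow> 0) ?F"
    using tendsto_norm[OF tendsto_diff[OF tendsto_hstate[OF tM tA a0, of k] tendsto_const[of \<phi>]]]
    by (simp add: hs_def \<phi>_def)
  have tb: "((\<lambda>u0. norm (boost (- Y0 u0) (- X0 u0) \<phi> - \<phi>)) \<longlongrightarrow> 0) ?F"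
  proof (rule tendstoI)
    fix e :: real assume e: "0 < e"
    have "((\<lambda>u0. (- Y0 u0, - X0 u0)) \<longlongrightarrow> (- 0, - 0)) ?F" by (intro tendsto_intros tX tY)
    then have "filterlim (\<lambda>u0. (- Y0 u0, - X0 u0)) (nhds (0, 0)) ?F" by simp
    from eventually_compose_filterlim[OF boost_pgs_near[OF a0 e, of "smult (sqrt M0) (hn a0 k)", folded hstate_def \<phi>_def] this]
    show "\<forall>\<^sub>F u0 in ?F. dist (norm (boost (- Y0 u0) (- X0 u0) \<phi> - \<phi>)) 0 < e" by simp
  qed
  have tW: "(W \<longlongrightarrow> 0) ?F"
  proof -
    have "(W \<longlongrightarrow> 0 + 0 + (4 + \<bar>0\<bar> + \<bar>0\<bar>) * norm (\<phi> - \<phi>)) ?F"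
      unfolding W_def by (intro tendsto_intros ths tb tX tY id)
    then show ?thesis by simp
  qed
  have tK: "(K \<longlongrightarrow> 0) ?F"
  proof -
    have "(K \<longlongrightarrow> (4 + 0) * (0 + sqrt ((2 / a0 + 1 + 1 / a0\<^sup>2) * (1 + a0\<^sup>2)) * 0)) ?F"
      unfolding K_def using a0 by (intro tendsto_intros ths tW tV tA) auto
    then show ?thesis by simp
  qed
  have "\<forall>\<^sub>F z in nhds (0, 0). norm (boost (fst z) (snd z) \<phi> - \<phi>) < \<epsilon> / 4"
    using boost_pgs_near[OF a0, of "\<epsilon> / 4" "smult (sqrt M0) (hn a0 k)", folded hstate_def \<phi>_def] \<epsilon> by simp
  then obtain d where d: "0 < d" "\<And>z. dist z (0, 0) < d \<Longrightarrow> norm (boost (fst z) (snd z) \<phi> - \<phi>) < \<epsilon> / 4"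
    unfolding eventually_nhds_metric by auto
  have "\<forall>\<^sub>F u0 in ?F. mass u0 > 0 \<and> A u0 > 0 \<and> V u0 < d \<and> K u0 < \<epsilon> / 4"
    using order_tendstoD(1)[OF tM M0] order_tendstoD(1)[OF tA a0] order_tendstoD(2)[OF tV d(1)]
      order_tendstoD(2)[OF tK, of "\<epsilon> / 4"] \<epsilon> by (auto intro!: eventually_conj)
  then obtain \<delta> where \<delta>: "0 < \<delta>" "\<And>u0. dist u0 \<phi> < \<delta> \<Longrightarrow> mass u0 > 0 \<and> A u0 > 0 \<and> V u0 < d \<and> K u0 < \<epsilon> / 4"
    unfolding eventually_nhds_metric by auto
  \<comment> \<open>\<epsilon> / 2 instead of \<epsilon>, since the supremum over time has to stay
    strictly below \<epsilon>.\<close>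
  have main: "\<exists>\<theta> y. norm (\<phi> - gauge_translate \<theta> y (u t)) \<le> \<epsilon> / 2"
    if u0: "norm (u 0 - \<phi>) < \<delta>" and sol: "solution_H lam \<eta> u" and t: "0 \<le> t" for u t
  proof -
    let ?u = "u 0"
    have g: "mass ?u > 0" "A ?u > 0" "V ?u < d" "K ?u < \<epsilon> / 4" using \<delta>(2)[of ?u] u0 by (auto simp: dist_norm)
    have A2: "lam + \<eta> * mass ?u = (A ?u)\<^sup>2" using g(2) unfolding A_def by simp
    obtain \<theta> y v w where v: "\<bar>v\<bar> \<le> V ?u" and gt: "gauge_translate \<theta> y (u t) = boost v 0 w"
      and o: "osc (A ?u) (hs ?u - w) \<le> osc (A ?u) (hs ?u - boost (- Y0 ?u) (- X0 ?u) ?u)"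
      using solution_near_orbit[OF sol g(2) lam A2 g(1) t, of k] unfolding V_def hs_def X0_def Y0_def by blast
    let ?c = "2 / A ?u + 1 + 1 / (A ?u)\<^sup>2"
    have c: "0 \<le> ?c" using g(2) by simp
    have 1: "norm (hs ?u - boost (- Y0 ?u) (- X0 ?u) ?u) \<le> W ?u"
    proof -
      have "hs ?u - boost (- Y0 ?u) (- X0 ?u) ?u = (hs ?u - \<phi>) - (boost (- Y0 ?u) (- X0 ?u) \<phi> - \<phi>) - boost (- Y0 ?u) (- X0 ?u) (?u - \<phi>)"
        by (simp add: boost_diff)
      then have "norm (hs ?u - boost (- Y0 ?u) (- X0 ?u) ?u) \<le> norm (hs ?u - \<phi>) + norm (boost (- Y0 ?u) (- X0 ?u) \<phi> - \<phi>) + norm (boost (- Y0 ?u) (- X0 ?u) (?u - \<phi>))"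
        by (metis norm_triangle_ineq4 add_right_mono order_trans)
      then show ?thesis using norm_boost_le[of "- Y0 ?u" "- X0 ?u" "?u - \<phi>"] by (simp add: W_def)
    qed
    have W0: "0 \<le> W ?u" using 1 norm_ge_zero order_trans by blast
    have "(norm (hs ?u - w))\<^sup>2 \<le> ?c * osc (A ?u) (hs ?u - w)" by (rule norm_le_osc[OF g(2)])
    also have "\<dots> \<le> ?c * osc (A ?u) (hs ?u - boost (- Y0 ?u) (- X0 ?u) ?u)" by (rule mult_left_mono[OF o c])
    also have "\<dots> \<le> ?c * ((1 + (A ?u)\<^sup>2) * (norm (hs ?u - boost (- Y0 ?u) (- X0 ?u) ?u))\<^sup>2)" by (rule mult_left_mono[OF osc_le c])
    also have "\<dots> \<le> ?c * ((1 + (A ?u)\<^sup>2) * (W ?u)\<^sup>2)"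
      using 1 c by (intro mult_left_mono power_mono) auto
    also have "\<dots> = (sqrt (?c * (1 + (A ?u)\<^sup>2)) * W ?u)\<^sup>2"
      using c by (simp add: power_mult_distrib)
    finally have 2: "norm (hs ?u - w) \<le> sqrt (?c * (1 + (A ?u)\<^sup>2)) * W ?u"
      by (rule power2_le_imp_le) (use W0 c in simp)
    have "\<phi> - boost v 0 w = boost v 0 (\<phi> - w) - (boost v 0 \<phi> - \<phi>)" by (simp add: boost_diff)
    then have "norm (\<phi> - boost v 0 w) \<le> norm (boost v 0 (\<phi> - w)) + norm (boost v 0 \<phi> - \<phi>)"
      by (simp only: norm_triangle_ineq4)
    moreover have "norm (boost v 0 \<phi> - \<phi>) < \<epsilon> / 4"
      using d(2)[of "(v, 0)"] v g(3) by (simp add: dist_Pair_Pair dist_real_def)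
    moreover have "norm (boost v 0 (\<phi> - w)) \<le> K ?u"
    proof -
      have "norm (boost v 0 (\<phi> - w)) \<le> (4 + \<bar>v\<bar> + \<bar>0\<bar>) * norm (\<phi> - w)" by (rule norm_boost_le)
      also have "\<dots> \<le> (4 + V ?u) * (norm (hs ?u - \<phi>) + sqrt (?c * (1 + (A ?u)\<^sup>2)) * W ?u)"
      proof (intro mult_mono)
        have "norm (\<phi> - w) = norm ((hs ?u - w) - (hs ?u - \<phi>))" by simp
        also have "\<dots> \<le> norm (hs ?u - w) + norm (hs ?u - \<phi>)" by (rule norm_triangle_ineq4)
        finally show "norm (\<phi> - w) \<le> norm (hs ?u - \<phi>) + sqrt (?c * (1 + (A ?u)\<^sup>2)) * W ?u" using 2 by simp
      qed (use v in auto)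
      finally show ?thesis by (simp add: K_def)
    qed
    ultimately have "norm (\<phi> - gauge_translate \<theta> y (u t)) \<le> \<epsilon> / 2" unfolding gt using g(4) by linarith
    then show ?thesis by blast
  qed
  show "\<exists>\<delta>>0. \<forall>u\<^sub>0. norm (u\<^sub>0 - hstate M0 a0 k) < \<delta> \<longrightarrow> (\<forall>u. solution_H lam \<eta> u \<and> u 0 = u\<^sub>0 \<longrightarrow>
      (SUP t\<in>{0<..}. INF (\<theta>, y)\<in>UNIV. ereal (norm (hstate M0 a0 k - gauge_translate \<theta> y (u t)))) < ereal \<epsilon>)"
    unfolding \<phi>_def[symmetric]
  proof (intro exI[of _ \<delta>] conjI allI impI \<delta>(1))
    fix u0 u assume u0: "norm (u0 - \<phi>) < \<delta>" and u: "solution_H lam \<eta> u \<and> u 0 = u0"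
    have "(SUP t\<in>{0<..}. INF (\<theta>, y)\<in>UNIV. ereal (norm (\<phi> - gauge_translate \<theta> y (u t)))) \<le> ereal (\<epsilon> / 2)"
    proof (rule SUP_least)
      fix t :: real assume "t \<in> {0<..}"
      then obtain \<theta> y where "norm (\<phi> - gauge_translate \<theta> y (u t)) \<le> \<epsilon> / 2" using main[of u t] u0 u by auto
      then show "(INF (\<theta>, y)\<in>UNIV. ereal (norm (\<phi> - gauge_translate \<theta> y (u t)))) \<le> ereal (\<epsilon> / 2)"
        by (intro INF_lower2[of "(\<theta>, y)"]) auto
    qed
    also have "\<dots> < ereal \<epsilon>" using \<epsilon> by simp
    finally show "(SUP t\<in>{0<..}. INF (\<theta>, y)\<in>UNIV. ereal (norm (\<phi> - gauge_translate \<theta> y (u t)))) < ereal \<epsilon>" .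
  qed
qed

subsection \<open>Derivatives of the action\<close>

lemma bounded_bilinear_Re: "bounded_bilinear f \<Longrightarrow> bounded_bilinear (\<lambda>u v. Re (f u v))"
proof -
  assume f: "bounded_bilinear f"
  then obtain K where K: "\<And>a b. norm (f a b) \<le> norm a * norm b * K"
    using bounded_bilinear.bounded by blast
  show ?thesis
    using f
    by unfold_locales
       (auto simp: bounded_bilinear.add_left bounded_bilinear.add_right bounded_bilinear.scaleR_left
         bounded_bilinear.scaleR_right intro!: exI[of _ K] order_trans[OF abs_Re_le_cmod K])
qed

definition rg :: "energy_space \<Rightarrow> energy_space \<Rightarrow> real" where "rg u v = Re (cg u v)"
definition rm :: "energy_space \<Rightarrow> energy_space \<Rightarrow> real" where "rm u v = Re (cm u v)"
definition rx :: "energy_space \<Rightarrow> energy_space \<Rightarrow> real" where "rx u v = Re (cx u v)"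
definition rv :: "energy_space \<Rightarrow> energy_space \<Rightarrow> real" where "rv u v = Re (cv u v)"

lemma bounded_bilinear_real_forms: "bounded_bilinear rg" "bounded_bilinear rm" "bounded_bilinear rx" "bounded_bilinear rv"
  using bounded_bilinear_Re[OF bounded_bilinear_cg] bounded_bilinear_Re[OF bounded_bilinear_cm] bounded_bilinear_Re[OF bounded_bilinear_cx] bounded_bilinear_Re[OF bounded_bilinear_cv]
  by (simp_all add: rg_def[abs_def] rm_def[abs_def] rx_def[abs_def] rv_def[abs_def])

lemma real_forms_commute: "rg u v = rg v u" "rm u v = rm v u" "rx u v = rx v u" "rv u v = rv v u"
  unfolding rg_def rm_def rx_def rv_def
  by (subst cg_commute, simp) (subst cm_commute, simp, (subst cx_commute, simp, (subst cv_commute, simp)?)?)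

lemma real_forms_self: "rm u u = mass u" "rx u u = mom1 u" "rv u u = mom2 u"
  by (simp_all add: rm_def rx_def rv_def mass_def mom1_def mom2_def)

text \<open>Multiplied out, the double integral is 2 (M V - P^2) with mass M, second moment V and
  first moment P. The action is thus a polynomial in bounded real forms, and its derivatives follow
  from the product rule.\<close>

lemma energy_eq:
  "energy lam \<eta> u = 1/2 * rg u u + lam/2 * rv u u + \<eta>/2 * (rm u u * rv u u - (rx u u)\<^sup>2)"
proof -
  have i0: "integrable lborel (\<lambda>y. (cmod (fn u y))\<^sup>2)" by (rule L2_square_integrable[OF fn_L2])
  have i2: "integrable lborel (\<lambda>y. (cmod (of_real y * fn u y))\<^sup>2)" by (rule L2_square_integrable[OF fn_times_x_L2])
  have e1: "of_real y * fn u y * cnj (fn u y) = of_real (y * (cmod (fn u y))\<^sup>2)" for y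
    by (simp only: mult.assoc complex_norm_square[symmetric] of_real_mult)
  have i1: "integrable lborel (\<lambda>y. y * (cmod (fn u y))\<^sup>2)"
    using L2_mult_cnj_integrable[OF fn_times_x_L2[of u] fn_L2[of u]] unfolding e1 by (simp only: complex_of_real_integrable_eq)
  have m1: "mom1 u = (LINT y|lborel. y * (cmod (fn u y))\<^sup>2)"
    unfolding mom1_def cx_def ip_def e1 by (simp only: integral_complex_of_real Re_complex_of_real)
  have m0: "mass u = (LINT y|lborel. (cmod (fn u y))\<^sup>2)" by (simp add: mass_l2n l2n_sq)
  have m2: "mom2 u = (LINT y|lborel. (cmod (of_real y * fn u y))\<^sup>2)" by (simp add: mom2_def cv_self l2n_sq)
  have "(LINT x|lborel. LINT y|lborel. \<bar>x - y\<bar>\<^sup>2 * (cmod (fn u x))\<^sup>2 * (cmod (fn u y))\<^sup>2) =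
      (LINT x|lborel. (cmod (fn u x))\<^sup>2 * (LINT y|lborel. \<bar>x - y\<bar>\<^sup>2 * (cmod (fn u y))\<^sup>2))"
    by (subst integral_mult_right_zero[symmetric]) (simp add: ac_simps)
  also have "\<dots> = (LINT x|lborel. mass u * (cmod (of_real x * fn u x))\<^sup>2 - 2 * mom1 u * (x * (cmod (fn u x))\<^sup>2) + mom2 u * (cmod (fn u x))\<^sup>2)"
    unfolding hartree
    by (intro Bochner_Integration.integral_cong) (auto simp: norm_mult power_mult_distrib algebra_simps)
  also have "\<dots> = mass u * mom2 u - 2 * mom1 u * mom1 u + mom2 u * mass u"
    using i0 i1 i2 by (simp add: m0[symmetric] m1[symmetric] m2[symmetric])
  finally have "(LINT x|lborel. LINT y|lborel. \<bar>x - y\<bar>\<^sup>2 * (cmod (fn u x))\<^sup>2 * (cmod (fn u y))\<^sup>2) =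
     2 * (mass u * mom2 u - (mom1 u)\<^sup>2)" by (simp add: power2_eq_square)
  moreover have "(LINT x|lborel. (cmod (grad u x))\<^sup>2) = rg u u" by (simp add: rg_def cg_self l2n_sq)
  ultimately show ?thesis unfolding energy_def real_forms_self m2[symmetric] by simp
qed

lemma action_eq:
  "action lam \<eta> \<omega> u = 1/2 * rg u u + lam/2 * rv u u + \<eta>/2 * (rm u u * rv u u - (rx u u)\<^sup>2) - \<omega>/2 * rm u u"
  unfolding action_def energy_eq charge_def real_forms_self(1) mass_l2n l2n_sq by simp

lemma quad_deriv:
  fixes B :: "'a::real_normed_vector \<Rightarrow> 'a \<Rightarrow> real"
  assumes "bounded_bilinear B" "\<And>u v. B u v = B v u"
  shows "((\<lambda>u. B u u) has_derivative (\<lambda>h. 2 * B u h)) (at u)"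
proof -
  have "((\<lambda>u. B u u) has_derivative (\<lambda>h. B u h + B h u)) (at u)"
    by (rule bounded_bilinear.FDERIV[OF assms(1)]) (rule has_derivative_ident)+
  moreover have "(\<lambda>h. B u h + B h u) = (\<lambda>h. 2 * B u h)" using assms(2) by auto
  ultimately show ?thesis by simp
qed

lemmas quad_derivs = quad_deriv[OF bounded_bilinear_real_forms(1) real_forms_commute(1)] quad_deriv[OF bounded_bilinear_real_forms(2) real_forms_commute(2)]
  quad_deriv[OF bounded_bilinear_real_forms(3) real_forms_commute(3)] quad_deriv[OF bounded_bilinear_real_forms(4) real_forms_commute(4)]

definition DA :: "real \<Rightarrow> real \<Rightarrow> real \<Rightarrow> energy_space \<Rightarrow> energy_space \<Rightarrow>\<^sub>L real" where
  "DA lam \<eta> \<omega> u = bl rg u + lam *\<^sub>R bl rv u + \<eta> *\<^sub>R (rv u u *\<^sub>R bl rm u + rm u u *\<^sub>R bl rv u - (2 * rx u u) *\<^sub>R bl rx u) - \<omega> *\<^sub>R bl rm u"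

lemma DA_apply:
  "blinfun_apply (DA lam \<eta> \<omega> u) h = rg u h + lam * rv u h + \<eta> * (rv u u * rm u h + rm u u * rv u h - 2 * rx u u * rx u h) - \<omega> * rm u h"
  unfolding DA_def
  by (simp add: blinfun.add_left blinfun.diff_left blinfun.scaleR_left bl_apply bounded_bilinear_real_forms)

lemma action_has_derivative: "(action lam \<eta> \<omega> has_derivative blinfun_apply (DA lam \<eta> \<omega> u)) (at u)"
proof -
  have "((\<lambda>u. 1/2 * rg u u + lam/2 * rv u u + \<eta>/2 * (rm u u * rv u u - (rx u u)\<^sup>2) - \<omega>/2 * rm u u) has_derivative
     (\<lambda>h. 1/2 * (2 * rg u h) + lam/2 * (2 * rv u h) + \<eta>/2 * ((rm u u * (2 * rv u h) + 2 * rm u h * rv u u) - 2 * (2 * rx u h) * rx u u) - \<omega>/2 * (2 * rm u h))) (at u)"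
    by (auto intro!: derivative_eq_intros quad_derivs simp: fun_eq_iff power2_eq_square)
  moreover have "action lam \<eta> \<omega> = (\<lambda>u. 1/2 * rg u u + lam/2 * rv u u + \<eta>/2 * (rm u u * rv u u - (rx u u)\<^sup>2) - \<omega>/2 * rm u u)"
    by (rule ext) (rule action_eq)
  moreover have "(\<lambda>h. 1/2 * (2 * rg u h) + lam/2 * (2 * rv u h) + \<eta>/2 * ((rm u u * (2 * rv u h) + 2 * rm u h * rv u u) - 2 * (2 * rx u h) * rx u u) - \<omega>/2 * (2 * rm u h)) = blinfun_apply (DA lam \<eta> \<omega> u)"
    by (rule ext) (simp add: DA_apply algebra_simps)
  ultimately show ?thesis by simp
qed

lemma action_deriv_eq: "action_deriv lam \<eta> \<omega> = DA lam \<eta> \<omega>"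
proof
  fix u
  show "action_deriv lam \<eta> \<omega> u = DA lam \<eta> \<omega> u"
    unfolding action_deriv_def frechet_derivative_at[OF action_has_derivative, symmetric] by (rule blinfun_apply_inverse)
qed

lemma action_deriv2_eq:
  "action_deriv2 lam \<eta> \<omega> u v w = rg v w + lam * rv v w + \<eta> * (rv u u * rm v w + 2 * rv u v * rm u w
     + rm u u * rv v w + 2 * rm u v * rv u w - 2 * rx u u * rx v w - 4 * rx u v * rx u w) - \<omega> * rm v w"
proof -
  have lin: "(bl f has_derivative bl f) (at u)" if "bounded_bilinear f" for f :: "energy_space \<Rightarrow> energy_space \<Rightarrow> real"
    by (rule bounded_linear_imp_has_derivative[OF bounded_linear_bl[OF that]])
  have "(DA lam \<eta> \<omega> has_derivative (\<lambda>v. bl rg v + lam *\<^sub>R bl rv v + \<eta> *\<^sub>R ((rv u u *\<^sub>R bl rm v + (2 * rv u v) *\<^sub>R bl rm u)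
      + (rm u u *\<^sub>R bl rv v + (2 * rm u v) *\<^sub>R bl rv u) - ((2 * rx u u) *\<^sub>R bl rx v + (2 * (2 * rx u v)) *\<^sub>R bl rx u)) - \<omega> *\<^sub>R bl rm v)) (at u)"
    unfolding DA_def[abs_def]
    by (intro has_derivative_add has_derivative_diff has_derivative_scaleR_right has_derivative_scaleR
        lin bounded_bilinear_real_forms quad_derivs has_derivative_mult_right)
  from frechet_derivative_at[OF this, symmetric]
  show ?thesis
    unfolding action_deriv2_def action_deriv_eq
    by (simp add: blinfun.add_left blinfun.diff_left blinfun.scaleR_left bl_apply bounded_bilinear_real_forms)
qed

subsection \<open>Hermite functions as elements of the energy space\<close>

definition he :: "real \<Rightarrow> nat \<Rightarrow> energy_space" where
  "he a n = pgs (hn a n) a"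

lemma fn_he: "0 < a \<Longrightarrow> fn (he a n) = HE a n"
  by (simp add: he_def fn_pgs)

lemma cm_he: "0 < a \<Longrightarrow> cm u (he a n) = hcoef a (fn u) n"
  by (simp add: cm_def hcoef_def fn_he)

lemma hstate_he: "0 < a \<Longrightarrow> hstate M a k = sqrt M *\<^sub>R he a k"
  by (rule fn_eqI) (simp add: fn_hstate fn_scaleR fn_he)

lemma cm_he_he: "0 < a \<Longrightarrow> cm (he a i) (he a j) = (if i = j then 1 else 0)"
  by (simp add: cm_def fn_he ip_HE)

text \<open>The special case lam = a^2, \<eta> = 0 of \<open>FB_boost_HE\<close> without boost: the
  eigenvalue equation in weak form, valid against every element of the energy space.\<close>

lemma he_eigen:
  assumes a: "0 < a"
  shows "cg u (he a n) + of_real (a\<^sup>2) * cv u (he a n) = of_real ((2 * real n + 1) * a) * cm u (he a n)"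
proof -
  have b: "boost 0 0 (pgs (hn a n) a) = he a n"
    by (rule fn_eqI) (simp add: fn_boost he_def)
  have e: "EB a 0 0 (hn a n) = HE a n" by (simp add: EB_def[abs_def])
  show ?thesis
    using FB_boost_HE[OF a, of "a\<^sup>2" 0 u 0 0 n] unfolding b e FB_apply
    by (simp add: cm_def fn_he[OF a])
qed

text \<open>The recursion for multiplication by x is used twice, once for each factor x. For n < 2
  the truncated index n - 2 comes with coefficient 0.\<close>

lemma cv_he:
  assumes a: "0 < a"
  shows "of_real (2 * a) * cv u (he a n) = of_real (sqrt (real (n + 1) * real (n + 2))) * hcoef a (fn u) (n + 2)
     + of_real (2 * real n + 1) * hcoef a (fn u) n + of_real (sqrt (real n * real (n - 1))) * hcoef a (fn u) (n - 2)"
proof -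
  let ?c = "hcoef a (fn u)"
  let ?s = "\<lambda>n. complex_of_real (sqrt (2 * a * real n))"
  let ?X = "\<lambda>m. ip (\<lambda>x. of_real x * fn u x) (HE a m)"
  have X: "of_real (2 * a) * ?X m = ?s (Suc m) * ?c (Suc m) + ?s m * ?c (m - 1)" for m
  proof -
    have "?X m = ip (fn u) (\<lambda>x. of_real x * HE a m x)"
      unfolding ip_def by (simp add: ac_simps)
    then show ?thesis using ip_x_HE[OF a fn_L2, of u m] by (simp only: hcoef_def)
  qed
  have "of_real (2 * a) * cv u (he a n) = ?s (Suc n) * ?X (Suc n) + ?s n * ?X (n - 1)"
    using ip_x_HE[OF a fn_times_x_L2, of u n] unfolding cv_def fn_he[OF a] .
  then have "of_real (2 * a) * (of_real (2 * a) * cv u (he a n)) =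
      ?s (Suc n) * (of_real (2 * a) * ?X (Suc n)) + ?s n * (of_real (2 * a) * ?X (n - 1))"
    by (simp add: algebra_simps)
  also have "\<dots> = ?s (Suc n) * (?s (Suc (Suc n)) * ?c (Suc (Suc n)) + ?s (Suc n) * ?c n) + ?s n * (?s (Suc (n - 1)) * ?c (Suc (n - 1)) + ?s (n - 1) * ?c (n - 1 - 1))"
    unfolding X by simp
  also have "\<dots> = of_real (2 * a) * (of_real (sqrt (real (n + 1) * real (n + 2))) * ?c (n + 2)
     + of_real (2 * real n + 1) * ?c n + of_real (sqrt (real n * real (n - 1))) * ?c (n - 2))"
  proof -
    have ss: "?s i * ?s j = of_real (2 * a) * of_real (sqrt (real i * real j))" for i j
    proof -
      have "sqrt (2 * a * real i) * sqrt (2 * a * real j) = sqrt ((2 * a)\<^sup>2 * (real i * real j))"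
        unfolding real_sqrt_mult[symmetric] by (simp add: power2_eq_square ac_simps)
      also have "\<dots> = (2 * a) * sqrt (real i * real j)" using a by (simp only: real_sqrt_mult real_sqrt_abs)
      finally show ?thesis by (simp only: of_real_mult[symmetric])
    qed
    have 1: "?s n * (?s (Suc (n - 1)) * ?c (Suc (n - 1)) + ?s (n - 1) * ?c (n - 1 - 1)) =
       of_real (2 * a) * (of_real (real n) * ?c n + of_real (sqrt (real n * real (n - 1))) * ?c (n - 2))"
    proof (cases n)
      case (Suc m)
      have "?s n * (?s n * ?c n + ?s (n - 1) * ?c (n - 2)) = (?s n * ?s n) * ?c n + (?s n * ?s (n - 1)) * ?c (n - 2)"
        by (simp only: distrib_left mult.assoc)
      also have "\<dots> = of_real (2 * a) * (of_real (real n) * ?c n + of_real (sqrt (real n * real (n - 1))) * ?c (n - 2))"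
        unfolding ss real_sqrt_mult_self by (simp add: algebra_simps)
      finally show ?thesis using Suc by (simp add: numeral_2_eq_2)
    qed simp
    have 2: "?s (Suc n) * (?s (Suc (Suc n)) * ?c (Suc (Suc n)) + ?s (Suc n) * ?c n) =
       of_real (2 * a) * (of_real (sqrt (real (n + 1) * real (n + 2))) * ?c (n + 2) + of_real (real n + 1) * ?c n)"
    proof -
      have "?s (Suc n) * (?s (Suc (Suc n)) * ?c (Suc (Suc n)) + ?s (Suc n) * ?c n) =
        (?s (Suc n) * ?s (Suc (Suc n))) * ?c (Suc (Suc n)) + (?s (Suc n) * ?s (Suc n)) * ?c n"
        by (simp only: distrib_left mult.assoc)
      moreover have "sqrt (real i * real i) = real i" for i by simp
      ultimately show ?thesis unfolding ss by (simp only:) (simp add: algebra_simps)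
    qed
    show ?thesis unfolding 1 2 by (simp add: algebra_simps)
  qed
  finally show ?thesis using a by (subst (asm) mult_left_cancel) auto
qed

lemma mom1_hstate: "0 < a \<Longrightarrow> mom1 (hstate M a k) = 0"
  by (rule ip_lower_eq_0(1)[OF _ ip_lower_hstate])

lemma mom2_hstate:
  assumes a: "0 < a" and M: "0 \<le> M"
  shows "mom2 (hstate M a k) = M * (2 * real k + 1) / (2 * a)"
proof -
  have h: "hcoef a (fn (he a k)) j = (if j = k then 1 else 0)" for j
    using hcoef_hstate[OF a, of 1 k j] hstate_he[OF a, of 1 k] by simp
  \<comment> \<open>By truncation k - 2 = k happens for k = 0, where the coefficient
    vanishes.\<close>
  have "sqrt (real k * real (k - 1)) = 0" if "k - 2 = k" using that by (cases k) auto
  then have "of_real (2 * a) * cv (he a k) (he a k) = of_real (2 * real k + 1)"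
    unfolding cv_he[OF a] h by auto
  then have "2 * a * mom2 (he a k) = 2 * real k + 1"
    unfolding cv_mom2 by (simp only: of_real_mult[symmetric] of_real_eq_iff)
  moreover have "mom2 (hstate M a k) = M * mom2 (he a k)"
    unfolding hstate_he[OF a] real_forms_self(3)[symmetric]
    using M by (simp add: bounded_bilinear.scaleR_left[OF bounded_bilinear_real_forms(4)] bounded_bilinear.scaleR_right[OF bounded_bilinear_real_forms(4)])
  ultimately show ?thesis using a by (simp add: field_simps)
qed

text \<open>The first moment of the state vanishes, so its Hartree potential is M x^2 plus a
  constant. The quadratic part completes lam to a^2, and the constant part is what \<omega> has
  beyond the oscillator eigenvalue.\<close>

lemma hstate_critical:
  assumes a: "0 < a" and M: "0 \<le> M" and eq: "lam + \<eta> * M = a\<^sup>2"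
    and w: "\<omega> = (2 * real k + 1) * a + \<eta> * (M * (2 * real k + 1) / (2 * a))"
  shows "(action lam \<eta> \<omega> has_derivative (\<lambda>_. 0)) (at (hstate M a k))"
proof -
  let ?\<phi> = "hstate M a k"
  have "blinfun_apply (DA lam \<eta> \<omega> ?\<phi>) h = 0" for h
  proof -
    have "rg h (he a k) + a\<^sup>2 * rv h (he a k) = (2 * real k + 1) * a * rm h (he a k)"
      using arg_cong[OF he_eigen[OF a, of h k], of Re] by (simp add: rg_def rv_def rm_def)
    then have "sqrt M * rg (he a k) h + sqrt M * (a\<^sup>2 * rv (he a k) h) = sqrt M * ((2 * real k + 1) * a * rm (he a k) h)"
      by (simp only: real_forms_commute[of h] distrib_left[symmetric])
    then have e: "rg ?\<phi> h + a\<^sup>2 * rv ?\<phi> h = (2 * real k + 1) * a * rm ?\<phi> h"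
      unfolding hstate_he[OF a]
      by (simp add: bounded_bilinear.scaleR_left[OF bounded_bilinear_real_forms(1)] bounded_bilinear.scaleR_left[OF bounded_bilinear_real_forms(2)]
          bounded_bilinear.scaleR_left[OF bounded_bilinear_real_forms(4)] algebra_simps)
    have "blinfun_apply (DA lam \<eta> \<omega> ?\<phi>) h = (rg ?\<phi> h + (lam + \<eta> * M) * rv ?\<phi> h) + (\<eta> * mom2 ?\<phi> - \<omega>) * rm ?\<phi> h"
      unfolding DA_apply real_forms_self mom1_hstate[OF a] mass_hstate[OF a M] by (simp add: algebra_simps)
    also have "\<dots> = 0"
      unfolding eq e mom2_hstate[OF a M] w by (simp add: algebra_simps)
    finally show ?thesis .
  qed
  then have "blinfun_apply (DA lam \<eta> \<omega> ?\<phi>) = (\<lambda>_. 0)" by auto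
  then show ?thesis using action_has_derivative[of lam \<eta> \<omega> ?\<phi>] by simp
qed

section \<open>Parity\<close>

lemma poly_hp_minus: "poly (hp a n) (- x) = (- 1) ^ n * poly (hp a n) x"
proof (induction n rule: less_induct)
  case (less n)
  show ?case
  proof (cases n)
    case (Suc i)
    have s: "poly (hp a (Suc i)) y = 2 * a * y * poly (hp a i) y - 2 * a * real i * poly (hp a (i - 1)) y" for y
    proof (cases i)
      case (Suc j)
      then show ?thesis using hp.simps(2)[of a "Suc j"] pderiv_hp[of a j] by simp
    qed (simp add: hp.simps(2))
    show ?thesis
    proof (cases i)
      case 0
      then show ?thesis using Suc s[of x] s[of "- x"] by simp
    next
      case (Suc j)
      have "poly (hp a i) (- x) = (- 1) ^ i * poly (hp a i) x" "poly (hp a j) (- x) = (- 1) ^ j * poly (hp a j) x"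
        using less.IH \<open>n = Suc i\<close> Suc by auto
      then show ?thesis unfolding \<open>n = Suc i\<close> s using Suc by (simp add: algebra_simps)
    qed
  qed simp
qed

lemma HE_minus: "HE a n (- x) = (- 1) ^ n * HE a n x"
  by (simp add: pg_def hn_def poly_hp_minus)

lemma integral_odd_zero:
  fixes f :: "real \<Rightarrow> complex"
  assumes "\<And>x. f (- x) = - f x"
  shows "(LINT x|lborel. f x) = 0"
proof -
  have "(LINT x|lborel. f x) = (LINT x|lborel. f (- x))"
    by (subst lborel_integral_real_affine[where c = "- 1" and t = 0]) simp_all
  also have "\<dots> = - (LINT x|lborel. f x)" unfolding assms by simp
  finally show ?thesis by simp
qed

lemma hcoef_even_odd:
  assumes "u \<in> even_fns" "odd n"
  shows "hcoef a (fn u) n = 0"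
  unfolding hcoef_def ip_def
  by (rule integral_odd_zero) (use assms in \<open>simp add: even_fns_def HE_minus\<close>)

lemma cx_even:
  assumes "u \<in> even_fns" "v \<in> even_fns"
  shows "cx u v = 0"
  unfolding cx_def ip_def
  by (rule integral_odd_zero) (use assms in \<open>simp add: even_fns_def\<close>)

lemma he_even: "0 < a \<Longrightarrow> even n \<Longrightarrow> he a n \<in> even_fns"
  unfolding even_fns_def by (simp add: fn_he HE_minus)

lemma even_fns_add: "u \<in> even_fns \<Longrightarrow> v \<in> even_fns \<Longrightarrow> u + v \<in> even_fns"
  and even_fns_scaleR: "u \<in> even_fns \<Longrightarrow> r *\<^sub>R u \<in> even_fns"
  and even_fns_phase: "u \<in> even_fns \<Longrightarrow> gauge_translate \<theta> 0 u \<in> even_fns"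
  by (simp_all add: even_fns_def fn_plus fn_scaleR fn_gauge_translate)

lemma hcoef_zero_imp_zero:
  assumes a: "0 < a" and z: "\<And>n. hcoef a (fn u) n = 0"
  shows "u = 0"
proof -
  have "(\<lambda>n. a * (2 * real n + 1) * (cmod (hcoef a (fn u) n))\<^sup>2) sums osc a u"
    using oscillator_energy_sums[OF a, of u] unfolding osc_def .
  then have "osc a u = 0" using sums_unique2[OF _ sums_zero] by (simp add: z)
  then have "(norm u)\<^sup>2 \<le> 0" using norm_le_osc[OF a, of u] by simp
  then show ?thesis by simp
qed

subsection \<open>Counting negative eigenvalues\<close>

lemma independent_of_orthogonal:
  fixes B :: "'a::real_normed_vector \<Rightarrow> 'a \<Rightarrow> real"
  assumes "finite S" "bounded_bilinear B" "\<And>x. x \<in> S \<Longrightarrow> B x x \<noteq> 0"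
    "\<And>x y. x \<in> S \<Longrightarrow> y \<in> S \<Longrightarrow> x \<noteq> y \<Longrightarrow> B x y = 0"
  shows "independent S"
proof (rule independent_if_scalars_zero[OF assms(1)])
  fix f x assume z: "(\<Sum>x\<in>S. f x *\<^sub>R x) = 0" and x: "x \<in> S"
  have "0 = B (\<Sum>y\<in>S. f y *\<^sub>R y) x" unfolding z by (simp add: bounded_bilinear.zero_left[OF assms(2)])
  also have "\<dots> = (\<Sum>y\<in>S. f y * B y x)"
    by (simp add: bounded_bilinear.sum_left[OF assms(2)] bounded_bilinear.scaleR_left[OF assms(2)])
  also have "\<dots> = f x * B x x"
    using assms(1) x assms(4) by (subst sum.remove[of _ x]) (auto intro!: sum.neutral)
  finally show "f x = 0" using assms(3)[OF x] by simp
qed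

text \<open>An indexed family of eigenvectors computes the count. The values \<open>f i\<close> may
  coincide, so orthogonality is asked for only within one eigenvalue, and \<open>sp\<close>
  guarantees that no negative eigenvalue and no multiplicity is missed.\<close>

lemma even_neg_count_basis:
  fixes e :: "'i \<Rightarrow> energy_space" and f :: "'i \<Rightarrow> real"
  assumes J: "finite J" and f: "\<And>i. i \<in> J \<Longrightarrow> f i < 0"
    and e: "\<And>i. i \<in> J \<Longrightarrow> e i \<in> even_eigenspace lam \<eta> \<omega> \<phi> (f i)"
    and nz: "\<And>i. i \<in> J \<Longrightarrow> rm (e i) (e i) \<noteq> 0"
    and orth: "\<And>i j. i \<in> J \<Longrightarrow> j \<in> J \<Longrightarrow> i \<noteq> j \<Longrightarrow> f i = f j \<Longrightarrow> rm (e i) (e j) = 0"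
    and sp: "\<And>\<mu> v. \<mu> < 0 \<Longrightarrow> v \<in> even_eigenspace lam \<eta> \<omega> \<phi> \<mu> \<Longrightarrow> v \<in> span (e ` {i \<in> J. f i = \<mu>})"
  shows "even_neg_count lam \<eta> \<omega> \<phi> (card J)"
proof -
  have inj: "inj_on e {i \<in> J. f i = \<mu>}" for \<mu>
  proof (rule inj_onI, rule ccontr)
    fix i j assume "i \<in> {i \<in> J. f i = \<mu>}" "j \<in> {i \<in> J. f i = \<mu>}" "e i = e j" "i \<noteq> j"
    then show False using orth[of i j] nz[of i] by simp
  qed
  have ind: "independent (e ` {i \<in> J. f i = \<mu>})" for \<mu>
    by (rule independent_of_orthogonal[OF _ bounded_bilinear_real_forms(2)]) (use J nz in auto, metis orth)
  have ev: "even_neg_eigenvalues lam \<eta> \<omega> \<phi> = f ` J"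
  proof (intro equalityI subsetI)
    fix \<mu> assume "\<mu> \<in> even_neg_eigenvalues lam \<eta> \<omega> \<phi>"
    then obtain v where v: "\<mu> < 0" "v \<in> even_eigenspace lam \<eta> \<omega> \<phi> \<mu>" "v \<noteq> 0"
      by (auto simp: even_neg_eigenvalues_def)
    then have "{i \<in> J. f i = \<mu>} \<noteq> {}" using sp[OF v(1,2)] by (metis image_is_empty singletonD span_empty)
    then show "\<mu> \<in> f ` J" by auto
  next
    fix \<mu> assume "\<mu> \<in> f ` J"
    then obtain i where i: "i \<in> J" "\<mu> = f i" by auto
    have "e i \<noteq> 0" using nz[OF i(1)] by (auto simp: bounded_bilinear.zero_left[OF bounded_bilinear_real_forms(2)])
    then show "\<mu> \<in> even_neg_eigenvalues lam \<eta> \<omega> \<phi>"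
      using f[OF i(1)] e[OF i(1)] i(2) by (auto simp: even_neg_eigenvalues_def)
  qed
  have dim: "dim (even_eigenspace lam \<eta> \<omega> \<phi> \<mu>) = card {i \<in> J. f i = \<mu>}" if "\<mu> \<in> f ` J" for \<mu>
  proof (rule dim_unique)
    have "\<mu> < 0" using that f by auto
    then show "even_eigenspace lam \<eta> \<omega> \<phi> \<mu> \<subseteq> span (e ` {i \<in> J. f i = \<mu>})" using sp by auto
    show "e ` {i \<in> J. f i = \<mu>} \<subseteq> even_eigenspace lam \<eta> \<omega> \<phi> \<mu>" using e by auto
    show "card (e ` {i \<in> J. f i = \<mu>}) = card {i \<in> J. f i = \<mu>}"
      by (rule card_image[OF inj])
  qed (rule ind)
  have "(\<Sum>\<mu>\<in>f ` J. dim (even_eigenspace lam \<eta> \<omega> \<phi> \<mu>)) = (\<Sum>\<mu>\<in>f ` J. \<Sum>i\<in>{i \<in> J. f i = \<mu>}. 1)"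
    using dim by simp
  also have "\<dots> = card J" using sum.image_gen[OF J, of "\<lambda>_. 1::nat" f] by simp
  finally have "(\<Sum>\<mu>\<in>f ` J. dim (even_eigenspace lam \<eta> \<omega> \<phi> \<mu>)) = card J" .
  moreover have "\<exists>B. finite B \<and> even_eigenspace lam \<eta> \<omega> \<phi> \<mu> \<subseteq> span B" if "\<mu> \<in> f ` J" for \<mu>
    by (rule exI[of _ "e ` {i \<in> J. f i = \<mu>}"]) (use J sp f that in auto)
  ultimately show ?thesis unfolding even_neg_count_def ev using J by blast
qed

text \<open>Multiplication by i written as a phase. Multiplicities are real dimensions, so
  \<open>he\<close> and \<open>ie\<close> together play the role of the Hermite basis.\<close>

abbreviation ie :: "real \<Rightarrow> nat \<Rightarrow> energy_space" where
  "ie a n \<equiv> gauge_translate (pi / 2) 0 (he a n)"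

lemma phase_forms:
  "cm u (gauge_translate \<theta> 0 w) = cis (- \<theta>) * cm u w"
  "cg u (gauge_translate \<theta> 0 w) = cis (- \<theta>) * cg u w"
  "cv u (gauge_translate \<theta> 0 w) = cis (- \<theta>) * cv u w"
proof -
  show "cm u (gauge_translate \<theta> 0 w) = cis (- \<theta>) * cm u w"
    unfolding cm_def fn_phase ip_cmult_right by (simp add: cis_cnj)
  show "cv u (gauge_translate \<theta> 0 w) = cis (- \<theta>) * cv u w"
    unfolding cv_def fn_phase mult.left_commute[of "of_real _" "cis \<theta>"] ip_cmult_right by (simp add: cis_cnj)
  have "AE x in lborel. grad (gauge_translate \<theta> 0 w) x = cis \<theta> * grad w x"
    by (rule grad_AE_eq) (auto simp: fn_phase intro: L2_cmult grad weak_deriv_cmult)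
  then have "cg u (gauge_translate \<theta> 0 w) = ip (grad u) (\<lambda>x. cis \<theta> * grad w x)"
    unfolding cg_def by (intro ip_cong_AE) (auto intro: grad L2_cmult)
  then show "cg u (gauge_translate \<theta> 0 w) = cis (- \<theta>) * cg u w"
    unfolding ip_cmult_right cg_def by (simp add: cis_cnj)
qed

lemma cis_minus_half_pi: "cis (- (pi / 2)) = - \<i>"
  by (simp add: complex_eq_iff)

definition rr :: "real \<Rightarrow> energy_space \<Rightarrow> nat \<Rightarrow> real" where "rr a u j = rm u (he a j)"
definition ri :: "real \<Rightarrow> energy_space \<Rightarrow> nat \<Rightarrow> real" where "ri a u j = rm u (ie a j)"

lemma rr_ri_hcoef:
  assumes "0 < a"
  shows "rr a u j = Re (hcoef a (fn u) j)" "ri a u j = Im (hcoef a (fn u) j)"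
  unfolding rr_def ri_def rm_def phase_forms cm_he[OF assms] cis_minus_half_pi by simp_all

lemma rr_ri_linear:
  "rr a (u + v) j = rr a u j + rr a v j" "ri a (u + v) j = ri a u j + ri a v j"
  "rr a (u - v) j = rr a u j - rr a v j" "ri a (u - v) j = ri a u j - ri a v j"
  "rr a (c *\<^sub>R u) j = c * rr a u j" "ri a (c *\<^sub>R u) j = c * ri a u j"
  "rr a (\<Sum>i\<in>A. g i) j = (\<Sum>i\<in>A. rr a (g i) j)" "ri a (\<Sum>i\<in>A. g i) j = (\<Sum>i\<in>A. ri a (g i) j)"
  "rr a 0 j = 0" "ri a 0 j = 0"
  unfolding rr_def ri_def
  by (simp_all add: bounded_bilinear.add_left[OF bounded_bilinear_real_forms(2)] bounded_bilinear.diff_left[OF bounded_bilinear_real_forms(2)]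
      bounded_bilinear.scaleR_left[OF bounded_bilinear_real_forms(2)] bounded_bilinear.sum_left[OF bounded_bilinear_real_forms(2)]
      bounded_bilinear.zero_left[OF bounded_bilinear_real_forms(2)])

lemma rr_ri_basis:
  assumes a: "0 < a"
  shows "rr a (he a i) j = (if i = j then 1 else 0)" "ri a (he a i) j = 0"
    "rr a (ie a i) j = 0" "ri a (ie a i) j = (if i = j then 1 else 0)"
proof -
  show h: "rr a (he a i) j = (if i = j then 1 else 0)" "ri a (he a i) j = 0"
    unfolding rr_ri_hcoef[OF a] cm_he[OF a, symmetric] cm_he_he[OF a] by simp_all
  have "hcoef a (fn (ie a i)) j = cis (pi / 2) * (if i = j then 1 else 0)"
    unfolding hcoef_def fn_phase ip_cmult_left fn_he[OF a] ip_HE[OF a] ..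
  then have "hcoef a (fn (ie a i)) j = \<i> * (if i = j then 1 else 0)"
    by (simp add: complex_eq_iff)
  then show "rr a (ie a i) j = 0" "ri a (ie a i) j = (if i = j then 1 else 0)"
    unfolding rr_ri_hcoef[OF a] by simp_all
qed

lemma rr_ri_eqI:
  assumes a: "0 < a" and "\<And>j. rr a u j = rr a v j" "\<And>j. ri a u j = ri a v j"
  shows "u = v"
proof -
  have "u - v = 0"
    by (rule hcoef_zero_imp_zero[OF a], rule complex_eqI)
       (use assms rr_ri_hcoef[OF a, of "u - v"] in \<open>simp_all add: rr_ri_linear\<close>)
  then show ?thesis by simp
qed

lemma oscillator_he:
  assumes a: "0 < a"
  shows "rg v (he a j) + a\<^sup>2 * rv v (he a j) = (2 * real j + 1) * a * rr a v j"
    "rg v (ie a j) + a\<^sup>2 * rv v (ie a j) = (2 * real j + 1) * a * ri a v j"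
proof -
  note e = he_eigen[OF a, of v j]
  show "rg v (he a j) + a\<^sup>2 * rv v (he a j) = (2 * real j + 1) * a * rr a v j"
    using arg_cong[OF e, of Re] by (simp add: rg_def rv_def rr_def rm_def)
  have "cg v (ie a j) + of_real (a\<^sup>2) * cv v (ie a j) = of_real ((2 * real j + 1) * a) * cm v (ie a j)"
    unfolding phase_forms using arg_cong[OF e, of "\<lambda>z. cis (- (pi / 2)) * z"] by (simp add: algebra_simps)
  from arg_cong[OF this, of Re]
  show "rg v (ie a j) + a\<^sup>2 * rv v (ie a j) = (2 * real j + 1) * a * ri a v j"
    by (simp add: rg_def rv_def ri_def rm_def)
qed

text \<open>In the Hermite basis the second derivative of the action at the \<open>k\<close>-th state is diagonal, up to
  a rank two perturbation \<open>q (L \<otimes> e\<^sub>k + e\<^sub>k \<otimes> L)\<close> of the real part, where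
  \<open>L v = Re \<integral> x\<^sup>2 e\<^sub>k v\<close> only sees the coefficients \<open>k - 2\<close>, \<open>k\<close> and \<open>k + 2\<close>.\<close>

definition hal :: "real \<Rightarrow> nat \<Rightarrow> real" where "hal a k = sqrt (real k * real (k - 1)) / (2 * a)"
definition hbe :: "real \<Rightarrow> nat \<Rightarrow> real" where "hbe a k = (2 * real k + 1) / (2 * a)"
definition hga :: "real \<Rightarrow> nat \<Rightarrow> real" where "hga a k = sqrt (real (k + 1) * real (k + 2)) / (2 * a)"

definition LL :: "real \<Rightarrow> nat \<Rightarrow> energy_space \<Rightarrow> real" where
  "LL a k v = hal a k * rr a v (k - 2) + hbe a k * rr a v k + hga a k * rr a v (k + 2)"

lemma rv_he: "0 < a \<Longrightarrow> rv (he a k) w = LL a k w"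
proof -
  assume a: "0 < a"
  have "2 * a * rv w (he a k) = 2 * a * LL a k w"
    using arg_cong[OF cv_he[OF a, of w k], of Re] a
    by (simp add: LL_def hal_def hbe_def hga_def rv_def rr_ri_hcoef[OF a] field_simps)
  then show ?thesis using a real_forms_commute(4)[of w] by simp
qed

text \<open>Evenness of \<phi> and v removes every term with a first moment. Subtracting \<omega>
  leaves the oscillator minus its k-th eigenvalue, and the rank two term comes from differentiating
  the product of mass and second moment.\<close>

lemma hessian_formula:
  assumes a: "0 < a" and M: "0 \<le> M" and eq: "lam + \<eta> * M = a\<^sup>2"
    and w: "\<omega> = (2 * real k + 1) * a + \<eta> * (M * (2 * real k + 1) / (2 * a))"
    and k: "even k" and v: "v \<in> even_fns"
  shows "action_deriv2 lam \<eta> \<omega> (hstate M a k) v w' =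
     rg v w' + a\<^sup>2 * rv v w' - (2 * real k + 1) * a * rm v w' + 2 * \<eta> * M * (LL a k v * rr a w' k + rr a v k * LL a k w')"
proof -
  let ?\<phi> = "hstate M a k"
  have "?\<phi> \<in> even_fns" unfolding hstate_he[OF a] by (intro even_fns_scaleR he_even a k)
  then have x: "rx ?\<phi> v = 0" using cx_even[OF _ v] by (simp add: rx_def)
  have V: "rv ?\<phi> u = sqrt M * LL a k u" for u
    unfolding hstate_he[OF a] by (simp add: bounded_bilinear.scaleR_left[OF bounded_bilinear_real_forms(4)] rv_he[OF a])
  have m: "rm ?\<phi> u = sqrt M * rr a u k" for u
    unfolding hstate_he[OF a] rr_def real_forms_commute(2)[of u] by (simp add: bounded_bilinear.scaleR_left[OF bounded_bilinear_real_forms(2)])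
  have ss: "sqrt M * x * (sqrt M * y) = M * (x * y)" for x y
  proof -
    have "sqrt M * x * (sqrt M * y) = (sqrt M * sqrt M) * (x * y)" by (simp only: ac_simps)
    then show ?thesis using M by simp
  qed
  have "action_deriv2 lam \<eta> \<omega> ?\<phi> v w' = rg v w' + (lam + \<eta> * M) * rv v w' + (\<eta> * mom2 ?\<phi> - \<omega>) * rm v w'
     + \<eta> * (2 * (rv ?\<phi> v * rm ?\<phi> w') + 2 * (rm ?\<phi> v * rv ?\<phi> w'))"
    unfolding action_deriv2_eq real_forms_self mom1_hstate[OF a] mass_hstate[OF a M] x by (simp add: algebra_simps)
  also have "\<eta> * mom2 ?\<phi> - \<omega> = - ((2 * real k + 1) * a)"
    unfolding mom2_hstate[OF a M] w by simp
  finally show ?thesis unfolding V m ss eq by (simp add: algebra_simps)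
qed

text \<open>The determinant of B - \<mu>, where B is the symmetric tridiagonal block on k - 2, k, k
  + 2 with diagonal - 4 a, 2 q \<open>hbe a k\<close>, 4 a and off-diagonal entries q
  \<open>hal a k\<close>, q \<open>hga a k\<close>.\<close>

definition secular :: "real \<Rightarrow> nat \<Rightarrow> real \<Rightarrow> real \<Rightarrow> real" where
  "secular a k q \<mu> = (2 * q * hbe a k - \<mu>) * ((\<mu> + 4 * a) * (\<mu> - 4 * a))
     + (q * hal a k)\<^sup>2 * (\<mu> - 4 * a) + (q * hga a k)\<^sup>2 * (\<mu> + 4 * a)"

text \<open>The eigenvector of the block with k-th coefficient 1: the outer two rows determine the
  other coefficients, and the middle row is then the equation
  \<open>secular a k q \<mu> = 0\<close>.\<close>

definition zvec :: "real \<Rightarrow> nat \<Rightarrow> real \<Rightarrow> real \<Rightarrow> energy_space" where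
  "zvec a k q \<mu> = (q * hal a k / (\<mu> + 4 * a)) *\<^sub>R he a (k - 2) + he a k + (q * hga a k / (\<mu> - 4 * a)) *\<^sub>R he a (k + 2)"

lemma rr_ri_zvec:
  assumes "0 < a" "2 \<le> k"
  shows "rr a (zvec a k q \<mu>) j = (if j = k - 2 then q * hal a k / (\<mu> + 4 * a) else if j = k then 1
      else if j = k + 2 then q * hga a k / (\<mu> - 4 * a) else 0)"
    "ri a (zvec a k q \<mu>) j = 0"
  using assms by (auto simp: zvec_def rr_ri_linear rr_ri_basis)

lemma secular_root:
  assumes "secular a k q \<mu> = 0" "\<mu> \<noteq> - 4 * a" "\<mu> \<noteq> 4 * a"
  shows "2 * q * hbe a k + q * hal a k * (q * hal a k / (\<mu> + 4 * a)) + q * hga a k * (q * hga a k / (\<mu> - 4 * a)) = \<mu>"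
proof -
  have nz: "\<mu> + 4 * a \<noteq> 0" "\<mu> - 4 * a \<noteq> 0" using assms by auto
  let ?l = "2 * q * hbe a k + q * hal a k * (q * hal a k / (\<mu> + 4 * a)) + q * hga a k * (q * hga a k / (\<mu> - 4 * a)) - \<mu>"
  have "(T + A * (A / P) + G * (G / N) - \<mu>) * (P * N) = (T - \<mu>) * (P * N) + A\<^sup>2 * N + G\<^sup>2 * P"
    if "P \<noteq> 0" "N \<noteq> 0" for T A G P N :: real
    using that by (simp add: field_simps power2_eq_square)
  from this[OF nz] have "?l * ((\<mu> + 4 * a) * (\<mu> - 4 * a)) = secular a k q \<mu>"
    unfolding secular_def .
  then show ?thesis using assms(1) nz by simp
qed

text \<open>Each root in \<open>R\<close> counts once: the coupling \<open>A\<close> between k - 2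
  and k is nonzero, so a block eigenvector for a negative eigenvalue with vanishing k-th coefficient
  is 0. Multiplicities above one can therefore only come from coincidences between the three
  families of modes.\<close>

lemma even_neg_count_hstate:
  assumes a: "0 < a" and M: "0 < M" and eq: "lam + \<eta> * M = a\<^sup>2" and \<eta>: "\<eta> \<noteq> 0" and m: "1 \<le> m"
    and k: "k = 2 * m"
    and w: "\<omega> = (2 * real k + 1) * a + \<eta> * (M * (2 * real k + 1) / (2 * a))"
    and R: "R = {\<mu>. \<mu> < 0 \<and> secular a k (2 * \<eta> * M) \<mu> = 0}" "finite R"
  shows "even_neg_count lam \<eta> \<omega> (hstate M a k) (2 * m - 1 + card R)"
proof -
  let ?q = "2 * \<eta> * M"
  let ?\<phi> = "hstate M a k"
  define A where "A = ?q * hal a k"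
  define G where "G = ?q * hga a k"
  define T where "T = 2 * ?q * hbe a k"
  have k2: "2 \<le> k" "even k" "k - 2 = 2 * (m - 1)" using m k by auto
  have kne: "k \<noteq> k - 2" "k - 2 \<noteq> k" "k + 2 \<noteq> k - 2" "k - 2 \<noteq> k + 2" "Suc (Suc k) \<noteq> k - 2" "k - 2 \<noteq> Suc (Suc k)"
    using k2(1) by linarith+
  have A0: "A \<noteq> 0" using a M \<eta> k2 by (simp add: A_def hal_def)
  have G0: "G \<noteq> 0" using a M \<eta> by (simp add: G_def hga_def)
  \<comment> \<open>The denominators in \<open>zvec\<close>: 4 a is not negative, and at - 4 a only
    the term with \<open>A\<close> survives in \<open>secular\<close>, so neither value lies in
    \<open>R\<close>.\<close>
  have R4: "\<mu> \<noteq> - 4 * a" "\<mu> \<noteq> 4 * a" if "\<mu> \<in> R" for \<mu>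
  proof -
    show "\<mu> \<noteq> 4 * a" using that a R by auto
    show "\<mu> \<noteq> - 4 * a"
    proof
      assume "\<mu> = - 4 * a"
      then have "secular a k ?q \<mu> = A\<^sup>2 * (- 8 * a)" by (simp add: secular_def A_def)
      then show False using that A0 a R by simp
    qed
  qed
  note hess = hessian_formula[OF a less_imp_le[OF M] eq w k2(2)]
  have graph: "v \<in> even_eigenspace lam \<eta> \<omega> ?\<phi> \<mu> \<longleftrightarrow> v \<in> even_fns \<and> (\<forall>w'. action_deriv2 lam \<eta> \<omega> ?\<phi> v w' = \<mu> * rm v w')" for v \<mu>
    unfolding even_eigenspace_def hessian_graph_def l2_inner_scale
    by (auto simp: l2_inner_ip rm_def cm_def intro: L2_cmult fn_L2)
  \<comment> \<open>Imaginary modes, uncoupled real modes, roots of the block. The disjoint sum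
    keeps apart modes with the same eigenvalue; the mode 2 i has 2 a (2 i - k) = 4 a (i - m), both
    as an imaginary and as an uncoupled real one.\<close>
  define J where "J = ({..<m} <+> ({..<m - 1} <+> R))"
  define e where "e = (\<lambda>i. case i of Inl i \<Rightarrow> ie a (2 * i) | Inr (Inl i) \<Rightarrow> he a (2 * i) | Inr (Inr \<mu>) \<Rightarrow> zvec a k ?q \<mu>)"
  define f where "f = (\<lambda>i. case i of Inl i \<Rightarrow> 4 * a * (real i - real m) | Inr (Inl i) \<Rightarrow> 4 * a * (real i - real m) | Inr (Inr \<mu>) \<Rightarrow> \<mu>)"
  have e_simps: "e (Inl i) = ie a (2 * i)" "e (Inr (Inl i)) = he a (2 * i)" "e (Inr (Inr \<mu>)) = zvec a k ?q \<mu>" for i \<mu>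
    by (simp_all add: e_def)
  have f_simps: "f (Inl i) = 4 * a * (real i - real m)" "f (Inr (Inl i)) = 4 * a * (real i - real m)" "f (Inr (Inr \<mu>)) = \<mu>" for i \<mu>
    by (simp_all add: f_def)
  have J_cases: "P i" if "i \<in> J" "\<And>j. j < m \<Longrightarrow> P (Inl j)" "\<And>j. j < m - 1 \<Longrightarrow> P (Inr (Inl j))" "\<And>\<mu>. \<mu> \<in> R \<Longrightarrow> P (Inr (Inr \<mu>))" for P i
    using that unfolding J_def by auto
  have bas_rm: "rm (he a i) w' = rr a w' i" "rm (ie a i) w' = ri a w' i" for i w'
    unfolding rr_def ri_def by (rule real_forms_commute(2))+
  have bas_osc: "rg (he a j) w' + a\<^sup>2 * rv (he a j) w' = (2 * real j + 1) * a * rr a w' j"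
     "rg (ie a j) w' + a\<^sup>2 * rv (ie a j) w' = (2 * real j + 1) * a * ri a w' j" for j w'
    using oscillator_he[OF a, of w' j] by (simp_all add: real_forms_commute[of w'])
  have "even_neg_count lam \<eta> \<omega> ?\<phi> (card J)"
  proof (rule even_neg_count_basis[where e = e and f = f])
    show "finite J" unfolding J_def using R(2) by simp
    show "f i < 0" if "i \<in> J" for i
      using that by (rule J_cases) (use a R in \<open>auto simp: f_simps mult_pos_neg\<close>)
    show "e i \<in> even_eigenspace lam \<eta> \<omega> ?\<phi> (f i)" if "i \<in> J" for i
      using that
    proof (rule J_cases)
      fix j assume "j < m"
      have ev: "ie a (2 * j) \<in> even_fns" by (intro even_fns_phase he_even a) simp
      show "e (Inl j) \<in> even_eigenspace lam \<eta> \<omega> ?\<phi> (f (Inl j))"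
        unfolding e_simps f_simps graph
      proof (intro conjI allI ev)
        fix w'
        show "action_deriv2 lam \<eta> \<omega> ?\<phi> (ie a (2 * j)) w' = 4 * a * (real j - real m) * rm (ie a (2 * j)) w'"
          unfolding hess[OF ev] bas_osc bas_rm LL_def rr_ri_basis[OF a] using k by (simp add: algebra_simps)
      qed
    next
      fix j assume j: "j < m - 1"
      have ev: "he a (2 * j) \<in> even_fns" by (intro he_even a) simp
      show "e (Inr (Inl j)) \<in> even_eigenspace lam \<eta> \<omega> ?\<phi> (f (Inr (Inl j)))"
        unfolding e_simps f_simps graph
      proof (intro conjI allI ev)
        fix w'
        have L: "LL a k (he a (2 * j)) = 0" "rr a (he a (2 * j)) k = 0"
          unfolding LL_def rr_ri_basis[OF a] k2(3) using k j by auto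
        show "action_deriv2 lam \<eta> \<omega> ?\<phi> (he a (2 * j)) w' = 4 * a * (real j - real m) * rm (he a (2 * j)) w'"
          unfolding hess[OF ev] bas_osc bas_rm L using k by (simp add: algebra_simps)
      qed
    next
      fix \<mu> assume \<mu>: "\<mu> \<in> R"
      let ?z = "zvec a k ?q \<mu>"
      have ev: "?z \<in> even_fns"
        unfolding zvec_def using k2 by (intro even_fns_add even_fns_scaleR he_even a) auto
      define y1 where "y1 = A / (\<mu> + 4 * a)"
      define y3 where "y3 = G / (\<mu> - 4 * a)"
      have y1: "A - 4 * a * y1 = \<mu> * y1" unfolding y1_def using R4[OF \<mu>] by (simp add: field_simps)
      have y3: "G + 4 * a * y3 = \<mu> * y3" unfolding y3_def using R4[OF \<mu>] by (simp add: field_simps)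
      have sec: "T + A * y1 + G * y3 = \<mu>"
        using secular_root[of a k ?q \<mu>] \<mu> R4[OF \<mu>] R by (simp add: A_def G_def T_def y1_def y3_def)
      have z: "?z = y1 *\<^sub>R he a (k - 2) + he a k + y3 *\<^sub>R he a (k + 2)"
        by (simp add: zvec_def y1_def y3_def A_def G_def)
      have Lz: "?q * LL a k ?z = A * y1 + T / 2 + G * y3"
      proof -
        have "k \<noteq> k - 2" "k + 2 \<noteq> k - 2" using k2(1) by linarith+
        then show ?thesis
          unfolding LL_def rr_ri_zvec[OF a k2(1)] by (simp add: A_def G_def T_def y1_def y3_def algebra_simps)
      qed
      have rz: "rr a ?z k = 1"
      proof -
        have "k \<noteq> k - 2" using k2(1) by linarith
        then show ?thesis by (simp add: rr_ri_zvec[OF a k2(1)])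
      qed
      show "e (Inr (Inr \<mu>)) \<in> even_eigenspace lam \<eta> \<omega> ?\<phi> (f (Inr (Inr \<mu>)))"
        unfolding e_simps f_simps graph
      proof (intro conjI allI ev)
        fix w'
        let ?r = "rr a w'"
        have mz: "rm ?z w' = y1 * ?r (k - 2) + ?r k + y3 * ?r (k + 2)"
          unfolding z by (simp add: bounded_bilinear.add_left[OF bounded_bilinear_real_forms(2)] bounded_bilinear.scaleR_left[OF bounded_bilinear_real_forms(2)] bas_rm)
        have "rg ?z w' + a\<^sup>2 * rv ?z w' = y1 * (rg (he a (k - 2)) w' + a\<^sup>2 * rv (he a (k - 2)) w')
            + (rg (he a k) w' + a\<^sup>2 * rv (he a k) w') + y3 * (rg (he a (k + 2)) w' + a\<^sup>2 * rv (he a (k + 2)) w')"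
          unfolding z by (simp add: bounded_bilinear.add_left[OF bounded_bilinear_real_forms(1)] bounded_bilinear.scaleR_left[OF bounded_bilinear_real_forms(1)]
            bounded_bilinear.add_left[OF bounded_bilinear_real_forms(4)] bounded_bilinear.scaleR_left[OF bounded_bilinear_real_forms(4)] algebra_simps)
        also have "\<dots> = (2 * real k + 1) * a * rm ?z w' - 4 * a * y1 * ?r (k - 2) + 4 * a * y3 * ?r (k + 2)"
          unfolding bas_osc mz using k2(1) by (simp add: of_nat_diff algebra_simps)
        finally have o: "rg ?z w' + a\<^sup>2 * rv ?z w' = (2 * real k + 1) * a * rm ?z w' - 4 * a * y1 * ?r (k - 2) + 4 * a * y3 * ?r (k + 2)" .
        have Lw: "?q * LL a k w' = A * ?r (k - 2) + T / 2 * ?r k + G * ?r (k + 2)"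
          by (simp add: LL_def A_def G_def T_def algebra_simps)
        have "action_deriv2 lam \<eta> \<omega> ?\<phi> ?z w' = (rg ?z w' + a\<^sup>2 * rv ?z w') - (2 * real k + 1) * a * rm ?z w'
            + ((?q * LL a k ?z) * ?r k + (?q * LL a k w'))"
          unfolding hess[OF ev] rz by (simp add: algebra_simps)
        also have "\<dots> = (A - 4 * a * y1) * ?r (k - 2) + (T + A * y1 + G * y3) * ?r k + (G + 4 * a * y3) * ?r (k + 2)"
          unfolding o Lz Lw by (simp add: algebra_simps)
        also have "\<dots> = \<mu> * rm ?z w'" unfolding y1 y3 sec mz by (simp add: algebra_simps)
        finally show "action_deriv2 lam \<eta> \<omega> ?\<phi> ?z w' = \<mu> * rm ?z w'" .
      qed
    qed
    have zz: "rm (zvec a k ?q \<mu>) u = (?q * hal a k / (\<mu> + 4 * a)) * rr a u (k - 2) + rr a u k + (?q * hga a k / (\<mu> - 4 * a)) * rr a u (k + 2)" for \<mu> u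
      by (simp add: zvec_def bounded_bilinear.add_left[OF bounded_bilinear_real_forms(2)] bounded_bilinear.scaleR_left[OF bounded_bilinear_real_forms(2)] bas_rm)
    show "rm (e i) (e i) \<noteq> 0" if "i \<in> J" for i
      using that
    proof (rule J_cases)
      fix \<mu>
      have "rm (zvec a k ?q \<mu>) (zvec a k ?q \<mu>) = (?q * hal a k / (\<mu> + 4 * a))\<^sup>2 + 1 + (?q * hga a k / (\<mu> - 4 * a))\<^sup>2"
        unfolding zz rr_ri_zvec[OF a k2(1)] using kne by (simp add: power2_eq_square)
      also have "\<dots> > 0" by (intro add_pos_nonneg add_nonneg_pos) auto
      finally show "rm (e (Inr (Inr \<mu>))) (e (Inr (Inr \<mu>))) \<noteq> 0" by (simp add: e_simps)
    qed (simp_all add: e_simps bas_rm rr_ri_basis[OF a])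
    have z_other: "rm (zvec a k ?q \<mu>) (ie a i) = 0" "j < m - 1 \<Longrightarrow> rm (zvec a k ?q \<mu>) (he a (2 * j)) = 0" for \<mu> i j
      unfolding zz rr_ri_basis[OF a] using k k2(3) by auto
    show "rm (e i) (e j) = 0" if ij: "i \<in> J" "j \<in> J" "i \<noteq> j" "f i = f j" for i j
    proof -
      have h: "rm (he a p) (he a r) = (if p = r then 1 else 0)" "rm (ie a p) (he a r) = 0"
        "rm (he a p) (ie a r) = 0" "rm (ie a p) (ie a r) = (if p = r then 1 else 0)" for p r
        unfolding bas_rm rr_ri_basis[OF a] by auto
      have s: "rm (ie a p) (zvec a k ?q \<mu>) = 0" "p < m - 1 \<Longrightarrow> rm (he a (2 * p)) (zvec a k ?q \<mu>) = 0" for p \<mu>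
        using z_other real_forms_commute(2) by metis+
      have c: "(\<exists>p<m. i = Inl p) \<or> (\<exists>p<m - 1. i = Inr (Inl p)) \<or> (\<exists>\<nu>\<in>R. i = Inr (Inr \<nu>))" if "i \<in> J" for i
        using that unfolding J_def by auto
      have nzz: "i = Inr (Inr \<mu>) \<Longrightarrow> j \<noteq> Inr (Inr \<nu>)" for \<mu> \<nu>
        using ij(3,4) by (auto simp: f_simps)
      show ?thesis using c[OF ij(1)] c[OF ij(2)] ij(3)
        by (elim disjE exE bexE conjE) (use nzz in \<open>simp_all add: e_simps h s z_other\<close>)
    qed
    show "v \<in> span (e ` {i \<in> J. f i = \<mu>})" if \<mu>: "\<mu> < 0" and v: "v \<in> even_eigenspace lam \<eta> \<omega> ?\<phi> \<mu>" for \<mu> v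
    proof -
      have ev: "v \<in> even_fns" and E: "\<And>w'. action_deriv2 lam \<eta> \<omega> ?\<phi> v w' = \<mu> * rm v w'"
        using v unfolding graph by auto
      have im: "4 * a * (real n - real m) * ri a v (2 * n) = \<mu> * ri a v (2 * n)" for n
        using E[of "ie a (2 * n)"] unfolding hess[OF ev] oscillator_he[OF a] LL_def rr_ri_basis[OF a] ri_def[symmetric]
        using k by (simp add: algebra_simps)
      have re: "4 * a * (real n - real m) * rr a v (2 * n) + ?q * (LL a k v * (if 2 * n = k then 1 else 0) + rr a v k * LL a k (he a (2 * n))) = \<mu> * rr a v (2 * n)" for n
        using E[of "he a (2 * n)"] unfolding hess[OF ev] oscillator_he[OF a] rr_def[symmetric] rr_ri_basis[OF a]
        using k by (simp add: algebra_simps)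
      have odd0: "rr a v j = 0" "ri a v j = 0" if "odd j" for j
        unfolding rr_ri_hcoef[OF a] hcoef_even_odd[OF ev that] by simp_all
      let ?x = "rr a v"
      \<comment> \<open>The three rows of the block, read off by testing with the basis vectors k -
        2, k and k + 2.\<close>
      have r1: "- 4 * a * ?x (k - 2) + A * ?x k = \<mu> * ?x (k - 2)"
        using re[of "m - 1"] m unfolding LL_def rr_ri_basis[OF a] k2(3)[symmetric] using k2(1) kne by (simp add: A_def of_nat_diff algebra_simps)
      have r2: "T * ?x k + A * ?x (k - 2) + G * ?x (k + 2) = \<mu> * ?x k"
        using re[of m] unfolding LL_def rr_ri_basis[OF a] k[symmetric] using kne by (simp add: A_def G_def T_def algebra_simps)
      have r3: "4 * a * ?x (k + 2) + G * ?x k = \<mu> * ?x (k + 2)"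
      proof -
        have "2 * (m + 1) = k + 2" using k by simp
        then show ?thesis
          using re[of "m + 1"] kne unfolding LL_def rr_ri_basis[OF a] by (simp add: G_def algebra_simps)
      qed
      \<comment> \<open>On the block v is a multiple of \<open>zvec\<close> if \<mu> is a root and 0
        otherwise; all three coefficients are put in the conditional form that \<open>v'\<close> has
        below.\<close>
      have blk: "?x (k - 2) = (if \<mu> \<in> R then ?x k * (A / (\<mu> + 4 * a)) else 0) \<and> ?x k = (if \<mu> \<in> R then ?x k else 0)
           \<and> ?x (k + 2) = (if \<mu> \<in> R then ?x k * (G / (\<mu> - 4 * a)) else 0)"
      proof (cases "?x k = 0")
        case True
        have "(4 * a - \<mu>) * ?x (k + 2) = 0" using r3 True by (simp add: algebra_simps)
        then have "?x (k + 2) = 0" using \<mu> a by simp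
        moreover from this have "?x (k - 2) = 0" using r2 True A0 by simp
        ultimately show ?thesis using True by simp
      next
        case False
        have p: "A * ?x k = (\<mu> + 4 * a) * ?x (k - 2)" using r1 by (simp add: algebra_simps)
        then have n1: "\<mu> + 4 * a \<noteq> 0" using False A0 by auto
        have p': "G * ?x k = (\<mu> - 4 * a) * ?x (k + 2)" using r3 by (simp add: algebra_simps)
        have n3: "\<mu> - 4 * a \<noteq> 0" using \<mu> a by simp
        have x1: "?x (k - 2) = ?x k * (A / (\<mu> + 4 * a))" using p n1 by (simp add: field_simps)
        have x3: "?x (k + 2) = ?x k * (G / (\<mu> - 4 * a))" using p' n3 by (simp add: field_simps)
        have "?x k * secular a k ?q \<mu> = (T * ?x k + A * ?x (k - 2) + G * ?x (k + 2) - \<mu> * ?x k) * ((\<mu> + 4 * a) * (\<mu> - 4 * a))"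
        proof -
          have "x * ((T - \<mu>) * (P * N) + A\<^sup>2 * N + G\<^sup>2 * P) = (T * x + A * (x * (A / P)) + G * (x * (G / N)) - \<mu> * x) * (P * N)"
            if "P \<noteq> 0" "N \<noteq> 0" for x T A G P N :: real
            using that by (simp add: field_simps power2_eq_square)
          from this[OF n1 n3] show ?thesis unfolding x1 x3 secular_def A_def G_def T_def .
        qed
        then have "secular a k ?q \<mu> = 0" using r2 False by simp
        then have "\<mu> \<in> R" using \<mu> R by simp
        then show ?thesis using x1 x3 by simp
      qed
      define S1 where "S1 = {i. i < m \<and> 4 * a * (real i - real m) = \<mu>}"
      define S2 where "S2 = {i. i < m - 1 \<and> 4 * a * (real i - real m) = \<mu>}"
      have fin: "finite S1" "finite S2" by (auto simp: S1_def S2_def)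
      \<comment> \<open>The expansion of v in the listed eigenvectors for \<mu>; equality with v is
        then checked coefficient by coefficient.\<close>
      define v' where "v' = (\<Sum>i\<in>S1. ri a v (2 * i) *\<^sub>R ie a (2 * i)) + (\<Sum>i\<in>S2. ?x (2 * i) *\<^sub>R he a (2 * i))
         + (if \<mu> \<in> R then ?x k *\<^sub>R zvec a k ?q \<mu> else 0)"
      have "v = v'"
      proof (rule rr_ri_eqI[OF a])
        fix j
        have d: "(\<Sum>i\<in>S. c (2 * i) * (if 2 * i = j then 1 else 0)) = (if even j \<and> j div 2 \<in> S then c j else 0)"
          if "finite S" for S and c :: "nat \<Rightarrow> real"
        proof (cases "even j")
          case True
          then obtain n where n: "j = 2 * n" by auto
          have "(\<Sum>i\<in>S. c (2 * i) * (if 2 * i = j then 1 else 0)) = (\<Sum>i\<in>S. if i = n then c (2 * n) else 0)"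
            by (intro sum.cong) (auto simp: n)
          then show ?thesis using that n by simp
        next
          case False
          then show ?thesis by (auto intro!: sum.neutral)
        qed
        show "ri a v j = ri a v' j"
        proof -
          have "ri a v' j = (if even j \<and> j div 2 \<in> S1 then ri a v j else 0)"
            unfolding v'_def by (simp add: rr_ri_linear rr_ri_basis[OF a] rr_ri_zvec[OF a k2(1)] if_distrib[of "\<lambda>u. ri a u j"] d[OF fin(1), of "ri a v"] del: mult_eq_0_iff cong: if_cong)
          moreover have "ri a v j = (if even j \<and> j div 2 \<in> S1 then ri a v j else 0)"
          proof (cases "even j")
            case True
            then obtain n where n: "j = 2 * n" by auto
            have "ri a v j = 0" if "n \<notin> S1"
            proof -
              have "4 * a * (real n - real m) \<noteq> \<mu>"
              proof (cases "n < m")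
                case False
                then have "0 \<le> 4 * a * (real n - real m)" using a by simp
                then show ?thesis using \<mu> by linarith
              qed (use that in \<open>auto simp: S1_def\<close>)
              then show ?thesis using im[of n] by (simp add: n)
            qed
            then show ?thesis by (simp add: n)
          qed (use odd0 in simp)
          ultimately show ?thesis by simp
        qed
        show "rr a v j = rr a v' j"
        proof -
          have e': "rr a v' j = (if even j \<and> j div 2 \<in> S2 then ?x j else 0) + (if \<mu> \<in> R then ?x k * rr a (zvec a k ?q \<mu>) j else 0)"
            unfolding v'_def by (simp add: rr_ri_linear rr_ri_basis[OF a] if_distrib[of "\<lambda>u. rr a u j"] d[OF fin(2), of ?x] del: mult_eq_0_iff cong: if_cong)
          show ?thesis
          proof (cases "even j")
            case False
            then show ?thesis unfolding e' rr_ri_zvec[OF a k2(1)] using odd0 k2(2) by auto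
          next
            case True
            then obtain n where n: "j = 2 * n" by auto
            have e2: "rr a v' j = (if n \<in> S2 then ?x j else 0) + (if \<mu> \<in> R then ?x k * rr a (zvec a k ?q \<mu>) j else 0)"
              unfolding e' by (simp add: n)
            consider "n < m - 1" | "n = m - 1" | "n = m" | "n = m + 1" | "n > m + 1" using m by linarith
            then show ?thesis
            proof cases
              case 1
              have z0: "rr a (zvec a k ?q \<mu>) j = 0" "LL a k (he a (2 * n)) = 0" "2 * n \<noteq> k"
                unfolding rr_ri_zvec[OF a k2(1)] LL_def rr_ri_basis[OF a] using 1 k k2 n m by auto
              have "4 * a * (real n - real m) * ?x j = \<mu> * ?x j" using re[of n] z0 by (simp add: n)
              then have "n \<notin> S2 \<Longrightarrow> ?x j = 0" using 1 by (auto simp: S2_def)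
              then show ?thesis unfolding e' z0 by (auto simp: n)
            next
              case 2
              have j: "j = k - 2" using n 2 k2(3) by simp
              have "n \<notin> S2" using 2 by (auto simp: S2_def)
              then have "rr a v' j = (if \<mu> \<in> R then ?x k * (A / (\<mu> + 4 * a)) else 0)"
                unfolding e2 rr_ri_zvec[OF a k2(1)] using j kne by (simp add: A_def)
              then show ?thesis using blk j by metis
            next
              case 3
              have j: "j = k" using n 3 k by simp
              have "n \<notin> S2" using 3 by (auto simp: S2_def)
              then have "rr a v' j = (if \<mu> \<in> R then ?x k else 0)"
                unfolding e2 rr_ri_zvec[OF a k2(1)] using j kne by simp
              then show ?thesis using blk j by metis
            next
              case 4
              have j: "j = k + 2" using n 4 k by simp
              have "n \<notin> S2" using 4 by (auto simp: S2_def)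
              then have "rr a v' j = (if \<mu> \<in> R then ?x k * (G / (\<mu> - 4 * a)) else 0)"
                unfolding e2 rr_ri_zvec[OF a k2(1)] using j kne by (simp add: G_def)
              then show ?thesis using blk j by metis
            next
              case 5
              have z0: "rr a (zvec a k ?q \<mu>) j = 0" "LL a k (he a (2 * n)) = 0" "2 * n \<noteq> k"
                unfolding rr_ri_zvec[OF a k2(1)] LL_def rr_ri_basis[OF a] using 5 k k2 n m by auto
              have "4 * a * (real n - real m) * ?x j = \<mu> * ?x j" using re[of n] z0 by (simp add: n)
              moreover have "0 < 4 * a * (real n - real m)" using 5 a by simp
              ultimately have "?x j = 0" using \<mu> by auto
              moreover have "n \<notin> S2" using 5 by (auto simp: S2_def)
              ultimately show ?thesis unfolding e' z0 by (simp add: n)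
            qed
          qed
        qed
      qed
      moreover have "v' \<in> span (e ` {i \<in> J. f i = \<mu>})"
        unfolding v'_def
      proof (intro span_add span_sum)
        fix i assume "i \<in> S1"
        then have "Inl i \<in> {i \<in> J. f i = \<mu>}" by (auto simp: S1_def J_def f_simps)
        then have "e (Inl i) \<in> span (e ` {i \<in> J. f i = \<mu>})" by (intro span_base imageI)
        then show "ri a v (2 * i) *\<^sub>R ie a (2 * i) \<in> span (e ` {i \<in> J. f i = \<mu>})" unfolding e_simps by (rule span_scale)
      next
        fix i assume "i \<in> S2"
        then have "Inr (Inl i) \<in> {i \<in> J. f i = \<mu>}" by (auto simp: S2_def J_def f_simps)
        then have "e (Inr (Inl i)) \<in> span (e ` {i \<in> J. f i = \<mu>})" by (intro span_base imageI)
        then show "?x (2 * i) *\<^sub>R he a (2 * i) \<in> span (e ` {i \<in> J. f i = \<mu>})" unfolding e_simps by (rule span_scale)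
      next
        show "(if \<mu> \<in> R then ?x k *\<^sub>R zvec a k ?q \<mu> else 0) \<in> span (e ` {i \<in> J. f i = \<mu>})"
        proof (cases "\<mu> \<in> R")
          case True
          then have "Inr (Inr \<mu>) \<in> {i \<in> J. f i = \<mu>}" by (auto simp: J_def f_simps)
          then have "e (Inr (Inr \<mu>)) \<in> span (e ` {i \<in> J. f i = \<mu>})" by (intro span_base imageI)
          then show ?thesis unfolding e_simps using True by (simp add: span_scale)
        qed (simp add: span_zero)
      qed
      ultimately show ?thesis by simp
    qed
  qed
  moreover have "card J = 2 * m - 1 + card R" unfolding J_def using R(2) m by (simp add: card_Plus)
  ultimately show ?thesis by simp
qed

section \<open>Signs of the roots of the secular polynomial\<close>

lemma cubic_roots:
  fixes B C D :: real
  defines "p \<equiv> \<lambda>x. - (x ^ 3) + B * x\<^sup>2 + C * x + D"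
  assumes "p x = 0" "p y = 0" "p z = 0" "p w = 0" "x \<noteq> y" "x \<noteq> z" "y \<noteq> z"
  shows "w = x \<or> w = y \<or> w = z"
proof -
  \<comment> \<open>Vieta by two divided differences: any three distinct roots have sum B. Two
    candidates for the third root must then agree.\<close>
  have s: "u + v + t = B" if "p u = 0" "p v = 0" "p t = 0" "u \<noteq> v" "u \<noteq> t" "v \<noteq> t" for u v t
  proof -
    have g: "- (u\<^sup>2 + u * v + v\<^sup>2) + B * (u + v) + C = 0" if "p u = 0" "p v = 0" "u \<noteq> v" for u v
    proof -
      have "(u - v) * (- (u\<^sup>2 + u * v + v\<^sup>2) + B * (u + v) + C) = p u - p v"
        by (simp add: p_def power2_eq_square power3_eq_cube algebra_simps)
      then show ?thesis using that by simp
    qed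
    have "(v - t) * (B - (u + v + t)) = (- (u\<^sup>2 + u * v + v\<^sup>2) + B * (u + v) + C) - (- (u\<^sup>2 + u * t + t\<^sup>2) + B * (u + t) + C)"
      by (simp add: power2_eq_square algebra_simps)
    also have "\<dots> = 0" using g[of u v] g[of u t] that by simp
    finally show ?thesis using that by simp
  qed
  show ?thesis
  proof (rule ccontr)
    assume n: "\<not> ?thesis"
    then have "x + y + z = B" "x + y + w = B" using s[of x y z] s[of x y w] assms by auto
    then show False using n by simp
  qed
qed

lemma secular_cubic:
  "secular a k q \<mu> = - (\<mu> ^ 3) + (2 * q * hbe a k) * \<mu>\<^sup>2 + (16 * a\<^sup>2 + (q * hal a k)\<^sup>2 + (q * hga a k)\<^sup>2) * \<mu>
     + (- 16 * a\<^sup>2 * (2 * q * hbe a k) - 4 * a * (q * hal a k)\<^sup>2 + 4 * a * (q * hga a k)\<^sup>2)"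
  unfolding secular_def by (simp add: power2_eq_square power3_eq_cube algebra_simps)

lemma secular_roots_unique:
  assumes "secular a k q x = 0" "secular a k q y = 0" "secular a k q z = 0" "secular a k q w = 0" "x \<noteq> y" "x \<noteq> z" "y \<noteq> z"
  shows "w = x \<or> w = y \<or> w = z"
  by (rule cubic_roots[OF assms(1-4)[unfolded secular_cubic] assms(5-7)])

lemma secular_continuous: "continuous_on A (secular a k q)"
  unfolding secular_def by (intro continuous_intros)

text \<open>At - 4 a and at 4 a a single coupling term survives and fixes the sign, while far out
  the leading term - \<mu>^3 has the opposite one. So one root lies beyond each of the two points,
  and the third is caught between them.\<close>

lemma secular_outer_roots:
  assumes a: "0 < a" and k: "2 \<le> k" and q: "q \<noteq> 0"
  shows "secular a k q (- 4 * a) < 0" "secular a k q (4 * a) > 0"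
    "\<exists>\<mu>. \<mu> < - 4 * a \<and> secular a k q \<mu> = 0" "\<exists>\<mu>. 4 * a < \<mu> \<and> secular a k q \<mu> = 0"
proof -
  define A where "A = (q * hal a k)\<^sup>2"
  define G where "G = (q * hga a k)\<^sup>2"
  define T where "T = 2 * q * hbe a k"
  have A: "0 < A" using a k q by (simp add: A_def hal_def)
  have G: "0 < G" using a q by (simp add: G_def hga_def)
  have s: "secular a k q \<mu> = (T - \<mu>) * ((\<mu> + 4 * a) * (\<mu> - 4 * a)) + A * (\<mu> - 4 * a) + G * (\<mu> + 4 * a)" for \<mu>
    by (simp add: secular_def A_def G_def T_def)
  show m: "secular a k q (- 4 * a) < 0" unfolding s using A a by (simp add: mult_pos_pos)
  show p: "secular a k q (4 * a) > 0" unfolding s using G a by simp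
  \<comment> \<open>Large enough that N - 4 a \<ge> 1 and that N + T and N - T both exceed A + G by
    1; \<open>key\<close> then lets the cubic part win over both coupling terms. Reflection
    exchanges A with G and T with - T, so one inequality serves both ends.\<close>
  define N where "N = 4 * a + 1 + \<bar>T\<bar> + A + G"
  have N: "1 \<le> N - 4 * a" "1 \<le> N + 4 * a" "1 + A + G \<le> N + T" "1 + A + G \<le> N - T" using a A G by (auto simp: N_def)
  have key: "B * (N + 4 * a) < (N - 4 * a) * (X * (N + 4 * a) - H)"
    if "0 < B" "0 < H" "1 + B + H \<le> X" for B H X
  proof -
    have "H * 1 \<le> H * (N + 4 * a)" using that N by (intro mult_left_mono) auto
    moreover have "(1 + B + H) * (N + 4 * a) \<le> X * (N + 4 * a)" using that N by (intro mult_right_mono) auto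
    ultimately have 1: "(1 + B) * (N + 4 * a) \<le> X * (N + 4 * a) - H" by (simp add: algebra_simps)
    have "B * (N + 4 * a) < 1 * ((1 + B) * (N + 4 * a))" using N that by (simp add: algebra_simps)
    also have "\<dots> \<le> (N - 4 * a) * ((1 + B) * (N + 4 * a))" using N that by (intro mult_right_mono) auto
    also have "\<dots> \<le> (N - 4 * a) * (X * (N + 4 * a) - H)" using N 1 by (intro mult_left_mono) auto
    finally show ?thesis .
  qed
  have "secular a k q (- N) = (N - 4 * a) * ((N + T) * (N + 4 * a) - G) - A * (N + 4 * a)"
    unfolding s by (simp add: algebra_simps)
  then have n: "secular a k q (- N) > 0" using key[of A G "N + T"] A G N by simp
  have "secular a k q N = - ((N - 4 * a) * ((N - T) * (N + 4 * a) - A) - G * (N + 4 * a))"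
    unfolding s by (simp add: algebra_simps)
  then have n': "secular a k q N < 0" using key[of G A "N - T"] A G N by simp
  obtain x where "- N \<le> x" "x \<le> - 4 * a" "secular a k q x = 0"
    using IVT2'[of "secular a k q" "- 4 * a" 0 "- N"] secular_continuous m n N by auto
  then show "\<exists>\<mu>. \<mu> < - 4 * a \<and> secular a k q \<mu> = 0" using m by (intro exI[of _ x]) (auto simp: less_le)
  obtain y where "4 * a \<le> y" "y \<le> N" "secular a k q y = 0"
    using IVT2'[of "secular a k q" N 0 "4 * a"] secular_continuous p n' N by auto
  then show "\<exists>\<mu>. 4 * a < \<mu> \<and> secular a k q \<mu> = 0" using p by (intro exI[of _ y]) (auto simp: less_le)
qed

text \<open>Since (k + 1) (k + 2) - k (k - 1) = 2 (2 k + 1), both contributions contain 2 k + 1, and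
  the sign depends only on q and q - 8 a^2. This sign tells on which side of 0 the middle root
  lies.\<close>

lemma secular_0:
  assumes "0 < a" "2 \<le> k"
  shows "secular a k q 0 = 2 * q * (2 * real k + 1) / a * (q - 8 * a\<^sup>2)"
proof -
  have h: "(hga a k)\<^sup>2 = real (k + 1) * real (k + 2) / (4 * a\<^sup>2)" "(hal a k)\<^sup>2 = real k * real (k - 1) / (4 * a\<^sup>2)"
    by (simp_all add: hga_def hal_def power_divide power_mult_distrib)
  show ?thesis
    unfolding secular_cubic power_mult_distrib h using assms
    by (simp add: hbe_def of_nat_diff power2_eq_square field_simps)
qed

text \<open>The determinant is negative at 0 and positive at 4 a, so the middle root lies to the
  right of 0 and only the outer left root is negative.\<close>

lemma secular_negative_roots_1:
  assumes a: "0 < a" and k: "2 \<le> k" and q: "0 < q" "q < 8 * a\<^sup>2"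
  shows "finite {\<mu>. \<mu> < 0 \<and> secular a k q \<mu> = 0} \<and> card {\<mu>. \<mu> < 0 \<and> secular a k q \<mu> = 0} = 1"
proof -
  have q0: "q \<noteq> 0" using q by simp
  note o = secular_outer_roots[OF a k q0]
  have z: "secular a k q 0 < 0" unfolding secular_0[OF a k] using a q by (intro mult_pos_neg) auto
  obtain x y where xy: "x < - 4 * a" "secular a k q x = 0" "4 * a < y" "secular a k q y = 0" using o by blast
  obtain w where w: "0 \<le> w" "w \<le> 4 * a" "secular a k q w = 0"
    using IVT'[of "secular a k q" 0 0 "4 * a"] secular_continuous o z a by auto
  have "{\<mu>. \<mu> < 0 \<and> secular a k q \<mu> = 0} = {x}"
    using secular_roots_unique[OF xy(2,4) w(3)] xy w a by fastforce
  then show ?thesis by simp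
qed

text \<open>The determinant is negative at - 4 a and positive at 0, so the middle root joins the
  outer left one on the negative side.\<close>

lemma secular_negative_roots_2:
  assumes a: "0 < a" and k: "2 \<le> k" and q: "q < 0"
  shows "finite {\<mu>. \<mu> < 0 \<and> secular a k q \<mu> = 0} \<and> card {\<mu>. \<mu> < 0 \<and> secular a k q \<mu> = 0} = 2"
proof -
  have q0: "q \<noteq> 0" using q by simp
  note o = secular_outer_roots[OF a k q0]
  have "q - 8 * a\<^sup>2 < 0" using q zero_le_power2[of a] by linarith
  moreover have "2 * q * (2 * real k + 1) / a < 0" using q a by (simp add: divide_neg_pos mult_neg_pos)
  ultimately have z: "secular a k q 0 > 0" unfolding secular_0[OF a k] by (rule mult_neg_neg[rotated])
  obtain x y where xy: "x < - 4 * a" "secular a k q x = 0" "4 * a < y" "secular a k q y = 0" using o by blast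
  obtain w where w: "- 4 * a \<le> w" "w \<le> 0" "secular a k q w = 0"
    using IVT'[of "secular a k q" "- 4 * a" 0 0] secular_continuous o z a by auto
  have "w \<noteq> 0" using w z by auto
  then have "{\<mu>. \<mu> < 0 \<and> secular a k q \<mu> = 0} = {x, w}"
    using secular_roots_unique[OF xy(2,4) w(3)] xy w a by fastforce
  moreover have "x \<noteq> w" using xy w by auto
  ultimately show ?thesis by simp
qed

subsection \<open>The curve of standing waves\<close>

text \<open>Iterating a choice of derivatives inside a class that is closed under differentiation
  supplies all higher derivatives, and no formula for them is needed.\<close>

lemma smooth_curve_onI:
  assumes step: "\<And>f. f \<in> K \<Longrightarrow> \<exists>g\<in>K. \<forall>\<nu>\<in>I. (f has_vector_derivative g \<nu>) (at \<nu>)" and f: "f \<in> K"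
  shows "smooth_curve_on I f"
proof -
  obtain n where n: "\<And>f. f \<in> K \<Longrightarrow> n f \<in> K" "\<And>f \<nu>. f \<in> K \<Longrightarrow> \<nu> \<in> I \<Longrightarrow> (f has_vector_derivative n f \<nu>) (at \<nu>)"
    using step by metis
  have "(n ^^ j) f \<in> K" for j by (induction j) (auto intro: n f)
  then show ?thesis
    unfolding smooth_curve_on_def by (intro exI[of _ "\<lambda>j. (n ^^ j) f"]) (auto intro: n)
qed

locale wave_curve =
  fixes lam \<eta> :: real and k :: nat and I :: "real set"
  assumes \<eta>0: "\<eta> \<noteq> 0" and ev: "even k"
    and I: "open I" "is_interval I"
begin

definition c :: real where "c = 2 * real k + 1"
text \<open>With \<sigma> = \<nu> / c, the relation between frequency and width reads 3 a^2 - 2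
  \<sigma> a = lam. \<open>a\<close> is its larger root, \<open>r\<close> the square root in the
  solution formula, and \<open>M\<close> is then fixed by lam + \<eta> M = a^2.\<close>

definition r :: "real \<Rightarrow> real" where "r \<nu> = sqrt ((\<nu> / c)\<^sup>2 + 3 * lam)"
definition a :: "real \<Rightarrow> real" where "a \<nu> = (\<nu> / c + r \<nu>) / 3"
definition M :: "real \<Rightarrow> real" where "M \<nu> = ((a \<nu>)\<^sup>2 - lam) / \<eta>"
definition g :: "real \<Rightarrow> real" where "g \<nu> = sqrt (M \<nu>) / sqrt (hN (a \<nu>) k)"

text \<open>Given by the expansion of \<open>hstate\<close>, with which it agrees on I, so that
  smoothness can be proved term by term.\<close>

definition \<Phi> :: "real \<Rightarrow> energy_space" where
  "\<Phi> \<nu> = (\<Sum>j\<le>k. (g \<nu> * coeff (hp (a \<nu>) k) j) *\<^sub>R pgs (monom 1 j) (a \<nu>))"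

end

text \<open>The definitions come in a locale of their own so that the positivity assumption can
  speak about \<open>a\<close> and \<open>M\<close>.\<close>

locale wave_curve_pos = wave_curve +
  assumes pos: "\<And>\<nu>. \<nu> \<in> I \<Longrightarrow> 0 < (\<nu> / c)\<^sup>2 + 3 * lam \<and> 0 < a \<nu> \<and> 0 < M \<nu>"
begin

lemma c_pos: "0 < c" by (simp add: c_def)

lemma \<Phi>_eq: "\<nu> \<in> I \<Longrightarrow> \<Phi> \<nu> = hstate (M \<nu>) (a \<nu>) k"
  unfolding \<Phi>_def g_def using pos by (simp add: hstate_expand)

lemma r_pos: "\<nu> \<in> I \<Longrightarrow> 0 < r \<nu>"
  using pos by (simp add: r_def)

lemma mass_relation: "lam + \<eta> * M \<nu> = (a \<nu>)\<^sup>2"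
  using \<eta>0 by (simp add: M_def)

lemma frequency:
  assumes "\<nu> \<in> I"
  shows "\<nu> = (2 * real k + 1) * a \<nu> + \<eta> * (M \<nu> * (2 * real k + 1) / (2 * a \<nu>))"
proof -
  have r2: "(r \<nu>)\<^sup>2 = (\<nu> / c)\<^sup>2 + 3 * lam" using pos[OF assms] unfolding r_def by simp
  have ra: "r \<nu> = 3 * a \<nu> - \<nu> / c"
  proof -
    have "3 * (x / 3) = x" for x :: real by simp
    from this[of "\<nu> / c + r \<nu>"] have "3 * a \<nu> = \<nu> / c + r \<nu>" unfolding a_def .
    then show ?thesis by simp
  qed
  have "3 * \<alpha>\<^sup>2 - 2 * \<sigma> * \<alpha> = lam" if "\<rho>\<^sup>2 = \<sigma>\<^sup>2 + 3 * lam" "\<rho> = 3 * \<alpha> - \<sigma>" for \<alpha> \<sigma> \<rho> :: real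
    using that(1) unfolding that(2) by (simp add: power2_eq_square algebra_simps)
  from this[OF r2 ra] have "3 * (a \<nu>)\<^sup>2 - 2 * (\<nu> / c) * a \<nu> = lam" .
  then have e: "\<eta> * M \<nu> = 2 * (\<nu> / c) * a \<nu> - 2 * (a \<nu>)\<^sup>2"
    using mass_relation[of \<nu>] by simp
  have "(2 * real k + 1) * a \<nu> + \<eta> * (M \<nu> * (2 * real k + 1) / (2 * a \<nu>)) = c * a \<nu> + (\<eta> * M \<nu>) * c / (2 * a \<nu>)"
    by (simp add: c_def)
  also have "\<dots> = \<nu>" unfolding e using pos[OF assms] c_pos by (simp add: field_simps power2_eq_square)
  finally show ?thesis ..
qed

lemma r_deriv: "\<nu> \<in> I \<Longrightarrow> (r has_real_derivative \<nu> * (inverse (r \<nu>) * (1 / c\<^sup>2))) (at \<nu>)"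
proof -
  assume "\<nu> \<in> I"
  then have p: "0 < (\<nu> / c)\<^sup>2 + 3 * lam" using pos by blast
  have "((\<lambda>\<nu>. (\<nu> / c)\<^sup>2 + 3 * lam) has_real_derivative 2 * (\<nu> / c) * (1 / c)) (at \<nu>)"
    using c_pos by (auto intro!: derivative_eq_intros)
  from DERIV_chain2[OF DERIV_real_sqrt[OF p] this] show ?thesis
    unfolding r_def[abs_def] by (simp add: field_simps power2_eq_square)
qed

text \<open>(1 / c + \<nu> / (c^2 r)) / 3 is (r + \<nu> / c) / (3 c r), that is a / (c r). The
  derivative is written as a product of the generators of \<open>SS\<close>.\<close>

lemma a_deriv:
  assumes "\<nu> \<in> I"
  shows "(a has_real_derivative a \<nu> * (inverse (r \<nu>) * (1 / c))) (at \<nu>)"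
proof -
  have "(a has_real_derivative (1 / c + \<nu> * (inverse (r \<nu>) * (1 / c\<^sup>2))) / 3) (at \<nu>)"
    unfolding a_def[abs_def] using r_deriv[OF assms] c_pos by (auto intro!: derivative_eq_intros)
  also have "(1 / c + \<nu> * (inverse (r \<nu>) * (1 / c\<^sup>2))) / 3 = a \<nu> * (inverse (r \<nu>) * (1 / c))"
    using r_pos[OF assms] c_pos by (simp add: a_def field_simps power2_eq_square)
  finally show ?thesis .
qed

lemma M_deriv: "\<nu> \<in> I \<Longrightarrow> (M has_real_derivative (2 / \<eta>) * (a \<nu> * (a \<nu> * (inverse (r \<nu>) * (1 / c))))) (at \<nu>)"
  unfolding M_def[abs_def] using a_deriv[of \<nu>] \<eta>0 by (auto intro!: derivative_eq_intros simp: field_simps)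

text \<open>\<open>hN\<close> is a constant times a^(k - 1/2), so \<open>g\<close> is a constant
  times sqrt M times a power of a. Its derivative is \<open>g\<close> times a logarithmic
  derivative, in which neither the root of M nor a fractional power of a appears.\<close>

lemma g_deriv:
  assumes \<nu>: "\<nu> \<in> I"
  shows "(g has_real_derivative g \<nu> * ((1 / \<eta>) * (inverse (M \<nu>) * (a \<nu> * (a \<nu> * (inverse (r \<nu>) * (1 / c)))))
     + (- (2 * real k - 1) / 4) * (inverse (r \<nu>) * (1 / c)))) (at \<nu>)"
proof -
  have p: "0 < a \<nu>" "0 < M \<nu>" using pos[OF \<nu>] by auto
  define a' where "a' = a \<nu> * (inverse (r \<nu>) * (1 / c))"
  \<comment> \<open>Minus half of the exponent k - 1/2, because \<open>g\<close> divides by the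
    square root of \<open>hN\<close>.\<close>
  define e where "e = - (2 * real k - 1) / 4"
  define K where "K = 1 / sqrt (2 ^ k * fact k * sqrt pi)"
  have gf: "g x = sqrt (M x) * (K * a x powr e)" if "0 < a x" for x
  proof -
    have "hN (a x) k = (2 ^ k * fact k * sqrt pi) * (a x ^ k / sqrt (a x))"
      by (simp add: hN_def power_mult_distrib real_sqrt_divide)
    also have "a x ^ k / sqrt (a x) = a x powr (real k - 1 / 2)"
      using that by (simp add: powr_diff powr_realpow powr_half_sqrt)
    finally have "sqrt (hN (a x) k) = sqrt (2 ^ k * fact k * sqrt pi) * sqrt (a x powr (real k - 1 / 2))"
      by (simp only: real_sqrt_mult)
    also have "sqrt (a x powr (real k - 1 / 2)) = a x powr (- e)"
    proof -
      have "(real k - 1 / 2) * (1 / 2) = - e" by (simp add: e_def field_simps)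
      then show ?thesis using powr_half_sqrt[of "a x powr (real k - 1 / 2)"] by (simp only: powr_powr powr_ge_zero)
    qed
    finally show ?thesis by (simp add: g_def K_def powr_minus divide_inverse)
  qed
  have s: "((\<lambda>x. sqrt (M x)) has_real_derivative inverse (sqrt (M \<nu>)) / 2 * ((2 / \<eta>) * (a \<nu> * a'))) (at \<nu>)"
    using DERIV_chain2[OF DERIV_real_sqrt[OF p(2)] M_deriv[OF \<nu>]] unfolding a'_def by simp
  have t: "((\<lambda>x. K * a x powr e) has_real_derivative K * (a' * (e * a \<nu> powr (e - 1)))) (at \<nu>)"
    using DERIV_cmult[OF DERIV_powr[OF a_deriv[OF \<nu>] p(1) DERIV_const[of e]], of K] p(1)
    unfolding a'_def by (simp add: powr_diff divide_inverse algebra_simps)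
  have "((\<lambda>x. sqrt (M x) * (K * a x powr e)) has_real_derivative
     inverse (sqrt (M \<nu>)) / 2 * ((2 / \<eta>) * (a \<nu> * a')) * (K * a \<nu> powr e) + K * (a' * (e * a \<nu> powr (e - 1))) * sqrt (M \<nu>)) (at \<nu>)"
    by (rule DERIV_mult[OF s t])
  also have "inverse (sqrt (M \<nu>)) / 2 * ((2 / \<eta>) * (a \<nu> * a')) * (K * a \<nu> powr e) + K * (a' * (e * a \<nu> powr (e - 1))) * sqrt (M \<nu>)
     = sqrt (M \<nu>) * (K * a \<nu> powr e) * ((1 / \<eta>) * (inverse (M \<nu>) * (a \<nu> * a')) + e * (a' / a \<nu>))"
  proof -
    have "inverse (sqrt (M \<nu>)) = sqrt (M \<nu>) * inverse (M \<nu>)"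
      using p(2) real_sqrt_pow2[of "M \<nu>"] by (simp add: field_simps power2_eq_square)
    moreover have "a \<nu> powr (e - 1) = a \<nu> powr e / a \<nu>" using p(1) by (simp add: powr_diff)
    ultimately show ?thesis by (simp add: algebra_simps)
  qed
  also have "\<dots> = g \<nu> * ((1 / \<eta>) * (inverse (M \<nu>) * (a \<nu> * (a \<nu> * (inverse (r \<nu>) * (1 / c)))))
     + (- (2 * real k - 1) / 4) * (inverse (r \<nu>) * (1 / c)))"
    unfolding gf[OF p(1)] a'_def e_def using p(1) by simp
  finally have d: "((\<lambda>x. sqrt (M x) * (K * a x powr e)) has_real_derivative g \<nu> * ((1 / \<eta>) * (inverse (M \<nu>) * (a \<nu> * (a \<nu> * (inverse (r \<nu>) * (1 / c)))))
     + (- (2 * real k - 1) / 4) * (inverse (r \<nu>) * (1 / c)))) (at \<nu>)" .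
  show ?thesis
    by (rule has_field_derivative_transform_within_open[OF d I(1) \<nu>]) (use gf pos in auto)
qed

text \<open>The algebra generated by the scalar functions that occur in the curve and its
  derivatives. The generators are chosen so that the derivative of each is again a polynomial in
  them.\<close>

inductive_set SS :: "(real \<Rightarrow> real) set" where
  const: "(\<lambda>\<nu>. x) \<in> SS"
| ident: "(\<lambda>\<nu>. \<nu>) \<in> SS"
| r: "r \<in> SS"
| ir: "(\<lambda>\<nu>. inverse (r \<nu>)) \<in> SS"
| a: "a \<in> SS"
| iM: "(\<lambda>\<nu>. inverse (M \<nu>)) \<in> SS"
| g: "g \<in> SS"
| add: "f \<in> SS \<Longrightarrow> h \<in> SS \<Longrightarrow> (\<lambda>\<nu>. f \<nu> + h \<nu>) \<in> SS"
| mult: "f \<in> SS \<Longrightarrow> h \<in> SS \<Longrightarrow> (\<lambda>\<nu>. f \<nu> * h \<nu>) \<in> SS"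

lemma SS_deriv: "f \<in> SS \<Longrightarrow> \<exists>h\<in>SS. \<forall>\<nu>\<in>I. (f has_real_derivative h \<nu>) (at \<nu>)"
proof (induction rule: SS.induct)
  case (const x)
  then show ?case by (intro bexI[of _ "\<lambda>\<nu>. 0"] SS.const) auto
next
  case ident
  then show ?case by (intro bexI[of _ "\<lambda>\<nu>. 1"] SS.const) auto
next
  case r
  then show ?case
    by (intro bexI[of _ "\<lambda>\<nu>. \<nu> * (inverse (r \<nu>) * (1 / c\<^sup>2))"] SS.intros ballI r_deriv)
next
  case ir
  have "((\<lambda>\<nu>. inverse (r \<nu>)) has_real_derivative (- 1) * (inverse (r \<nu>) * (inverse (r \<nu>) * (\<nu> * (inverse (r \<nu>) * (1 / c\<^sup>2)))))) (at \<nu>)"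
    if "\<nu> \<in> I" for \<nu>
    using r_deriv[OF that] r_pos[OF that] by (auto intro!: derivative_eq_intros)
  then show ?case
    by (intro bexI[of _ "\<lambda>\<nu>. (- 1) * (inverse (r \<nu>) * (inverse (r \<nu>) * (\<nu> * (inverse (r \<nu>) * (1 / c\<^sup>2)))))"] SS.intros ballI)
next
  case a
  then show ?case
    by (intro bexI[of _ "\<lambda>\<nu>. a \<nu> * (inverse (r \<nu>) * (1 / c))"] SS.intros ballI a_deriv)
next
  case iM
  have "((\<lambda>\<nu>. inverse (M \<nu>)) has_real_derivative (- 1) * (inverse (M \<nu>) * (inverse (M \<nu>) * ((2 / \<eta>) * (a \<nu> * (a \<nu> * (inverse (r \<nu>) * (1 / c)))))))) (at \<nu>)"
    if "\<nu> \<in> I" for \<nu>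
    using M_deriv[OF that] pos[OF that] by (auto intro!: derivative_eq_intros)
  then show ?case
    by (intro bexI[of _ "\<lambda>\<nu>. (- 1) * (inverse (M \<nu>) * (inverse (M \<nu>) * ((2 / \<eta>) * (a \<nu> * (a \<nu> * (inverse (r \<nu>) * (1 / c)))))))"] SS.intros ballI)
next
  case g
  show ?case
    by (intro bexI[of _ "\<lambda>\<nu>. g \<nu> * ((1 / \<eta>) * (inverse (M \<nu>) * (a \<nu> * (a \<nu> * (inverse (r \<nu>) * (1 / c)))))
     + (- (2 * real k - 1) / 4) * (inverse (r \<nu>) * (1 / c)))"] SS.intros ballI g_deriv)
next
  case (add f h)
  then obtain f' h' where "f' \<in> SS" "h' \<in> SS" "\<And>\<nu>. \<nu> \<in> I \<Longrightarrow> (f has_real_derivative f' \<nu>) (at \<nu>)" "\<And>\<nu>. \<nu> \<in> I \<Longrightarrow> (h has_real_derivative h' \<nu>) (at \<nu>)"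
    by blast
  then show ?case by (intro bexI[of _ "\<lambda>\<nu>. f' \<nu> + h' \<nu>"] SS.intros ballI DERIV_add) auto
next
  case (mult f h)
  then obtain f' h' where "f' \<in> SS" "h' \<in> SS" "\<And>\<nu>. \<nu> \<in> I \<Longrightarrow> (f has_real_derivative f' \<nu>) (at \<nu>)" "\<And>\<nu>. \<nu> \<in> I \<Longrightarrow> (h has_real_derivative h' \<nu>) (at \<nu>)"
    by blast
  then show ?case using mult.hyps
    by (intro bexI[of _ "\<lambda>\<nu>. f' \<nu> * h \<nu> + h' \<nu> * f \<nu>"] SS.intros ballI DERIV_mult) auto
qed

inductive_set CC :: "(real \<Rightarrow> energy_space) set" where
  zero: "(\<lambda>\<nu>. 0) \<in> CC"
| scal: "f \<in> SS \<Longrightarrow> (\<lambda>\<nu>. f \<nu> *\<^sub>R pgs p (a \<nu>)) \<in> CC"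
| plus: "f \<in> CC \<Longrightarrow> h \<in> CC \<Longrightarrow> (\<lambda>\<nu>. f \<nu> + h \<nu>) \<in> CC"

lemma CC_deriv: "f \<in> CC \<Longrightarrow> \<exists>h\<in>CC. \<forall>\<nu>\<in>I. (f has_vector_derivative h \<nu>) (at \<nu>)"
proof (induction rule: CC.induct)
  case zero
  then show ?case by (intro bexI[of _ "\<lambda>\<nu>. 0"] CC.zero) auto
next
  case (scal f p)
  then obtain f' where f': "f' \<in> SS" "\<And>\<nu>. \<nu> \<in> I \<Longrightarrow> (f has_real_derivative f' \<nu>) (at \<nu>)"
    using SS_deriv by blast
  let ?q = "smult (-1/2) ([:0, 1:] * ([:0, 1:] * p))"
  let ?h = "\<lambda>\<nu>. (f \<nu> * (a \<nu> * (inverse (r \<nu>) * (1 / c)))) *\<^sub>R pgs ?q (a \<nu>) + f' \<nu> *\<^sub>R pgs p (a \<nu>)"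
  have "((\<lambda>\<nu>. f \<nu> *\<^sub>R pgs p (a \<nu>)) has_vector_derivative ?h \<nu>) (at \<nu>)" if \<nu>: "\<nu> \<in> I" for \<nu>
  proof -
    have "(pgs p \<circ> a has_vector_derivative (a \<nu> * (inverse (r \<nu>) * (1 / c))) *\<^sub>R pgs ?q (a \<nu>)) (at \<nu>)"
      by (rule vector_diff_chain_at)
         (use a_deriv[OF \<nu>] pgs_has_vector_derivative pos[OF \<nu>] in \<open>auto simp: has_real_derivative_iff_has_vector_derivative\<close>)
    from has_vector_derivative_scaleR[OF f'(2)[OF \<nu>] this]
    show ?thesis by (simp add: comp_def)
  qed
  note d = this
  have "?h \<in> CC" by (intro CC.plus CC.scal SS.intros scal f')
  then show ?case by (rule bexI[rotated]) (intro ballI d)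
next
  case (plus f h)
  then obtain f' h' where "f' \<in> CC" "h' \<in> CC" "\<And>\<nu>. \<nu> \<in> I \<Longrightarrow> (f has_vector_derivative f' \<nu>) (at \<nu>)" "\<And>\<nu>. \<nu> \<in> I \<Longrightarrow> (h has_vector_derivative h' \<nu>) (at \<nu>)"
    by blast
  then show ?case by (intro bexI[of _ "\<lambda>\<nu>. f' \<nu> + h' \<nu>"] CC.plus ballI has_vector_derivative_add) auto
qed

lemma coeff_hp_SS: "(\<lambda>\<nu>. coeff (hp (a \<nu>) n) j) \<in> SS"
proof (induction n arbitrary: j)
  case 0
  show ?case by (simp add: SS.const)
next
  case (Suc n)
  have d: "(\<lambda>\<nu>. (- real (Suc j)) * coeff (hp (a \<nu>) n) (Suc j)) \<in> SS" for j
    by (intro SS.mult SS.const Suc)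
  show ?case
  proof (cases j)
    case 0
    then show ?thesis using d[of 0] unfolding coeff_hp_Suc by simp
  next
    case j: (Suc i)
    have "(\<lambda>\<nu>. (2 * a \<nu>) * coeff (hp (a \<nu>) n) i + (- real (Suc j)) * coeff (hp (a \<nu>) n) (Suc j)) \<in> SS"
      by (intro SS.add SS.mult SS.const SS.a Suc d)
    then show ?thesis unfolding coeff_hp_Suc j by (simp only: nat.case mult_minus_left diff_conv_add_uminus)
  qed
qed

lemma \<Phi>_CC: "\<Phi> \<in> CC"
proof -
  have "(\<lambda>\<nu>. \<Sum>j\<in>A. (g \<nu> * coeff (hp (a \<nu>) k) j) *\<^sub>R pgs (monom 1 j) (a \<nu>)) \<in> CC" if "finite A" for A
    using that
  proof (induction A)
    case (insert x A)
    then have "(\<lambda>\<nu>. (g \<nu> * coeff (hp (a \<nu>) k) x) *\<^sub>R pgs (monom 1 x) (a \<nu>) + (\<Sum>j\<in>A. (g \<nu> * coeff (hp (a \<nu>) k) j) *\<^sub>R pgs (monom 1 j) (a \<nu>))) \<in> CC"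
      by (intro CC.plus CC.scal SS.mult SS.g coeff_hp_SS)
    then show ?case using insert by simp
  qed (simp add: CC.zero)
  then show ?thesis unfolding \<Phi>_def[abs_def] by simp
qed

section \<open>Action, stability and index along the curve\<close>

lemma critical: "\<nu> \<in> I \<Longrightarrow> (action lam \<eta> \<nu> has_derivative (\<lambda>_. 0)) (at (\<Phi> \<nu>))"
  unfolding \<Phi>_eq by (rule hstate_critical[OF _ _ mass_relation frequency]) (use pos in \<open>auto intro: less_imp_le\<close>)

lemma standing_wave: "standing_wave_map lam \<eta> I \<Phi>"
  unfolding standing_wave_map_def
  using I smooth_curve_onI[of CC I \<Phi>, OF CC_deriv \<Phi>_CC] critical by auto

lemma charge_curve: "\<nu> \<in> I \<Longrightarrow> charge (\<Phi> \<nu>) = M \<nu> / 2"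
  unfolding charge_def \<Phi>_eq l2n_sq[symmetric] mass_l2n[symmetric] using pos[of \<nu>] by (simp add: mass_hstate)

text \<open>The action at the fixed frequency \<nu> is stationary at \<Phi> \<nu>, so only the
  explicit dependence on the frequency contributes, namely minus the charge. Writing the action at
  frequency x as the one at \<nu> minus (x - \<nu>) times the charge reduces this to one
  variable.\<close>

lemma action_deriv_curve:
  assumes \<nu>: "\<nu> \<in> I"
  shows "((\<lambda>\<nu>. action lam \<eta> \<nu> (\<Phi> \<nu>)) has_real_derivative - M \<nu> / 2) (at \<nu>)"
proof -
  obtain h where "\<And>\<nu>. \<nu> \<in> I \<Longrightarrow> (\<Phi> has_vector_derivative h \<nu>) (at \<nu>)" using CC_deriv[OF \<Phi>_CC] by blast
  then have "(\<Phi> has_derivative (\<lambda>t. t *\<^sub>R h \<nu>)) (at \<nu>)" using \<nu> by (simp add: has_vector_derivative_def)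
  from diff_chain_at[OF this critical[OF \<nu>]]
  have 1: "((\<lambda>x. action lam \<eta> \<nu> (\<Phi> x)) has_real_derivative 0) (at \<nu>)"
    by (simp add: comp_def has_field_derivative_def lambda_zero)
  have 2: "((\<lambda>x. (x - \<nu>) * (M x / 2)) has_real_derivative M \<nu> / 2) (at \<nu>)"
    using M_deriv[OF \<nu>] by (auto intro!: derivative_eq_intros)
  have "((\<lambda>x. action lam \<eta> \<nu> (\<Phi> x) - (x - \<nu>) * (M x / 2)) has_real_derivative - M \<nu> / 2) (at \<nu>)"
    using DERIV_diff[OF 1 2] by simp
  then show ?thesis
  proof (rule has_field_derivative_transform_within_open[OF _ I(1) \<nu>])
    fix x assume "x \<in> I"
    then show "action lam \<eta> \<nu> (\<Phi> x) - (x - \<nu>) * (M x / 2) = action lam \<eta> x (\<Phi> x)"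
      unfolding action_def charge_curve[OF \<open>x \<in> I\<close>] by (simp add: left_diff_distrib diff_divide_distrib)
  qed
qed

lemma action_deriv2_curve:
  assumes \<nu>: "\<nu> \<in> I"
  shows "deriv (deriv (\<lambda>\<nu>. action lam \<eta> \<nu> (\<Phi> \<nu>))) \<nu> = - (a \<nu>)\<^sup>2 / (\<eta> * c * r \<nu>)"
proof -
  have "((\<lambda>x. - M x / 2) has_real_derivative - (a \<nu>)\<^sup>2 / (\<eta> * c * r \<nu>)) (at \<nu>)"
    using M_deriv[OF \<nu>] c_pos r_pos[OF \<nu>] \<eta>0 by (auto intro!: derivative_eq_intros simp: field_simps power2_eq_square)
  then have "(deriv (\<lambda>\<nu>. action lam \<eta> \<nu> (\<Phi> \<nu>)) has_real_derivative - (a \<nu>)\<^sup>2 / (\<eta> * c * r \<nu>)) (at \<nu>)"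
  proof (rule has_field_derivative_transform_within_open[OF _ I(1) \<nu>])
    fix x assume "x \<in> I"
    then show "- M x / 2 = deriv (\<lambda>\<nu>. action lam \<eta> \<nu> (\<Phi> \<nu>)) x"
      using DERIV_imp_deriv[OF action_deriv_curve] by simp
  qed
  then show ?thesis by (rule DERIV_imp_deriv)
qed

lemma stable: "\<nu> \<in> I \<Longrightarrow> 0 \<le> lam \<Longrightarrow> orbitally_stable lam \<eta> (\<Phi> \<nu>)"
  unfolding \<Phi>_eq using pos by (intro hstate_stable mass_relation) auto

lemma curve_even: "\<nu> \<in> I \<Longrightarrow> \<Phi> \<nu> \<in> even_fns"
  unfolding \<Phi>_eq using pos[of \<nu>] ev by (simp add: hstate_he even_fns_scaleR he_even)

lemma count:
  assumes "\<nu> \<in> I" "k = 2 * m" "1 \<le> m" "finite {\<mu>. \<mu> < 0 \<and> secular (a \<nu>) k (2 * \<eta> * M \<nu>) \<mu> = 0}"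
    "card {\<mu>. \<mu> < 0 \<and> secular (a \<nu>) k (2 * \<eta> * M \<nu>) \<mu> = 0} = n"
  shows "even_neg_count lam \<eta> \<nu> (\<Phi> \<nu>) (2 * m - 1 + n)"
  unfolding \<Phi>_eq[OF assms(1)] assms(5)[symmetric]
  by (rule even_neg_count_hstate[OF _ _ mass_relation \<eta>0 assms(3,2) frequency[OF assms(1)] refl assms(4)])
     (use pos assms(1) in auto)

end

text \<open>Both parts use the state k = 2 m; the sign of \<eta> decides on which side of 0 the
  middle root of the block lies.\<close>

theorem theorem4:
  shows "(\<forall>m::nat. m \<ge> 1 \<longrightarrow>
            (\<exists>I \<Phi> \<omega>. standing_wave_map 0 1 I \<Phi> \<and> \<omega> \<in> I \<and>
               orbitally_stable 0 1 (\<Phi> \<omega>) \<and> \<Phi> \<omega> \<in> even_fns \<and>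
               deriv (deriv (\<lambda>\<nu>. action 0 1 \<nu> (\<Phi> \<nu>))) \<omega> < 0 \<and>
               even_neg_count 0 1 \<omega> (\<Phi> \<omega>) (2 * m))) \<and>
         (\<forall>m::nat. m \<ge> 1 \<longrightarrow>
            (\<exists>I \<Phi> \<omega>. standing_wave_map 2 (-1) I \<Phi> \<and> \<omega> \<in> I \<and>
               orbitally_stable 2 (-1) (\<Phi> \<omega>) \<and> \<Phi> \<omega> \<in> even_fns \<and>
               deriv (deriv (\<lambda>\<nu>. action 2 (-1) \<nu> (\<Phi> \<nu>))) \<omega> > 0 \<and>
               even_neg_count 2 (-1) \<omega> (\<Phi> \<omega>) (2 * m + 1)))"
proof (intro conjI allI impI)
  fix m :: nat assume m: "1 \<le> m"
  define k where "k = 2 * m"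
  \<comment> \<open>For lam = 0 the formulas reduce to a = 2 \<nu> / (3 c) and M = a^2, so every
    positive frequency is admissible.\<close>
  define I where "I = {0::real<..}"
  interpret w: wave_curve 0 1 k I
    by unfold_locales (auto simp: k_def I_def is_interval_1)
  have cp: "0 < w.c" by (simp add: w.c_def)
  interpret w: wave_curve_pos 0 1 k I
    by unfold_locales (use cp in \<open>auto simp: I_def w.M_def w.a_def w.r_def\<close>)
  have 1: "1 \<in> I" by (simp add: I_def)
  have p: "0 < w.a 1" using w.pos[OF 1] by simp
  \<comment> \<open>The coupling is 2 a^2, well below the critical value 8 a^2.\<close>
  have q: "2 * 1 * w.M 1 = 2 * (w.a 1)\<^sup>2" by (simp add: w.M_def)
  have "finite {\<mu>. \<mu> < 0 \<and> secular (w.a 1) k (2 * 1 * w.M 1) \<mu> = 0} \<and> card {\<mu>. \<mu> < 0 \<and> secular (w.a 1) k (2 * 1 * w.M 1) \<mu> = 0} = 1"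
    by (rule secular_negative_roots_1) (use p m q in \<open>auto simp: k_def\<close>)
  then have "even_neg_count 0 1 1 (w.\<Phi> 1) (2 * m - 1 + 1)"
    using w.count[OF 1 k_def m] by blast
  moreover have "deriv (deriv (\<lambda>\<nu>. action 0 1 \<nu> (w.\<Phi> \<nu>))) 1 < 0"
    unfolding w.action_deriv2_curve[OF 1] using p cp w.r_pos[OF 1] by simp
  ultimately show "\<exists>I \<Phi> \<omega>. standing_wave_map 0 1 I \<Phi> \<and> \<omega> \<in> I \<and>
               orbitally_stable 0 1 (\<Phi> \<omega>) \<and> \<Phi> \<omega> \<in> even_fns \<and>
               deriv (deriv (\<lambda>\<nu>. action 0 1 \<nu> (\<Phi> \<nu>))) \<omega> < 0 \<and>
               even_neg_count 0 1 \<omega> (\<Phi> \<omega>) (2 * m)"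
    using w.standing_wave 1 w.stable[OF 1] w.curve_even[OF 1] m by (intro exI[of _ I] exI[of _ w.\<Phi>] exI[of _ 1]) auto
next
  fix m :: nat assume m: "1 \<le> m"
  define k where "k = 2 * m"
  \<comment> \<open>M = 2 - a^2 must be positive. For 0 < \<nu> / c < 1 one has r < 3, since r^2 <
    7, hence a < 4 / 3, whose square 16 / 9 is below 2.\<close>
  define I where "I = {0<..<2 * real k + 1}"
  interpret w: wave_curve 2 "-1" k I
    by unfold_locales (auto simp: k_def I_def is_interval_1)
  have cp: "0 < w.c" and cI: "I = {0<..<w.c}" by (auto simp: w.c_def I_def)
  interpret w: wave_curve_pos 2 "-1" k I
  proof unfold_locales
    fix \<nu> assume "\<nu> \<in> I"
    then have s: "0 < \<nu> / w.c" "\<nu> / w.c < 1" using cp by (auto simp: cI)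
    then have s2: "(\<nu> / w.c)\<^sup>2 < 1" by (simp add: power_less_one_iff)
    have "w.r \<nu> < sqrt (3\<^sup>2)" unfolding w.r_def using s2 by (intro real_sqrt_less_mono) simp
    then have r3: "w.r \<nu> < 3" by simp
    have "0 < w.r \<nu>" unfolding w.r_def by (simp add: add_nonneg_pos)
    then have a0: "0 < w.a \<nu>" using add_pos_pos[OF s(1)] unfolding w.a_def by (intro divide_pos_pos) auto
    have "w.a \<nu> < (1 + 3) / 3"
      unfolding w.a_def by (rule divide_strict_right_mono[OF add_strict_mono[OF s(2) r3]]) simp
    with a0 have a: "0 < w.a \<nu>" "w.a \<nu> < 4 / 3" by auto
    have "(w.a \<nu>)\<^sup>2 < (4 / 3)\<^sup>2" using a by (intro power_strict_mono) auto
    then have "0 < w.M \<nu>" by (simp add: w.M_def power2_eq_square)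
    then show "0 < (\<nu> / w.c)\<^sup>2 + 3 * 2 \<and> 0 < w.a \<nu> \<and> 0 < w.M \<nu>"
      using a by (simp add: add_nonneg_pos)
  qed
  let ?w = "w.c / 2"
  have 1: "?w \<in> I" using cp by (simp add: cI)
  have p: "0 < w.a ?w" "0 < w.M ?w" using w.pos[OF 1] by auto
  have "finite {\<mu>. \<mu> < 0 \<and> secular (w.a ?w) k (2 * (-1) * w.M ?w) \<mu> = 0} \<and> card {\<mu>. \<mu> < 0 \<and> secular (w.a ?w) k (2 * (-1) * w.M ?w) \<mu> = 0} = 2"
    by (rule secular_negative_roots_2) (use p m in \<open>auto simp: k_def\<close>)
  then have "even_neg_count 2 (-1) ?w (w.\<Phi> ?w) (2 * m - 1 + 2)"
    using w.count[OF 1 k_def m] by blast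
  moreover have "deriv (deriv (\<lambda>\<nu>. action 2 (-1) \<nu> (w.\<Phi> \<nu>))) ?w > 0"
    unfolding w.action_deriv2_curve[OF 1] using p cp w.r_pos[OF 1] by simp
  moreover have "2 * m - 1 + 2 = 2 * m + 1" using m by simp
  ultimately show "\<exists>I \<Phi> \<omega>. standing_wave_map 2 (-1) I \<Phi> \<and> \<omega> \<in> I \<and>
               orbitally_stable 2 (-1) (\<Phi> \<omega>) \<and> \<Phi> \<omega> \<in> even_fns \<and>
               deriv (deriv (\<lambda>\<nu>. action 2 (-1) \<nu> (\<Phi> \<nu>))) \<omega> > 0 \<and>
               even_neg_count 2 (-1) \<omega> (\<Phi> \<omega>) (2 * m + 1)"
    using w.standing_wave 1 w.stable[OF 1] w.curve_even[OF 1] by (intro exI[of _ I] exI[of _ w.\<Phi>] exI[of _ ?w]) auto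
qed

end
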